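(* Let $f$ be a smooth $\mathbb R^m$-valued function on an open set $\mathcal P\subset\mathbb R^m$, let $\overline V\in\mathcal P$, and assume that the 1-d system $v_t+f(v)_z=0$ is strictly hyperbolic at $\overline V$, that each of its $m$ characteristic fields is either genuinely nonlinear or linearly degenerate near $\overline V$, and that it has a smooth entropy-flux pair $(e,q)$ with uniformly convex $e$. Then there is $\epsilon>0$ such that for all $V_L,V_R$ with $|V_L-\overline V|\le\epsilon$, $|V_R-\overline V|\le\epsilon$ (in particular with small jump $|V_R-V_L|$), the Riemann problem $$v_t+f(v)_z=0\quad(t>0),\qquad v(0,z)=\begin{cases}V_L,&z<0,\\ V_R,&z>0,\end{cases}$$ has at most one entropy-admissible self-similar weak solution $v(t,z)=V(z/t)$ in the class of $L^\infty$ functions with $\|V-\overline V\|_{L^\infty}\le\epsilon$ (any two such solutions coincide almost everywhere); no bounded-variation assumption is made.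
   Context: Strictly hyperbolic at $\overline V$: $f_V(\overline V)$ has $m$ distinct real eigenvalues; then for $V$ near $\overline V$ the matrix $f_V(V)$ has $m$ distinct real eigenvalues $\lambda^1(V)<\dots<\lambda^m(V)$ with right eigenvectors $r^1(V),\dots,r^m(V)$, all smooth in $V$. The $\alpha$-th field is genuinely nonlinear near $\overline V$ if $\lambda^\alpha_V(V)r^\alpha(V)\neq0$ for all $V$ in a neighbourhood of $\overline V$, and linearly degenerate near $\overline V$ if $\lambda^\alpha_V(V)r^\alpha(V)=0$ for all $V$ in a neighbourhood of $\overline V$. $(e,q)$ is an entropy-flux pair if $q_V=e_Vf_V$. A weak (distributional) solution $v$ is entropy-admissible if $e(v)_t+q(v)_z\le0$ in the sense of distributions for $t>0$. *)

theory Defs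
  imports "HOL-Analysis.Analysis"
begin

primrec Ck_on :: "nat \<Rightarrow> ('a::euclidean_space \<Rightarrow> 'b::real_normed_vector) \<Rightarrow> 'a set \<Rightarrow> bool" where
  "Ck_on 0 f S \<longleftrightarrow> continuous_on S f"
| "Ck_on (Suc k) f S \<longleftrightarrow> (\<forall>x\<in>S. f differentiable at x) \<and>
     (\<forall>h. Ck_on k (\<lambda>x. frechet_derivative f (at x) h) S)"

text \<open>Intended for open sets only, since derivatives are taken in full neighbourhoods.\<close>
definition smooth_on :: "('a::euclidean_space \<Rightarrow> 'b::real_normed_vector) \<Rightarrow> 'a set \<Rightarrow> bool" where
  "smooth_on f S \<longleftrightarrow> (\<forall>k. Ck_on k f S)"

definition right_eigenvector :: "real^'m^'m \<Rightarrow> real \<Rightarrow> real^'m \<Rightarrow> bool" where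
  "right_eigenvector A l r \<longleftrightarrow> r \<noteq> 0 \<and> A *v r = l *\<^sub>R r"

definition real_eigenvalues :: "real^'m^'m \<Rightarrow> real set" where
  "real_eigenvalues A = {l. \<exists>r. right_eigenvector A l r}"

definition strictly_hyperbolic_at :: "(real^'m \<Rightarrow> real^'m) \<Rightarrow> real^'m \<Rightarrow> bool" where
  "strictly_hyperbolic_at f V \<longleftrightarrow> card (real_eigenvalues (jacobian f (at V))) = CARD('m)"

text \<open>The eigenvalues of the Jacobian in increasing order, numbered from \<open>0\<close> to \<open>m - 1\<close>;
  meaningful where the Jacobian has \<open>m\<close> distinct real eigenvalues.\<close>
definition char_speed :: "(real^'m \<Rightarrow> real^'m) \<Rightarrow> nat \<Rightarrow> real^'m \<Rightarrow> real" where
  "char_speed f \<alpha> V = sorted_list_of_set (real_eigenvalues (jacobian f (at V))) ! \<alpha>"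

text \<open>Near a point of strict hyperbolicity the eigenspaces are one-dimensional, so whether
  the directional derivative vanishes does not depend on the choice of the right eigenvector;
  the two notions below quantify over all choices.\<close>
definition genuinely_nonlinear_near ::
    "(real^'m \<Rightarrow> real^'m) \<Rightarrow> nat \<Rightarrow> real^'m \<Rightarrow> bool" where
  "genuinely_nonlinear_near f \<alpha> V0 \<longleftrightarrow> (\<forall>\<^sub>F V in nhds V0.
     \<forall>r. right_eigenvector (jacobian f (at V)) (char_speed f \<alpha> V) r \<longrightarrow>
       frechet_derivative (char_speed f \<alpha>) (at V) r \<noteq> 0)"

definition linearly_degenerate_near ::
    "(real^'m \<Rightarrow> real^'m) \<Rightarrow> nat \<Rightarrow> real^'m \<Rightarrow> bool" where
  "linearly_degenerate_near f \<alpha> V0 \<longleftrightarrow> (\<forall>\<^sub>F V in nhds V0.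
     \<forall>r. right_eigenvector (jacobian f (at V)) (char_speed f \<alpha> V) r \<longrightarrow>
       frechet_derivative (char_speed f \<alpha>) (at V) r = 0)"

definition entropy_flux_pair ::
    "(real^'m \<Rightarrow> real^'m) \<Rightarrow> (real^'m) set \<Rightarrow> (real^'m \<Rightarrow> real) \<Rightarrow> (real^'m \<Rightarrow> real) \<Rightarrow> bool" where
  "entropy_flux_pair f P e q \<longleftrightarrow> (\<forall>V\<in>P.
     frechet_derivative q (at V) = frechet_derivative e (at V) \<circ> frechet_derivative f (at V))"

text \<open>The domain need not be convex: uniform convexity means a uniform positive lower bound
  on the Hessian.\<close>
definition uniformly_convex_on :: "(real^'m \<Rightarrow> real) \<Rightarrow> (real^'m) set \<Rightarrow> bool" where
  "uniformly_convex_on e P \<longleftrightarrow> (\<exists>c>0. \<forall>V\<in>P. \<forall>h.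
     c * (norm h)\<^sup>2 \<le> frechet_derivative (\<lambda>W. frechet_derivative e (at W) h) (at V) h)"

definition test_function :: "(real \<times> real \<Rightarrow> real) \<Rightarrow> bool" where
  "test_function \<phi> \<longleftrightarrow> smooth_on \<phi> UNIV \<and> compact (closure {p. \<phi> p \<noteq> 0})"

abbreviation dt :: "(real \<times> real \<Rightarrow> real) \<Rightarrow> real \<times> real \<Rightarrow> real" where
  "dt \<phi> p \<equiv> frechet_derivative \<phi> (at p) (1, 0)"

abbreviation dz :: "(real \<times> real \<Rightarrow> real) \<Rightarrow> real \<times> real \<Rightarrow> real" where
  "dz \<phi> p \<equiv> frechet_derivative \<phi> (at p) (0, 1)"

abbreviation upper_half :: "(real \<times> real) set" where
  "upper_half \<equiv> {0<..} \<times> UNIV"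

text \<open>Points of space-time are pairs \<open>(t, z)\<close>. Test functions need not vanish at \<open>t = 0\<close>, so that
  the initial data are part of the weak formulation. Integrals are taken with respect to the
  completed measure: \<open>f\<close> is arbitrary outside its domain, where \<open>v\<close> may take values on a
  null set, and \<open>f \<circ> v\<close> need not be Borel there.\<close>
definition weak_solution ::
    "(real^'m \<Rightarrow> real^'m) \<Rightarrow> (real \<Rightarrow> real^'m) \<Rightarrow> (real \<times> real \<Rightarrow> real^'m) \<Rightarrow> bool" where
  "weak_solution f v0 v \<longleftrightarrow> (\<forall>\<phi>. test_function \<phi> \<longrightarrow>
     (LINT p:upper_half|lebesgue. dt \<phi> p *\<^sub>R v p + dz \<phi> p *\<^sub>R f (v p))
       + (LINT z|lebesgue. \<phi> (0, z) *\<^sub>R v0 z) = 0)"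

definition entropy_admissible ::
    "(real^'m \<Rightarrow> real) \<Rightarrow> (real^'m \<Rightarrow> real) \<Rightarrow> (real \<times> real \<Rightarrow> real^'m) \<Rightarrow> bool" where
  "entropy_admissible e q v \<longleftrightarrow> (\<forall>\<phi>. test_function \<phi> \<and> (\<forall>p. 0 \<le> \<phi> p) \<and>
       closure {p. \<phi> p \<noteq> 0} \<subseteq> upper_half \<longrightarrow>
     0 \<le> (LINT p:upper_half|lebesgue. dt \<phi> p * e (v p) + dz \<phi> p * q (v p)))"

definition riemann_data :: "real^'m \<Rightarrow> real^'m \<Rightarrow> real \<Rightarrow> real^'m" where
  "riemann_data VL VR z = (if z < 0 then VL else VR)"

text \<open>Only the values for \<open>t > 0\<close> are relevant.\<close>
definition self_similar :: "(real \<Rightarrow> real^'m) \<Rightarrow> real \<times> real \<Rightarrow> real^'m" where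
  "self_similar V = (\<lambda>(t, z). V (z / t))"

definition Linfty_cball :: "real^'m \<Rightarrow> real \<Rightarrow> (real \<Rightarrow> real^'m) set" where
  "Linfty_cball V0 \<epsilon> = {V. V \<in> borel_measurable lebesgue \<and> (AE \<xi> in lebesgue. norm (V \<xi> - V0) \<le> \<epsilon>)}"

definition admissible_riemann_solution ::
    "(real^'m \<Rightarrow> real^'m) \<Rightarrow> (real^'m \<Rightarrow> real) \<Rightarrow> (real^'m \<Rightarrow> real) \<Rightarrow> real^'m \<Rightarrow> real^'m \<Rightarrow>
     (real \<Rightarrow> real^'m) \<Rightarrow> bool" where
  "admissible_riemann_solution f e q VL VR V \<longleftrightarrow>
     weak_solution f (riemann_data VL VR) (self_similar V) \<and>
     entropy_admissible e q (self_similar V)"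

end

theory Submission
  imports Defs
begin

text \<open>A self-similar weak solution \<open>V\<close>, considered as a function of \<open>\<xi> = z/t\<close>, satisfies \<open>f(V)' = \<xi> V'\<close> in the sense of
  distributions. Integrated between Lebesgue points and extended to all points by limits, this becomes a relation
  between values (\<open>regular_representative\<close>): \<open>f(V x) - f(V y) - x (V x - V y)\<close> is at most \<open>\<bar>x - y\<bar>\<close> times the oscillation of
  \<open>V\<close> between \<open>x\<close> and \<open>y\<close>, while \<open>q(V) - \<xi> e(V)\<close> is nonincreasing up to a linear term. Everything else is derived from
  these two pointwise relations (locale \<open>riemann_profile\<close>), so bounded variation never enters.

  The first relation says that an increment of \<open>V\<close> is almost in the kernel of \<open>A - x\<close>, where \<open>A\<close> is an averaged Jacobian
  close to \<open>f_V\<close> at the centre. Hence \<open>V\<close> is constant while \<open>\<xi>\<close> stays away from the characteristic speeds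
  (\<open>constant_in_gap\<close>), and near the \<open>i\<close>-th speed its increments are almost parallel to the \<open>i\<close>-th eigenvector. In a
  genuinely nonlinear field the entropy changes strictly across a jump (\<open>entropy_jump\<close>). Therefore two limit points of \<open>V\<close>
  from the same side coincide, each discontinuity is a Lax shock, after and before which \<open>V\<close> is constant, and the
  \<open>i\<close>-th wave is a single shock, a single centred rarefaction, or trivial. In a linearly degenerate field two
  distinct points cannot both be sonic (\<open>sonic_unique\<close>), so the wave is a single contact discontinuity.

  Finally, two solutions with the same data are compared wave by wave. The difference of two \<open>i\<close>-waves is close to a multiple of the
  eigenvector \<open>r i\<close>, up to a small multiple of the difference of their left states (\<open>wave_cone\<close>). The differences
  add up to zero because the outer states are prescribed (\<open>far_states\<close>), and the \<open>r i\<close> are linearly independent, so for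
  a small ball all of them vanish (\<open>cone_sum_zero\<close>). Waves of the same family with the same end states coincide
  except at the position of a jump (\<open>wave_unique\<close>).\<close>

section \<open>Matrices near one with distinct real eigenvalues\<close>

lemma norm_matrix_vector_le: "norm (A *v x) \<le> norm A * norm (x::real^'n)" for A :: "real^'n^'m"
proof -
  have "(A *v x) $ i = A $ i \<bullet> x" for i
    by (simp add: matrix_vector_mult_def inner_vec_def)
  then have "norm (A *v x) = L2_set (\<lambda>i. \<bar>A $ i \<bullet> x\<bar>) UNIV"
    by (simp add: norm_vec_def)
  also have "\<dots> \<le> L2_set (\<lambda>i. norm (A $ i) * norm x) UNIV"
    by (intro L2_set_mono) (auto simp: Cauchy_Schwarz_ineq2)
  also have "\<dots> = norm A * norm x"
    by (simp add: norm_vec_def L2_set_left_distrib)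
  finally show ?thesis .
qed

lemma norm_transpose: "norm (transpose A) = norm (A :: real^'n^'m)"
proof -
  have "transpose A \<bullet> transpose A = A \<bullet> A"
    unfolding inner_vec_def transpose_def by (simp add: sum.swap[of _ "UNIV::'n set"])
  then show ?thesis by (simp add: norm_eq_sqrt_inner)
qed

lemma transpose_diff: "transpose (A - B) = transpose A - transpose (B :: real^'n^'m)"
  by (simp add: transpose_def vec_eq_iff)

lemma eigenvectors_independent:
  fixes A :: "real^'m^'m"
  assumes "finite F" and "inj_on lam F" and "\<And>i. i \<in> F \<Longrightarrow> right_eigenvector A (lam i) (r i)"
    and "(\<Sum>i\<in>F. c i *\<^sub>R r i) = 0" and "i \<in> F"
  shows "c i = 0"
  using assms
proof (induction F arbitrary: c i rule: finite_induct)
  case empty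
  then show ?case by simp
next
  case (insert k F)
  have ev: "A *v r j = lam j *\<^sub>R r j" if "j \<in> insert k F" for j
    using insert.prems(2)[OF that] by (simp add: right_eigenvector_def)
  have "A *v (\<Sum>i\<in>insert k F. c i *\<^sub>R r i) - lam k *\<^sub>R (\<Sum>i\<in>insert k F. c i *\<^sub>R r i) = 0"
    unfolding insert.prems(3) by (simp add: matrix_vector_mult_0_right)
  moreover have "A *v (\<Sum>i\<in>insert k F. c i *\<^sub>R r i) = (\<Sum>i\<in>insert k F. (c i * lam i) *\<^sub>R r i)"
    using ev by (simp add: linear_sum[OF matrix_vector_mul_linear] matrix_vector_mult_scaleR)
  moreover have "lam k *\<^sub>R (\<Sum>i\<in>insert k F. c i *\<^sub>R r i) = (\<Sum>i\<in>insert k F. (c i * lam k) *\<^sub>R r i)"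
    by (simp add: scaleR_sum_right mult.commute scaleR_add_right)
  ultimately have "(\<Sum>i\<in>insert k F. (c i * (lam i - lam k)) *\<^sub>R r i) = 0"
    by (simp only: right_diff_distrib scaleR_diff_left sum_subtractf)
  then have 0: "(\<Sum>i\<in>F. (c i * (lam i - lam k)) *\<^sub>R r i) = 0"
    using insert.hyps by simp
  have cF: "c j = 0" if "j \<in> F" for j
  proof -
    have "c j * (lam j - lam k) = 0"
      using insert.IH[OF _ _ 0 that] insert.prems by auto
    moreover have "lam j \<noteq> lam k"
      using insert.prems(1) insert.hyps(2) that by (auto simp: inj_on_def)
    ultimately show ?thesis by simp
  qed
  then have "c k *\<^sub>R r k = 0"
    using insert.prems(3) insert.hyps by simp
  moreover have "r k \<noteq> 0"
    using insert.prems(2) by (auto simp: right_eigenvector_def)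
  ultimately show ?case
    using cF insert.prems(4) by auto
qed

text \<open>Separation by \<open>4 * \<delta>\<close> leaves room for the two kinds of regions used throughout: speeds within \<open>2 * \<delta>\<close> of
  \<open>lam i\<close> stay \<open>\<delta>\<close>-far from all other eigenvalues, and the values \<open>lam i - \<delta>\<close>, \<open>lam i + \<delta>\<close> are \<open>\<delta>\<close>-far from all of them.\<close>
locale spectral =
  fixes A0 :: "real^'m^'m" and lam :: "'m \<Rightarrow> real" and r l :: "'m \<Rightarrow> real^'m" and \<delta> :: real
  assumes right: "A0 *v r i = lam i *\<^sub>R r i"
    and left: "l i \<bullet> (A0 *v x) = lam i * (l i \<bullet> x)"
    and dual: "l i \<bullet> r j = (if i = j then 1 else 0)"
    and expand: "x = (\<Sum>i\<in>UNIV. (l i \<bullet> x) *\<^sub>R r i)"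
    and det_A0: "det (A0 - t *\<^sub>R mat 1) = (\<Prod>i\<in>UNIV. lam i - t)"
    and \<delta>_pos: "\<delta> > 0"
    and separated: "i \<noteq> j \<Longrightarrow> \<bar>lam i - lam j\<bar> \<ge> 4 * \<delta>"

lemma spectral_basis_exists:
  fixes A :: "real^'m^'m"
  assumes "card (real_eigenvalues A) = CARD('m)"
  obtains lam :: "'m \<Rightarrow> real" and r l \<delta>
  where "spectral A lam r l \<delta>" and "range lam = real_eigenvalues A" and "inj lam"
proof -
  have fin: "finite (real_eigenvalues A)"
    using assms by (simp add: card_ge_0_finite)
  obtain lam :: "'m \<Rightarrow> real" where bij: "bij_betw lam UNIV (real_eigenvalues A)"
    using finite_same_card_bij[of "UNIV :: 'm set", OF _ fin] assms by auto
  then have inj: "inj lam" and range: "range lam = real_eigenvalues A"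
    by (auto simp: bij_betw_def)
  have "\<exists>v. right_eigenvector A (lam i) v" for i
    using range by (auto simp: real_eigenvalues_def set_eq_iff)
  then obtain r where r: "\<And>i. right_eigenvector A (lam i) (r i)" by metis
  define S :: "real^'m^'m" where "S = (\<chi> i j. r j $ i)"
  have S: "S *v c = (\<Sum>j\<in>UNIV. c $ j *\<^sub>R r j)" for c
    by (simp add: vec_eq_iff S_def matrix_vector_mult_def mult.commute)
  have "inj ((*v) S)"
  proof (rule linear_injective_0[THEN iffD2], simp, intro allI impI)
    fix c assume "S *v c = 0"
    then have "c $ i = 0" for i
      using eigenvectors_independent[OF finite inj r, of "($) c" i] by (simp add: S[symmetric])
    then show "c = 0" by (simp add: vec_eq_iff)
  qed
  then obtain R where R: "R ** S = mat 1"
    using matrix_left_invertible_injective by blast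
  then have R': "S ** R = mat 1"
    using matrix_left_right_inverse by blast
  define l where "l = ($) R"
  have lx: "l i \<bullet> x = (R *v x) $ i" for i x
    by (simp add: l_def matrix_vector_mult_def inner_vec_def)
  have r_axis: "r j = S *v axis j 1" for j
    by (simp add: vec_eq_iff S_def matrix_vector_mult_def axis_def if_distrib[of "\<lambda>c. _ * c"] cong: if_cong)
  have right: "A *v r i = lam i *\<^sub>R r i" for i
    using r by (simp add: right_eigenvector_def)
  have expand: "x = (\<Sum>i\<in>UNIV. (l i \<bullet> x) *\<^sub>R r i)" for x
    by (simp only: lx S[symmetric] matrix_vector_mul_assoc R' matrix_vector_mul_lid)
  have dual: "l i \<bullet> r j = (if i = j then 1 else 0)" for i j
    unfolding lx r_axis matrix_vector_mul_assoc R by (simp add: axis_def)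
  have left: "l i \<bullet> (A *v x) = lam i * (l i \<bullet> x)" for i x
  proof -
    have "A *v x = (\<Sum>j\<in>UNIV. (l j \<bullet> x) *\<^sub>R (lam j *\<^sub>R r j))"
      by (subst expand[of x]) (simp add: linear_sum[OF matrix_vector_mul_linear] matrix_vector_mult_scaleR right)
    then show ?thesis
      by (simp add: inner_sum_right dual if_distrib[of "\<lambda>x. _ * x"] cong: if_cong)
  qed
  define D :: "real \<Rightarrow> real^'m^'m" where "D x = (\<chi> i j. if i = j then lam i - x else 0)" for x
  have AS: "(A - x *\<^sub>R mat 1) ** S = S ** D x" for x
  proof -
    have "((A - x *\<^sub>R mat 1) ** S) *v axis j 1 = (S ** D x) *v axis j 1" for j
    proof -
      have "((A - x *\<^sub>R mat 1) ** S) *v axis j 1 = (lam j - x) *\<^sub>R r j"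
        by (simp add: matrix_vector_mul_assoc[symmetric] r_axis[symmetric] matrix_vector_mult_diff_rdistrib
            right scaleR_matrix_vector_assoc[symmetric] scaleR_diff_left)
      moreover have "D x *v axis j 1 = (lam j - x) *\<^sub>R axis j 1"
        unfolding matrix_vector_mult_basis by (auto simp: D_def column_def vec_eq_iff axis_def)
      ultimately show ?thesis
        by (simp add: matrix_vector_mul_assoc[symmetric] matrix_vector_mult_scaleR r_axis)
    qed
    then have "column j ((A - x *\<^sub>R mat 1) ** S) = column j (S ** D x)" for j
      by (simp only: matrix_vector_mult_basis)
    then show ?thesis by (auto simp: column_def vec_eq_iff)
  qed
  have det: "det (A - x *\<^sub>R mat 1) = (\<Prod>i\<in>UNIV. lam i - x)" for x
  proof -
    have "det (A - x *\<^sub>R mat 1) * det S = det S * det (D x)"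
      using arg_cong[OF AS[of x], of det] by (simp add: det_mul)
    moreover have "det S \<noteq> 0"
      using R R' invertible_det_nz invertible_def by blast
    ultimately show ?thesis
      by (simp add: D_def det_diagonal)
  qed
  obtain d where d: "d > 0" "\<And>i j. i \<noteq> j \<Longrightarrow> \<bar>lam i - lam j\<bar> \<ge> d"
  proof -
    have "finite ((\<lambda>(i,j). \<bar>lam i - lam j\<bar>) ` {(i,j). i \<noteq> j})" by simp
    then obtain d where "d > 0" "\<And>z. z \<in> (\<lambda>(i,j). \<bar>lam i - lam j\<bar>) ` {(i,j). i \<noteq> j} \<Longrightarrow> d \<le> z"
    proof -
      let ?F = "insert 1 ((\<lambda>(i,j). \<bar>lam i - lam j\<bar>) ` {(i,j). i \<noteq> j})"
      have "Min ?F > 0"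
        using inj by (subst Min_gr_iff) (auto simp: inj_def)
      moreover have "z \<in> ?F \<Longrightarrow> Min ?F \<le> z" for z by simp
      ultimately show ?thesis using that[of "Min ?F"] by blast
    qed
    then show ?thesis using that[of d] by auto
  qed
  show ?thesis
    by (rule that[of lam r l "d/4"]) (use right left dual expand det d range inj in \<open>unfold_locales, auto\<close>)
qed

lemma matrix_diff_vector: "(A - B) *v x = A *v x - B *v (x :: real^'n)" for A :: "real^'n^'m"
  by (rule matrix_vector_mult_diff_rdistrib)

lemma shifted_matrix_vector: "(A - t *\<^sub>R mat 1) *v x = A *v x - t *\<^sub>R x" for A :: "real^'n^'n"
  by (simp add: matrix_vector_mult_diff_rdistrib scaleR_matrix_vector_assoc[symmetric])

lemma det_zero_eigenvector:
  fixes A :: "real^'n^'n"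
  assumes "det (A - t *\<^sub>R mat 1) = 0"
  obtains v where "v \<noteq> 0" "A *v v = t *\<^sub>R v"
proof -
  have "\<not> inj ((*v) (A - t *\<^sub>R mat 1))"
    using assms by (metis invertible_det_nz invertible_left_inverse matrix_left_invertible_injective)
  then obtain v where "v \<noteq> 0" "(A - t *\<^sub>R mat 1) *v v = 0"
    using linear_injective_0[OF matrix_vector_mul_linear] by blast
  then show ?thesis
    using that by (simp add: shifted_matrix_vector)
qed

lemma det_transpose_shifted: "det (transpose A - t *\<^sub>R mat 1) = det (A - t *\<^sub>R mat 1)"
  for A :: "real^'n^'n"
proof -
  have "transpose A - t *\<^sub>R mat 1 = transpose (A - t *\<^sub>R mat 1)"
    by (simp add: transpose_def vec_eq_iff mat_def eq_commute)
  then show ?thesis by (simp add: det_transpose)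
qed

lemma inner_transpose: "(transpose A *v x) \<bullet> y = x \<bullet> (A *v y)" for A :: "real^'n^'m"
  by (metis dot_lmul_matrix vector_transpose_matrix transpose_transpose)

context spectral
begin

definition Cr where "Cr = (\<Sum>k\<in>UNIV. norm (r k) * norm (l k)) / \<delta>"
definition R where "R = 1 + (\<Sum>k\<in>UNIV. norm (r k) + norm (l k))"
text \<open>The projection along \<open>r i\<close> onto the span of the other eigenvectors.\<close>
definition N where "N i v = v - (l i \<bullet> v) *\<^sub>R r i"

lemma Cr_nonneg: "0 \<le> Cr"
  using \<delta>_pos by (auto simp: Cr_def intro!: sum_nonneg divide_nonneg_pos)

lemma R_ge: "1 \<le> R" "norm (r i) \<le> R" "norm (l i) \<le> R"
proof -
  have "norm (r i) + norm (l i) \<le> (\<Sum>k\<in>UNIV. norm (r k) + norm (l k))"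
    by (rule member_le_sum) auto
  then show "norm (r i) \<le> R" "norm (l i) \<le> R"
    using norm_ge_zero[of "l i"] norm_ge_zero[of "r i"] by (simp_all only: R_def)
  show "1 \<le> R" by (simp add: R_def sum_nonneg)
qed

lemma transposed: "spectral (transpose A0) lam l r \<delta>"
proof
  fix i j and x :: "real^'m" and t
  show "transpose A0 *v l i = lam i *\<^sub>R l i"
    by (rule vector_eq_rdot[THEN iffD1], rule allI)
      (simp only: inner_transpose left inner_scaleR_left)
  show "r i \<bullet> (transpose A0 *v x) = lam i * (r i \<bullet> x)"
    using inner_transpose[of A0 x "r i"] by (simp add: right inner_commute)
  show "r i \<bullet> l j = (if i = j then 1 else 0)"
    using dual[of j i] by (auto simp: inner_commute)
  show "x = (\<Sum>i\<in>UNIV. (r i \<bullet> x) *\<^sub>R l i)"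
  proof (rule vector_eq_ldot[THEN iffD1], rule allI)
    fix y
    have "y \<bullet> x = (\<Sum>i\<in>UNIV. (l i \<bullet> y) *\<^sub>R r i) \<bullet> x" by (subst expand[of y]) simp
    then show "y \<bullet> x = y \<bullet> (\<Sum>i\<in>UNIV. (r i \<bullet> x) *\<^sub>R l i)"
      by (simp add: inner_sum_left inner_sum_right inner_commute mult.commute)
  qed
  show "det (transpose A0 - t *\<^sub>R mat 1) = (\<Prod>i\<in>UNIV. lam i - t)"
    by (simp add: det_transpose_shifted det_A0)
qed (use \<delta>_pos separated in auto)

text \<open>On the span of the eigenvectors whose eigenvalues are \<open>\<delta>\<close>-far from \<open>t\<close>, the matrix \<open>A0 - t\<close> is
  invertible with inverse bounded by \<open>Cr\<close>.\<close>
lemma resolvent_part: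
  assumes "\<And>k. k \<in> I \<Longrightarrow> \<delta> \<le> \<bar>lam k - t\<bar>"
  shows "norm (\<Sum>k\<in>I. (l k \<bullet> v) *\<^sub>R r k) \<le> Cr * norm (A0 *v v - t *\<^sub>R v)"
proof -
  let ?w = "A0 *v v - t *\<^sub>R v"
  have "norm ((l k \<bullet> v) *\<^sub>R r k) \<le> norm (r k) * norm (l k) / \<delta> * norm ?w" if "k \<in> I" for k
  proof -
    have "l k \<bullet> ?w = (lam k - t) * (l k \<bullet> v)"
      by (simp add: inner_diff_right left algebra_simps)
    then have "\<bar>lam k - t\<bar> * \<bar>l k \<bullet> v\<bar> \<le> norm (l k) * norm ?w"
      by (metis Cauchy_Schwarz_ineq2 abs_mult)
    moreover have "\<delta> * \<bar>l k \<bullet> v\<bar> \<le> \<bar>lam k - t\<bar> * \<bar>l k \<bullet> v\<bar>"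
      using assms[OF that] by (simp add: mult_right_mono)
    ultimately have "\<bar>l k \<bullet> v\<bar> \<le> norm (l k) * norm ?w / \<delta>"
      using \<delta>_pos by (simp add: field_simps)
    then have "norm (r k) * \<bar>l k \<bullet> v\<bar> \<le> norm (r k) * (norm (l k) * norm ?w / \<delta>)"
      by (rule mult_left_mono) simp
    then show ?thesis by (simp add: algebra_simps)
  qed
  then have "norm (\<Sum>k\<in>I. (l k \<bullet> v) *\<^sub>R r k) \<le> (\<Sum>k\<in>I. norm (r k) * norm (l k) / \<delta> * norm ?w)"
    by (rule sum_norm_le)
  also have "\<dots> \<le> (\<Sum>k\<in>UNIV. norm (r k) * norm (l k) / \<delta> * norm ?w)"
    using \<delta>_pos by (intro sum_mono2) auto
  also have "\<dots> = Cr * norm ?w"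
    by (simp add: Cr_def sum_distrib_right sum_divide_distrib)
  finally show ?thesis .
qed

lemma N_expand: "N i v = (\<Sum>k\<in>-{i}. (l k \<bullet> v) *\<^sub>R r k)"
proof -
  have "v = (l i \<bullet> v) *\<^sub>R r i + (\<Sum>k\<in>UNIV-{i}. (l k \<bullet> v) *\<^sub>R r k)"
    by (subst expand[of v], subst sum.remove[of UNIV i]) auto
  then show ?thesis
    by (simp add: N_def Compl_eq_Diff_UNIV algebra_simps)
qed

lemma far_from_others:
  assumes "\<bar>t - lam i\<bar> \<le> 2 * \<delta>" "k \<noteq> i"
  shows "\<delta> \<le> \<bar>lam k - t\<bar>"
  using separated[OF assms(2)] assms(1) \<delta>_pos by linarith

lemma shift_perturb: "norm (A0 *v v - t *\<^sub>R v) \<le> norm (A *v v - t *\<^sub>R v) + norm (A - A0) * norm v"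
proof -
  have "norm (A0 *v v - t *\<^sub>R v) = norm ((A *v v - t *\<^sub>R v) - (A - A0) *v v)"
    by (simp add: matrix_diff_vector)
  also have "\<dots> \<le> norm (A *v v - t *\<^sub>R v) + norm ((A - A0) *v v)"
    by (rule norm_triangle_ineq4)
  finally show ?thesis
    using norm_matrix_vector_le[of "A - A0" v] by linarith
qed

lemma N_bound:
  assumes "\<bar>t - lam i\<bar> \<le> 2 * \<delta>"
  shows "norm (N i v) \<le> Cr * (norm (A *v v - t *\<^sub>R v) + norm (A - A0) * norm v)"
proof -
  have "norm (N i v) \<le> Cr * norm (A0 *v v - t *\<^sub>R v)"
    unfolding N_expand by (rule resolvent_part) (use far_from_others[OF assms] in auto)
  also have "\<dots> \<le> Cr * (norm (A *v v - t *\<^sub>R v) + norm (A - A0) * norm v)"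
    by (intro mult_left_mono shift_perturb Cr_nonneg)
  finally show ?thesis .
qed

text \<open>The characteristic polynomial changes sign between \<open>lam i - \<delta>/2\<close> and \<open>lam i + \<delta>/2\<close>; this persists
  for nearby matrices by continuity of the determinant, and the intermediate value theorem gives a root.\<close>
lemma eigenvalue_nearby:
  "\<exists>\<eta>>0. \<forall>A. norm (A - A0) \<le> \<eta> \<longrightarrow> (\<forall>i. \<exists>x. \<bar>x - lam i\<bar> < \<delta> \<and> det (A - x *\<^sub>R mat 1) = 0)"
proof -
  define D where "D i s A = det (A - (lam i + s * \<delta> / 2) *\<^sub>R mat 1)" for i s and A :: "real^'m^'m"
  have cont_det: "continuous_on UNIV (\<lambda>B::real^'m^'m. det B)"
    unfolding det_def by (intro continuous_intros)
  have cont: "continuous_on UNIV (D i s)" for i s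
    unfolding D_def by (intro continuous_on_compose2[OF cont_det] continuous_intros) auto
  have prod0: "D i s A0 = (- s * \<delta> / 2) * (\<Prod>k\<in>-{i}. lam k - (lam i + s * \<delta> / 2))" for i s
    unfolding D_def det_A0
    by (subst prod.remove[of UNIV i]) (auto simp: Compl_eq_Diff_UNIV)
  have sgn_eq: "sgn (\<Prod>k\<in>-{i}. lam k - (lam i + s * \<delta> / 2)) = (\<Prod>k\<in>-{i}. sgn (lam k - lam i))"
    if "\<bar>s\<bar> \<le> 1" for i s
  proof -
    have "sgn (lam k - (lam i + s * \<delta> / 2)) = sgn (lam k - lam i)" if "k \<in> -{i}" for k
    proof -
      have "\<bar>s * \<delta>\<bar> \<le> \<delta>" using \<open>\<bar>s\<bar> \<le> 1\<close> \<delta>_pos by (simp add: abs_mult mult_left_le_one_le)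
      then show ?thesis
        using separated[of k i] that \<delta>_pos by (simp add: sgn_if) linarith
    qed
    moreover have "sgn (prod g S) = (\<Prod>k\<in>S. sgn (g k :: real))" for g and S :: "'m set"
      by (induction S rule: infinite_finite_induct) (auto simp: sgn_mult)
    ultimately show ?thesis by simp
  qed
  have neg: "D i 1 A0 * D i (-1) A0 < 0" for i
  proof -
    have "sgn (D i 1 A0 * D i (-1) A0) = - ((\<Prod>k\<in>-{i}. sgn (lam k - lam i)) ^ 2)"
      using \<delta>_pos sgn_eq[of 1 i] sgn_eq[of "-1" i] unfolding prod0
      by (simp add: sgn_mult power2_eq_square)
    moreover have "(\<Prod>k\<in>-{i}. sgn (lam k - lam i)) \<noteq> 0"
      using separated \<delta>_pos by (auto simp: sgn_zero_iff) (metis abs_zero cancel_comm_monoid_add_class.diff_cancel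
          linorder_not_le mult_pos_pos zero_less_numeral)
    ultimately have "sgn (D i 1 A0 * D i (-1) A0) < 0"
      by simp
    then show ?thesis by (simp only: sgn_less)
  qed
  have "\<forall>\<^sub>F A in nhds A0. D i 1 A * D i (-1) A < 0" for i
  proof -
    have "continuous_on UNIV (\<lambda>A. D i 1 A * D i (-1) A)"
      by (intro continuous_intros cont)
    then have "((\<lambda>A. D i 1 A * D i (-1) A) \<longlongrightarrow> D i 1 A0 * D i (-1) A0) (nhds A0)"
      using tendsto_at_iff_tendsto_nhds[of "\<lambda>A. D i 1 A * D i (-1) A" A0]
      by (simp add: continuous_on_eq_continuous_at isCont_def)
    then show ?thesis
      using neg[of i] order_tendstoD(2) by blast
  qed
  then have "\<forall>\<^sub>F A in nhds A0. \<forall>i. D i 1 A * D i (-1) A < 0"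
    by (simp add: eventually_all_finite)
  then obtain \<eta> where \<eta>: "\<eta> > 0" "\<And>A i. dist A A0 < \<eta> \<Longrightarrow> D i 1 A * D i (-1) A < 0"
    unfolding eventually_nhds_metric by blast
  have "\<exists>x. \<bar>x - lam i\<bar> < \<delta> \<and> det (A - x *\<^sub>R mat 1) = 0" if "dist A A0 < \<eta>" for A i
  proof -
    let ?d = "\<lambda>x. det (A - x *\<^sub>R mat 1)"
    have cd: "continuous_on S ?d" for S
      by (intro continuous_on_compose2[OF cont_det] continuous_intros) auto
    have le: "lam i - \<delta>/2 \<le> lam i + \<delta>/2" using \<delta>_pos by simp
    have "?d (lam i + \<delta>/2) * ?d (lam i - \<delta>/2) < 0"
      using \<eta>(2)[OF that, of i] by (simp add: D_def)
    then have "\<exists>x. lam i - \<delta>/2 \<le> x \<and> x \<le> lam i + \<delta>/2 \<and> ?d x = 0"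
      using IVT'[of ?d "lam i - \<delta>/2" 0 "lam i + \<delta>/2", OF _ _ le cd]
        IVT2'[of ?d "lam i + \<delta>/2" 0 "lam i - \<delta>/2", OF _ _ le cd]
      by (smt (verit) mult_nonneg_nonneg mult_nonpos_nonpos)
    then show ?thesis using \<delta>_pos by force
  qed
  then have "\<forall>A. norm (A - A0) \<le> \<eta>/2 \<longrightarrow> (\<forall>i. \<exists>x. \<bar>x - lam i\<bar> < \<delta> \<and> det (A - x *\<^sub>R mat 1) = 0)"
    using \<eta>(1) by (auto simp: dist_norm)
  then show ?thesis using \<eta>(1) by (intro exI[of _ "\<eta>/2"]) auto
qed

end

locale spectral_nbhd = spectral A0 lam r l \<delta>
  for A0 :: "real^'m^'m" and lam r l \<delta> +
  fixes \<eta> :: real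
  assumes \<eta>_pos: "\<eta> > 0"
    and \<eta>_small: "4 * (1 + Cr) * R * \<eta> \<le> 1"
    and eigenvalue_exists: "norm (A - A0) \<le> \<eta> \<Longrightarrow> \<exists>x. \<bar>x - lam i\<bar> < \<delta> \<and> det (A - x *\<^sub>R mat 1) = 0"
begin

text \<open>The choices are forced for matrices within \<open>\<eta>\<close> of \<open>A0\<close> (\<open>eigenpair_unique\<close>). Eigenvectors are normalised against
  the fixed dual basis rather than to unit length, which makes them Lipschitz functions of the matrix.\<close>
definition ev :: "'m \<Rightarrow> real^'m^'m \<Rightarrow> real" where
  "ev i A = (SOME x. \<bar>x - lam i\<bar> < \<delta> \<and> det (A - x *\<^sub>R mat 1) = 0)"
definition rv where "rv i A = (SOME v. A *v v = ev i A *\<^sub>R v \<and> l i \<bullet> v = 1)"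
definition lv where "lv i A = (SOME w. transpose A *v w = ev i A *\<^sub>R w \<and> r i \<bullet> w = 1)"
text \<open>A common upper bound for the constants of the perturbation estimates below, which makes them easy to combine.\<close>
definition K where "K = 8*R*R + 2*Cr + 2*R + 2*Cr*(2*R + 8*R*R*(2*R))"

text \<open>Transposition exchanges right and left eigenvectors, so that facts about \<open>rv\<close> transfer to \<open>lv\<close>.\<close>
lemma transposed_nbhd: "spectral_nbhd (transpose A0) lam l r \<delta> \<eta>"
proof -
  interpret t: spectral "transpose A0" lam l r \<delta> by (rule transposed)
  have "t.Cr = Cr" "t.R = R"
    by (simp_all add: t.Cr_def t.R_def Cr_def R_def mult.commute add.commute)
  then show ?thesis
  proof unfold_locales
    fix A i assume "norm (A - transpose A0) \<le> \<eta>"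
    then have "norm (transpose A - A0) \<le> \<eta>"
      using norm_transpose[of "A - transpose A0"] by (simp add: transpose_diff)
    from eigenvalue_exists[OF this, of i]
    show "\<exists>x. \<bar>x - lam i\<bar> < \<delta> \<and> det (A - x *\<^sub>R mat 1) = 0"
      by (simp add: det_transpose_shifted)
  qed (use \<eta>_pos \<eta>_small in auto)
qed

lemma \<eta>_bounds: "Cr * \<eta> \<le> 1/4" "Cr * \<eta> * (2 * R) \<le> 1/2"
proof -
  have "Cr * \<eta> * (4 * R) \<le> (1 + Cr) * \<eta> * (4 * R)"
    using \<eta>_pos R_ge(1) by (intro mult_right_mono) auto
  then have 1: "Cr * \<eta> * (4 * R) \<le> 1"
    using \<eta>_small by (simp add: algebra_simps)
  then show "Cr * \<eta> * (2 * R) \<le> 1/2" by simp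
  have "Cr * \<eta> * 4 \<le> Cr * \<eta> * (4 * R)"
    using \<eta>_pos R_ge(1) Cr_nonneg by (intro mult_left_mono) auto
  with 1 show "Cr * \<eta> \<le> 1/4" by linarith
qed

lemma ev: 
  assumes "norm (A - A0) \<le> \<eta>"
  shows "\<bar>ev i A - lam i\<bar> < \<delta>" "det (A - ev i A *\<^sub>R mat 1) = 0"
  using someI_ex[OF eigenvalue_exists[OF assms, of i]] by (auto simp: ev_def)

lemma K_ge: "1 \<le> K" "8*R*R \<le> K" "2*Cr \<le> K" "2*R \<le> K" "2*Cr*(2*R + 8*R*R*(2*R)) \<le> K"
proof -
  have *: "0 \<le> 8*R*R" "0 \<le> 2*Cr" "0 \<le> 2*R" "0 \<le> 2*Cr*(2*R + 8*R*R*(2*R))"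
    using R_ge(1) Cr_nonneg by auto
  from * show "8*R*R \<le> K" "2*Cr \<le> K" "2*R \<le> K" "2*Cr*(2*R + 8*R*R*(2*R)) \<le> K"
    unfolding K_def by linarith+
  then show "1 \<le> K" using R_ge(1) by linarith
qed

lemma near_mult: "norm (A - A0) \<le> \<eta> \<Longrightarrow> Cr * (norm (A - A0) * norm v) \<le> Cr * \<eta> * norm v"
  using Cr_nonneg by (simp add: mult.assoc mult_left_mono mult_right_mono)

text \<open>For \<open>t\<close> near \<open>lam i\<close> the matrix \<open>A - t\<close> can only annihilate the \<open>i\<close>-th direction: a vector with small image is
  controlled by its \<open>i\<close>-th coordinate.\<close>
lemma sector_strong:
  assumes "norm (A - A0) \<le> \<eta>" "\<bar>t - lam i\<bar> \<le> 2 * \<delta>"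
  shows "norm v \<le> 2*Cr * norm (A *v v - t *\<^sub>R v) + 2*R * \<bar>l i \<bullet> v\<bar>"
proof -
  have "norm v \<le> norm (N i v) + norm ((l i \<bullet> v) *\<^sub>R r i)"
    unfolding N_def by (metis norm_triangle_ineq diff_add_cancel)
  also have "norm ((l i \<bullet> v) *\<^sub>R r i) \<le> R * \<bar>l i \<bullet> v\<bar>"
    using mult_right_mono[OF R_ge(2)[of i], of "\<bar>l i \<bullet> v\<bar>"] by (simp add: mult.commute)
  also have "norm (N i v) \<le> Cr * norm (A *v v - t *\<^sub>R v) + Cr * \<eta> * norm v"
    using N_bound[OF assms(2), of v A] near_mult[OF assms(1), of v] by (simp add: distrib_left)
  also have "Cr * \<eta> * norm v \<le> 1/4 * norm v"
    using \<eta>_bounds(1) by (intro mult_right_mono) auto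
  finally have "norm v \<le> Cr * norm (A *v v - t *\<^sub>R v) + 1/4 * norm v + R * \<bar>l i \<bullet> v\<bar>" by linarith
  moreover have "0 \<le> Cr * norm (A *v v - t *\<^sub>R v)" "0 \<le> R * \<bar>l i \<bullet> v\<bar>"
    using Cr_nonneg R_ge(1) by auto
  ultimately show ?thesis by linarith
qed

lemma sector:
  assumes "norm (A - A0) \<le> \<eta>" "\<bar>t - lam i\<bar> \<le> 2 * \<delta>"
  shows "norm v \<le> K * (norm (A *v v - t *\<^sub>R v) + \<bar>l i \<bullet> v\<bar>)"
proof -
  have "2*Cr * norm (A *v v - t *\<^sub>R v) \<le> K * norm (A *v v - t *\<^sub>R v)"
    "2*R * \<bar>l i \<bullet> v\<bar> \<le> K * \<bar>l i \<bullet> v\<bar>"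
    using K_ge by (auto intro!: mult_right_mono)
  then show ?thesis
    using sector_strong[OF assms, of v] by (simp add: distrib_left)
qed

lemma gap:
  assumes "norm (A - A0) \<le> \<eta>" "\<And>k. \<delta> \<le> \<bar>lam k - t\<bar>"
  shows "norm v \<le> K * norm (A *v v - t *\<^sub>R v)"
proof -
  have "norm v \<le> Cr * norm (A0 *v v - t *\<^sub>R v)"
    using resolvent_part[of UNIV t v] assms(2) by (simp add: expand[symmetric])
  also have "\<dots> \<le> Cr * (norm (A *v v - t *\<^sub>R v) + norm (A - A0) * norm v)"
    by (intro mult_left_mono shift_perturb Cr_nonneg)
  also have "\<dots> \<le> Cr * norm (A *v v - t *\<^sub>R v) + Cr * \<eta> * norm v"
    using near_mult[OF assms(1), of v] by (simp add: distrib_left)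
  also have "Cr * \<eta> * norm v \<le> 1/4 * norm v"
    using \<eta>_bounds(1) by (intro mult_right_mono) auto
  finally have "norm v \<le> 2 * Cr * norm (A *v v - t *\<^sub>R v)"
    using Cr_nonneg by (simp add: field_simps) (smt (verit) norm_ge_zero mult_nonneg_nonneg)
  also have "\<dots> \<le> K * norm (A *v v - t *\<^sub>R v)"
    using K_ge by (auto intro!: mult_right_mono)
  finally show ?thesis .
qed

lemma rv:
  assumes "norm (A - A0) \<le> \<eta>"
  shows "A *v rv i A = ev i A *\<^sub>R rv i A" "l i \<bullet> rv i A = 1"
proof -
  obtain v where v: "v \<noteq> 0" "A *v v = ev i A *\<^sub>R v"
    using det_zero_eigenvector[OF ev(2)[OF assms, of i]] by blast
  have "l i \<bullet> v \<noteq> 0"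
    using sector_strong[OF assms, of "ev i A" i v] ev(1)[OF assms, of i] v \<delta>_pos by auto
  then have "A *v (v /\<^sub>R (l i \<bullet> v)) = ev i A *\<^sub>R (v /\<^sub>R (l i \<bullet> v)) \<and> l i \<bullet> (v /\<^sub>R (l i \<bullet> v)) = 1"
    using v by (simp add: matrix_vector_mult_scaleR)
  then have "A *v rv i A = ev i A *\<^sub>R rv i A \<and> l i \<bullet> rv i A = 1"
    unfolding rv_def by (rule someI)
  then show "A *v rv i A = ev i A *\<^sub>R rv i A" "l i \<bullet> rv i A = 1" by auto
qed

lemma norm_rv_le: assumes "norm (A - A0) \<le> \<eta>" shows "norm (rv i A) \<le> 2 * R"
  using sector_strong[OF assms, of "ev i A" i "rv i A"] ev(1)[OF assms, of i] rv[OF assms, of i] \<delta>_pos by simp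

lemma N_rv_le:
  assumes "norm (A - A0) \<le> \<eta>"
  shows "norm (N i (rv i A)) \<le> 1/2"
proof -
  have "norm (N i (rv i A)) \<le> Cr * \<eta> * norm (rv i A)"
    using N_bound[of "ev i A" i "rv i A" A] ev(1)[OF assms, of i] rv[OF assms, of i]
      near_mult[OF assms, of "rv i A"] \<delta>_pos by simp
  also have "\<dots> \<le> Cr * \<eta> * (2 * R)"
    using norm_rv_le[OF assms] Cr_nonneg \<eta>_pos by (intro mult_left_mono) auto
  finally show ?thesis using \<eta>_bounds(2) by linarith
qed

interpretation t: spectral_nbhd "transpose A0" lam l r \<delta> \<eta>
  by (rule transposed_nbhd)

lemma near_transpose: "norm (A - A0) \<le> \<eta> \<Longrightarrow> norm (transpose A - transpose A0) \<le> \<eta>"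
  using norm_transpose[of "A - A0"] by (simp add: transpose_diff)

lemma t_ev: "t.ev i (transpose A) = ev i A"
  unfolding t.ev_def ev_def det_transpose_shifted ..

lemma lv_eq: "lv i A = t.rv i (transpose A)"
  unfolding t.rv_def lv_def t_ev ..

lemma t_const: "t.R = R" "t.Cr = Cr" "t.K = K"
proof -
  show *: "t.R = R" "t.Cr = Cr"
    by (simp_all add: t.Cr_def t.R_def Cr_def R_def mult.commute add.commute)
  show "t.K = K" by (simp add: t.K_def K_def *)
qed

lemma lv:
  assumes "norm (A - A0) \<le> \<eta>"
  shows "lv i A \<bullet> (A *v x) = ev i A * (lv i A \<bullet> x)" "lv i A \<bullet> r i = 1" "norm (lv i A) \<le> 2 * R"
proof -
  note a = near_transpose[OF assms]
  show "lv i A \<bullet> (A *v x) = ev i A * (lv i A \<bullet> x)"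
    using t.rv(1)[OF a, of i] inner_transpose[of A "lv i A" x] by (simp add: lv_eq t_ev)
  show "lv i A \<bullet> r i = 1"
    using t.rv(2)[OF a, of i] by (simp add: lv_eq inner_commute)
  show "norm (lv i A) \<le> 2 * R"
    using t.norm_rv_le[OF a, of i] by (simp add: lv_eq t_const)
qed

lemma lv_rv_ge:
  assumes "norm (A - A0) \<le> \<eta>" "norm (B - A0) \<le> \<eta>"
  shows "1/2 \<le> lv i A \<bullet> rv i B"
proof -
  let ?w = "t.N i (lv i A)" and ?v = "N i (rv i B)"
  have w: "lv i A = l i + ?w"
    using lv(2)[OF assms(1), of i] by (simp add: t.N_def inner_commute)
  have v: "rv i B = r i + ?v"
    using rv(2)[OF assms(2), of i] by (simp add: N_def)
  have "?w \<bullet> r i = 0" "l i \<bullet> ?v = 0"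
    using lv(2)[OF assms(1), of i] rv(2)[OF assms(2), of i]
    by (simp_all add: N_def t.N_def inner_diff_left inner_diff_right dual inner_commute)
  then have "lv i A \<bullet> rv i B = 1 + ?w \<bullet> ?v"
    by (subst w, subst v) (simp add: inner_add_left inner_add_right dual)
  moreover have "\<bar>?w \<bullet> ?v\<bar> \<le> 1/2 * (1/2)"
    using Cauchy_Schwarz_ineq2[of ?w ?v] N_rv_le[OF assms(2), of i]
      t.N_rv_le[OF near_transpose[OF assms(1)], of i]
    by (smt (verit) lv_eq mult_mono norm_ge_zero)
  ultimately show ?thesis by linarith
qed

lemma ev_Lipschitz:
  assumes "norm (A - A0) \<le> \<eta>" "norm (B - A0) \<le> \<eta>"
  shows ev_diff: "(ev i A - ev i B) * (lv i A \<bullet> rv i B) = lv i A \<bullet> ((A - B) *v rv i B)"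
    and "\<bar>ev i A - ev i B\<bar> \<le> K * norm (A - B)"
proof -
  show eq: "(ev i A - ev i B) * (lv i A \<bullet> rv i B) = lv i A \<bullet> ((A - B) *v rv i B)"
    using lv(1)[OF assms(1), of i "rv i B"] rv(1)[OF assms(2), of i]
    by (simp add: matrix_diff_vector inner_diff_right algebra_simps)
  have "\<bar>ev i A - ev i B\<bar> * (1/2) \<le> \<bar>ev i A - ev i B\<bar> * \<bar>lv i A \<bullet> rv i B\<bar>"
    using lv_rv_ge[OF assms, of i] by (intro mult_left_mono) auto
  also have "\<dots> = \<bar>lv i A \<bullet> ((A - B) *v rv i B)\<bar>"
    by (simp only: abs_mult[symmetric] eq)
  also have "\<dots> \<le> norm (lv i A) * norm ((A - B) *v rv i B)"
    by (rule Cauchy_Schwarz_ineq2)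
  also have "\<dots> \<le> norm (lv i A) * (norm (A - B) * norm (rv i B))"
    by (intro mult_left_mono norm_matrix_vector_le) simp
  also have "\<dots> \<le> (2 * R) * (norm (A - B) * (2 * R))"
    using lv(3)[OF assms(1)] norm_rv_le[OF assms(2)] R_ge(1) by (intro mult_mono) auto
  finally have "\<bar>ev i A - ev i B\<bar> \<le> (8*R*R) * norm (A - B)" by (simp add: algebra_simps)
  also have "\<dots> \<le> K * norm (A - B)"
    using K_ge(2) by (intro mult_right_mono) auto
  finally show "\<bar>ev i A - ev i B\<bar> \<le> K * norm (A - B)" .
qed

lemma ev_Lipschitz': 
  assumes "norm (A - A0) \<le> \<eta>" "norm (B - A0) \<le> \<eta>"
  shows "\<bar>ev i A - ev i B\<bar> \<le> 8*R*R * norm (A - B)"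
proof -
  have "\<bar>ev i A - ev i B\<bar> * (1/2) \<le> \<bar>ev i A - ev i B\<bar> * \<bar>lv i A \<bullet> rv i B\<bar>"
    using lv_rv_ge[OF assms, of i] by (intro mult_left_mono) auto
  also have "\<dots> = \<bar>lv i A \<bullet> ((A - B) *v rv i B)\<bar>"
    by (simp only: abs_mult[symmetric] ev_diff[OF assms])
  also have "\<dots> \<le> norm (lv i A) * norm ((A - B) *v rv i B)"
    by (rule Cauchy_Schwarz_ineq2)
  also have "\<dots> \<le> norm (lv i A) * (norm (A - B) * norm (rv i B))"
    by (intro mult_left_mono norm_matrix_vector_le) simp
  also have "\<dots> \<le> (2 * R) * (norm (A - B) * (2 * R))"
    using lv(3)[OF assms(1)] norm_rv_le[OF assms(2)] R_ge(1) by (intro mult_mono) auto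
  finally show ?thesis by (simp add: algebra_simps)
qed

text \<open>The difference of two normalised eigenvectors has \<open>i\<close>-th coordinate zero, so \<open>sector\<close> bounds it by its image.\<close>
lemma rv_Lipschitz:
  assumes "norm (A - A0) \<le> \<eta>" "norm (B - A0) \<le> \<eta>"
  shows "norm (rv i A - rv i B) \<le> K * norm (A - B)"
proof -
  let ?d = "rv i A - rv i B"
  have "A *v ?d - ev i A *\<^sub>R ?d = - ((A - B) *v rv i B) + (ev i A - ev i B) *\<^sub>R rv i B"
    using rv(1)[OF assms(1), of i] rv(1)[OF assms(2), of i]
    by (simp add: matrix_diff_vector algebra_simps matrix_vector_mult_diff_distrib)
  then have "norm (A *v ?d - ev i A *\<^sub>R ?d) \<le> norm ((A - B) *v rv i B) + norm ((ev i A - ev i B) *\<^sub>R rv i B)"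
    using norm_triangle_ineq[of "- ((A - B) *v rv i B)" "(ev i A - ev i B) *\<^sub>R rv i B"] by simp
  also have "\<dots> \<le> norm (A - B) * norm (rv i B) + \<bar>ev i A - ev i B\<bar> * norm (rv i B)"
    using norm_matrix_vector_le[of "A - B" "rv i B"] by simp
  also have "\<dots> \<le> norm (A - B) * (2*R) + (8*R*R * norm (A - B)) * (2*R)"
    using norm_rv_le[OF assms(2)] ev_Lipschitz'[OF assms] R_ge(1)
    by (intro add_mono mult_mono) auto
  finally have *: "norm (A *v ?d - ev i A *\<^sub>R ?d) \<le> (2*R + 8*R*R*(2*R)) * norm (A - B)"
    by (simp add: algebra_simps)
  have "norm ?d \<le> 2*Cr * norm (A *v ?d - ev i A *\<^sub>R ?d)"
    using sector_strong[OF assms(1), of "ev i A" i ?d] ev(1)[OF assms(1), of i]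
      rv(2)[OF assms(1), of i] rv(2)[OF assms(2), of i] \<delta>_pos by (simp add: inner_diff_right)
  also have "\<dots> \<le> 2*Cr * ((2*R + 8*R*R*(2*R)) * norm (A - B))"
    using * Cr_nonneg by (intro mult_left_mono) auto
  also have "\<dots> \<le> K * norm (A - B)"
    using K_ge(5) by (metis mult.assoc mult_right_mono norm_ge_zero)
  finally show ?thesis .
qed

end

context spectral_nbhd
begin

interpretation t: spectral_nbhd "transpose A0" lam l r \<delta> \<eta>
  by (rule transposed_nbhd)

lemma lv_Lipschitz:
  assumes "norm (A - A0) \<le> \<eta>" "norm (B - A0) \<le> \<eta>"
  shows "norm (lv i A - lv i B) \<le> K * norm (A - B)"
  using t.rv_Lipschitz[OF near_transpose near_transpose, OF assms, of i]
  by (simp add: lv_eq t_const norm_transpose transpose_diff[symmetric])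

lemma eigenpair_unique:
  assumes "norm (A - A0) \<le> \<eta>" "\<bar>t - lam i\<bar> \<le> 2 * \<delta>" "A *v v = t *\<^sub>R v" "v \<noteq> 0"
  shows "t = ev i A" "v = (l i \<bullet> v) *\<^sub>R rv i A" "l i \<bullet> v \<noteq> 0"
proof -
  show ne: "l i \<bullet> v \<noteq> 0"
    using sector_strong[OF assms(1,2), of v] assms(3,4) by auto
  let ?d = "v - (l i \<bullet> v) *\<^sub>R rv i A"
  have 1: "A *v ?d - t *\<^sub>R ?d = (l i \<bullet> v) *\<^sub>R ((t - ev i A) *\<^sub>R rv i A)"
    using assms(3) rv(1)[OF assms(1), of i]
    by (simp add: algebra_simps matrix_vector_mult_scaleR)
  have 0: "l i \<bullet> ?d = 0"
    using rv(2)[OF assms(1), of i] by (simp add: inner_diff_right)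
  have "norm (N i v) \<le> Cr * \<eta> * norm v"
    using N_bound[OF assms(2), of v A] near_mult[OF assms(1), of v] assms(3) by simp
  moreover have "norm v \<le> 2*R*\<bar>l i \<bullet> v\<bar>"
    using sector_strong[OF assms(1,2), of v] assms(3) by simp
  ultimately have Nv: "norm (N i v) \<le> 1/2 * \<bar>l i \<bullet> v\<bar>"
    using \<eta>_bounds Cr_nonneg \<eta>_pos
    by (smt (verit, best) abs_ge_zero mult.assoc mult_left_mono mult_nonneg_nonneg mult_right_mono)
  have "lv i A \<bullet> v = (l i \<bullet> v) + t.N i (lv i A) \<bullet> N i v"
  proof -
    have w: "lv i A = l i + t.N i (lv i A)"
      using lv(2)[OF assms(1), of i] by (simp add: t.N_def inner_commute)
    have v: "v = (l i \<bullet> v) *\<^sub>R r i + N i v" by (simp add: N_def)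
    have "t.N i (lv i A) \<bullet> r i = 0" "l i \<bullet> N i v = 0"
      using lv(2)[OF assms(1), of i]
      by (simp_all add: N_def t.N_def inner_diff_left inner_diff_right dual inner_commute)
    then show ?thesis
      by (subst w, subst v) (simp add: inner_add_left inner_add_right dual)
  qed
  moreover have "\<bar>t.N i (lv i A) \<bullet> N i v\<bar> \<le> 1/2 * (1/2 * \<bar>l i \<bullet> v\<bar>)"
    using Cauchy_Schwarz_ineq2[of "t.N i (lv i A)" "N i v"] Nv
      t.N_rv_le[OF near_transpose[OF assms(1)], of i]
    by (smt (verit) lv_eq mult_mono norm_ge_zero)
  ultimately have "lv i A \<bullet> v \<noteq> 0" using ne by linarith
  moreover have "(t - ev i A) * (lv i A \<bullet> v) = 0"
    using lv(1)[OF assms(1), of i v] assms(3) by (simp add: algebra_simps)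
  ultimately show t: "t = ev i A" by simp
  have "norm ?d \<le> 0"
    using sector_strong[OF assms(1,2), of ?d] 0 1 t by simp
  then show "v = (l i \<bullet> v) *\<^sub>R rv i A" by simp
qed

end

context spectral_nbhd
begin

interpretation t: spectral_nbhd "transpose A0" lam l r \<delta> \<eta>
  by (rule transposed_nbhd)

lemma at_A0: "ev i A0 = lam i" "rv i A0 = r i" "lv i A0 = l i"
proof -
  have n: "norm (A0 - A0) \<le> \<eta>" using \<eta>_pos by simp
  have e: "lam i = ev i A0" "r i = (l i \<bullet> r i) *\<^sub>R rv i A0"
    by (rule eigenpair_unique[OF n, of "lam i" i "r i"]; use right \<delta>_pos dual[of i i] in fastforce)+
  then show "ev i A0 = lam i" "rv i A0 = r i" by (auto simp: dual)
  have "l i = (r i \<bullet> l i) *\<^sub>R t.rv i (transpose A0)"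
    by (rule t.eigenpair_unique; use n \<delta>_pos t.right t.dual[of i i] in fastforce)
  then show "lv i A0 = l i" by (simp add: lv_eq t.dual)
qed

end

lemma (in spectral) nbhd_exists: "\<exists>\<eta>. spectral_nbhd A0 lam r l \<delta> \<eta>"
proof -
  obtain \<eta>0 where \<eta>0: "\<eta>0 > 0" "\<And>A i. norm (A - A0) \<le> \<eta>0 \<Longrightarrow>
      \<exists>x. \<bar>x - lam i\<bar> < \<delta> \<and> det (A - x *\<^sub>R mat 1) = 0"
    using eigenvalue_nearby by blast
  let ?c = "4 * (1 + Cr) * R"
  have c: "?c > 0" using Cr_nonneg R_ge(1) by (intro mult_pos_pos) auto
  have "?c * min \<eta>0 (1 / ?c) \<le> ?c * (1 / ?c)"
    using c by (intro mult_left_mono) auto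
  also have "?c * (1 / ?c) = 1"
    using c by (metis less_irrefl nonzero_eq_divide_eq mult.commute)
  finally have "spectral_nbhd A0 lam r l \<delta> (min \<eta>0 (1 / ?c))"
    using \<eta>0 c by unfold_locales auto
  then show ?thesis by blast
qed

section \<open>The Rankine-Hugoniot relation\<close>

lemma norm_vector_minus_le: "x \<in> cball c d \<Longrightarrow> norm (x - c) \<le> d"
  by (simp add: dist_norm norm_minus_commute)

lemma bounded_linear_mult_vector: "bounded_linear (\<lambda>A :: real^'n^'m. A *v x)"
  by (intro linear_conv_bounded_linear[THEN iffD1] linearI)
    (simp_all add: matrix_vector_mult_add_rdistrib scaleR_matrix_vector_assoc)

lemma continuous_on_matrix_vector_mult [continuous_intros]:
  fixes F :: "'a::topological_space \<Rightarrow> real^'n^'m"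
  assumes "continuous_on S F" "continuous_on S g"
  shows "continuous_on S (\<lambda>x. F x *v g x)"
  unfolding matrix_vector_mult_def
  by (intro continuous_intros assms continuous_on_vec_lambda)

text \<open>Schwarz's theorem: both values are the limit of the same second difference of \<open>\<phi>\<close>.\<close>
lemma gradient_derivative_symmetric:
  fixes g :: "'a::euclidean_space \<Rightarrow> 'a"
  assumes "d > 0" and \<phi>: "\<And>x. x \<in> ball x0 d \<Longrightarrow> (\<phi> has_derivative (\<lambda>h. g x \<bullet> h)) (at x)"
    and g: "(g has_derivative G) (at x0)"
  shows "G h \<bullet> k = G k \<bullet> h"
proof -
  define S where "S t h k = \<phi> (x0 + t *\<^sub>R h + t *\<^sub>R k) - \<phi> (x0 + t *\<^sub>R h) - \<phi> (x0 + t *\<^sub>R k) + \<phi> x0"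
    for t :: real and h k
  interpret G: bounded_linear G using g by (rule has_derivative_bounded_linear)
  have lim: "((\<lambda>t. S t h k / t\<^sup>2) \<longlongrightarrow> G k \<bullet> h) (at_right 0)" for h k
  proof (rule tendstoI)
    fix \<epsilon> :: real assume "\<epsilon> > 0"
    define M where "M = 2 * (norm h + norm k) * norm h + 1"
    have M: "M > 0" by (simp add: M_def add_nonneg_pos)
    obtain d' where d': "d' > 0" "\<And>y. norm (y - x0) < d' \<Longrightarrow> norm (g y - g x0 - G (y - x0)) \<le> \<epsilon> / M / 2 * norm (y - x0)"
      using g \<open>\<epsilon> > 0\<close> M unfolding has_derivative_at_alt
      by (metis divide_pos_pos zero_less_numeral)
    define t0 where "t0 = min d d' / (2 * (norm h + norm k + 1))"
    have t0: "t0 > 0" using \<open>d > 0\<close> d' by (auto simp: t0_def intro!: divide_pos_pos add_nonneg_pos)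
    have "dist (S t h k / t\<^sup>2) (G k \<bullet> h) < \<epsilon>" if "0 < t" "t < t0" for t
    proof -
      have small: "t * (norm h + norm k) < min d d'"
      proof -
        have "t * (norm h + norm k) \<le> t * (2 * (norm h + norm k + 1))"
          using that by (intro mult_left_mono) auto
        also have "\<dots> < t0 * (2 * (norm h + norm k + 1))"
          using that by (intro mult_strict_right_mono) (auto intro: add_nonneg_pos)
        also have "\<dots> = min d d'"
        proof -
          have "2 * (norm h + norm k + 1) \<noteq> 0" by (smt (verit) norm_ge_zero)
          then show ?thesis unfolding t0_def by simp
        qed
        finally show ?thesis .
      qed
      have bnd: "norm ((s * t) *\<^sub>R h + c *\<^sub>R k) \<le> t * (norm h + norm k)" if "0 \<le> s" "s \<le> 1" "c = 0 \<or> c = t" for s c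
      proof -
        have "norm ((s * t) *\<^sub>R h + c *\<^sub>R k) \<le> s * t * norm h + t * norm k"
          using that \<open>0 < t\<close> by (intro order_trans[OF norm_triangle_ineq] add_mono) (auto simp: abs_mult)
        also have "s * t * norm h \<le> t * norm h"
          using that \<open>0 < t\<close> by (intro mult_right_mono) auto
        finally show ?thesis by (simp add: algebra_simps)
      qed
      have der: "((\<lambda>s. \<phi> (x0 + (s * t) *\<^sub>R h + c *\<^sub>R k)) has_real_derivative
          g (x0 + (s * t) *\<^sub>R h + c *\<^sub>R k) \<bullet> (t *\<^sub>R h)) (at s)" if "0 \<le> s" "s \<le> 1" "c = 0 \<or> c = t" for s c
      proof -
        have "x0 + (s * t) *\<^sub>R h + c *\<^sub>R k \<in> ball x0 d"
          using bnd[OF that] small dist_add_cancel[of x0 0 "(s * t) *\<^sub>R h + c *\<^sub>R k"]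
          by (simp add: add.assoc)
        note \<phi>[OF this]
        then have "((\<lambda>s. \<phi> (x0 + (s * t) *\<^sub>R h + c *\<^sub>R k)) has_derivative
            (\<lambda>y. g (x0 + (s * t) *\<^sub>R h + c *\<^sub>R k) \<bullet> ((y * t) *\<^sub>R h))) (at s)"
          by (rule has_derivative_compose[rotated]) (auto intro!: derivative_eq_intros)
        then show ?thesis
          by (rule has_derivative_imp_has_field_derivative) simp
      qed
      define \<psi> where "\<psi> s = \<phi> (x0 + (s * t) *\<^sub>R h + t *\<^sub>R k) - \<phi> (x0 + (s * t) *\<^sub>R h + 0 *\<^sub>R k)" for s
      have d\<psi>: "(\<psi> has_real_derivative (g (x0 + (s * t) *\<^sub>R h + t *\<^sub>R k) \<bullet> (t *\<^sub>R h)
          - g (x0 + (s * t) *\<^sub>R h + 0 *\<^sub>R k) \<bullet> (t *\<^sub>R h))) (at s)" if "0 \<le> s" "s \<le> 1" for s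
        unfolding \<psi>_def by (intro DERIV_diff der that) auto
      obtain s where s: "0 < s" "s < 1" and eq: "\<psi> 1 - \<psi> 0 = (1 - 0) * (g (x0 + (s * t) *\<^sub>R h + t *\<^sub>R k) \<bullet> (t *\<^sub>R h)
          - g (x0 + (s * t) *\<^sub>R h + 0 *\<^sub>R k) \<bullet> (t *\<^sub>R h))"
        using MVT2[of 0 1 \<psi>, OF _ d\<psi>] by auto
      let ?y = "x0 + (s * t) *\<^sub>R h + t *\<^sub>R k" and ?z = "x0 + (s * t) *\<^sub>R h + 0 *\<^sub>R k"
      have Seq: "S t h k = t * ((g ?y - g ?z) \<bullet> h)"
        using eq by (simp add: S_def \<psi>_def inner_diff_left algebra_simps)
      have est: "norm (g w - g x0 - G (w - x0)) \<le> \<epsilon> / M / 2 * (t * (norm h + norm k))"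
        if w: "w = x0 + (s * t) *\<^sub>R h + c *\<^sub>R k" "c = 0 \<or> c = t" for w c
      proof -
        have 1: "norm (w - x0) \<le> t * (norm h + norm k)"
          using bnd[of s c] s w by (simp add: add.assoc)
        have "norm (g w - g x0 - G (w - x0)) \<le> \<epsilon> / M / 2 * norm (w - x0)"
          using d'(2)[of w] 1 small by simp
        also have "\<dots> \<le> \<epsilon> / M / 2 * (t * (norm h + norm k))"
          using 1 \<open>\<epsilon> > 0\<close> M by (intro mult_left_mono) auto
        finally show ?thesis .
      qed
      have Geq: "G (?y - x0) - G (?z - x0) = t *\<^sub>R G k"
        by (simp add: G.diff[symmetric] G.scaleR[symmetric])
      have "norm (g ?y - g ?z - t *\<^sub>R G k) \<le> 2 * (\<epsilon> / M / 2 * (t * (norm h + norm k)))"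
      proof -
        have "g ?y - g ?z - t *\<^sub>R G k = (g ?y - g x0 - G (?y - x0)) - (g ?z - g x0 - G (?z - x0))"
          using Geq by (simp add: algebra_simps)
        then have "norm (g ?y - g ?z - t *\<^sub>R G k) \<le> norm (g ?y - g x0 - G (?y - x0)) + norm (g ?z - g x0 - G (?z - x0))"
          by (metis norm_triangle_ineq4)
        then show ?thesis
          unfolding mult_2 using add_mono[OF est[OF refl disjI2[OF refl]] est[OF refl disjI1[OF refl]]]
          by (rule order_trans)
      qed
      then have "norm (g ?y - g ?z - t *\<^sub>R G k) * norm h \<le> 2 * (\<epsilon> / M / 2 * (t * (norm h + norm k))) * norm h"
        by (rule mult_right_mono) simp
      moreover have "\<bar>(g ?y - g ?z - t *\<^sub>R G k) \<bullet> h\<bar> \<le> norm (g ?y - g ?z - t *\<^sub>R G k) * norm h"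
        by (rule Cauchy_Schwarz_ineq2)
      ultimately have 2: "\<bar>(g ?y - g ?z) \<bullet> h - t * (G k \<bullet> h)\<bar> \<le> \<epsilon> / M * ((norm h + norm k) * norm h) * t"
        by (simp add: inner_diff_left algebra_simps)
      have "\<epsilon> / M * ((norm h + norm k) * norm h) < \<epsilon>"
        using \<open>\<epsilon> > 0\<close> M by (simp add: field_simps M_def) (smt (verit) mult_nonneg_nonneg norm_ge_zero)
      then have "\<epsilon> / M * ((norm h + norm k) * norm h) * t < \<epsilon> * t"
        using that by (intro mult_strict_right_mono) auto
      with 2 have "\<bar>(g ?y - g ?z) \<bullet> h - t * (G k \<bullet> h)\<bar> < \<epsilon> * t" by linarith
      moreover have "S t h k / t\<^sup>2 - G k \<bullet> h = ((g ?y - g ?z) \<bullet> h - t * (G k \<bullet> h)) / t"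
        using that by (simp add: Seq power2_eq_square field_simps)
      ultimately show ?thesis
        using that by (simp add: dist_real_def pos_divide_less_eq abs_divide)
    qed
    then show "\<forall>\<^sub>F t in at_right 0. dist (S t h k / t\<^sup>2) (G k \<bullet> h) < \<epsilon>"
      using t0 by (auto simp: eventually_at_right_field)
  qed
  have sym: "S t h k = S t k h" for t
    by (simp add: S_def algebra_simps)
  then have "((\<lambda>t. S t h k / t\<^sup>2) \<longlongrightarrow> G h \<bullet> k) (at_right 0)"
    using lim[of k h] by simp
  then show ?thesis
    using tendsto_unique[OF _ _ lim[of h k]] by simp
qed

locale flux = spectral_nbhd A0 lam r l \<delta> \<eta>
  for A0 :: "real^'m^'m" and lam r l \<delta> \<eta> +
  fixes f :: "real^'m \<Rightarrow> real^'m" and J :: "real^'m \<Rightarrow> real^'m^'m"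
    and J' :: "real^'m \<Rightarrow> real^'m \<Rightarrow> real^'m^'m"
    and Vbar :: "real^'m" and \<rho> L :: real
  assumes \<rho>_pos: "\<rho> > 0"
    and f_deriv: "X \<in> cball Vbar \<rho> \<Longrightarrow> (f has_derivative (\<lambda>h. J X *v h)) (at X)"
    and J_deriv: "X \<in> cball Vbar \<rho> \<Longrightarrow> (J has_derivative J' X) (at X)"
    and J_center: "J Vbar = A0"
    and J_near: "X \<in> cball Vbar \<rho> \<Longrightarrow> norm (J X - A0) \<le> \<eta>"
    and J'_bound: "X \<in> cball Vbar \<rho> \<Longrightarrow> norm (J' X h) \<le> L * norm h"
    and J'_cont: "continuous_on (cball Vbar \<rho>) (\<lambda>X. J' X h)"
begin

abbreviation B where "B \<equiv> cball Vbar \<rho>"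

lemma center [simp]: "Vbar \<in> B" using \<rho>_pos by simp

lemma L_nonneg: "0 \<le> L"
proof -
  have "0 \<le> L * norm (axis undefined 1 :: real^'m)"
    using J'_bound[OF center, of "axis undefined 1"] norm_ge_zero order_trans by blast
  then show ?thesis by (simp add: norm_axis_1)
qed

lemma segment_in_B:
  assumes "U \<in> cball Vbar d" "W \<in> cball Vbar d" "0 \<le> s" "s \<le> 1"
  shows "W + s *\<^sub>R (U - W) \<in> cball Vbar d"
proof -
  have "(1 - s) *\<^sub>R W + s *\<^sub>R U \<in> cball Vbar d"
    using convex_cball assms by (intro convexD) auto
  then show ?thesis by (simp add: algebra_simps)
qed

lemma J_Lipschitz: "X \<in> B \<Longrightarrow> Y \<in> B \<Longrightarrow> norm (J X - J Y) \<le> L * norm (X - Y)"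
  by (rule differentiable_bound[of B J J'])
    (auto intro!: onorm_le J'_bound has_derivative_at_withinI[OF J_deriv])

lemma J_continuous: "continuous_on B J"
  using has_derivative_continuous[OF J_deriv] by (auto intro!: continuous_at_imp_continuous_on)

lemma f_continuous: "continuous_on B f"
  using has_derivative_continuous[OF f_deriv] by (auto intro!: continuous_at_imp_continuous_on)

text \<open>The averaged Jacobian turns differences of the flux into matrix products: \<open>f U - f W = avg U W *v (U - W)\<close>.\<close>
definition avg :: "real^'m \<Rightarrow> real^'m \<Rightarrow> real^'m^'m" where
  "avg U W = integral {0..1} (\<lambda>s. J (W + s *\<^sub>R (U - W)))"

lemma avg_integrable: "U \<in> B \<Longrightarrow> W \<in> B \<Longrightarrow> (\<lambda>s. J (W + s *\<^sub>R (U - W))) integrable_on {0..1}"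
  by (intro integrable_continuous_real continuous_on_compose2[OF J_continuous] continuous_intros)
    (auto intro: segment_in_B)

lemma avg_same: "avg W W = J W"
  by (simp add: avg_def)

lemma avg_diff:
  assumes U: "U \<in> B" and W: "W \<in> B"
  shows "f U - f W = avg U W *v (U - W)"
proof -
  have "((\<lambda>s. J (W + s *\<^sub>R (U - W)) *v (U - W)) has_integral (f (W + 1 *\<^sub>R (U - W)) - f (W + 0 *\<^sub>R (U - W)))) {0..1}"
  proof (rule fundamental_theorem_of_calculus)
    fix s :: real assume s: "s \<in> {0..1}"
    have "((\<lambda>s. f (W + s *\<^sub>R (U - W))) has_derivative (\<lambda>y. J (W + s *\<^sub>R (U - W)) *v (y *\<^sub>R (U - W)))) (at s)"
    proof -
      have "((\<lambda>s. W + s *\<^sub>R (U - W)) has_derivative (\<lambda>y. y *\<^sub>R (U - W))) (at s)"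
        by (auto intro!: derivative_eq_intros)
      moreover have "(f has_derivative (*v) (J (W + s *\<^sub>R (U - W)))) (at (W + s *\<^sub>R (U - W)))"
        using f_deriv[OF segment_in_B[OF U W]] s by auto
      ultimately show ?thesis
        by (rule has_derivative_compose)
    qed
    then show "((\<lambda>s. f (W + s *\<^sub>R (U - W))) has_vector_derivative J (W + s *\<^sub>R (U - W)) *v (U - W)) (at s within {0..1})"
      unfolding has_vector_derivative_def
      by (simp add: has_derivative_at_withinI matrix_vector_mult_scaleR)
  qed simp
  moreover have "((\<lambda>s. J (W + s *\<^sub>R (U - W)) *v (U - W)) has_integral (avg U W *v (U - W))) {0..1}"
    using has_integral_linear[OF integrable_integral[OF avg_integrable[OF U W]] bounded_linear_mult_vector]
    by (simp add: o_def avg_def)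
  ultimately show ?thesis
    by (auto dest: has_integral_unique)
qed

lemma avg_near: assumes "U \<in> B" "W \<in> B" shows "norm (avg U W - A0) \<le> \<eta>"
proof -
  have "avg U W - A0 = integral {0..1} (\<lambda>s. J (W + s *\<^sub>R (U - W)) - A0)"
    using avg_integrable[OF assms] by (subst Henstock_Kurzweil_Integration.integral_diff) (auto simp: avg_def)
  also have "norm \<dots> \<le> \<eta> * (1 - 0)"
    by (intro integral_bound integrable_continuous_real continuous_intros continuous_on_compose2[OF J_continuous])
      (auto intro!: segment_in_B J_near assms)
  finally show ?thesis by simp
qed

lemma avg_Lipschitz:
  assumes "U \<in> B" "W \<in> B" "U' \<in> B" "W' \<in> B"
  shows "norm (avg U W - avg U' W') \<le> L * (norm (U - U') + norm (W - W'))"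
proof -
  have "avg U W - avg U' W' = integral {0..1} (\<lambda>s. J (W + s *\<^sub>R (U - W)) - J (W' + s *\<^sub>R (U' - W')))"
    using avg_integrable assms by (simp add: avg_def Henstock_Kurzweil_Integration.integral_diff)
  also have "norm \<dots> \<le> L * (norm (U - U') + norm (W - W')) * (1 - 0)"
  proof (rule integral_bound)
    show "continuous_on {0..1} (\<lambda>s. J (W + s *\<^sub>R (U - W)) - J (W' + s *\<^sub>R (U' - W')))"
      by (intro continuous_intros continuous_on_compose2[OF J_continuous])
        (auto intro!: segment_in_B assms)
    fix s :: real assume s: "s \<in> {0..1}"
    have "norm (J (W + s *\<^sub>R (U - W)) - J (W' + s *\<^sub>R (U' - W')))
        \<le> L * norm (W + s *\<^sub>R (U - W) - (W' + s *\<^sub>R (U' - W')))"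
      using s assms by (intro J_Lipschitz segment_in_B) auto
    also have "W + s *\<^sub>R (U - W) - (W' + s *\<^sub>R (U' - W')) = s *\<^sub>R (U - U') + (1 - s) *\<^sub>R (W - W')"
      by (simp add: algebra_simps)
    also have "norm \<dots> \<le> s * norm (U - U') + (1 - s) * norm (W - W')"
      using s by (intro order_trans[OF norm_triangle_ineq]) auto
    also have "\<dots> \<le> norm (U - U') + norm (W - W')"
      using s by (intro add_mono mult_left_le_one_le) auto
    finally show "norm (J (W + s *\<^sub>R (U - W)) - J (W' + s *\<^sub>R (U' - W'))) \<le> L * (norm (U - U') + norm (W - W'))"
      using L_nonneg by (simp add: mult_left_mono)
  qed simp
  finally show ?thesis by simp
qed

definition speed :: "'m \<Rightarrow> real^'m \<Rightarrow> real" where "speed i X = ev i (J X)"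
definition dir :: "'m \<Rightarrow> real^'m \<Rightarrow> real^'m" where "dir i X = rv i (J X)"
definition codir :: "'m \<Rightarrow> real^'m \<Rightarrow> real^'m" where "codir i X = lv i (J X)"

lemma speed_Lipschitz: "X \<in> B \<Longrightarrow> Y \<in> B \<Longrightarrow> \<bar>speed i X - speed i Y\<bar> \<le> K * L * norm (X - Y)"
  unfolding speed_def mult.assoc
  by (rule order_trans[OF ev_Lipschitz(2) mult_left_mono[OF J_Lipschitz]])
    (use J_near K_ge(1) in auto)

lemma dir_Lipschitz: "X \<in> B \<Longrightarrow> Y \<in> B \<Longrightarrow> norm (dir i X - dir i Y) \<le> K * L * norm (X - Y)"
  unfolding dir_def mult.assoc
  by (rule order_trans[OF rv_Lipschitz mult_left_mono[OF J_Lipschitz]])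
    (use J_near K_ge(1) in auto)

lemma codir_Lipschitz: "X \<in> B \<Longrightarrow> Y \<in> B \<Longrightarrow> norm (codir i X - codir i Y) \<le> K * L * norm (X - Y)"
  unfolding codir_def mult.assoc
  by (rule order_trans[OF lv_Lipschitz mult_left_mono[OF J_Lipschitz]])
    (use J_near K_ge(1) in auto)

lemma avg_dir_Lipschitz:
  assumes "U \<in> B" "W \<in> B" "U' \<in> B" "W' \<in> B"
  shows "norm (rv i (avg U W) - rv i (avg U' W')) \<le> K * L * (norm (U - U') + norm (W - W'))"
  unfolding mult.assoc
  by (rule order_trans[OF rv_Lipschitz mult_left_mono[OF avg_Lipschitz]])
    (use avg_near K_ge(1) assms in auto)

lemma speed_facts:
  assumes "X \<in> B"
  shows "\<bar>speed i X - lam i\<bar> < \<delta>" "J X *v dir i X = speed i X *\<^sub>R dir i X" "l i \<bullet> dir i X = 1"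
    "norm (dir i X) \<le> K" "codir i X \<bullet> (J X *v v) = speed i X * (codir i X \<bullet> v)" "norm (codir i X) \<le> K"
  using ev[OF J_near[OF assms], of i] rv[OF J_near[OF assms], of i] lv[OF J_near[OF assms], of i]
    norm_rv_le[OF J_near[OF assms], of i] K_ge(4)
  by (simp_all add: speed_def dir_def codir_def)

lemma at_center: "speed i Vbar = lam i" "dir i Vbar = r i" "codir i Vbar = l i"
  by (simp_all add: speed_def dir_def codir_def J_center at_A0)

lemma norm_inner_l: "\<bar>l i \<bullet> v\<bar> \<le> K * norm v"
proof -
  have "\<bar>l i \<bullet> v\<bar> \<le> norm (l i) * norm v" by (rule Cauchy_Schwarz_ineq2)
  also have "\<dots> \<le> K * norm v"
    using R_ge(3)[of i] K_ge(4) R_ge(1) by (intro mult_right_mono) auto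
  finally show ?thesis .
qed

text \<open>A jump satisfying the Rankine-Hugoniot relation is an eigenvector of the averaged Jacobian.\<close>
lemma Rankine_Hugoniot_direction:
  assumes "U \<in> B" "W \<in> B" "f U - f W = \<sigma> *\<^sub>R (U - W)" "\<bar>\<sigma> - lam i\<bar> \<le> 2 * \<delta>" "U \<noteq> W"
  shows "\<sigma> = ev i (avg U W)" "U - W = (l i \<bullet> (U - W)) *\<^sub>R rv i (avg U W)" "l i \<bullet> (U - W) \<noteq> 0"
  using eigenpair_unique[OF avg_near[OF assms(1,2)] assms(4), of "U - W"] assms
    avg_diff[OF assms(1,2)] by auto

text \<open>Both jumps are multiples, with the same factor, of eigenvectors of averaged Jacobians, which depend on the
  end states in a Lipschitz way; for a small factor the difference is absorbed.\<close>
lemma Hugoniot_unique: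
  assumes "U \<in> B" "U' \<in> B" "W \<in> B"
    and "f U - f W = \<sigma> *\<^sub>R (U - W)" "\<bar>\<sigma> - lam i\<bar> \<le> 2 * \<delta>"
    and "f U' - f W = \<sigma>' *\<^sub>R (U' - W)" "\<bar>\<sigma>' - lam i\<bar> \<le> 2 * \<delta>"
    and eq: "l i \<bullet> (U - W) = l i \<bullet> (U' - W)"
    and small: "\<bar>l i \<bullet> (U - W)\<bar> * (K * L) < 1"
  shows "U = U'"
proof (cases "U = W \<or> U' = W")
  case True
  then show ?thesis
    using Rankine_Hugoniot_direction(3)[of U W \<sigma> i] Rankine_Hugoniot_direction(3)[of U' W \<sigma>' i] assms
    by (metis diff_self inner_zero_right)
next
  case False
  let ?u = "l i \<bullet> (U - W)"
  have "U - W = ?u *\<^sub>R rv i (avg U W)" "U' - W = ?u *\<^sub>R rv i (avg U' W)"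
    unfolding eq using False Rankine_Hugoniot_direction(2)[OF assms(1,3,4,5), unfolded eq]
      Rankine_Hugoniot_direction(2)[OF assms(2,3,6,7)] by blast+
  then have "(U - W) - (U' - W) = ?u *\<^sub>R (rv i (avg U W) - rv i (avg U' W))"
    by (simp only: scaleR_diff_right)
  then have "U - U' = ?u *\<^sub>R (rv i (avg U W) - rv i (avg U' W))"
    by simp
  then have "norm (U - U') = \<bar>?u\<bar> * norm (rv i (avg U W) - rv i (avg U' W))"
    by (metis norm_scaleR)
  also have "\<dots> \<le> \<bar>?u\<bar> * (K * L * norm (U - U'))"
    using avg_dir_Lipschitz[of U W U' W i] assms by (intro mult_left_mono) auto
  finally have "(1 - \<bar>?u\<bar> * (K * L)) * norm (U - U') \<le> 0" by (simp add: algebra_simps)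
  with small have "norm (U - U') \<le> 0"
    by (simp add: mult_le_0_iff)
  then show ?thesis by simp
qed

end

section \<open>Genuinely nonlinear fields\<close>

lemma bounded_bilinear_matrix_vector: "bounded_bilinear ((*v) :: real^'n^'m \<Rightarrow> real^'n \<Rightarrow> real^'m)"
proof
  show "\<exists>K. \<forall>(A :: real^'n^'m) x. norm (A *v x) \<le> norm A * norm x * K"
    by (intro exI[of _ 1]) (simp add: norm_matrix_vector_le)
qed (simp_all add: matrix_vector_mult_add_rdistrib matrix_vector_right_distrib
    matrix_vector_mult_scaleR scaleR_matrix_vector_assoc)

lemma bounded_linear_transpose: "bounded_linear (transpose :: real^'n^'m \<Rightarrow> real^'m^'n)"
  by (intro linear_conv_bounded_linear[THEN iffD1] linearI) (simp_all add: transpose_def vec_eq_iff)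

text \<open>Where \<open>F\<close> vanishes, the increment of \<open>G y \<bullet> F y\<close> is \<open>G y\<close> times that of \<open>F\<close>, so continuity of \<open>G\<close> suffices.\<close>
lemma has_derivative_inner_vanishing:
  fixes F G :: "'a::real_normed_vector \<Rightarrow> 'b::real_inner"
  assumes F: "(F has_derivative D) (at x)" and "F x = 0" and G: "isCont G x"
  shows "((\<lambda>y. G y \<bullet> F y) has_derivative (\<lambda>h. G x \<bullet> D h)) (at x)"
proof -
  interpret D: bounded_linear D by (rule has_derivative_bounded_linear[OF F])
  have 1: "((\<lambda>y. G x \<bullet> F y) has_derivative (\<lambda>h. G x \<bullet> D h)) (at x)"
    by (intro derivative_intros F)
  have 2: "((\<lambda>y. (G y - G x) \<bullet> F y) has_derivative (\<lambda>h. 0)) (at x)"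
    unfolding has_derivative_at_alt
  proof (intro conjI allI impI)
    fix e :: real assume e: "e > 0"
    obtain C where C: "C > 0" "\<And>h. norm (D h) \<le> norm h * C"
      using D.pos_bounded by blast
    obtain d1 where d1: "d1 > 0" "\<And>y. norm (y - x) < d1 \<Longrightarrow> norm (F y - F x - D (y - x)) \<le> 1 * norm (y - x)"
      using F unfolding has_derivative_at_alt by (metis zero_less_one)
    have "e / (C + 1) > 0" using e C by simp
    then obtain d2 where d2: "d2 > 0" "\<And>y. norm (y - x) < d2 \<Longrightarrow> norm (G y - G x) < e / (C + 1)"
      using G unfolding continuous_at_eps_delta dist_norm by blast
    show "\<exists>d>0. \<forall>y. norm (y - x) < d \<longrightarrow>
        norm ((G y - G x) \<bullet> F y - (G x - G x) \<bullet> F x - 0) \<le> e * norm (y - x)"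
    proof (intro exI[of _ "min d1 d2"] conjI allI impI)
      fix y assume y: "norm (y - x) < min d1 d2"
      have "F y = (F y - F x - D (y - x)) + D (y - x)" using \<open>F x = 0\<close> by simp
      then have "norm (F y) \<le> norm (F y - F x - D (y - x)) + norm (D (y - x))"
        by (metis norm_triangle_ineq)
      also have "\<dots> \<le> (C + 1) * norm (y - x)"
        using d1(2)[of y] C(2)[of "y - x"] y by (simp add: algebra_simps)
      finally have "norm (G y - G x) * norm (F y) \<le> e / (C + 1) * ((C + 1) * norm (y - x))"
        using d2(2)[of y] y e C(1) by (intro mult_mono) auto
      also have "\<dots> = e * norm (y - x)" using C(1) by simp
      finally show "norm ((G y - G x) \<bullet> F y - (G x - G x) \<bullet> F x - 0) \<le> e * norm (y - x)"
        using Cauchy_Schwarz_ineq2[of "G y - G x" "F y"] by simp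
    qed (use d1 d2 in auto)
  qed simp
  show ?thesis
    using has_derivative_add[OF 1 2] by (simp add: inner_diff_left)
qed

context flux
begin

interpretation matvec: bounded_bilinear "(*v) :: real^'m^'m \<Rightarrow> real^'m \<Rightarrow> real^'m"
  by (rule bounded_bilinear_matrix_vector)

text \<open>The derivative of the \<open>i\<close>-th speed at the centre in the direction of its own eigenvector: it vanishes
  exactly when genuine nonlinearity fails there.\<close>
definition curv where "curv i = l i \<bullet> (J' Vbar (r i) *v r i)"

lemma J'_linear: "X \<in> B \<Longrightarrow> linear (J' X)"
  using J_deriv has_derivative_linear by blast

lemma J'_expand: "X \<in> B \<Longrightarrow> J' X h = (\<Sum>b\<in>Basis. (h \<bullet> b) *\<^sub>R J' X b)"
  by (subst euclidean_representation[of h, symmetric])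
    (simp only: linear_sum[OF J'_linear] linear_scale[OF J'_linear])

lemma J'_scale: "X \<in> B \<Longrightarrow> J' X (c *\<^sub>R h) = c *\<^sub>R J' X h"
  by (rule linear_scale[OF J'_linear])

lemma J'_continuous:
  assumes "continuous_on S g" "continuous_on S a" "\<And>x. x \<in> S \<Longrightarrow> g x \<in> B"
  shows "continuous_on S (\<lambda>x. J' (g x) (a x))"
proof -
  have "continuous_on S (\<lambda>x. \<Sum>b\<in>Basis. (a x \<bullet> b) *\<^sub>R J' (g x) b)"
    by (intro continuous_intros continuous_on_compose2[OF J'_cont] assms) (use assms in auto)
  then show ?thesis
    by (rule continuous_on_eq) (use J'_expand assms in auto)
qed

lemma line_point_deriv: "((\<lambda>s. W + s *\<^sub>R V) has_derivative (\<lambda>y. y *\<^sub>R V)) (at s)"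
  by (auto intro!: derivative_eq_intros)

lemma line_f_deriv:
  assumes "U \<in> B" "W \<in> B" "0 \<le> s" "s \<le> 1"
  shows "((\<lambda>s. f (W + s *\<^sub>R (U - W))) has_vector_derivative (J (W + s *\<^sub>R (U - W)) *v (U - W))) (at s)"
  unfolding has_vector_derivative_def
  using has_derivative_compose[OF line_point_deriv f_deriv[OF segment_in_B[OF assms]]]
  by (simp add: matrix_vector_mult_scaleR)

lemma line_inner_f_deriv:
  assumes "U \<in> B" "W \<in> B" "0 \<le> s" "s \<le> 1"
  shows "((\<lambda>s. p \<bullet> f (W + s *\<^sub>R (U - W))) has_real_derivative p \<bullet> (J (W + s *\<^sub>R (U - W)) *v (U - W))) (at s)"
  using bounded_linear.has_vector_derivative[OF bounded_linear_inner_right line_f_deriv[OF assms], of p]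
  by (simp add: has_real_derivative_iff_has_vector_derivative)

lemma line_J_deriv:
  assumes "U \<in> B" "W \<in> B" "0 \<le> s" "s \<le> 1"
  shows "((\<lambda>s. J (W + s *\<^sub>R (U - W))) has_vector_derivative J' (W + s *\<^sub>R (U - W)) (U - W)) (at s)"
  unfolding has_vector_derivative_def
  using has_derivative_compose[OF line_point_deriv J_deriv[OF segment_in_B[OF assms]]]
  by (simp add: J'_scale[OF segment_in_B[OF assms]])

lemma line_inner_J_deriv:
  assumes "U \<in> B" "W \<in> B" "0 \<le> s" "s \<le> 1"
  shows "((\<lambda>s. p \<bullet> (J (W + s *\<^sub>R (U - W)) *v b)) has_real_derivative
    p \<bullet> (J' (W + s *\<^sub>R (U - W)) (U - W) *v b)) (at s)"
proof -
  have "bounded_linear (\<lambda>A :: real^'m^'m. p \<bullet> (A *v b))"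
    by (intro bounded_linear_compose[OF bounded_linear_inner_right] bounded_linear_mult_vector)
  from bounded_linear.has_vector_derivative[OF this line_J_deriv[OF assms]]
  show ?thesis by (simp add: has_real_derivative_iff_has_vector_derivative)
qed

lemma near_curv:
  assumes "curv i \<noteq> 0"
  obtains \<kappa> where "\<kappa> > 0" "\<kappa> \<le> \<rho>" "\<And>X a b p. \<lbrakk>X \<in> cball Vbar \<kappa>; norm (a - r i) \<le> \<kappa>; norm (b - r i) \<le> \<kappa>;
      norm (p - l i) \<le> \<kappa>\<rbrakk> \<Longrightarrow> 0 < curv i * (p \<bullet> (J' X a *v b))"
proof -
  define g where "g = (\<lambda>(X, a, b, p). curv i * (p \<bullet> (J' X a *v b)))"
  have "continuous_on (B \<times> UNIV \<times> UNIV \<times> UNIV) g"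
    unfolding g_def split_def by (intro continuous_intros J'_continuous) auto
  moreover have "g (Vbar, r i, r i, l i) > 0"
    using assms by (simp add: g_def curv_def[symmetric] zero_less_mult_iff) linarith
  ultimately obtain d where d: "d > 0" "\<And>z. z \<in> B \<times> UNIV \<times> UNIV \<times> UNIV \<Longrightarrow>
      dist z (Vbar, r i, r i, l i) < d \<Longrightarrow> dist (g z) (g (Vbar, r i, r i, l i)) < g (Vbar, r i, r i, l i)"
    unfolding continuous_on_iff by (metis (no_types, lifting) SigmaI UNIV_I center)
  show ?thesis
  proof (rule that[of "min \<rho> (d / 8)"])
    fix X a b p assume *: "X \<in> cball Vbar (min \<rho> (d / 8))" "norm (a - r i) \<le> min \<rho> (d / 8)"
      "norm (b - r i) \<le> min \<rho> (d / 8)" "norm (p - l i) \<le> min \<rho> (d / 8)"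
    have "dist (X, a, b, p) (Vbar, r i, r i, l i) = norm (X - Vbar, a - r i, b - r i, p - l i)"
      by (simp add: dist_norm)
    also have "\<dots> \<le> norm (X - Vbar) + (norm (a - r i) + (norm (b - r i) + norm (p - l i)))"
      by (intro order_trans[OF norm_Pair_le] add_left_mono order_refl)
    also have "\<dots> < d" using * d(1) by (simp add: dist_norm norm_minus_commute)
    finally have "dist (g (X, a, b, p)) (g (Vbar, r i, r i, l i)) < g (Vbar, r i, r i, l i)"
      using * by (intro d(2)) auto
    then show "0 < curv i * (p \<bullet> (J' X a *v b))"
      by (simp add: g_def dist_real_def)
  qed (use \<rho>_pos d in auto)
qed

lemma KL_nonneg: "0 \<le> K * L" using K_ge(1) L_nonneg by simp

lemma near_directions:
  assumes "\<kappa>0 > 0" "\<kappa>0 \<le> \<rho>"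
  obtains \<kappa> where "\<kappa> > 0" "\<kappa> \<le> \<kappa>0"
    "\<And>X. X \<in> cball Vbar \<kappa> \<Longrightarrow> norm (dir i X - r i) \<le> \<kappa>0 \<and> norm (codir i X - l i) \<le> \<kappa>0"
    "\<And>U W. U \<in> cball Vbar \<kappa> \<Longrightarrow> W \<in> cball Vbar \<kappa> \<Longrightarrow> norm (rv i (avg U W) - r i) \<le> \<kappa>0"
proof -
  define \<kappa> where "\<kappa> = \<kappa>0 / (1 + 2 * (K * L))"
  have pos: "1 + 2 * (K * L) > 0" using KL_nonneg by linarith
  have "\<kappa>0 = \<kappa> * (1 + 2 * (K * L))" using pos by (simp add: \<kappa>_def)
  then have eq: "\<kappa>0 = \<kappa> + K * L * (\<kappa> + \<kappa>)" by (simp add: algebra_simps)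
  have k: "\<kappa> > 0" using assms pos by (simp add: \<kappa>_def)
  have KLk: "0 \<le> K * L * \<kappa>" using k KL_nonneg by simp
  have eq': "\<kappa>0 = \<kappa> + (K * L * \<kappa> + K * L * \<kappa>)" by (subst eq) (simp only: distrib_left)
  with KLk k have le: "\<kappa> \<le> \<kappa>0" by linarith
  have inB: "X \<in> B" if "X \<in> cball Vbar \<kappa>" for X using that le assms by auto
  show ?thesis
  proof (rule that[OF k le])
    fix X assume X: "X \<in> cball Vbar \<kappa>"
    have "K * L * norm (X - Vbar) \<le> K * L * \<kappa>"
      using norm_vector_minus_le[OF X] KL_nonneg by (rule mult_left_mono)
    also have "\<dots> \<le> \<kappa>0" using eq' k KLk by linarith
    finally show "norm (dir i X - r i) \<le> \<kappa>0 \<and> norm (codir i X - l i) \<le> \<kappa>0"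
      using dir_Lipschitz[OF inB[OF X] center, of i] codir_Lipschitz[OF inB[OF X] center, of i] by (simp add: at_center)
  next
    fix U W assume U: "U \<in> cball Vbar \<kappa>" and W: "W \<in> cball Vbar \<kappa>"
    have "norm (rv i (avg U W) - rv i (avg Vbar Vbar)) \<le> K * L * (norm (U - Vbar) + norm (W - Vbar))"
      using inB U W by (intro avg_dir_Lipschitz center) blast+
    also have "\<dots> \<le> K * L * (\<kappa> + \<kappa>)"
      using norm_vector_minus_le[OF U] norm_vector_minus_le[OF W] KL_nonneg by (intro mult_left_mono) auto
    also have "\<dots> \<le> \<kappa>0" using eq k by linarith
    finally show "norm (rv i (avg U W) - r i) \<le> \<kappa>0"
      by (simp add: avg_same J_center at_A0)
  qed
qed

lemma codir_dir_ge: "X \<in> B \<Longrightarrow> Y \<in> B \<Longrightarrow> 1/2 \<le> codir i X \<bullet> dir i Y"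
  unfolding codir_def dir_def by (intro lv_rv_ge J_near)

lemma speed_diff: "X \<in> B \<Longrightarrow> Y \<in> B \<Longrightarrow>
    (speed i X - speed i Y) * (codir i X \<bullet> dir i Y) = codir i X \<bullet> ((J X - J Y) *v dir i Y)"
  unfolding codir_def dir_def speed_def by (intro ev_Lipschitz(1) J_near)

text \<open>Along a direction close to \<open>r i\<close> the speed is strictly monotone, by the mean value theorem and the
  continuity of the second derivative of the flux.\<close>
lemma speed_monotone:
  assumes "curv i \<noteq> 0"
  obtains \<kappa> where "\<kappa> > 0" "\<kappa> \<le> \<rho>" "\<And>U W u w. \<lbrakk>U \<in> cball Vbar \<kappa>; W \<in> cball Vbar \<kappa>; U - W = u *\<^sub>R (r i + w);
     norm w \<le> \<kappa>; u \<noteq> 0\<rbrakk> \<Longrightarrow> 0 < (speed i U - speed i W) * (curv i * u)"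
proof -
  obtain \<kappa>0 where k0: "\<kappa>0 > 0" "\<kappa>0 \<le> \<rho>" "\<And>X a b p. \<lbrakk>X \<in> cball Vbar \<kappa>0; norm (a - r i) \<le> \<kappa>0;
      norm (b - r i) \<le> \<kappa>0; norm (p - l i) \<le> \<kappa>0\<rbrakk> \<Longrightarrow> 0 < curv i * (p \<bullet> (J' X a *v b))"
    using near_curv[OF assms] by blast
  obtain \<kappa> where k: "\<kappa> > 0" "\<kappa> \<le> \<kappa>0"
    "\<And>X. X \<in> cball Vbar \<kappa> \<Longrightarrow> norm (dir i X - r i) \<le> \<kappa>0 \<and> norm (codir i X - l i) \<le> \<kappa>0"
    using near_directions[OF k0(1,2)] by metis
  show ?thesis
  proof (rule that[of \<kappa>])
    fix U W w and u :: real
    assume U: "U \<in> cball Vbar \<kappa>" and W: "W \<in> cball Vbar \<kappa>" and eq: "U - W = u *\<^sub>R (r i + w)"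
      and w: "norm w \<le> \<kappa>" and u: "u \<noteq> 0"
    have B: "U \<in> B" "W \<in> B" using U W k k0 by auto
    let ?p = "codir i U" and ?b = "dir i W"
    obtain s where s: "0 < s" "s < 1" and "?p \<bullet> (J (W + 1 *\<^sub>R (U - W)) *v ?b) - ?p \<bullet> (J (W + 0 *\<^sub>R (U - W)) *v ?b)
        = (1 - 0) * (?p \<bullet> (J' (W + s *\<^sub>R (U - W)) (U - W) *v ?b))"
      using MVT2[OF zero_less_one line_inner_J_deriv[OF B], of ?p ?b] by blast
    then have 1: "(speed i U - speed i W) * (?p \<bullet> ?b) = ?p \<bullet> (J' (W + s *\<^sub>R (U - W)) (U - W) *v ?b)"
      using speed_diff[OF B] by (simp add: matrix_diff_vector inner_diff_right)
    let ?X = "W + s *\<^sub>R (U - W)" and ?z = "?p \<bullet> (J' (W + s *\<^sub>R (U - W)) (r i + w) *v ?b)"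
    have X: "?X \<in> cball Vbar \<kappa>" using segment_in_B[OF U W] s by simp
    then have "J' ?X (U - W) = u *\<^sub>R J' ?X (r i + w)"
      unfolding eq using k k0 by (intro J'_scale) auto
    with 1 have "(speed i U - speed i W) * (?p \<bullet> ?b) = u * ?z"
      by (simp add: scaleR_matrix_vector_assoc[symmetric])
    then have "(speed i U - speed i W) * (curv i * u) * (?p \<bullet> ?b) = u\<^sup>2 * (curv i * ?z)"
      by (simp add: power2_eq_square)
    moreover have "0 < curv i * ?z"
      using k0(3)[of ?X "r i + w" ?b ?p] k X U W w by auto
    ultimately have "0 < (speed i U - speed i W) * (curv i * u) * (?p \<bullet> ?b)"
      using u by (metis mult_pos_pos zero_less_power2)
    then show "0 < (speed i U - speed i W) * (curv i * u)"
      using codir_dir_ge[OF B, of i] by (simp add: zero_less_mult_iff)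
  qed (use k k0 in auto)
qed

text \<open>Testing the Rankine-Hugoniot relation with the left eigenvector at \<open>W\<close> removes the first order term;
  the remaining second order term has the sign of \<open>curv i\<close>. With the roles of \<open>U\<close> and \<open>W\<close> exchanged this places the
  shock speed strictly between the two characteristic speeds.\<close>
lemma Lax_condition:
  assumes "curv i \<noteq> 0"
  obtains \<kappa> where "\<kappa> > 0" "\<kappa> \<le> \<rho>" "\<And>U W \<sigma>. \<lbrakk>U \<in> cball Vbar \<kappa>; W \<in> cball Vbar \<kappa>;
     f U - f W = \<sigma> *\<^sub>R (U - W); \<bar>\<sigma> - lam i\<bar> \<le> 2 * \<delta>; U \<noteq> W\<rbrakk>
     \<Longrightarrow> 0 < (\<sigma> - speed i W) * (curv i * (l i \<bullet> (U - W)))"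
proof -
  obtain \<kappa>0 where k0: "\<kappa>0 > 0" "\<kappa>0 \<le> \<rho>" "\<And>X a b p. \<lbrakk>X \<in> cball Vbar \<kappa>0; norm (a - r i) \<le> \<kappa>0;
      norm (b - r i) \<le> \<kappa>0; norm (p - l i) \<le> \<kappa>0\<rbrakk> \<Longrightarrow> 0 < curv i * (p \<bullet> (J' X a *v b))"
    using near_curv[OF assms] by blast
  obtain \<kappa> where k: "\<kappa> > 0" "\<kappa> \<le> \<kappa>0"
    "\<And>X. X \<in> cball Vbar \<kappa> \<Longrightarrow> norm (dir i X - r i) \<le> \<kappa>0 \<and> norm (codir i X - l i) \<le> \<kappa>0"
    "\<And>U W. U \<in> cball Vbar \<kappa> \<Longrightarrow> W \<in> cball Vbar \<kappa> \<Longrightarrow> norm (rv i (avg U W) - r i) \<le> \<kappa>0"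
    using near_directions[OF k0(1,2)] by metis
  show ?thesis
  proof (rule that[of \<kappa>])
    fix U W and \<sigma> :: real
    assume U: "U \<in> cball Vbar \<kappa>" and W: "W \<in> cball Vbar \<kappa>" and RH: "f U - f W = \<sigma> *\<^sub>R (U - W)"
      and \<sigma>: "\<bar>\<sigma> - lam i\<bar> \<le> 2 * \<delta>" and ne: "U \<noteq> W"
    have B: "U \<in> B" "W \<in> B" using U W k k0 by auto
    define v where "v = rv i (avg U W)"
    define u where "u = l i \<bullet> (U - W)"
    have \<Delta>: "U - W = u *\<^sub>R v" and u: "u \<noteq> 0"
      using Rankine_Hugoniot_direction(2,3)[OF B RH \<sigma> ne] by (auto simp: u_def v_def)
    let ?p = "codir i W"
    obtain t where t: "0 < t" "t < 1" and 1: "?p \<bullet> f (W + 1 *\<^sub>R (U - W)) - ?p \<bullet> f (W + 0 *\<^sub>R (U - W))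
        = (1 - 0) * (?p \<bullet> (J (W + t *\<^sub>R (U - W)) *v (U - W)))"
      using MVT2[OF zero_less_one line_inner_f_deriv[OF B]] by metis
    have "\<exists>s. 0 < s \<and> s < t \<and> ?p \<bullet> (J (W + t *\<^sub>R (U - W)) *v (U - W)) - ?p \<bullet> (J (W + 0 *\<^sub>R (U - W)) *v (U - W))
        = (t - 0) * (?p \<bullet> (J' (W + s *\<^sub>R (U - W)) (U - W) *v (U - W)))"
      using t by (intro MVT2 line_inner_J_deriv B) auto
    then obtain s where s: "0 < s" "s < t" and 2: "?p \<bullet> (J (W + t *\<^sub>R (U - W)) *v (U - W)) - ?p \<bullet> (J W *v (U - W))
        = t * (?p \<bullet> (J' (W + s *\<^sub>R (U - W)) (U - W) *v (U - W)))" by auto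
    let ?X = "W + s *\<^sub>R (U - W)"
    let ?z = "?p \<bullet> (J' ?X v *v v)"
    have X: "?X \<in> cball Vbar \<kappa>" using segment_in_B[OF U W] s t by simp
    then have XB: "?X \<in> B" using k k0 by auto
    have "?p \<bullet> (f U - f W) = \<sigma> * (?p \<bullet> (U - W))" by (simp add: RH)
    then have "(\<sigma> - speed i W) * (?p \<bullet> (U - W)) = t * (?p \<bullet> (J' ?X (U - W) *v (U - W)))"
      using 1 2 speed_facts(5)[OF B(2), of i "U - W"] by (simp add: inner_diff_right left_diff_distrib)
    moreover have "J' ?X (U - W) *v (U - W) = (u * u) *\<^sub>R (J' ?X v *v v)"
    proof -
      have "J' ?X (u *\<^sub>R v) *v (u *\<^sub>R v) = (u * u) *\<^sub>R (J' ?X v *v v)"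
        using XB by (simp add: J'_scale matrix_vector_mult_scaleR scaleR_matrix_vector_assoc[symmetric])
      then show ?thesis by (simp only: \<Delta>[symmetric])
    qed
    ultimately have "(\<sigma> - speed i W) * (u * (?p \<bullet> v)) = t * (u * u * ?z)"
      by (simp add: \<Delta>)
    then have "(\<sigma> - speed i W) * (curv i * u) * (?p \<bullet> v) = t * (u\<^sup>2 * (curv i * ?z))"
      by (simp add: power2_eq_square)
    moreover have "0 < curv i * ?z"
      using k0(3)[of ?X v v ?p] k X U W unfolding v_def by auto
    ultimately have "0 < (\<sigma> - speed i W) * (curv i * u) * (?p \<bullet> v)"
      using u t by (metis mult_pos_pos zero_less_power2)
    moreover have "1/2 \<le> ?p \<bullet> v"
      unfolding codir_def v_def using B by (intro lv_rv_ge J_near avg_near)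
    ultimately show "0 < (\<sigma> - speed i W) * (curv i * (l i \<bullet> (U - W)))"
      unfolding u_def by (simp add: zero_less_mult_iff)
  qed (use k k0 in auto)
qed

lemma speed_has_derivative:
  assumes X: "X \<in> ball Vbar \<rho>"
  shows "(speed i has_derivative (\<lambda>h. (codir i X \<bullet> (J' X h *v dir i X)) / (codir i X \<bullet> dir i X))) (at X)"
proof -
  have XB: "X \<in> B" using X by auto
  let ?G = "\<lambda>Y. inverse (codir i Y \<bullet> dir i X) *\<^sub>R codir i Y"
  let ?F = "\<lambda>Y. (J Y - J X) *v dir i X"
  have F: "(?F has_derivative (\<lambda>h. J' X h *v dir i X)) (at X)"
    using bounded_linear.has_derivative[OF bounded_linear_mult_vector[of "dir i X"]
        has_derivative_diff[OF J_deriv[OF XB] has_derivative_const[of "J X"]]] by simp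
  have "isCont (codir i) X"
  proof -
    have "(K * L)-lipschitz_on B (codir i)"
      using codir_Lipschitz KL_nonneg by (auto simp: lipschitz_on_def dist_norm)
    then have "continuous_on B (codir i)" by (rule lipschitz_on_continuous_on)
    then show ?thesis
      using X by (meson ball_subset_cball continuous_on_eq_continuous_at continuous_on_subset open_ball)
  qed
  then have G: "isCont ?G X"
    using codir_dir_ge[OF XB XB, of i] by (intro continuous_intros) auto
  have D: "((\<lambda>Y. speed i X + ?G Y \<bullet> ?F Y) has_derivative (\<lambda>h. 0 + ?G X \<bullet> (J' X h *v dir i X))) (at X)"
    by (intro has_derivative_add has_derivative_const has_derivative_inner_vanishing F G) simp
  have "(speed i has_derivative (\<lambda>h. 0 + ?G X \<bullet> (J' X h *v dir i X))) (at X)"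
  proof (rule has_derivative_transform_within_open[OF D open_ball X])
    fix Y assume "Y \<in> ball Vbar \<rho>"
    then have Y: "Y \<in> B" by auto
    show "speed i X + ?G Y \<bullet> ?F Y = speed i Y"
      using speed_diff[OF Y XB, of i, symmetric] codir_dir_ge[OF Y XB, of i]
      by (simp add: field_simps)
  qed
  then show ?thesis by (simp add: divide_inverse mult.commute)
qed

end

section \<open>Linearly degenerate fields\<close>

context flux
begin

lemma small_ball_nearby:
  assumes X: "X \<in> cball Vbar (\<rho> / 2)" and Y: "norm (Y - X) \<le> \<rho> / 4"
  shows "Y \<in> ball Vbar \<rho>"
proof -
  have "norm (Y - Vbar) \<le> norm (Y - X) + norm (X - Vbar)"
    by (metis norm_triangle_sub diff_add_cancel add.commute norm_triangle_ineq add_diff_cancel_left' diff_add_eq diff_diff_eq2)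
  then show ?thesis
    using X Y \<rho>_pos by (simp add: dist_norm norm_minus_commute)
qed

definition lindeg where
  "lindeg i \<longleftrightarrow> (\<forall>X\<in>ball Vbar \<rho>. codir i X \<bullet> (J' X (dir i X) *v dir i X) = 0)"

lemma speed_step:
  assumes "lindeg i" and X: "X \<in> cball Vbar (\<rho> / 2)" and t: "\<bar>t\<bar> * K \<le> \<rho> / 4"
  shows "\<bar>speed i (X + t *\<^sub>R dir i X) - speed i X\<bar> \<le> 2 * K ^ 4 * L\<^sup>2 * t\<^sup>2"
proof -
  define D where "D Y h = (codir i Y \<bullet> (J' Y h *v dir i Y)) / (codir i Y \<bullet> dir i Y)" for Y h
  let ?v = "dir i X"
  have XB: "X \<in> B" using X \<rho>_pos by auto
  have v: "norm ?v \<le> K" using speed_facts(4)[OF XB] .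
  have nearX: "norm ((s * t) *\<^sub>R ?v) \<le> \<bar>t\<bar> * K" if "0 \<le> s" "s \<le> 1" for s
  proof -
    have "norm ((s * t) *\<^sub>R ?v) = s * (\<bar>t\<bar> * norm ?v)" using that by (simp add: abs_mult)
    also have "\<dots> \<le> 1 * (\<bar>t\<bar> * norm ?v)" using that by (intro mult_right_mono) auto
    also have "\<dots> \<le> \<bar>t\<bar> * K" using v by (simp add: mult_left_mono)
    finally show ?thesis .
  qed
  have inB: "X + (s * t) *\<^sub>R ?v \<in> ball Vbar \<rho>" if "0 \<le> s" "s \<le> 1" for s
    using nearX[OF that] t by (intro small_ball_nearby[OF X]) auto
  have D_deriv: "(speed i has_derivative D Y) (at Y)" if "Y \<in> ball Vbar \<rho>" for Y
    using speed_has_derivative[OF that] by (simp add: D_def[abs_def])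
  then have lin: "linear (D Y)" if "Y \<in> ball Vbar \<rho>" for Y
    using that has_derivative_linear by blast
  have "((\<lambda>s. speed i (X + (s * t) *\<^sub>R ?v)) has_real_derivative D (X + (s * t) *\<^sub>R ?v) (t *\<^sub>R ?v)) (at s)"
    if "0 \<le> s" "s \<le> 1" for s
  proof -
    have "((\<lambda>s. X + (s * t) *\<^sub>R ?v) has_derivative (\<lambda>y. (y * t) *\<^sub>R ?v)) (at s)"
      by (auto intro!: derivative_eq_intros)
    from has_derivative_compose[OF this D_deriv[OF inB[OF that]]]
    show ?thesis
      by (rule has_derivative_imp_has_field_derivative)
        (simp add: linear_scale[OF lin[OF inB[OF that]]])
  qed
  from MVT2[OF zero_less_one this]
  obtain s where s: "0 < s" "s < 1"
    and eq: "speed i (X + t *\<^sub>R ?v) - speed i X = D (X + (s * t) *\<^sub>R ?v) (t *\<^sub>R ?v)" by auto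
  let ?Y = "X + (s * t) *\<^sub>R ?v"
  have Yb: "?Y \<in> ball Vbar \<rho>" using inB s by simp
  then have YB: "?Y \<in> B" by auto
  have Dv: "D ?Y (dir i ?Y) = 0" using assms(1) Yb by (simp add: D_def lindeg_def)
  have Dle: "\<bar>D ?Y h\<bar> \<le> 2 * (K * (L * norm h * K))" for h
  proof -
    have "\<bar>codir i ?Y \<bullet> (J' ?Y h *v dir i ?Y)\<bar> \<le> norm (codir i ?Y) * norm (J' ?Y h *v dir i ?Y)"
      by (rule Cauchy_Schwarz_ineq2)
    also have "\<dots> \<le> norm (codir i ?Y) * (norm (J' ?Y h) * norm (dir i ?Y))"
      by (intro mult_left_mono norm_matrix_vector_le) simp
    also have "\<dots> \<le> K * (L * norm h * K)"
      using speed_facts(4,6)[OF YB] J'_bound[OF YB] K_ge(1) L_nonneg by (intro mult_mono) auto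
    finally have a: "\<bar>codir i ?Y \<bullet> (J' ?Y h *v dir i ?Y)\<bar> \<le> K * (L * norm h * K)" .
    have b: "1/2 \<le> codir i ?Y \<bullet> dir i ?Y" by (rule codir_dir_ge[OF YB YB])
    have "\<bar>D ?Y h\<bar> = \<bar>codir i ?Y \<bullet> (J' ?Y h *v dir i ?Y)\<bar> / (codir i ?Y \<bullet> dir i ?Y)"
      using b by (simp add: D_def abs_divide)
    also have "\<dots> \<le> K * (L * norm h * K) / (1/2)"
      using a b by (intro frac_le) auto
    finally show ?thesis by simp
  qed
  have "D ?Y (t *\<^sub>R ?v) = t * D ?Y (?v - dir i ?Y)"
    using linear_scale[OF lin[OF Yb]] linear_diff[OF lin[OF Yb]] Dv by simp
  then have "\<bar>D ?Y (t *\<^sub>R ?v)\<bar> \<le> \<bar>t\<bar> * (2 * (K * (L * norm (?v - dir i ?Y) * K)))"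
    using Dle[of "?v - dir i ?Y"] by (simp add: abs_mult mult_left_mono)
  also have "\<dots> \<le> \<bar>t\<bar> * (2 * (K * (L * (K * L * (\<bar>t\<bar> * K)) * K)))"
  proof -
    have "norm (?v - dir i ?Y) \<le> K * L * norm (X - ?Y)" by (rule dir_Lipschitz[OF XB YB])
    also have "\<dots> \<le> K * L * (\<bar>t\<bar> * K)"
      using nearX[of s] s KL_nonneg by (intro mult_left_mono) auto
    finally show ?thesis
      using K_ge(1) L_nonneg by (intro mult_left_mono mult_right_mono) auto
  qed
  also have "\<dots> = 2 * K ^ 4 * L\<^sup>2 * t\<^sup>2"
    by (simp add: power2_eq_square power4_eq_xxxx algebra_simps)
  finally show ?thesis using eq by simp
qed

lemma f_step:
  assumes X: "X \<in> cball Vbar (\<rho> / 2)" and t: "\<bar>t\<bar> * K \<le> \<rho> / 4"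
  shows "norm (f (X + t *\<^sub>R dir i X) - f X - speed i X *\<^sub>R (t *\<^sub>R dir i X)) \<le> L * K\<^sup>2 * t\<^sup>2"
proof -
  let ?Y = "X + t *\<^sub>R dir i X"
  have XB: "X \<in> B" using X \<rho>_pos by auto
  have n: "norm (t *\<^sub>R dir i X) \<le> \<bar>t\<bar> * K"
    using speed_facts(4)[OF XB, of i] by (simp add: mult_left_mono)
  have YB: "?Y \<in> B"
    using small_ball_nearby[OF X, of ?Y] n t by auto
  have "f ?Y - f X - speed i X *\<^sub>R (t *\<^sub>R dir i X) = (avg ?Y X - J X) *v (t *\<^sub>R dir i X)"
    using avg_diff[OF YB XB] speed_facts(2)[OF XB, of i]
    by (simp add: matrix_diff_vector matrix_vector_mult_scaleR scaleR_diff_right mult.commute)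
  then have "norm (f ?Y - f X - speed i X *\<^sub>R (t *\<^sub>R dir i X)) \<le> norm (avg ?Y X - J X) * norm (t *\<^sub>R dir i X)"
    by (metis norm_matrix_vector_le)
  also have "\<dots> \<le> (L * (\<bar>t\<bar> * K)) * (\<bar>t\<bar> * K)"
  proof (intro mult_mono n)
    have "norm (avg ?Y X - J X) \<le> L * norm (t *\<^sub>R dir i X)"
      using avg_Lipschitz[OF YB XB XB XB] by (simp add: avg_same)
    then show "norm (avg ?Y X - J X) \<le> L * (\<bar>t\<bar> * K)"
      using mult_left_mono[OF n L_nonneg] by linarith
  qed (use L_nonneg K_ge(1) in auto)
  also have "\<dots> = L * K\<^sup>2 * t\<^sup>2" by (simp add: power2_eq_square algebra_simps)
  finally show ?thesis .
qed

text \<open>The contact curve through a state is the limit of Euler polygons along the eigenvector field;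
  linear degeneracy makes the speed, and hence the Rankine-Hugoniot defect, stationary to second order
  in each step.\<close>
lemma contact_curve:
  assumes "lindeg i" and W: "W \<in> cball Vbar (\<rho> / 4)" and u: "\<bar>u\<bar> * K \<le> \<rho> / 4"
  obtains U where "U \<in> cball Vbar (\<rho> / 2)" "l i \<bullet> (U - W) = u" "speed i U = speed i W"
    "f U - f W = speed i W *\<^sub>R (U - W)"
proof -
  define P where "P n j = ((\<lambda>X. X + (u / real (Suc n)) *\<^sub>R dir i X) ^^ j) W" for n j :: nat
  have P0: "P n 0 = W" and PS: "P n (Suc j) = P n j + (u / real (Suc n)) *\<^sub>R dir i (P n j)" for n j
    by (simp_all add: P_def)
  define M where "M = 2 * K ^ 4 * L\<^sup>2 * u\<^sup>2 + L * K\<^sup>2 * u\<^sup>2"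
  have M0: "2 * K ^ 4 * L\<^sup>2 * u\<^sup>2 \<le> M" "L * K\<^sup>2 * u\<^sup>2 \<le> M" "0 \<le> M"
    using K_ge(1) L_nonneg by (simp_all add: M_def)
  have step: "norm (P n j - W) \<le> real j * (\<bar>u\<bar> * K / real (Suc n)) \<and> P n j \<in> cball Vbar (\<rho> / 2)
      \<and> l i \<bullet> (P n j - W) = real j * (u / real (Suc n))
      \<and> \<bar>speed i (P n j) - speed i W\<bar> \<le> real j * (M / (real (Suc n))\<^sup>2)
      \<and> norm (f (P n j) - f W - speed i W *\<^sub>R (P n j - W)) \<le> real j * (M * (1 + \<bar>u\<bar> * K) / (real (Suc n))\<^sup>2)"
    if "j \<le> Suc n" for n j
    using that
  proof (induction j)
    case 0
    then show ?case using W \<rho>_pos by (auto simp: P0)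
  next
    case (Suc j)
    let ?N = "real (Suc n)"
    let ?t = "u / ?N"
    have N: "?N > 0" "?N \<ge> 1" by simp_all
    have IH: "norm (P n j - W) \<le> real j * (\<bar>u\<bar> * K / ?N)" "P n j \<in> cball Vbar (\<rho> / 2)"
      "l i \<bullet> (P n j - W) = real j * (u / ?N)"
      "\<bar>speed i (P n j) - speed i W\<bar> \<le> real j * (M / ?N\<^sup>2)"
      "norm (f (P n j) - f W - speed i W *\<^sub>R (P n j - W)) \<le> real j * (M * (1 + \<bar>u\<bar> * K) / ?N\<^sup>2)"
      using Suc by auto
    have XB: "P n j \<in> B" using IH(2) \<rho>_pos by auto
    have t: "\<bar>?t\<bar> * K \<le> \<rho> / 4"
    proof -
      have "\<bar>?t\<bar> * K = \<bar>u\<bar> * K / ?N" by (simp add: abs_divide)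
      also have "\<dots> \<le> \<bar>u\<bar> * K / 1" using N K_ge(1) by (intro divide_left_mono) auto
      finally show ?thesis using u by linarith
    qed
    have d: "norm (?t *\<^sub>R dir i (P n j)) \<le> \<bar>u\<bar> * K / ?N"
    proof -
      have "norm (?t *\<^sub>R dir i (P n j)) = \<bar>u\<bar> / ?N * norm (dir i (P n j))" by (simp add: abs_divide)
      also have "\<dots> \<le> \<bar>u\<bar> / ?N * K" using speed_facts(4)[OF XB] by (intro mult_left_mono) auto
      finally show ?thesis by simp
    qed
    have 1: "norm (P n (Suc j) - W) \<le> real (Suc j) * (\<bar>u\<bar> * K / ?N)"
    proof -
      have "P n (Suc j) - W = (P n j - W) + ?t *\<^sub>R dir i (P n j)" by (simp add: PS)
      then have "norm (P n (Suc j) - W) \<le> norm (P n j - W) + norm (?t *\<^sub>R dir i (P n j))"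
        by (metis norm_triangle_ineq)
      also have "\<dots> \<le> real j * (\<bar>u\<bar> * K / ?N) + \<bar>u\<bar> * K / ?N" using IH(1) d by (rule add_mono)
      finally show ?thesis by (simp only: of_nat_Suc distrib_right mult_1 add.commute)
    qed
    have 2: "P n (Suc j) \<in> cball Vbar (\<rho> / 2)"
    proof -
      have "real (Suc j) * (\<bar>u\<bar> * K / ?N) \<le> ?N * (\<bar>u\<bar> * K / ?N)"
        using Suc.prems K_ge(1) by (intro mult_right_mono) auto
      also have "\<dots> = \<bar>u\<bar> * K" by simp
      finally have "norm (P n (Suc j) - W) \<le> \<rho> / 4" using 1 u by linarith
      moreover have "norm (P n (Suc j) - Vbar) \<le> norm (P n (Suc j) - W) + norm (W - Vbar)"
        using norm_triangle_ineq[of "P n (Suc j) - W" "W - Vbar"] by simp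
      ultimately show ?thesis
        using W by (simp add: dist_norm norm_minus_commute)
    qed
    have 3: "l i \<bullet> (P n (Suc j) - W) = real (Suc j) * (u / ?N)"
    proof -
      have eq: "P n (Suc j) - W = (P n j - W) + ?t *\<^sub>R dir i (P n j)" by (simp add: PS)
      show ?thesis
        unfolding eq by (simp only: inner_add_right inner_scaleR_right IH(3) speed_facts(3)[OF XB, of i]
            mult_1_right of_nat_Suc distrib_right mult_1 add.commute)
    qed
    have t2: "?t\<^sup>2 = u\<^sup>2 / ?N\<^sup>2" by (simp add: power_divide)
    have 4: "\<bar>speed i (P n (Suc j)) - speed i W\<bar> \<le> real (Suc j) * (M / ?N\<^sup>2)"
    proof -
      have "\<bar>speed i (P n (Suc j)) - speed i (P n j)\<bar> \<le> 2 * K ^ 4 * L\<^sup>2 * ?t\<^sup>2"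
        unfolding PS by (rule speed_step[OF assms(1) IH(2) t])
      also have "\<dots> = (2 * K ^ 4 * L\<^sup>2 * u\<^sup>2) / ?N\<^sup>2" unfolding t2 by simp
      also have "\<dots> \<le> M / ?N\<^sup>2" using M0 by (intro divide_right_mono) auto
      finally have "\<bar>speed i (P n (Suc j)) - speed i W\<bar> \<le> M / ?N\<^sup>2 + real j * (M / ?N\<^sup>2)" using IH(4) by linarith
      then show ?thesis by (simp only: of_nat_Suc distrib_right mult_1)
    qed
    have 5: "norm (f (P n (Suc j)) - f W - speed i W *\<^sub>R (P n (Suc j) - W))
        \<le> real (Suc j) * (M * (1 + \<bar>u\<bar> * K) / ?N\<^sup>2)"
    proof -
      let ?d = "?t *\<^sub>R dir i (P n j)"
      have "f (P n (Suc j)) - f W - speed i W *\<^sub>R (P n (Suc j) - W)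
          = (f (P n j) - f W - speed i W *\<^sub>R (P n j - W)) + ((f (P n (Suc j)) - f (P n j) - speed i (P n j) *\<^sub>R ?d)
            + (speed i (P n j) - speed i W) *\<^sub>R ?d)"
        by (simp add: PS algebra_simps)
      then have "norm (f (P n (Suc j)) - f W - speed i W *\<^sub>R (P n (Suc j) - W))
          \<le> norm (f (P n j) - f W - speed i W *\<^sub>R (P n j - W)) + (norm (f (P n (Suc j)) - f (P n j) - speed i (P n j) *\<^sub>R ?d)
            + norm ((speed i (P n j) - speed i W) *\<^sub>R ?d))"
        by (metis norm_triangle_le norm_triangle_ineq add_left_mono)
      moreover have "norm (f (P n (Suc j)) - f (P n j) - speed i (P n j) *\<^sub>R ?d) \<le> M / ?N\<^sup>2"
      proof -
        have "norm (f (P n (Suc j)) - f (P n j) - speed i (P n j) *\<^sub>R ?d) \<le> L * K\<^sup>2 * ?t\<^sup>2"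
          unfolding PS by (rule f_step[OF IH(2) t])
        also have "\<dots> = L * K\<^sup>2 * u\<^sup>2 / ?N\<^sup>2" unfolding t2 by simp
        also have "\<dots> \<le> M / ?N\<^sup>2" using M0 by (intro divide_right_mono) auto
        finally show ?thesis .
      qed
      moreover have "norm ((speed i (P n j) - speed i W) *\<^sub>R ?d) \<le> M * (\<bar>u\<bar> * K) / ?N\<^sup>2"
      proof -
        have "norm ((speed i (P n j) - speed i W) *\<^sub>R ?d) \<le> (real j * (M / ?N\<^sup>2)) * (\<bar>u\<bar> * K / ?N)"
          using IH(4) d M0(3) by (simp only: norm_scaleR real_norm_def) (intro mult_mono, auto)
        also have "\<dots> \<le> (?N * (M / ?N\<^sup>2)) * (\<bar>u\<bar> * K / ?N)"
          using Suc.prems M0(3) K_ge(1) by (intro mult_right_mono) auto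
        also have "\<dots> = M * (\<bar>u\<bar> * K) / ?N\<^sup>2" by (simp add: power2_eq_square)
        finally show ?thesis .
      qed
      ultimately have "norm (f (P n (Suc j)) - f W - speed i W *\<^sub>R (P n (Suc j) - W))
          \<le> real j * (M * (1 + \<bar>u\<bar> * K) / ?N\<^sup>2) + (M / ?N\<^sup>2 + M * (\<bar>u\<bar> * K) / ?N\<^sup>2)"
        using IH(5) by linarith
      also have "M / ?N\<^sup>2 + M * (\<bar>u\<bar> * K) / ?N\<^sup>2 = M * (1 + \<bar>u\<bar> * K) / ?N\<^sup>2"
        by (simp add: distrib_left add_divide_distrib)
      finally show ?thesis by (simp only: of_nat_Suc distrib_right mult_1 add.commute)
    qed
    show ?case using 1 2 3 4 5 by blast
  qed
  define Z where "Z n = P n (Suc n)" for n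
  have Z: "Z n \<in> cball Vbar (\<rho> / 2)" "l i \<bullet> (Z n - W) = u" for n
    using step[of "Suc n" n] by (simp_all add: Z_def)
  define E where "E X = \<bar>speed i X - speed i W\<bar> + norm (f X - f W - speed i W *\<^sub>R (X - W))" for X
  define C where "C = M + M * (1 + \<bar>u\<bar> * K)"
  have EZ: "E (Z n) \<le> C / real (Suc n)" for n
  proof -
    have eq: "real (Suc n) * (x / (real (Suc n))\<^sup>2) = x / real (Suc n)" for x
      by (simp add: power2_eq_square)
    have "E (Z n) \<le> M / real (Suc n) + M * (1 + \<bar>u\<bar> * K) / real (Suc n)"
      using step[of "Suc n" n, OF order_refl] unfolding E_def Z_def eq by linarith
    then show ?thesis by (simp add: C_def add_divide_distrib)
  qed
  have "compact (cball Vbar (\<rho> / 2))" by simp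
  then obtain U \<phi> where U: "U \<in> cball Vbar (\<rho> / 2)" and \<phi>: "strict_mono (\<phi> :: nat \<Rightarrow> nat)"
    and lim: "(Z \<circ> \<phi>) \<longlonglongrightarrow> U"
    unfolding compact_def using Z(1) by blast
  have sub: "cball Vbar (\<rho> / 2) \<subseteq> B" using \<rho>_pos by auto
  have "(K * L)-lipschitz_on B (speed i)"
    using speed_Lipschitz KL_nonneg by (auto simp: lipschitz_on_def dist_norm)
  then have "continuous_on B (speed i)" by (rule lipschitz_on_continuous_on)
  then have "continuous_on B E"
    unfolding E_def by (intro continuous_intros f_continuous)
  then have contE: "continuous_on (cball Vbar (\<rho> / 2)) E"
    using sub continuous_on_subset by blast
  have "(\<lambda>n. E ((Z \<circ> \<phi>) n)) \<longlonglongrightarrow> E U"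
    by (rule continuous_on_tendsto_compose[OF contE lim U]) (use Z in auto)
  moreover have "(\<lambda>n. C / real (Suc (\<phi> n))) \<longlonglongrightarrow> 0"
    using LIMSEQ_subseq_LIMSEQ[OF LIMSEQ_Suc[OF lim_const_over_n[of C]] \<phi>] by (simp add: o_def)
  ultimately have "E U \<le> 0"
    using EZ by (rule_tac LIMSEQ_le) auto
  then have E0: "\<bar>speed i U - speed i W\<bar> = 0" "norm (f U - f W - speed i W *\<^sub>R (U - W)) = 0"
    unfolding E_def using norm_ge_zero[of "f U - f W - speed i W *\<^sub>R (U - W)"] by linarith+
  have "(\<lambda>n. l i \<bullet> ((Z \<circ> \<phi>) n - W)) \<longlonglongrightarrow> l i \<bullet> (U - W)"
    by (intro tendsto_intros lim)
  then have "l i \<bullet> (U - W) = u"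
    using Z(2) LIMSEQ_unique[OF _ tendsto_const] by auto
  with U E0 show ?thesis using that[of U] by simp
qed

text \<open>The contact curve through \<open>W\<close> contains a state with the same \<open>i\<close>-th coordinate as \<open>U\<close>; by uniqueness on the
  Hugoniot locus it is \<open>U\<close>, so the jump travels with the common characteristic speed.\<close>
lemma contact_speeds:
  assumes "lindeg i"
  obtains \<kappa> where "\<kappa> > 0" "\<kappa> \<le> \<rho>" "\<And>U W \<sigma>. \<lbrakk>U \<in> cball Vbar \<kappa>; W \<in> cball Vbar \<kappa>;
     f U - f W = \<sigma> *\<^sub>R (U - W); \<bar>\<sigma> - lam i\<bar> \<le> 2 * \<delta>; U \<noteq> W\<rbrakk>
     \<Longrightarrow> speed i U = \<sigma> \<and> speed i W = \<sigma>"
proof -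
  \<comment> \<open>The second bound keeps the contact curve inside the ball, the third one is for \<open>Hugoniot_unique\<close>.\<close>
  define \<kappa> where "\<kappa> = min (\<rho> / 4) (min (\<rho> / 4 / (2 * K * K)) (1 / (4 * K * (1 + K * L))))"
  have KK: "2 * K * K > 0" "4 * K * (1 + K * L) > 0" using K_ge(1) KL_nonneg by (auto intro!: mult_pos_pos add_pos_nonneg)
  have k: "\<kappa> > 0" "\<kappa> \<le> \<rho> / 4" "\<kappa> \<le> \<rho>"
    using \<rho>_pos KK by (auto simp: \<kappa>_def)
  have k1: "2 * K * K * \<kappa> \<le> \<rho> / 4"
  proof -
    have "\<kappa> \<le> \<rho> / 4 / (2 * K * K)" by (simp add: \<kappa>_def)
    then show ?thesis using KK(1) by (simp add: pos_le_divide_eq mult.commute)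
  qed
  have k2: "4 * K * (1 + K * L) * \<kappa> \<le> 1"
  proof -
    have "\<kappa> \<le> 1 / (4 * K * (1 + K * L))" by (simp add: \<kappa>_def)
    then show ?thesis using KK(2) by (simp add: pos_le_divide_eq mult.commute)
  qed
  show ?thesis
  proof (rule that[OF k(1,3)])
    fix U W and \<sigma> :: real
    assume U: "U \<in> cball Vbar \<kappa>" and W: "W \<in> cball Vbar \<kappa>" and RH: "f U - f W = \<sigma> *\<^sub>R (U - W)"
      and \<sigma>: "\<bar>\<sigma> - lam i\<bar> \<le> 2 * \<delta>" and ne: "U \<noteq> W"
    have B: "U \<in> B" "W \<in> B" using U W k by auto
    let ?u = "l i \<bullet> (U - W)"
    have "norm (U - W) \<le> 2 * \<kappa>"
      using norm_vector_minus_le[OF U] norm_vector_minus_le[OF W] norm_triangle_ineq4[of "U - Vbar" "W - Vbar"] by simp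
    then have u: "\<bar>?u\<bar> \<le> K * (2 * \<kappa>)"
      using norm_inner_l[of i "U - W"] K_ge(1) by (smt (verit) mult_left_mono)
    have u1: "\<bar>?u\<bar> * K \<le> \<rho> / 4"
    proof -
      have "\<bar>?u\<bar> * K \<le> K * (2 * \<kappa>) * K" using u K_ge(1) by (intro mult_right_mono) auto
      also have "\<dots> = 2 * K * K * \<kappa>" by simp
      finally show ?thesis using k1 by linarith
    qed
    have u2: "\<bar>?u\<bar> * (K * L) < 1"
    proof -
      have "\<bar>?u\<bar> * (K * L) \<le> K * (2 * \<kappa>) * (K * L)" using u KL_nonneg by (rule mult_right_mono)
      also have "\<dots> \<le> K * (2 * \<kappa>) * (1 + K * L)" using K_ge(1) k by (intro mult_left_mono) auto
      also have "\<dots> \<le> 1 / 2" using k2 by (simp add: algebra_simps)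
      finally show ?thesis by simp
    qed
    have W4: "W \<in> cball Vbar (\<rho> / 4)" using W k by auto
    obtain U' where U': "U' \<in> cball Vbar (\<rho> / 2)" "l i \<bullet> (U' - W) = ?u" "speed i U' = speed i W"
      "f U' - f W = speed i W *\<^sub>R (U' - W)"
      using contact_curve[OF assms W4 u1] by metis
    have U'B: "U' \<in> B" using U'(1) \<rho>_pos by auto
    have "\<bar>speed i W - lam i\<bar> \<le> 2 * \<delta>" using speed_facts(1)[OF B(2), of i] \<delta>_pos by linarith
    then have "U = U'"
      using Hugoniot_unique[OF B(1) U'B B(2) RH \<sigma> U'(4) _ U'(2)[symmetric] u2] by simp
    then have "\<sigma> *\<^sub>R (U - W) = speed i W *\<^sub>R (U - W)" using RH U'(4) by metis
    then have "\<sigma> = speed i W" using ne by simp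
    then show "speed i U = \<sigma> \<and> speed i W = \<sigma>" using U'(3) \<open>U = U'\<close> by simp
  qed
qed

end

section \<open>Entropy across jumps\<close>

text \<open>The functions \<open>g\<close> and \<open>g'\<close> are the gradient and the Hessian of the entropy.\<close>
locale entropic = flux A0 lam r l \<delta> \<eta> f J J' Vbar \<rho> L
  for A0 :: "real^'m^'m" and lam r l \<delta> \<eta> f J J' Vbar \<rho> L +
  fixes e q :: "real^'m \<Rightarrow> real" and g :: "real^'m \<Rightarrow> real^'m" and g' :: "real^'m \<Rightarrow> real^'m \<Rightarrow> real^'m"
    and c :: real
  assumes e_deriv: "X \<in> cball Vbar \<rho> \<Longrightarrow> (e has_derivative (\<lambda>h. g X \<bullet> h)) (at X)"
    and q_deriv: "X \<in> cball Vbar \<rho> \<Longrightarrow> (q has_derivative (\<lambda>h. g X \<bullet> (J X *v h))) (at X)"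
    and g_deriv: "X \<in> cball Vbar \<rho> \<Longrightarrow> (g has_derivative g' X) (at X)"
    and g'_cont: "continuous_on (cball Vbar \<rho>) (\<lambda>X. g' X h)"
    and c_pos: "c > 0"
    and e_convex: "c * (norm h)\<^sup>2 \<le> g' Vbar h \<bullet> h"
begin

lemma e_continuous: "continuous_on B e"
  using has_derivative_continuous[OF e_deriv] by (auto intro!: continuous_at_imp_continuous_on)

lemma q_continuous: "continuous_on B q"
  using has_derivative_continuous[OF q_deriv] by (auto intro!: continuous_at_imp_continuous_on)

lemma g'_linear: "X \<in> B \<Longrightarrow> linear (g' X)"
  using g_deriv has_derivative_linear by blast

lemma g'_continuous:
  assumes "continuous_on S x" "continuous_on S a" "\<And>y. y \<in> S \<Longrightarrow> x y \<in> B"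
  shows "continuous_on S (\<lambda>y. g' (x y) (a y))"
proof -
  have ex: "g' X h = (\<Sum>b\<in>Basis. (h \<bullet> b) *\<^sub>R g' X b)" if "X \<in> B" for X h
    by (subst euclidean_representation[of h, symmetric])
      (simp only: linear_sum[OF g'_linear[OF that]] linear_scale[OF g'_linear[OF that]])
  have "continuous_on S (\<lambda>y. \<Sum>b\<in>Basis. (a y \<bullet> b) *\<^sub>R g' (x y) b)"
    by (intro continuous_intros continuous_on_compose2[OF g'_cont] assms) (use assms in auto)
  then show ?thesis
    by (rule continuous_on_eq) (use ex assms in auto)
qed

text \<open>The Hessian of the entropy symmetrises the Jacobian. Both symmetries come from Schwarz's theorem,
  applied to \<open>e\<close> and to the combination of \<open>q\<close> and \<open>f\<close> whose gradient vanishes at the centre.\<close>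
lemma Hessian_symmetric: "g' Vbar h \<bullet> k = g' Vbar k \<bullet> h"
  by (rule gradient_derivative_symmetric[OF \<rho>_pos, of Vbar e g]) (use e_deriv g_deriv[OF center] in auto)

lemma Hessian_symmetrises: "g' Vbar h \<bullet> (A0 *v k) = g' Vbar k \<bullet> (A0 *v h)"
proof -
  interpret matvec: bounded_bilinear "(*v) :: real^'m^'m \<Rightarrow> real^'m \<Rightarrow> real^'m"
    by (rule bounded_bilinear_matrix_vector)
  interpret tr: bounded_linear "transpose :: real^'m^'m \<Rightarrow> real^'m^'m"
    by (rule bounded_linear_transpose)
  let ?G = "\<lambda>X. transpose (J X) *v (g X - g Vbar)"
  have d1: "((\<lambda>X. transpose (J X)) has_derivative (\<lambda>h. transpose (J' Vbar h))) (at Vbar)"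
    by (rule tr.has_derivative[OF J_deriv[OF center]])
  have d2: "((\<lambda>X. g X - g Vbar) has_derivative (\<lambda>h. g' Vbar h)) (at Vbar)"
    using has_derivative_diff[OF g_deriv[OF center] has_derivative_const] by simp
  have G: "(?G has_derivative (\<lambda>h. transpose A0 *v g' Vbar h)) (at Vbar)"
    using matvec.FDERIV[OF d1 d2] by (simp add: J_center)
  have "((\<lambda>X. q X - g Vbar \<bullet> f X) has_derivative (\<lambda>h. ?G X \<bullet> h)) (at X)" if "X \<in> ball Vbar \<rho>" for X
  proof -
    have XB: "X \<in> B" using that by auto
    have "((\<lambda>X. q X - g Vbar \<bullet> f X) has_derivative (\<lambda>h. g X \<bullet> (J X *v h) - g Vbar \<bullet> (J X *v h))) (at X)"
      by (intro has_derivative_diff q_deriv[OF XB]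
          bounded_linear.has_derivative[OF bounded_linear_inner_right f_deriv[OF XB]])
    moreover have "(\<lambda>h. g X \<bullet> (J X *v h) - g Vbar \<bullet> (J X *v h)) = (\<lambda>h. ?G X \<bullet> h)"
      by (simp only: inner_transpose inner_diff_left)
    ultimately show ?thesis by (simp only:)
  qed
  from gradient_derivative_symmetric[OF \<rho>_pos this G, of h k]
  show ?thesis by (simp only: inner_transpose)
qed

lemma Hessian_left: "g' Vbar (r i) \<bullet> y = (g' Vbar (r i) \<bullet> r i) * (l i \<bullet> y)"
proof -
  have off: "g' Vbar (r i) \<bullet> r j = 0" if "j \<noteq> i" for j
  proof -
    have "lam j * (g' Vbar (r i) \<bullet> r j) = lam i * (g' Vbar (r i) \<bullet> r j)"
      using Hessian_symmetrises[of "r i" "r j"] Hessian_symmetric[of "r j" "r i"] by (simp add: right)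
    moreover have "lam j \<noteq> lam i" using separated[OF that] \<delta>_pos by auto
    ultimately show ?thesis by simp
  qed
  have "g' Vbar (r i) \<bullet> y = (\<Sum>j\<in>UNIV. (l j \<bullet> y) * (g' Vbar (r i) \<bullet> r j))"
    by (subst expand[of y]) (simp add: inner_sum_right)
  also have "\<dots> = (\<Sum>j\<in>UNIV. if j = i then (l i \<bullet> y) * (g' Vbar (r i) \<bullet> r i) else 0)"
    by (rule sum.cong) (auto simp: off)
  finally show ?thesis by simp
qed

lemma near_Hessian_curv:
  assumes "curv i \<noteq> 0"
  obtains \<kappa> where "\<kappa> > 0" "\<kappa> \<le> \<rho>" "\<And>X Y a. \<lbrakk>X \<in> cball Vbar \<kappa>; Y \<in> cball Vbar \<kappa>;
     norm (a - r i) \<le> \<kappa>\<rbrakk> \<Longrightarrow> 0 < curv i * (g' X a \<bullet> (J' Y a *v a))"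
proof -
  define F where "F = (\<lambda>(X, Y, a). curv i * (g' X a \<bullet> (J' Y a *v a)))"
  have "continuous_on (B \<times> B \<times> UNIV) F"
    unfolding F_def split_def by (intro continuous_intros J'_continuous g'_continuous) auto
  moreover have "F (Vbar, Vbar, r i) > 0"
  proof -
    have "r i \<noteq> 0" using dual[of i i] by auto
    then have "0 < c * (norm (r i))\<^sup>2" using c_pos by simp
    then have "0 < g' Vbar (r i) \<bullet> r i" using e_convex[of "r i"] by linarith
    then have "0 < (g' Vbar (r i) \<bullet> r i) * (curv i)\<^sup>2" using assms by simp
    then show ?thesis
      by (simp add: F_def Hessian_left[of i "J' Vbar (r i) *v r i"] curv_def[symmetric] power2_eq_square algebra_simps)
  qed
  ultimately obtain d where d: "d > 0" "\<And>z. z \<in> B \<times> B \<times> UNIV \<Longrightarrow>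
      dist z (Vbar, Vbar, r i) < d \<Longrightarrow> dist (F z) (F (Vbar, Vbar, r i)) < F (Vbar, Vbar, r i)"
    unfolding continuous_on_iff by (metis (no_types, lifting) SigmaI UNIV_I center)
  show ?thesis
  proof (rule that[of "min \<rho> (d / 8)"])
    fix X Y a assume *: "X \<in> cball Vbar (min \<rho> (d / 8))" "Y \<in> cball Vbar (min \<rho> (d / 8))"
      "norm (a - r i) \<le> min \<rho> (d / 8)"
    have "dist (X, Y, a) (Vbar, Vbar, r i) = norm (X - Vbar, Y - Vbar, a - r i)"
      by (simp add: dist_norm)
    also have "\<dots> \<le> norm (X - Vbar) + (norm (Y - Vbar) + norm (a - r i))"
      by (intro order_trans[OF norm_Pair_le] add_left_mono order_refl)
    also have "\<dots> < d" using * d(1) by (simp add: dist_norm norm_minus_commute)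
    finally have "dist (F (X, Y, a)) (F (Vbar, Vbar, r i)) < F (Vbar, Vbar, r i)"
      using * by (intro d(2)) auto
    then show "0 < curv i * (g' X a \<bullet> (J' Y a *v a))"
      by (simp add: F_def dist_real_def)
  qed (use \<rho>_pos d in auto)
qed

text \<open>With \<open>k\<close> the Rankine-Hugoniot defect along the segment, the derivative of \<open>q - \<sigma> e - e_V k\<close> is
  \<open>- e_VV(U - W, k)\<close>. Since \<open>k\<close> vanishes at both ends, its sign is that of the second derivative of \<open>k\<close>.\<close>
lemma entropy_jump:
  assumes "curv i \<noteq> 0"
  obtains \<kappa> where "\<kappa> > 0" "\<kappa> \<le> \<rho>" "\<And>U W \<sigma>. \<lbrakk>U \<in> cball Vbar \<kappa>; W \<in> cball Vbar \<kappa>;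
     f U - f W = \<sigma> *\<^sub>R (U - W); \<bar>\<sigma> - lam i\<bar> \<le> 2 * \<delta>; U \<noteq> W\<rbrakk>
     \<Longrightarrow> 0 < ((q U - \<sigma> * e U) - (q W - \<sigma> * e W)) * (curv i * (l i \<bullet> (U - W)))"
proof -
  obtain \<kappa>0 where k0: "\<kappa>0 > 0" "\<kappa>0 \<le> \<rho>" "\<And>X Y a. \<lbrakk>X \<in> cball Vbar \<kappa>0; Y \<in> cball Vbar \<kappa>0;
     norm (a - r i) \<le> \<kappa>0\<rbrakk> \<Longrightarrow> 0 < curv i * (g' X a \<bullet> (J' Y a *v a))"
    using near_Hessian_curv[OF assms] by blast
  obtain \<kappa> where k: "\<kappa> > 0" "\<kappa> \<le> \<kappa>0"
    "\<And>U W. U \<in> cball Vbar \<kappa> \<Longrightarrow> W \<in> cball Vbar \<kappa> \<Longrightarrow> norm (rv i (avg U W) - r i) \<le> \<kappa>0"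
    using near_directions[OF k0(1,2)] by metis
  show ?thesis
  proof (rule that[of \<kappa>])
    fix U W and \<sigma> :: real
    assume U: "U \<in> cball Vbar \<kappa>" and W: "W \<in> cball Vbar \<kappa>" and RH: "f U - f W = \<sigma> *\<^sub>R (U - W)"
      and \<sigma>: "\<bar>\<sigma> - lam i\<bar> \<le> 2 * \<delta>" and ne: "U \<noteq> W"
    have B: "U \<in> B" "W \<in> B" using U W k k0 by auto
    define v where "v = rv i (avg U W)"
    define u where "u = l i \<bullet> (U - W)"
    define \<Delta> where "\<Delta> = U - W"
    have \<Delta>: "\<Delta> = u *\<^sub>R v" and u: "u \<noteq> 0"
      using Rankine_Hugoniot_direction(2,3)[OF B RH \<sigma> ne] by (auto simp: u_def v_def \<Delta>_def)
    have v: "norm (v - r i) \<le> \<kappa>0" using k(3)[OF U W] by (simp add: v_def)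
    define X where "X s = W + s *\<^sub>R \<Delta>" for s
    have XB: "X s \<in> cball Vbar \<kappa>0" "X s \<in> B" if "0 \<le> s" "s \<le> 1" for s
      using segment_in_B[OF U W that] k k0 by (auto simp: X_def \<Delta>_def)
    define kk where "kk s = f (X s) - \<sigma> *\<^sub>R X s - (f W - \<sigma> *\<^sub>R W)" for s
    have k01: "kk 0 = 0" "kk 1 = 0"
      using RH by (simp_all add: kk_def X_def \<Delta>_def algebra_simps)
    have X_d: "(X has_vector_derivative \<Delta>) (at s)" for s
      unfolding X_def[abs_def] has_vector_derivative_def by (rule line_point_deriv)
    have kk_d: "(kk has_vector_derivative (J (X s) *v \<Delta> - \<sigma> *\<^sub>R \<Delta>)) (at s)" if "0 \<le> s" "s \<le> 1" for s
      unfolding kk_def[abs_def] X_def \<Delta>_def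
      by (rule derivative_eq_intros line_f_deriv[OF B that] line_point_deriv[folded has_vector_derivative_def] refl)+ simp
    have inner_d: "((\<lambda>s. p \<bullet> kk s) has_real_derivative p \<bullet> (J (X s) *v \<Delta> - \<sigma> *\<^sub>R \<Delta>)) (at s)"
      if "0 \<le> s" "s \<le> 1" for s p
      using bounded_linear.has_vector_derivative[OF bounded_linear_inner_right kk_d[OF that], of p]
      by (simp add: has_real_derivative_iff_has_vector_derivative)
    have inner_d2: "((\<lambda>s. p \<bullet> (J (X s) *v \<Delta> - \<sigma> *\<^sub>R \<Delta>)) has_real_derivative p \<bullet> (J' (X s) \<Delta> *v \<Delta>)) (at s)"
      if "0 \<le> s" "s \<le> 1" for s p
      using DERIV_diff[OF line_inner_J_deriv[OF B that, of p \<Delta>] DERIV_const[of "p \<bullet> (\<sigma> *\<^sub>R \<Delta>)"]]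
      by (simp add: X_def \<Delta>_def inner_diff_right)
    define T where "T s = q (X s) - \<sigma> * e (X s) - g (X s) \<bullet> kk s" for s
    have T_d: "(T has_real_derivative - (g' (X s) \<Delta> \<bullet> kk s)) (at s)" if s: "0 \<le> s" "s \<le> 1" for s
    proof -
      have g_d: "((\<lambda>s. g (X s)) has_vector_derivative g' (X s) \<Delta>) (at s)"
        using has_derivative_compose[OF X_d[unfolded has_vector_derivative_def] g_deriv[OF XB(2)[OF s]]]
        unfolding has_vector_derivative_def by (simp add: linear_scale[OF g'_linear[OF XB(2)[OF s]]])
      have e_d: "((\<lambda>s. e (X s)) has_vector_derivative g (X s) \<bullet> \<Delta>) (at s)"
        using has_derivative_compose[OF X_d[unfolded has_vector_derivative_def] e_deriv[OF XB(2)[OF s]]]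
        unfolding has_vector_derivative_def by simp
      have q_d: "((\<lambda>s. q (X s)) has_vector_derivative g (X s) \<bullet> (J (X s) *v \<Delta>)) (at s)"
        using has_derivative_compose[OF X_d[unfolded has_vector_derivative_def] q_deriv[OF XB(2)[OF s]]]
        unfolding has_vector_derivative_def by (simp add: matrix_vector_mult_scaleR)
      have p_d: "((\<lambda>s. g (X s) \<bullet> kk s) has_vector_derivative
          (g (X s) \<bullet> (J (X s) *v \<Delta> - \<sigma> *\<^sub>R \<Delta>) + g' (X s) \<Delta> \<bullet> kk s)) (at s)"
        by (rule bounded_bilinear.has_vector_derivative[OF bounded_bilinear_inner g_d kk_d[OF s]])
      have "(T has_vector_derivative (g (X s) \<bullet> (J (X s) *v \<Delta>) - \<sigma> * (g (X s) \<bullet> \<Delta>)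
          - (g (X s) \<bullet> (J (X s) *v \<Delta> - \<sigma> *\<^sub>R \<Delta>) + g' (X s) \<Delta> \<bullet> kk s))) (at s)"
        unfolding T_def[abs_def]
        by (intro has_vector_derivative_diff q_d p_d has_vector_derivative_mult_right e_d)
      then show ?thesis
        by (simp add: has_real_derivative_iff_has_vector_derivative inner_diff_right)
    qed
    obtain t where t: "0 < t" "t < 1" and Teq: "T 1 - T 0 = - (g' (X t) \<Delta> \<bullet> kk t)"
      using MVT2[OF zero_less_one T_d] by auto
    let ?p = "g' (X t) \<Delta>"
    have neg: "(curv i * u) * (?p \<bullet> kk t) < 0"
    proof (rule ccontr)
      assume *: "\<not> ?thesis"
      obtain a where a: "0 < a" "a < t" "?p \<bullet> kk t - ?p \<bullet> kk 0 = (t - 0) * (?p \<bullet> (J (X a) *v \<Delta> - \<sigma> *\<^sub>R \<Delta>))"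
        using MVT2[OF t(1) inner_d, of ?p] t by auto
      obtain b where b: "t < b" "b < 1" "?p \<bullet> kk 1 - ?p \<bullet> kk t = (1 - t) * (?p \<bullet> (J (X b) *v \<Delta> - \<sigma> *\<^sub>R \<Delta>))"
        using MVT2[OF t(2) inner_d, of ?p] t by auto
      have "a < b" using a b by simp
      obtain s where s: "a < s" "s < b" "?p \<bullet> (J (X b) *v \<Delta> - \<sigma> *\<^sub>R \<Delta>) - ?p \<bullet> (J (X a) *v \<Delta> - \<sigma> *\<^sub>R \<Delta>)
          = (b - a) * (?p \<bullet> (J' (X s) \<Delta> *v \<Delta>))"
        using MVT2[OF \<open>a < b\<close> inner_d2, of ?p] a b by auto
      let ?z = "g' (X t) v \<bullet> (J' (X s) v *v v)"
      have z: "0 < curv i * ?z"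
        using k0(3)[of "X t" "X s" v] XB(1) s a b t v by auto
      have "?p \<bullet> (J' (X s) \<Delta> *v \<Delta>) = u * u * u * ?z"
        unfolding \<Delta> using XB(2)[of t] XB(2)[of s] s a b t
        by (simp add: J'_scale matrix_vector_mult_scaleR scaleR_matrix_vector_assoc[symmetric]
            linear_scale[OF g'_linear])
      then have "(curv i * u) * (?p \<bullet> (J' (X s) \<Delta> *v \<Delta>)) = (u\<^sup>2)\<^sup>2 * (curv i * ?z)"
        by (simp add: power2_eq_square)
      then have pos: "0 < (curv i * u) * (?p \<bullet> (J' (X s) \<Delta> *v \<Delta>))"
        using z u by (metis mult_pos_pos zero_less_power2 power_not_zero)
      let ?A = "(curv i * u) * (?p \<bullet> (J (X a) *v \<Delta> - \<sigma> *\<^sub>R \<Delta>))"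
        and ?B = "(curv i * u) * (?p \<bullet> (J (X b) *v \<Delta> - \<sigma> *\<^sub>R \<Delta>))"
      have "?p \<bullet> kk t = t * (?p \<bullet> (J (X a) *v \<Delta> - \<sigma> *\<^sub>R \<Delta>))"
        using a(3) k01 by simp
      then have "t * ?A = (curv i * u) * (?p \<bullet> kk t)"
        by (simp only: mult.left_commute)
      then have A: "0 \<le> ?A" using * t by (smt (verit) mult_pos_neg)
      have "(1 - t) * ?B = - ((curv i * u) * (?p \<bullet> kk t))"
        using arg_cong[OF b(3), of "\<lambda>x. (curv i * u) * x"] k01 by (simp add: algebra_simps)
      then have B': "?B \<le> 0" using * t by (smt (verit) mult_pos_pos)
      have "?B - ?A = (b - a) * ((curv i * u) * (?p \<bullet> (J' (X s) \<Delta> *v \<Delta>)))"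
        using arg_cong[OF s(3), of "\<lambda>x. (curv i * u) * x"] by (simp only: right_diff_distrib mult.left_commute)
      moreover have "0 < (b - a) * ((curv i * u) * (?p \<bullet> (J' (X s) \<Delta> *v \<Delta>)))"
        using pos \<open>a < b\<close> by simp
      ultimately show False using A B' by linarith
    qed
    have T10: "T 1 - T 0 = (q U - \<sigma> * e U) - (q W - \<sigma> * e W)"
      by (simp add: T_def k01) (simp add: X_def \<Delta>_def)
    then have "((q U - \<sigma> * e U) - (q W - \<sigma> * e W)) * (curv i * u) = - ((curv i * u) * (?p \<bullet> kk t))"
    proof -
      have "(q U - \<sigma> * e U) - (q W - \<sigma> * e W) = - (?p \<bullet> kk t)"
        using Teq T10 by linarith
      then show ?thesis by (simp only: mult_minus_left mult_minus_right mult.commute)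
    qed
    then show "0 < ((q U - \<sigma> * e U) - (q W - \<sigma> * e W)) * (curv i * (l i \<bullet> (U - W)))"
      using neg unfolding u_def by linarith
  qed (use k k0 in auto)
qed

end

section \<open>Profiles of self-similar solutions\<close>

text \<open>By compactness every sequence has limit points, so uniqueness of the limit points is existence of the limit.\<close>
lemma compact_limit_exists:
  fixes V :: "real \<Rightarrow> 'a::metric_space"
  assumes C: "compact C" and V: "\<And>s. V s \<in> C" and nt: "at x within I \<noteq> bot"
    and uniq: "\<And>a b U W. \<lbrakk>\<And>n. a n \<in> I - {x}; a \<longlonglongrightarrow> x; (\<lambda>n. V (a n)) \<longlonglongrightarrow> U;
      \<And>n. b n \<in> I - {x}; b \<longlonglongrightarrow> x; (\<lambda>n. V (b n)) \<longlonglongrightarrow> W\<rbrakk> \<Longrightarrow> U = W"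
  shows "\<exists>U\<in>C. (V \<longlongrightarrow> U) (at x within I)"
proof -
  have sub: "\<exists>r U. strict_mono (r :: nat \<Rightarrow> nat) \<and> U \<in> C \<and> (\<lambda>n. V (X (r n))) \<longlonglongrightarrow> U" for X :: "nat \<Rightarrow> real"
  proof -
    have "\<exists>U\<in>C. \<exists>r. strict_mono (r :: nat \<Rightarrow> nat) \<and> ((\<lambda>n. V (X n)) \<circ> r) \<longlonglongrightarrow> U"
      by (rule C[unfolded compact_def, rule_format]) (rule V)
    then show ?thesis unfolding o_def by metis
  qed
  obtain a where a: "\<And>n. a n \<in> I - {x}" "a \<longlonglongrightarrow> x"
    using nt islimpt_sequential[of x I] by (auto simp: trivial_limit_within)
  obtain r U where r: "strict_mono r" "U \<in> C" "(\<lambda>n. V (a (r n))) \<longlonglongrightarrow> U"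
    using sub[of a] by blast
  have ar: "(\<lambda>n. a (r n)) \<longlonglongrightarrow> x"
    using LIMSEQ_subseq_LIMSEQ[OF a(2) r(1)] by (simp add: o_def)
  have "(V \<longlongrightarrow> U) (at x within I)"
    unfolding tendsto_at_iff_sequentially
  proof (intro allI impI)
    fix X assume X: "\<forall>i. X i \<in> I - {x}" "X \<longlonglongrightarrow> x"
    show "(V \<circ> X) \<longlonglongrightarrow> U"
    proof (rule ccontr)
      assume "\<not> ?thesis"
      then obtain d where d: "d > 0" "\<not> (\<forall>\<^sub>F n in sequentially. dist (V (X n)) U < d)"
        unfolding tendsto_iff by (auto simp: o_def)
      have "infinite {n. \<not> dist (V (X n)) U < d}"
        using d(2) unfolding cofinite_eq_sequentially[symmetric] eventually_cofinite .
      from infinite_enumerate[OF this]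
      obtain t where t: "strict_mono (t :: nat \<Rightarrow> nat)" "\<And>n. \<not> dist (V (X (t n))) U < d"
        by auto
      obtain p W where p: "strict_mono p" "W \<in> C" "(\<lambda>n. V (X (t (p n)))) \<longlonglongrightarrow> W"
        using sub[of "\<lambda>n. X (t n)"] by blast
      have "(\<lambda>n. X (t (p n))) \<longlonglongrightarrow> x"
        using LIMSEQ_subseq_LIMSEQ[OF X(2) strict_mono_o[OF t(1) p(1)]] by (simp add: o_def)
      then have "U = W"
        using uniq[of "\<lambda>n. a (r n)" U "\<lambda>n. X (t (p n))" W] a r ar X p by auto
      then have "\<forall>\<^sub>F n in sequentially. dist (V (X (t (p n)))) U < d"
        using p(3) d(1) tendstoD by blast
      then show False
        using t(2) by (auto simp: eventually_sequentially)
    qed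
  qed
  with r(2) show ?thesis by blast
qed

lemma antimono_one_sided_limits:
  fixes h :: "real \<Rightarrow> real"
  assumes "\<And>x y. x < y \<Longrightarrow> h y \<le> h x"
  shows "\<exists>H. (h \<longlongrightarrow> H) (at_right x)" "\<exists>H. (h \<longlongrightarrow> H) (at_left x)"
proof -
  have bdd: "bdd_above (h ` {x<..})" "bdd_below (h ` {..<x})"
    using assms by (auto intro!: bdd_aboveI[of _ "h x"] bdd_belowI[of _ "h x"])
  have "(h \<longlongrightarrow> Sup (h ` {x<..})) (at_right x)"
  proof (rule increasing_tendsto)
    show "\<forall>\<^sub>F s in at_right x. h s \<le> Sup (h ` {x<..})"
      using bdd by (auto simp: eventually_at_right_field intro!: cSup_upper exI[of _ "x + 1"])
    fix z assume "z < Sup (h ` {x<..})"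
    then obtain s where "s > x" "z < h s"
      using less_cSup_iff[OF _ bdd(1), of z] by (metis (no_types, lifting) greaterThan_iff imageE image_is_empty greaterThan_non_empty)
    then show "\<forall>\<^sub>F t in at_right x. z < h t"
      unfolding eventually_at_right_field using assms by (meson less_le_trans)
  qed
  then show "\<exists>H. (h \<longlongrightarrow> H) (at_right x)" by blast
  have "(h \<longlongrightarrow> Inf (h ` {..<x})) (at_left x)"
  proof (rule decreasing_tendsto)
    show "\<forall>\<^sub>F s in at_left x. Inf (h ` {..<x}) \<le> h s"
      using bdd by (auto simp: eventually_at_left_field intro!: cInf_lower exI[of _ "x - 1"])
    fix z assume "Inf (h ` {..<x}) < z"
    then obtain s where "s < x" "h s < z"
      using cInf_less_iff[OF _ bdd(2), of z] by (metis (no_types, lifting) lessThan_iff imageE image_is_empty lessThan_non_empty)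
    then show "\<forall>\<^sub>F t in at_left x. h t < z"
      unfolding eventually_at_left_field using assms by (meson le_less_trans)
  qed
  then show "\<exists>H. (h \<longlongrightarrow> H) (at_left x)" by blast
qed

lemma one_sided_nontrivial: "at x within {x<..} \<noteq> bot" "at x within {..<x} \<noteq> bot" for x :: real
  using trivial_limit_at_right_real[of x] trivial_limit_at_left_real[of x] by (simp_all add: trivial_limit_def)

text \<open>The conservation law and the entropy inequality for a self-similar solution, integrated between two points.
  For the conservation law, \<open>f(V x) - f(V y) - x (V x - V y)\<close> is the integral of \<open>V s - V y\<close> between \<open>x\<close> and \<open>y\<close>
  up to sign, and only the resulting bound is kept. Both relations hold at every point, so one can speak about
  values and one-sided limits without any bound on the variation of \<open>V\<close>.\<close>
locale riemann_profile = entropic A0 lam r l \<delta> \<eta> f J J' Vbar \<rho> L e q g g' c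
  for A0 :: "real^'m^'m" and lam r l \<delta> \<eta> f J J' Vbar \<rho> L e q g g' c +
  fixes \<epsilon> :: real and V :: "real \<Rightarrow> real^'m" and M :: real
  assumes \<epsilon>_bounds: "0 < \<epsilon>" "\<epsilon> \<le> \<rho>"
    and V_ball: "V x \<in> cball Vbar \<epsilon>"
    and V_eq: "(\<And>s. s \<in> closed_segment x y \<Longrightarrow> norm (V s - V y) \<le> C) \<Longrightarrow>
      norm (f (V x) - f (V y) - x *\<^sub>R (V x - V y)) \<le> C * \<bar>x - y\<bar>"
    and V_entropy: "x < y \<Longrightarrow> (q (V y) - y * e (V y)) - (q (V x) - x * e (V x)) \<le> M * (y - x)"
begin

lemma V_B [simp]: "V x \<in> B"
  using V_ball[of x] \<epsilon>_bounds by auto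

lemma V_dist [simp]: "dist Vbar (V x) \<le> \<rho>"
  using V_B[of x] by simp

lemma ball_B: "X \<in> cball Vbar \<epsilon> \<Longrightarrow> X \<in> B"
  using \<epsilon>_bounds by auto

lemma ball_diff: "X \<in> cball Vbar \<epsilon> \<Longrightarrow> Y \<in> cball Vbar \<epsilon> \<Longrightarrow> norm (X - Y) \<le> 2 * \<epsilon>"
  using norm_vector_minus_le[of X Vbar \<epsilon>] norm_vector_minus_le[of Y Vbar \<epsilon>]
    norm_triangle_ineq4[of "X - Vbar" "Y - Vbar"] by simp

lemma V_diff: "norm (V x - V y) \<le> 2 * \<epsilon>"
  using ball_diff V_ball by blast

lemma limit_in_ball: "a \<longlonglongrightarrow> x \<Longrightarrow> (\<lambda>n. V (a n)) \<longlonglongrightarrow> U \<Longrightarrow> U \<in> cball Vbar \<epsilon>"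
  using closed_sequentially[OF closed_cball, of "\<lambda>n. V (a n)"] V_ball by blast

text \<open>Every limit point of \<open>V\<close> at \<open>x\<close> is joined to \<open>V x\<close> by a jump of speed \<open>x\<close>.\<close>
lemma Rankine_Hugoniot_limit:
  assumes a: "a \<longlonglongrightarrow> x" "(\<lambda>n. V (a n)) \<longlonglongrightarrow> U"
  shows "f U - f (V x) = x *\<^sub>R (U - V x)"
proof -
  have U: "U \<in> B" using limit_in_ball[OF a] ball_B by blast
  have fU: "(\<lambda>n. f (V (a n))) \<longlonglongrightarrow> f U"
    by (rule continuous_on_tendsto_compose[OF f_continuous a(2) U]) simp
  have "(\<lambda>n. norm (f (V (a n)) - f (V x) - a n *\<^sub>R (V (a n) - V x))) \<longlonglongrightarrow> norm (f U - f (V x) - x *\<^sub>R (U - V x))"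
    by (intro tendsto_intros fU a)
  moreover have "(\<lambda>n. 2 * \<epsilon> * \<bar>a n - x\<bar>) \<longlonglongrightarrow> 2 * \<epsilon> * \<bar>x - x\<bar>"
    by (intro tendsto_intros a)
  ultimately have "norm (f U - f (V x) - x *\<^sub>R (U - V x)) \<le> 2 * \<epsilon> * \<bar>x - x\<bar>"
    by (rule LIMSEQ_le) (use V_eq V_diff in blast)
  then show ?thesis by simp
qed

lemma Rankine_Hugoniot_limits:
  assumes "a \<longlonglongrightarrow> x" "(\<lambda>n. V (a n)) \<longlonglongrightarrow> U" "b \<longlonglongrightarrow> x" "(\<lambda>n. V (b n)) \<longlonglongrightarrow> W"
  shows "f U - f W = x *\<^sub>R (U - W)"
proof -
  have "f U - f W = (f U - f (V x)) - (f W - f (V x))" by simp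
  also have "\<dots> = x *\<^sub>R (U - V x) - x *\<^sub>R (W - V x)"
    using Rankine_Hugoniot_limit[OF assms(1,2)] Rankine_Hugoniot_limit[OF assms(3,4)] by simp
  also have "\<dots> = x *\<^sub>R (U - W)" by (simp only: scaleR_diff_right[symmetric]) simp
  finally show ?thesis .
qed

lemma filter_limit_sequence:
  assumes "(V \<longlongrightarrow> U) (at x within I)" "at x within I \<noteq> bot"
  obtains a where "\<And>n. a n \<in> I - {x}" "a \<longlonglongrightarrow> x" "(\<lambda>n. V (a n)) \<longlonglongrightarrow> U"
proof -
  obtain a where a: "\<And>n. a n \<in> I - {x}" "a \<longlonglongrightarrow> x"
    using assms(2) islimpt_sequential[of x I] by (auto simp: trivial_limit_within)
  moreover have "(\<lambda>n. V (a n)) \<longlonglongrightarrow> U"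
    using assms(1) a unfolding tendsto_at_iff_sequentially by (auto simp: o_def)
  ultimately show ?thesis using that by blast
qed

text \<open>If \<open>W \<mapsto> f W - x W\<close> is injective with a uniform bound for all \<open>x\<close> in the interval, then \<open>V_eq\<close> bounds the
  oscillation of \<open>V\<close> over a short interval by half of itself.\<close>
lemma constant_on_interval:
  assumes conv: "convex I" and C: "C \<ge> 0"
    and inj: "\<And>x s t. \<lbrakk>x \<in> I; s \<in> I; t \<in> I\<rbrakk> \<Longrightarrow> norm (V s - V t) \<le> C * norm (f (V s) - f (V t) - x *\<^sub>R (V s - V t))"
    and xy: "x \<in> I" "y \<in> I"
  shows "V x = V y"
proof (rule connected_local_const[OF convex_connected[OF conv] xy], intro ballI)
  fix y assume y: "y \<in> I"
  define h where "h = 1 / (2 * C + 1)"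
  have h: "h > 0" "C * h \<le> 1 / 2" using C by (auto simp: h_def field_simps)
  have "V y = V x" if x: "x \<in> I" "\<bar>x - y\<bar> < h" for x
  proof -
    have seg: "s \<in> I \<and> \<bar>s - y\<bar> < h" if "s \<in> closed_segment x y" for s
    proof -
      have "s \<in> I" using that conv x(1) y closed_segment_subset by blast
      moreover have "\<bar>s - y\<bar> \<le> \<bar>y - x\<bar>" using segment_bound(2)[OF that] by simp
      ultimately show ?thesis using x(2) by auto
    qed
    have est: "\<forall>s \<in> closed_segment x y. norm (V s - V y) \<le> 2 * \<epsilon> / 2 ^ n" for n
    proof (induction n)
      case 0
      then show ?case using V_diff by simp
    next
      case (Suc n)
      show ?case
      proof
        fix s assume s: "s \<in> closed_segment x y"
        have "closed_segment s y \<subseteq> closed_segment x y"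
          using s by (simp add: subset_closed_segment)
        then have "norm (f (V s) - f (V y) - s *\<^sub>R (V s - V y)) \<le> (2 * \<epsilon> / 2 ^ n) * \<bar>s - y\<bar>"
          using Suc by (intro V_eq) auto
        then have "C * norm (f (V s) - f (V y) - s *\<^sub>R (V s - V y)) \<le> C * ((2 * \<epsilon> / 2 ^ n) * \<bar>s - y\<bar>)"
          using C by (rule mult_left_mono)
        also have "\<dots> \<le> C * ((2 * \<epsilon> / 2 ^ n) * h)"
          using C seg[OF s] \<epsilon>_bounds by (intro mult_left_mono) auto
        also have "\<dots> = (2 * \<epsilon> / 2 ^ n) * (C * h)" by simp
        also have "\<dots> \<le> (2 * \<epsilon> / 2 ^ n) * (1 / 2)"
          using h \<epsilon>_bounds by (intro mult_left_mono) auto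
        finally show "norm (V s - V y) \<le> 2 * \<epsilon> / 2 ^ Suc n"
          using inj[of s s y] seg[OF s] y by simp
      qed
    qed
    have "(\<lambda>n. 2 * \<epsilon> / 2 ^ n) \<longlonglongrightarrow> 0"
      by real_asymp
    then have "norm (V x - V y) \<le> 0"
      using est by (intro LIMSEQ_le_const) auto
    then show ?thesis by simp
  qed
  then show "\<forall>\<^sub>F x in at y within I. V y = V x"
    unfolding eventually_at using h(1) by (intro exI[of _ h]) (auto simp: dist_real_def)
qed

text \<open>Away from all characteristic speeds the averaged Jacobian minus the speed is uniformly invertible.\<close>
lemma constant_in_gap:
  assumes "convex I" "\<And>x k. x \<in> I \<Longrightarrow> \<delta> \<le> \<bar>lam k - x\<bar>" "x \<in> I" "y \<in> I"
  shows "V x = V y"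
proof (rule constant_on_interval[OF assms(1) _ _ assms(3,4)])
  show "0 \<le> K" using K_ge(1) by simp
  show "norm (V s - V t) \<le> K * norm (f (V s) - f (V t) - y *\<^sub>R (V s - V t))" if "y \<in> I" for y s t
    unfolding avg_diff[OF V_B V_B] using assms(2)[OF that] by (intro gap avg_near V_B)
qed

text \<open>A state that is not sonic makes \<open>J U - x\<close> invertible, and this persists near the one-sided limit.\<close>
lemma locally_constant:
  assumes conv: "convex I" and nt: "at x within I \<noteq> bot" and lim: "(V \<longlongrightarrow> U) (at x within I)" and "x \<notin> I"
    and xi: "\<bar>x - lam i\<bar> \<le> 2 * \<delta>" and ne: "speed i U \<noteq> x"
  shows "\<exists>d>0. \<forall>s\<in>I. \<bar>s - x\<bar> < d \<longrightarrow> V s = U"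
proof -
  obtain a where a: "a \<longlonglongrightarrow> x" "(\<lambda>n. V (a n)) \<longlonglongrightarrow> U"
    using filter_limit_sequence[OF lim nt] by metis
  have U: "U \<in> B" using limit_in_ball[OF a] ball_B by blast
  let ?T = "\<lambda>v. (J U - x *\<^sub>R mat 1) *v v"
  have "inj ?T"
  proof (rule linear_injective_0[THEN iffD2, OF matrix_vector_mul_linear], intro allI impI, rule ccontr)
    fix v assume "?T v = 0" "v \<noteq> 0"
    then have "J U *v v = x *\<^sub>R v" by (simp add: shifted_matrix_vector)
    from eigenpair_unique(1)[OF J_near[OF U] xi this \<open>v \<noteq> 0\<close>] ne show False by (simp add: speed_def)
  qed
  then obtain \<beta> where \<beta>: "\<beta> > 0" "\<And>v. \<beta> * norm v \<le> norm (J U *v v - x *\<^sub>R v)"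
    using linear_inj_bounded_below_pos[OF matrix_vector_mul_linear] by (metis shifted_matrix_vector)
  \<comment> \<open>Replacing \<open>J U\<close> by an averaged Jacobian of states within \<open>\<mu>\<close> of \<open>U\<close> costs \<open>\<beta>/2\<close>, moving \<open>x\<close> costs \<open>\<beta>/4\<close>.\<close>
  define \<mu> where "\<mu> = \<beta> / (4 * (L + 1))"
  have \<mu>: "\<mu> > 0" "L * (\<mu> + \<mu>) \<le> \<beta> / 2"
  proof -
    show "\<mu> > 0" using \<beta> L_nonneg by (simp add: \<mu>_def)
    have "L * (\<mu> + \<mu>) \<le> (L + 1) * (\<mu> + \<mu>)" using \<open>\<mu> > 0\<close> by simp
    also have "\<dots> = \<beta> / 2"
    proof -
      have "4 * L + 4 \<noteq> 0" using L_nonneg by linarith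
      then have "(L + 1) * \<mu> = \<beta> / 4" by (simp add: \<mu>_def field_simps)
      then show ?thesis by (simp only: distrib_left)
    qed
    finally show "L * (\<mu> + \<mu>) \<le> \<beta> / 2" .
  qed
  obtain d0 where d0: "d0 > 0" and d0': "\<forall>s\<in>I. s \<noteq> x \<and> dist s x < d0 \<longrightarrow> dist (V s) U < \<mu>"
    using tendstoD[OF lim \<mu>(1)] unfolding eventually_at by blast
  have d0'': "norm (V s - U) < \<mu>" if "s \<in> I" "\<bar>s - x\<bar> < d0" for s
    using d0' that \<open>x \<notin> I\<close> by (metis dist_norm real_norm_def)
  define d where "d = min d0 (\<beta> / 4)"
  have d: "d > 0" using d0 \<beta> by (simp add: d_def)
  let ?I = "I \<inter> ball x d"
  have eq: "V s = V t" if "s \<in> ?I" "t \<in> ?I" for s t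
  proof (rule constant_on_interval[of ?I "4 / \<beta>", OF _ _ _ that])
    show "convex ?I" using conv by (intro convex_Int convex_ball)
    show "0 \<le> 4 / \<beta>" using \<beta> by simp
    fix y s t assume *: "y \<in> ?I" "s \<in> ?I" "t \<in> ?I"
    let ?v = "V s - V t" and ?A = "avg (V s) (V t)"
    have 1: "norm (V s - U) < \<mu>" "norm (V t - U) < \<mu>"
      using * d0''[of s] d0''[of t] by (auto simp: d_def dist_real_def)
    have "norm (?A - avg U U) \<le> L * (norm (V s - U) + norm (V t - U))"
      using U by (intro avg_Lipschitz) auto
    also have "\<dots> \<le> L * (\<mu> + \<mu>)" using 1 L_nonneg by (intro mult_left_mono) auto
    finally have 2: "norm (?A - J U) \<le> \<beta> / 2" using \<mu> by (simp add: avg_same)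
    have 3: "\<bar>y - x\<bar> \<le> \<beta> / 4" using * by (auto simp: d_def dist_real_def abs_minus_commute)
    have "J U *v ?v - x *\<^sub>R ?v = (?A *v ?v - y *\<^sub>R ?v) - (?A - J U) *v ?v + (y - x) *\<^sub>R ?v"
      by (simp add: matrix_diff_vector algebra_simps)
    then have "norm (J U *v ?v - x *\<^sub>R ?v) = norm ((?A *v ?v - y *\<^sub>R ?v) - (?A - J U) *v ?v + (y - x) *\<^sub>R ?v)"
      by (rule arg_cong)
    also have "\<dots> \<le> norm (?A *v ?v - y *\<^sub>R ?v) + norm ((?A - J U) *v ?v) + norm ((y - x) *\<^sub>R ?v)"
      using norm_triangle_ineq[of "(?A *v ?v - y *\<^sub>R ?v) - (?A - J U) *v ?v" "(y - x) *\<^sub>R ?v"]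
        norm_triangle_ineq4[of "?A *v ?v - y *\<^sub>R ?v" "(?A - J U) *v ?v"] by linarith
    also have "norm ((?A - J U) *v ?v) \<le> \<beta> / 2 * norm ?v"
      using norm_matrix_vector_le[of "?A - J U" ?v] mult_right_mono[OF 2, of "norm ?v"] by simp
    also have "norm ((y - x) *\<^sub>R ?v) \<le> \<beta> / 4 * norm ?v"
      using mult_right_mono[OF 3, of "norm ?v"] by simp
    finally have "\<beta> / 4 * norm ?v \<le> norm (?A *v ?v - y *\<^sub>R ?v)"
      using \<beta>(2)[of ?v] by simp
    then have "norm ?v \<le> 4 / \<beta> * norm (?A *v ?v - y *\<^sub>R ?v)"
      using \<beta>(1) by (simp add: field_simps)
    then show "norm ?v \<le> 4 / \<beta> * norm (f (V s) - f (V t) - y *\<^sub>R ?v)"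
      by (simp add: avg_diff)
  qed
  have "V s = U" if s: "s \<in> ?I" for s
  proof (rule tendsto_unique[OF nt _ lim])
    have "\<forall>\<^sub>F t in at x within I. V s = V t"
      unfolding eventually_at using d eq[OF s] by (intro exI[of _ d]) (auto simp: dist_commute)
    then show "(V \<longlongrightarrow> V s) (at x within I)"
      by (intro tendsto_eventually) (auto elim: eventually_mono)
  qed
  then show ?thesis
    using d by (intro exI[of _ d]) (auto simp: dist_real_def)
qed

text \<open>The entropy inequality makes \<open>q(V) - \<xi> e(V)\<close> monotone up to a linear term, so it has one-sided limits.\<close>
lemma entropy_limits:
  assumes I: "I = {x<..} \<or> I = {..<x}"
  obtains H where "((\<lambda>s. q (V s) - s * e (V s)) \<longlongrightarrow> H) (at x within I)"
proof -
  let ?h = "\<lambda>s. q (V s) - s * e (V s) - M * s"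
  have "\<exists>H. (?h \<longlongrightarrow> H) (at x within I)"
    using antimono_one_sided_limits[of ?h] V_entropy I by (force simp: algebra_simps)
  then obtain H where "(?h \<longlongrightarrow> H) (at x within I)" by blast
  from tendsto_add[OF this tendsto_mult[OF tendsto_const[of M] tendsto_ident_at]]
  show ?thesis using that by (simp add: algebra_simps)
qed

lemma entropy_limit_value:
  assumes "a \<longlonglongrightarrow> x" "(\<lambda>n. V (a n)) \<longlonglongrightarrow> U"
  shows "(\<lambda>n. q (V (a n)) - a n * e (V (a n))) \<longlonglongrightarrow> q U - x * e U"
proof -
  have U: "U \<in> B" using limit_in_ball[OF assms] ball_B by blast
  show ?thesis
    by (intro tendsto_intros assms(1) continuous_on_tendsto_compose[OF q_continuous assms(2) U]
        continuous_on_tendsto_compose[OF e_continuous assms(2) U]) auto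
qed

lemma entropy_limit_le:
  assumes a: "a \<longlonglongrightarrow> x" "(\<lambda>n. V (a n)) \<longlonglongrightarrow> U" and b: "b \<longlonglongrightarrow> x" "(\<lambda>n. V (b n)) \<longlonglongrightarrow> W"
    and ab: "\<And>n. a n < b n"
  shows "q W - x * e W \<le> q U - x * e U"
proof -
  have "(\<lambda>n. (q (V (b n)) - b n * e (V (b n))) - (q (V (a n)) - a n * e (V (a n))))
      \<longlonglongrightarrow> (q W - x * e W) - (q U - x * e U)"
    by (intro tendsto_diff entropy_limit_value a b)
  moreover have "(\<lambda>n. M * (b n - a n)) \<longlonglongrightarrow> M * (x - x)"
    by (intro tendsto_intros a b)
  ultimately have "(q W - x * e W) - (q U - x * e U) \<le> M * (x - x)"
    by (rule LIMSEQ_le) (use V_entropy ab in blast)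
  then show ?thesis by simp
qed

end

section \<open>The wave inside one sector\<close>

context riemann_profile
begin

text \<open>Outside the \<open>\<delta>\<close>-neighbourhoods of the \<open>lam k\<close> the profile is constant, so \<open>left_state i\<close> and \<open>right_state i\<close> are the
  constant states before and after the \<open>i\<close>-th wave.\<close>
definition strip :: "'m \<Rightarrow> real set" where "strip i = {lam i - 2 * \<delta> <..< lam i + 2 * \<delta>}"
definition left_state where "left_state i = V (lam i - \<delta>)"
definition right_state where "right_state i = V (lam i + \<delta>)"

text \<open>Equal states are admitted: the trivial wave is a jump of strength zero.\<close>
definition jump_at where
  "jump_at i \<sigma> \<longleftrightarrow> \<bar>\<sigma> - lam i\<bar> < \<delta> \<and>
    (\<forall>s\<in>strip i. (s < \<sigma> \<longrightarrow> V s = left_state i) \<and> (\<sigma> < s \<longrightarrow> V s = right_state i)) \<and>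
    f (right_state i) - f (left_state i) = \<sigma> *\<^sub>R (right_state i - left_state i)"

definition fan where
  "fan i a b \<longleftrightarrow> a \<le> b \<and> \<bar>a - lam i\<bar> < \<delta> \<and> \<bar>b - lam i\<bar> < \<delta> \<and> continuous_on {a..b} V \<and>
    (\<forall>s\<in>strip i. (s \<le> a \<longrightarrow> V s = left_state i) \<and> (b \<le> s \<longrightarrow> V s = right_state i)) \<and>
    (\<forall>s\<in>{a..b}. speed i (V s) = s)"

lemma strip_iff: "x \<in> strip i \<longleftrightarrow> \<bar>x - lam i\<bar> < 2 * \<delta>"
  by (auto simp: strip_def)

lemma strip_le: "x \<in> strip i \<Longrightarrow> \<bar>x - lam i\<bar> \<le> 2 * \<delta>"
  by (simp add: strip_iff)

lemma strip_between: "x \<in> strip i \<Longrightarrow> y \<in> strip i \<Longrightarrow> x \<le> s \<Longrightarrow> s \<le> y \<Longrightarrow> s \<in> strip i"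
  by (auto simp: strip_def)

lemma speed_near: "U \<in> cball Vbar \<epsilon> \<Longrightarrow> \<bar>speed i U - lam i\<bar> < \<delta>"
  by (rule speed_facts(1)) (rule ball_B)

lemma ends_in_strip: "lam i - \<delta> \<in> strip i" "lam i + \<delta> \<in> strip i" "lam i \<in> strip i"
  using \<delta>_pos by (auto simp: strip_def)

lemma locally_constant_around:
  assumes x: "x \<in> strip i" and R: "(V \<longlongrightarrow> V x) (at_right x)" and Lf: "(V \<longlongrightarrow> V x) (at_left x)"
    and ne: "speed i (V x) \<noteq> x"
  shows "\<exists>d>0. \<forall>s. \<bar>s - x\<bar> < d \<longrightarrow> V s = V x"
proof -
  obtain d1 where d1: "d1 > 0" "\<forall>s\<in>{x<..}. \<bar>s - x\<bar> < d1 \<longrightarrow> V s = V x"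
    using locally_constant[OF convex_real_interval(3) one_sided_nontrivial(1) R _ strip_le[OF x] ne] by auto
  obtain d2 where d2: "d2 > 0" "\<forall>s\<in>{..<x}. \<bar>s - x\<bar> < d2 \<longrightarrow> V s = V x"
    using locally_constant[OF convex_real_interval(4) one_sided_nontrivial(2) Lf _ strip_le[OF x] ne] by auto
  show ?thesis
  proof (intro exI[of _ "min d1 d2"] conjI allI impI)
    fix s assume "\<bar>s - x\<bar> < min d1 d2"
    then show "V s = V x" using d1(2) d2(2) by (cases s x rule: linorder_cases) auto
  qed (use d1 d2 in auto)
qed

lemma constant_on_if_locally:
  assumes "convex T" "\<And>x. x \<in> T \<Longrightarrow> \<exists>d>0. \<forall>s. \<bar>s - x\<bar> < d \<longrightarrow> V s = V x" "x \<in> T" "y \<in> T"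
  shows "V x = V y"
proof (rule connected_local_const[OF convex_connected[OF assms(1)] assms(3,4)], intro ballI)
  fix a assume "a \<in> T"
  then obtain d where "d > 0" "\<And>s. \<bar>s - a\<bar> < d \<Longrightarrow> V s = V a" using assms(2) by blast
  then show "\<forall>\<^sub>F b in at a within T. V a = V b"
    unfolding eventually_at dist_real_def by metis
qed

end

locale nonlinear_profile = riemann_profile A0 lam r l \<delta> \<eta> f J J' Vbar \<rho> L e q g g' c \<epsilon> V M
  for A0 :: "real^'m^'m" and lam r l \<delta> \<eta> f J J' Vbar \<rho> L e q g g' c \<epsilon> V M +
  fixes i :: 'm
  assumes lax: "\<lbrakk>U \<in> cball Vbar \<epsilon>; W \<in> cball Vbar \<epsilon>; f U - f W = \<sigma> *\<^sub>R (U - W); \<bar>\<sigma> - lam i\<bar> \<le> 2 * \<delta>; U \<noteq> W\<rbrakk>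
     \<Longrightarrow> 0 < (\<sigma> - speed i W) * (curv i * (l i \<bullet> (U - W)))"
    and jump: "\<lbrakk>U \<in> cball Vbar \<epsilon>; W \<in> cball Vbar \<epsilon>; f U - f W = \<sigma> *\<^sub>R (U - W); \<bar>\<sigma> - lam i\<bar> \<le> 2 * \<delta>; U \<noteq> W\<rbrakk>
     \<Longrightarrow> 0 < ((q U - \<sigma> * e U) - (q W - \<sigma> * e W)) * (curv i * (l i \<bullet> (U - W)))"
begin

text \<open>Two limit points from the same side would be joined by a jump along which \<open>q - x e\<close> does not change, since that
  quantity has a limit; in a genuinely nonlinear field such a jump is trivial.\<close>
lemma limit_exists:
  assumes x: "x \<in> strip i" and I: "I = {x<..} \<or> I = {..<x}"
  shows "\<exists>U\<in>cball Vbar \<epsilon>. (V \<longlongrightarrow> U) (at x within I)"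
proof (rule compact_limit_exists[OF compact_cball V_ball])
  show "at x within I \<noteq> bot" using I one_sided_nontrivial by blast
  obtain H where H: "((\<lambda>s. q (V s) - s * e (V s)) \<longlongrightarrow> H) (at x within I)"
    using entropy_limits[OF I] by blast
  fix a b U W
  assume a: "\<And>n. a n \<in> I - {x}" "a \<longlonglongrightarrow> x" "(\<lambda>n. V (a n)) \<longlonglongrightarrow> U"
    and b: "\<And>n. b n \<in> I - {x}" "b \<longlonglongrightarrow> x" "(\<lambda>n. V (b n)) \<longlonglongrightarrow> W"
  have seqH: "(\<lambda>n. q (V (z n)) - z n * e (V (z n))) \<longlonglongrightarrow> H" if "\<And>n. z n \<in> I - {x}" "z \<longlonglongrightarrow> x" for z
    using H that unfolding tendsto_at_iff_sequentially by (auto simp: o_def)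
  have "q U - x * e U = H"
    using LIMSEQ_unique[OF entropy_limit_value[OF a(2,3)] seqH[OF a(1,2)]] .
  moreover have "q W - x * e W = H"
    using LIMSEQ_unique[OF entropy_limit_value[OF b(2,3)] seqH[OF b(1,2)]] .
  ultimately show "U = W"
    using jump[OF limit_in_ball[OF a(2,3)] limit_in_ball[OF b(2,3)]
        Rankine_Hugoniot_limits[OF a(2,3) b(2,3)] strip_le[OF x]] by auto
qed

definition Rt where "Rt x = (SOME U. U \<in> cball Vbar \<epsilon> \<and> (V \<longlongrightarrow> U) (at_right x))"
definition Lt where "Lt x = (SOME U. U \<in> cball Vbar \<epsilon> \<and> (V \<longlongrightarrow> U) (at_left x))"

lemma Rt: assumes "x \<in> strip i" shows "Rt x \<in> cball Vbar \<epsilon>" "(V \<longlongrightarrow> Rt x) (at_right x)"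
proof -
  have "\<exists>U. U \<in> cball Vbar \<epsilon> \<and> (V \<longlongrightarrow> U) (at_right x)"
    using limit_exists[OF assms, of "{x<..}"] by blast
  from someI_ex[OF this] show "Rt x \<in> cball Vbar \<epsilon>" "(V \<longlongrightarrow> Rt x) (at_right x)"
    unfolding Rt_def by auto
qed

lemma Lt: assumes "x \<in> strip i" shows "Lt x \<in> cball Vbar \<epsilon>" "(V \<longlongrightarrow> Lt x) (at_left x)"
proof -
  have "\<exists>U. U \<in> cball Vbar \<epsilon> \<and> (V \<longlongrightarrow> U) (at_left x)"
    using limit_exists[OF assms, of "{..<x}"] by blast
  from someI_ex[OF this] show "Lt x \<in> cball Vbar \<epsilon>" "(V \<longlongrightarrow> Lt x) (at_left x)"
    unfolding Lt_def by auto
qed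

text \<open>The entropy inequality fixes the sign of the jump in the \<open>i\<close>-th coordinate, and the Lax condition turns that
  sign into an ordering of the speeds.\<close>
lemma continuous_or_shock:
  assumes x: "x \<in> strip i"
  shows "(Lt x = V x \<and> Rt x = V x) \<or> (speed i (Rt x) < x \<and> x < speed i (Lt x) \<and>
    curv i * (l i \<bullet> (Rt x - Lt x)) < 0 \<and> f (Rt x) - f (Lt x) = x *\<^sub>R (Rt x - Lt x))"
proof -
  obtain a where a: "\<And>n. a n \<in> {..<x} - {x}" "a \<longlonglongrightarrow> x" "(\<lambda>n. V (a n)) \<longlonglongrightarrow> Lt x"
    using filter_limit_sequence[OF Lt(2)[OF x] one_sided_nontrivial(2)] by metis
  obtain b where b: "\<And>n. b n \<in> {x<..} - {x}" "b \<longlonglongrightarrow> x" "(\<lambda>n. V (b n)) \<longlonglongrightarrow> Rt x"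
    using filter_limit_sequence[OF Rt(2)[OF x] one_sided_nontrivial(1)] by metis
  have xx: "(\<lambda>n. x) \<longlonglongrightarrow> x" "(\<lambda>n. V x) \<longlonglongrightarrow> V x" by auto
  have ax: "a n < x" and xb: "x < b n" for n using a(1)[of n] b(1)[of n] by auto
  then have ab: "a n < b n" for n using less_trans by blast
  have Q: "q (Rt x) - x * e (Rt x) \<le> q (Lt x) - x * e (Lt x)"
    "q (V x) - x * e (V x) \<le> q (Lt x) - x * e (Lt x)" "q (Rt x) - x * e (Rt x) \<le> q (V x) - x * e (V x)"
    using entropy_limit_le[OF a(2,3) b(2,3) ab] entropy_limit_le[OF a(2,3) xx ax] entropy_limit_le[OF xx b(2,3) xb] .
  have RH: "f (Rt x) - f (Lt x) = x *\<^sub>R (Rt x - Lt x)" "f (Lt x) - f (Rt x) = x *\<^sub>R (Lt x - Rt x)"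
    "f (V x) - f (Lt x) = x *\<^sub>R (V x - Lt x)"
    using Rankine_Hugoniot_limits[OF b(2,3) a(2,3)] Rankine_Hugoniot_limits[OF a(2,3) b(2,3)]
      Rankine_Hugoniot_limits[OF xx a(2,3)] .
  note xs = strip_le[OF x]
  show ?thesis
  proof (cases "Lt x = Rt x")
    case True
    then have "V x = Lt x"
      using jump[OF V_ball Lt(1)[OF x] RH(3) xs] Q by auto
    with True show ?thesis by simp
  next
    case False
    have "0 < ((q (Rt x) - x * e (Rt x)) - (q (Lt x) - x * e (Lt x))) * (curv i * (l i \<bullet> (Rt x - Lt x)))"
      using jump[OF Rt(1)[OF x] Lt(1)[OF x] RH(1) xs] False by auto
    then have neg: "curv i * (l i \<bullet> (Rt x - Lt x)) < 0"
      using Q(1) by (smt (verit) mult_nonpos_nonneg)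
    have "0 < (x - speed i (Lt x)) * (curv i * (l i \<bullet> (Rt x - Lt x)))"
      using lax[OF Rt(1)[OF x] Lt(1)[OF x] RH(1) xs] False by auto
    then have 1: "x < speed i (Lt x)"
      using neg unfolding zero_less_mult_iff[of "x - speed i (Lt x)"] by linarith
    have "0 < (x - speed i (Rt x)) * (curv i * (l i \<bullet> (Lt x - Rt x)))"
      using lax[OF Lt(1)[OF x] Rt(1)[OF x] RH(2) xs False] .
    moreover have "curv i * (l i \<bullet> (Lt x - Rt x)) > 0" using neg by (simp add: inner_diff_right algebra_simps)
    ultimately have "speed i (Rt x) < x" by (simp add: zero_less_mult_iff)
    then show ?thesis using 1 neg RH(1) by blast
  qed
qed

text \<open>After a shock the state is slower than its position. Hence it is locally constant, and at a first point of change
  the limit from the left would still be slower, which rules out another shock there.\<close>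
lemma constant_to_right:
  assumes x: "x \<in> strip i" and lt: "speed i (Rt x) < x" and y: "y \<in> strip i" "x < y"
  shows "V y = Rt x"
proof (rule ccontr)
  assume ne: "V y \<noteq> Rt x"
  let ?T = "{t. x < t \<and> V t \<noteq> Rt x}"
  define Y where "Y = Inf ?T"
  have bdd: "bdd_below ?T" by (rule bdd_belowI[of _ x]) auto
  have Yy: "Y \<le> y" unfolding Y_def using ne y bdd by (intro cInf_lower) auto
  have before: "V s = Rt x" if "x < s" "s < Y" for s
    using that cInf_lower[OF _ bdd, of s] unfolding Y_def by force
  obtain d where d: "d > 0" "\<forall>s\<in>{x<..}. \<bar>s - x\<bar> < d \<longrightarrow> V s = Rt x"
    using locally_constant[OF convex_real_interval(3) one_sided_nontrivial(1) Rt(2)[OF x] _ strip_le[OF x]] lt by auto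
  have "x + d \<le> Y"
    unfolding Y_def using ne y d(2) by (intro cInf_greatest) force+
  then have xY: "x < Y" using d by simp
  have Ys: "Y \<in> strip i" using strip_between[OF x y(1)] xY Yy by simp
  have "(V \<longlongrightarrow> Rt x) (at_left Y)"
    by (rule tendsto_eventually) (auto simp: eventually_at_left_field intro!: exI[of _ x] xY before)
  then have LtY: "Lt Y = Rt x"
    using tendsto_unique[OF one_sided_nontrivial(2) Lt(2)[OF Ys]] by blast
  then have YV: "V Y = Rt x" "Rt Y = Rt x"
    using continuous_or_shock[OF Ys] lt xY by auto
  obtain d' where d': "d' > 0" "\<forall>s\<in>{Y<..}. \<bar>s - Y\<bar> < d' \<longrightarrow> V s = Rt Y"
    using locally_constant[OF convex_real_interval(3) one_sided_nontrivial(1) Rt(2)[OF Ys] _ strip_le[OF Ys]] lt xY YV by auto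
  have "Y + d' \<le> Inf ?T"
  proof (rule cInf_greatest)
    show "?T \<noteq> {}" using ne y by auto
    fix t assume t: "t \<in> ?T"
    show "Y + d' \<le> t"
    proof (rule ccontr)
      assume "\<not> ?thesis"
      then have "V t = Rt x"
        using before[of t] YV d'(2) t by (cases t Y rule: linorder_cases) auto
      with t show False by simp
    qed
  qed
  with d' show False by (simp add: Y_def)
qed

lemma constant_to_left:
  assumes x: "x \<in> strip i" and lt: "x < speed i (Lt x)" and y: "y \<in> strip i" "y < x"
  shows "V y = Lt x"
proof (rule ccontr)
  assume ne: "V y \<noteq> Lt x"
  let ?T = "{t. t < x \<and> V t \<noteq> Lt x}"
  define Y where "Y = Sup ?T"
  have bdd: "bdd_above ?T" by (rule bdd_aboveI[of _ x]) auto
  have Yy: "y \<le> Y" unfolding Y_def using ne y bdd by (intro cSup_upper) auto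
  have before: "V s = Lt x" if "s < x" "Y < s" for s
    using that cSup_upper[OF _ bdd, of s] unfolding Y_def by force
  obtain d where d: "d > 0" "\<forall>s\<in>{..<x}. \<bar>s - x\<bar> < d \<longrightarrow> V s = Lt x"
    using locally_constant[OF convex_real_interval(4) one_sided_nontrivial(2) Lt(2)[OF x] _ strip_le[OF x]] lt by auto
  have "Y \<le> x - d"
    unfolding Y_def using ne y d(2) by (intro cSup_least) force+
  then have xY: "Y < x" using d by simp
  have Ys: "Y \<in> strip i" using strip_between[OF y(1) x] xY Yy by simp
  have "(V \<longlongrightarrow> Lt x) (at_right Y)"
    by (rule tendsto_eventually) (auto simp: eventually_at_right_field intro!: exI[of _ x] xY before)
  then have RtY: "Rt Y = Lt x"
    using tendsto_unique[OF one_sided_nontrivial(1) Rt(2)[OF Ys]] by blast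
  then have YV: "V Y = Lt x" "Lt Y = Lt x"
    using continuous_or_shock[OF Ys] lt xY by auto
  obtain d' where d': "d' > 0" "\<forall>s\<in>{..<Y}. \<bar>s - Y\<bar> < d' \<longrightarrow> V s = Lt Y"
    using locally_constant[OF convex_real_interval(4) one_sided_nontrivial(2) Lt(2)[OF Ys] _ strip_le[OF Ys]] lt xY YV by auto
  have "Sup ?T \<le> Y - d'"
  proof (rule cSup_least)
    show "?T \<noteq> {}" using ne y by auto
    fix t assume t: "t \<in> ?T"
    show "t \<le> Y - d'"
    proof (rule ccontr)
      assume "\<not> ?thesis"
      then have "V t = Lt x"
        using before[of t] YV d'(2) t by (cases t Y rule: linorder_cases) auto
      with t show False by simp
    qed
  qed
  with d' show False by (simp add: Y_def)
qed

theorem sector_structure: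
  "(\<exists>\<sigma>. jump_at i \<sigma> \<and> curv i * (l i \<bullet> (right_state i - left_state i)) < 0) \<or> (\<exists>a b. fan i a b) \<or>
    (\<forall>s\<in>strip i. V s = left_state i)"
proof (cases "\<exists>x\<in>strip i. \<not> (Lt x = V x \<and> Rt x = V x)")
  case True
  then obtain x where x: "x \<in> strip i" and shock: "speed i (Rt x) < x" "x < speed i (Lt x)"
    "curv i * (l i \<bullet> (Rt x - Lt x)) < 0" "f (Rt x) - f (Lt x) = x *\<^sub>R (Rt x - Lt x)"
    using continuous_or_shock by blast
  have xl: "\<bar>x - lam i\<bar> < \<delta>"
    using shock(1,2) speed_near[OF Rt(1)[OF x], of i] speed_near[OF Lt(1)[OF x], of i] by auto
  then have "lam i - \<delta> < x" "x < lam i + \<delta>" by auto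
  then have st: "left_state i = Lt x" "right_state i = Rt x"
    using constant_to_left[OF x shock(2) ends_in_strip(1)] constant_to_right[OF x shock(1) ends_in_strip(2)]
    by (simp_all add: left_state_def right_state_def)
  have "jump_at i x"
    unfolding jump_at_def st using xl shock(4) constant_to_left[OF x shock(2)] constant_to_right[OF x shock(1)] by blast
  then show ?thesis using shock(3) st by auto
next
  case False
  then have cont: "Lt x = V x" "Rt x = V x" if "x \<in> strip i" for x using that by auto
  have lims: "(V \<longlongrightarrow> V x) (at_right x)" "(V \<longlongrightarrow> V x) (at_left x)" if "x \<in> strip i" for x
    using Rt(2)[OF that] Lt(2)[OF that] cont[OF that] by auto
  have isC: "isCont V x" if "x \<in> strip i" for x
    using lims[OF that] by (simp add: isCont_def filterlim_split_at)
  let ?Z = "{x \<in> strip i. speed i (V x) = x}"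
  show ?thesis
  proof (cases "?Z = {}")
    case True
    have "V s = left_state i" if "s \<in> strip i" for s
      unfolding left_state_def
    proof (rule constant_on_if_locally[of "strip i", OF _ _ that ends_in_strip(1)])
      show "convex (strip i)" by (simp add: strip_def)
      show "\<exists>d>0. \<forall>s. \<bar>s - x\<bar> < d \<longrightarrow> V s = V x" if "x \<in> strip i" for x
        using locally_constant_around[OF that lims[OF that]] True that by blast
    qed
    then show ?thesis by blast
  next
    case False
    have Zsub: "\<bar>x - lam i\<bar> < \<delta>" if "x \<in> ?Z" for x
      using speed_near[OF V_ball[of x], of i] that by auto
    have ZIcc: "?Z = {x \<in> {lam i - \<delta>..lam i + \<delta>}. speed i (V x) - x = 0}"
      using Zsub \<delta>_pos by (force simp: strip_def)
    have sc: "continuous_on {lam i - \<delta>..lam i + \<delta>} V"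
      using isC \<delta>_pos by (intro continuous_at_imp_continuous_on) (auto simp: strip_def)
    have "(K * L)-lipschitz_on B (speed i)"
      using speed_Lipschitz KL_nonneg by (auto simp: lipschitz_on_def dist_norm)
    then have "continuous_on B (speed i)" by (rule lipschitz_on_continuous_on)
    then have "continuous_on {lam i - \<delta>..lam i + \<delta>} (\<lambda>x. speed i (V x))"
      using sc by (rule continuous_on_compose2) auto
    then have "continuous_on {lam i - \<delta>..lam i + \<delta>} (\<lambda>x. speed i (V x) - x)"
      by (intro continuous_intros)
    then have "closed ?Z"
      unfolding ZIcc by (intro continuous_closed_preimage_constant) auto
    moreover have "bounded ?Z"
      unfolding ZIcc by (rule bounded_subset[OF bounded_closed_interval]) auto
    ultimately have comp: "compact ?Z" by (simp add: compact_eq_bounded_closed)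
    obtain a where a: "a \<in> ?Z" "\<And>x. x \<in> ?Z \<Longrightarrow> a \<le> x"
      using compact_attains_inf[OF comp False] by blast
    obtain b where b: "b \<in> ?Z" "\<And>x. x \<in> ?Z \<Longrightarrow> x \<le> b"
      using compact_attains_sup[OF comp False] by blast
    have ab: "a \<le> b" using a b by auto
    have right: "V y = V s" if "s \<in> strip i" "y \<in> strip i" "s < y" "speed i (V s) < s" for s y
      using constant_to_right[OF that(1) _ that(2,3)] cont[OF that(1)] that(4) by simp
    have left: "V y = V s" if "s \<in> strip i" "y \<in> strip i" "y < s" "s < speed i (V s)" for s y
      using constant_to_left[OF that(1) _ that(2,3)] cont[OF that(1)] that(4) by simp
    have mid: "speed i (V s) = s" if s: "s \<in> {a..b}" for s
    proof -
      have ss: "s \<in> strip i" using strip_between[of a i b s] a b s by auto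
      have "\<not> speed i (V s) < s"
        using right[OF ss, of b] b(1) s by (cases "s = b") auto
      moreover have "\<not> s < speed i (V s)"
        using left[OF ss, of a] a(1) s by (cases "s = a") auto
      ultimately show ?thesis by simp
    qed
    have lo: "s < speed i (V s)" if "s \<in> strip i" "s < a" for s
      using right[OF that(1), of a] a that by (cases "speed i (V s)" s rule: linorder_cases) force+
    have hi: "speed i (V s) < s" if "s \<in> strip i" "b < s" for s
      using left[OF that(1), of b] b that by (cases "speed i (V s)" s rule: linorder_cases) force+
    have Va: "V s = V a" if s: "s \<in> strip i" "s \<le> a" for s
    proof (cases "s = a")
      case False
      with s have sa: "s < a" by simp
      have as: "a \<in> strip i" using a by simp
      have "(V \<longlongrightarrow> V s) (at_left a)"
      proof (rule tendsto_eventually)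
        have "V t = V s" if "s < t" "t < a" for t
        proof -
          have ts: "t \<in> strip i" using strip_between[OF s(1) as] that by simp
          show ?thesis using left[OF ts s(1) that(1) lo[OF ts that(2)]] by simp
        qed
        then show "\<forall>\<^sub>F t in at_left a. V t = V s"
          using sa by (auto simp: eventually_at_left_field)
      qed
      then show ?thesis using tendsto_unique[OF one_sided_nontrivial(2) lims(2)[OF as]] by auto
    qed simp
    have Vb: "V s = V b" if s: "s \<in> strip i" "b \<le> s" for s
    proof (cases "s = b")
      case False
      with s have sb: "b < s" by simp
      have bs: "b \<in> strip i" using b by simp
      have "(V \<longlongrightarrow> V s) (at_right b)"
      proof (rule tendsto_eventually)
        have "V t = V s" if "b < t" "t < s" for t
        proof -
          have ts: "t \<in> strip i" using strip_between[OF bs s(1)] that by simp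
          show ?thesis using right[OF ts s(1) that(2) hi[OF ts that(1)]] by simp
        qed
        then show "\<forall>\<^sub>F t in at_right b. V t = V s"
          using sb by (auto simp: eventually_at_right_field)
      qed
      then show ?thesis using tendsto_unique[OF one_sided_nontrivial(1) lims(1)[OF bs]] by auto
    qed simp
    have "lam i - \<delta> \<le> a" "b \<le> lam i + \<delta>" using Zsub[OF a(1)] Zsub[OF b(1)] by auto
    then have st: "left_state i = V a" "right_state i = V b"
      using Va[OF ends_in_strip(1)] Vb[OF ends_in_strip(2)] by (simp_all add: left_state_def right_state_def)
    have "continuous_on {a..b} V"
      by (rule continuous_on_subset[OF sc]) (use Zsub[OF a(1)] Zsub[OF b(1)] in auto)
    then have "fan i a b"
      unfolding fan_def st using ab Zsub[OF a(1)] Zsub[OF b(1)] Va Vb mid by blast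
    then show ?thesis by blast
  qed
qed

end

locale contact_profile = riemann_profile A0 lam r l \<delta> \<eta> f J J' Vbar \<rho> L e q g g' c \<epsilon> V M
  for A0 :: "real^'m^'m" and lam r l \<delta> \<eta> f J J' Vbar \<rho> L e q g g' c \<epsilon> V M +
  fixes i :: 'm
  assumes lindeg: "lindeg i"
    and contact: "\<lbrakk>U \<in> cball Vbar \<epsilon>; W \<in> cball Vbar \<epsilon>; f U - f W = \<sigma> *\<^sub>R (U - W); \<bar>\<sigma> - lam i\<bar> \<le> 2 * \<delta>; U \<noteq> W\<rbrakk>
     \<Longrightarrow> speed i U = \<sigma> \<and> speed i W = \<sigma>"
    and \<epsilon>_contact: "\<epsilon> \<le> \<rho> / 4" "2 * K * K * \<epsilon> \<le> \<rho> / 4" "K * L * K * (2 * \<epsilon> + 2 * \<epsilon> * K * K) < 1"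
begin

lemma limit_speed:
  assumes "x \<in> strip i" "a \<longlonglongrightarrow> x" "(\<lambda>n. V (a n)) \<longlonglongrightarrow> U"
  shows "U = V x \<or> (speed i U = x \<and> speed i (V x) = x)"
  using contact[OF limit_in_ball[OF assms(2,3)] V_ball Rankine_Hugoniot_limit[OF assms(2,3)] strip_le[OF assms(1)]]
  by blast

lemma continuous_off_sonic:
  assumes x: "x \<in> strip i" and ne: "speed i (V x) \<noteq> x" and I: "I = {x<..} \<or> I = {..<x}"
  shows "(V \<longlongrightarrow> V x) (at x within I)"
proof -
  have nt: "at x within I \<noteq> bot" using I one_sided_nontrivial by blast
  have eq: "U = V x" if "a \<longlonglongrightarrow> x" "(\<lambda>n. V (a n)) \<longlonglongrightarrow> U" for a U
    using limit_speed[OF x that] ne by blast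
  have "\<exists>U\<in>cball Vbar \<epsilon>. (V \<longlongrightarrow> U) (at x within I)"
    by (rule compact_limit_exists[OF compact_cball V_ball nt]) (use eq in blast)
  then obtain U where U: "(V \<longlongrightarrow> U) (at x within I)" by blast
  obtain a where "a \<longlonglongrightarrow> x" "(\<lambda>n. V (a n)) \<longlonglongrightarrow> U"
    using filter_limit_sequence[OF U nt] by metis
  then show ?thesis using eq U by blast
qed

lemma locally_constant_off_sonic:
  assumes "x \<in> strip i" "speed i (V x) \<noteq> x"
  shows "\<exists>d>0. \<forall>s. \<bar>s - x\<bar> < d \<longrightarrow> V s = V x"
  using locally_constant_around[OF assms(1) _ _ assms(2)] continuous_off_sonic[OF assms] by blast

text \<open>Along a contact curve the speed does not change. Comparing \<open>V y\<close> with the state \<open>R\<close> on the contact curve through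
  \<open>V x\<close> that has the same \<open>i\<close>-th coordinate shows that the speed changes from \<open>x\<close> to \<open>y\<close> by less than \<open>y - x\<close>.\<close>
lemma sonic_unique:
  assumes a: "a \<in> strip i" "speed i (V a) = a" and b: "b \<in> strip i" "speed i (V b) = b"
  shows "a = b"
proof (rule ccontr)
  assume "a \<noteq> b"
  have "speed i (V x) \<noteq> x \<or> speed i (V y) \<noteq> y" if xy: "x \<in> strip i" "y \<in> strip i" "x < y" for x y
  proof (rule ccontr)
    assume "\<not> ?thesis"
    then have s: "speed i (V x) = x" "speed i (V y) = y" by auto
    define u where "u = l i \<bullet> (V y - V x)"
    have u: "\<bar>u\<bar> \<le> K * (2 * \<epsilon>)"
      unfolding u_def using norm_inner_l[of i "V y - V x"] V_diff[of y x] K_ge(1) by (smt (verit) mult_left_mono)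
    have "\<bar>u\<bar> * K \<le> K * (2 * \<epsilon>) * K" using u K_ge(1) by (intro mult_right_mono) auto
    then have uK: "\<bar>u\<bar> * K \<le> 2 * K * K * \<epsilon>" "\<bar>u\<bar> * K \<le> \<rho> / 4" using \<epsilon>_contact(2) by (simp_all add: algebra_simps)
    have Vx4: "V x \<in> cball Vbar (\<rho> / 4)" using V_ball[of x] \<epsilon>_contact(1) by auto
    obtain R where R: "R \<in> cball Vbar (\<rho> / 2)" "l i \<bullet> (R - V x) = u" "speed i R = speed i (V x)"
      "f R - f (V x) = speed i (V x) *\<^sub>R (R - V x)"
      using contact_curve[OF lindeg Vx4 uK(2)] by metis
    have RB: "R \<in> B" using R(1) \<rho>_pos by auto
    have nR: "norm (R - V x) \<le> 2 * K * K * \<epsilon>"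
    proof (cases "R = V x")
      case True
      then show ?thesis using K_ge(1) \<epsilon>_bounds by simp
    next
      case False
      have "R - V x = u *\<^sub>R rv i (avg R (V x))"
        using Rankine_Hugoniot_direction(2)[OF RB V_B R(4) _ False, of i] R(2,3) s(1) strip_le[OF xy(1)] by simp
      then have "norm (R - V x) = \<bar>u\<bar> * norm (rv i (avg R (V x)))" by simp
      also have "\<dots> \<le> \<bar>u\<bar> * K"
        using norm_rv_le[OF avg_near[OF RB V_B], of i] K_ge(4) by (intro mult_left_mono) (auto intro: order_trans)
      finally show ?thesis using uK(1) by linarith
    qed
    have "f (V y) - f R - y *\<^sub>R (V y - R) = (f (V y) - f (V x) - y *\<^sub>R (V y - V x)) + (y - x) *\<^sub>R (R - V x)"
      using R(4) s(1) by (simp add: algebra_simps)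
    then have "norm (f (V y) - f R - y *\<^sub>R (V y - R)) \<le> norm (f (V y) - f (V x) - y *\<^sub>R (V y - V x)) + norm ((y - x) *\<^sub>R (R - V x))"
      by (metis norm_triangle_ineq)
    also have "\<dots> \<le> 2 * \<epsilon> * \<bar>y - x\<bar> + \<bar>y - x\<bar> * (2 * K * K * \<epsilon>)"
      using V_eq[of y x "2 * \<epsilon>"] V_diff nR by (intro add_mono) (auto intro!: mult_left_mono)
    also have "\<dots> = (2 * \<epsilon> + 2 * \<epsilon> * K * K) * (y - x)" using xy by (simp add: algebra_simps)
    finally have 1: "norm (f (V y) - f R - y *\<^sub>R (V y - R)) \<le> (2 * \<epsilon> + 2 * \<epsilon> * K * K) * (y - x)" .
    have "l i \<bullet> (V y - R) = 0"
      using R(2) by (simp add: u_def inner_diff_right)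
    then have "norm (V y - R) \<le> K * norm (f (V y) - f R - y *\<^sub>R (V y - R))"
      using sector[OF avg_near[OF V_B RB] strip_le[OF xy(2)], of "V y - R"] by (simp add: avg_diff[OF V_B RB])
    also have "\<dots> \<le> K * ((2 * \<epsilon> + 2 * \<epsilon> * K * K) * (y - x))"
      using 1 K_ge(1) by (intro mult_left_mono) auto
    finally have 2: "norm (V y - R) \<le> K * ((2 * \<epsilon> + 2 * \<epsilon> * K * K) * (y - x))" .
    have "y - x \<le> K * L * norm (V y - R)"
      using speed_Lipschitz[OF V_B[of y] RB, of i] R(3) s by simp
    also have "\<dots> \<le> K * L * (K * ((2 * \<epsilon> + 2 * \<epsilon> * K * K) * (y - x)))"
      using 2 KL_nonneg by (intro mult_left_mono) auto
    also have "\<dots> = (K * L * K * (2 * \<epsilon> + 2 * \<epsilon> * K * K)) * (y - x)" by simp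
    also have "\<dots> < 1 * (y - x)"
      using \<epsilon>_contact(3) xy(3) by (intro mult_strict_right_mono) auto
    finally show False by simp
  qed
  note two = this
  then show False
    using a b \<open>a \<noteq> b\<close> by (metis linorder_neqE)
qed

theorem sector_structure: "\<exists>\<sigma>. jump_at i \<sigma>"
proof (cases "\<exists>x\<in>strip i. speed i (V x) = x")
  case False
  have conv: "convex (strip i)" by (simp add: strip_def)
  have eq: "V s = V t" if "s \<in> strip i" "t \<in> strip i" for s t
    by (rule constant_on_if_locally[OF conv _ that]) (use locally_constant_off_sonic False in blast)
  then have "right_state i = left_state i"
    using ends_in_strip by (simp add: left_state_def right_state_def)
  then have "jump_at i (lam i)"
    unfolding jump_at_def using eq[OF _ ends_in_strip(1)] \<delta>_pos by (simp add: left_state_def)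
  then show ?thesis by blast
next
  case True
  then obtain x where x: "x \<in> strip i" "speed i (V x) = x" by blast
  then have off: "speed i (V s) \<noteq> s" if "s \<in> strip i" "s \<noteq> x" for s
    using sonic_unique that by blast
  have xl: "\<bar>x - lam i\<bar> < \<delta>" using speed_near[OF V_ball[of x], of i] x by simp
  have L: "V s = left_state i" if "s \<in> strip i" "s < x" for s
    unfolding left_state_def
  proof (rule constant_on_if_locally[of "strip i \<inter> {..<x}"])
    show "convex (strip i \<inter> {..<x})" by (simp add: strip_def convex_Int)
    show "lam i - \<delta> \<in> strip i \<inter> {..<x}" "s \<in> strip i \<inter> {..<x}"
      using that xl ends_in_strip by auto
  qed (use locally_constant_off_sonic off in blast)
  have R: "V s = right_state i" if "s \<in> strip i" "x < s" for s
    unfolding right_state_def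
  proof (rule constant_on_if_locally[of "strip i \<inter> {x<..}"])
    show "convex (strip i \<inter> {x<..})" by (simp add: strip_def convex_Int)
    show "lam i + \<delta> \<in> strip i \<inter> {x<..}" "s \<in> strip i \<inter> {x<..}"
      using that xl ends_in_strip by auto
  qed (use locally_constant_off_sonic off in blast)
  have "\<forall>\<^sub>F t in at_left x. V t = left_state i"
    unfolding eventually_at_left_field using xl \<delta>_pos L
    by (intro exI[of _ "lam i - \<delta>"]) (auto simp: strip_def)
  then have "(V \<longlongrightarrow> left_state i) (at_left x)" by (rule tendsto_eventually)
  then obtain a where a: "a \<longlonglongrightarrow> x" "(\<lambda>n. V (a n)) \<longlonglongrightarrow> left_state i"
    using filter_limit_sequence[OF _ one_sided_nontrivial(2)] by metis
  have "\<forall>\<^sub>F t in at_right x. V t = right_state i"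
    unfolding eventually_at_right_field using xl \<delta>_pos R
    by (intro exI[of _ "lam i + \<delta>"]) (auto simp: strip_def)
  then have "(V \<longlongrightarrow> right_state i) (at_right x)" by (rule tendsto_eventually)
  then obtain b where b: "b \<longlonglongrightarrow> x" "(\<lambda>n. V (b n)) \<longlonglongrightarrow> right_state i"
    using filter_limit_sequence[OF _ one_sided_nontrivial(1)] by metis
  have "jump_at i x"
    unfolding jump_at_def using xl L R Rankine_Hugoniot_limits[OF b a] by blast
  then show ?thesis by blast
qed

end

section \<open>Comparison of two waves of the same family\<close>

lemma vector_derivative_norm_bound:
  fixes F :: "real \<Rightarrow> 'a::real_normed_vector"
  assumes "a \<le> b" and "\<And>t. t \<in> {a..b} \<Longrightarrow> (F has_vector_derivative F' t) (at t within {a..b})"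
    and "\<And>t. t \<in> {a..b} \<Longrightarrow> norm (F' t) \<le> C"
  shows "norm (F b - F a) \<le> C * (b - a)"
proof -
  have "norm (F b - F a) \<le> C * norm (b - a)"
  proof (rule differentiable_bound[of "{a..b}" F "\<lambda>t h. h *\<^sub>R F' t"])
    show "onorm (\<lambda>h. h *\<^sub>R F' t) \<le> C" if "t \<in> {a..b}" for t
    proof (rule onorm_le)
      show "norm (h *\<^sub>R F' t) \<le> C * norm h" for h
        using mult_left_mono[OF assms(3)[OF that], of "\<bar>h\<bar>"] by (simp add: mult.commute)
    qed
  qed (use assms in \<open>auto simp: has_vector_derivative_def\<close>)
  then show ?thesis using assms(1) by simp
qed

context flux
begin

lemma N_diff: "N i (x - y) = N i x - N i y"
  by (simp add: N_def inner_diff_right algebra_simps)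

lemma N_scale: "N i (t *\<^sub>R x) = t *\<^sub>R N i x"
  by (simp add: N_def algebra_simps)

lemma N_normalised: "l i \<bullet> v = 1 \<Longrightarrow> N i v = v - r i"
  by (simp add: N_def)

lemma N_kernel: "l i \<bullet> v = 0 \<Longrightarrow> N i v = v"
  by (simp add: N_def)

text \<open>Of a shock only the direction of the jump is recorded; the sign of its strength is added where it matters.\<close>
definition shock_pair where
  "shock_pair i \<epsilon> U0 U1 \<longleftrightarrow> U0 \<in> cball Vbar \<epsilon> \<and> U1 \<in> cball Vbar \<epsilon> \<and>
    U1 - U0 = (l i \<bullet> (U1 - U0)) *\<^sub>R rv i (avg U1 U0)"

text \<open>An integral curve of the \<open>i\<close>-th eigenvector field, parametrised by the \<open>l i\<close>-component. The bound on \<open>T\<close> is the largest change of that component within the ball.\<close>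
definition fan_curve where
  "fan_curve i \<epsilon> sg T \<Gamma> \<longleftrightarrow> 0 \<le> T \<and> T \<le> 2 * K * \<epsilon> \<and> \<bar>sg\<bar> = (1::real) \<and>
    (\<forall>\<tau>\<in>{0..T}. \<Gamma> \<tau> \<in> cball Vbar \<epsilon> \<and> (\<Gamma> has_vector_derivative sg *\<^sub>R dir i (\<Gamma> \<tau>)) (at \<tau> within {0..T}))"

lemma rv_avg_near:
  assumes "U \<in> cball Vbar \<epsilon>" "W \<in> cball Vbar \<epsilon>" "\<epsilon> \<le> \<rho>"
  shows "norm (rv i (avg U W) - r i) \<le> 2 * (K * L * \<epsilon>)"
proof -
  have B: "U \<in> B" "W \<in> B" using assms by auto
  have "norm (rv i (avg U W) - rv i (avg Vbar Vbar)) \<le> K * L * (norm (U - Vbar) + norm (W - Vbar))"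
    by (rule avg_dir_Lipschitz[OF B center center])
  also have "\<dots> \<le> K * L * (\<epsilon> + \<epsilon>)"
    using norm_vector_minus_le assms KL_nonneg by (intro mult_left_mono add_mono) auto
  finally show ?thesis by (simp add: avg_same J_center at_A0)
qed

lemma dir_near:
  assumes "X \<in> cball Vbar \<epsilon>" "\<epsilon> \<le> \<rho>"
  shows "norm (dir i X - r i) \<le> K * L * \<epsilon>"
proof -
  have B: "X \<in> B" using assms by auto
  have "norm (dir i X - dir i Vbar) \<le> K * L * norm (X - Vbar)"
    by (rule dir_Lipschitz[OF B center])
  also have "\<dots> \<le> K * L * \<epsilon>"
    using norm_vector_minus_le assms KL_nonneg by (intro mult_left_mono) auto
  finally show ?thesis by (simp add: at_center)
qed

lemma l_rv_avg: "U \<in> B \<Longrightarrow> W \<in> B \<Longrightarrow> l i \<bullet> rv i (avg U W) = 1"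
  by (intro rv(2) avg_near)

lemma shock_cone:
  assumes S: "shock_pair i \<epsilon> U0 U1" and \<epsilon>: "\<epsilon> \<le> \<rho>"
  shows "norm (N i (U1 - U0)) \<le> \<bar>l i \<bullet> (U1 - U0)\<bar> * (2 * (K * L * \<epsilon>))"
proof -
  let ?u = "l i \<bullet> (U1 - U0)" and ?v = "rv i (avg U1 U0)"
  have b: "U0 \<in> cball Vbar \<epsilon>" "U1 \<in> cball Vbar \<epsilon>" and eq: "U1 - U0 = ?u *\<^sub>R ?v"
    using S by (auto simp: shock_pair_def)
  have B: "U0 \<in> B" "U1 \<in> B" using b \<epsilon> by auto
  have "N i (U1 - U0) = ?u *\<^sub>R (?v - r i)"
    by (subst eq) (simp only: N_scale N_normalised[OF l_rv_avg[OF B(2,1)]])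
  then show ?thesis
    using rv_avg_near[OF b(2,1) \<epsilon>, of i] by (simp add: mult_left_mono)
qed

text \<open>Two waves of the same family with nearby left states differ, up to a small error, by a multiple of \<open>r i\<close>: the
  component along \<open>r i\<close> measures the difference in strength, and the directions depend on the states in a Lipschitz way.
  The following estimates say the same for two fans and for a shock and a fan; in the last case the strengths have
  opposite signs and add up.\<close>
lemma shock_shock_cone:
  assumes S: "shock_pair i \<epsilon> U0 U1" and S': "shock_pair i \<epsilon> W0 W1" and \<epsilon>: "\<epsilon> \<le> \<rho>" "0 < \<epsilon>"
  shows "norm (N i ((U1 - U0) - (W1 - W0)))
    \<le> 4 * K * (K * L * \<epsilon>) * (norm ((U1 - U0) - (W1 - W0)) + norm (U0 - W0))"
proof -
  let ?d = "U1 - U0" and ?d' = "W1 - W0"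
  let ?u = "l i \<bullet> ?d" and ?u' = "l i \<bullet> ?d'"
  let ?v = "rv i (avg U1 U0)" and ?v' = "rv i (avg W1 W0)"
  have b: "U0 \<in> cball Vbar \<epsilon>" "U1 \<in> cball Vbar \<epsilon>" "W0 \<in> cball Vbar \<epsilon>" "W1 \<in> cball Vbar \<epsilon>"
    and eq: "?d = ?u *\<^sub>R ?v" "?d' = ?u' *\<^sub>R ?v'"
    using S S' by (auto simp: shock_pair_def)
  have B: "U0 \<in> B" "U1 \<in> B" "W0 \<in> B" "W1 \<in> B" using b \<epsilon> by auto
  have nd: "N i ?d = ?u *\<^sub>R (?v - r i)" "N i ?d' = ?u' *\<^sub>R (?v' - r i)"
    by (subst eq, simp only: N_scale N_normalised[OF l_rv_avg] B)+
  have gen: "a *\<^sub>R (x - z) - b *\<^sub>R (y - z) = (a - b) *\<^sub>R (x - z) + b *\<^sub>R (x - y)"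
    for a b :: real and x y z :: "real^'m"
    by (simp add: algebra_simps)
  have "N i (?d - ?d') = (?u - ?u') *\<^sub>R (?v - r i) + ?u' *\<^sub>R (?v - ?v')"
    unfolding N_diff[of i ?d ?d'] nd by (rule gen)
  then have "norm (N i (?d - ?d')) \<le> \<bar>?u - ?u'\<bar> * norm (?v - r i) + \<bar>?u'\<bar> * norm (?v - ?v')"
    by (metis norm_scaleR norm_triangle_ineq)
  also have "\<dots> \<le> (K * norm (?d - ?d')) * (2 * (K * L * \<epsilon>)) + (K * (2 * \<epsilon>)) * (K * L * (norm (?d - ?d') + 2 * norm (U0 - W0)))"
  proof (intro add_mono mult_mono)
    show "\<bar>?u - ?u'\<bar> \<le> K * norm (?d - ?d')"
      using norm_inner_l[of i "?d - ?d'"] by (simp only: inner_diff_right)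
    show "norm (?v - r i) \<le> 2 * (K * L * \<epsilon>)" by (rule rv_avg_near[OF b(2,1) \<epsilon>(1)])
    have "norm ?d' \<le> 2 * \<epsilon>"
      using norm_vector_minus_le[OF b(3)] norm_vector_minus_le[OF b(4)] norm_triangle_ineq4[of "W1 - Vbar" "W0 - Vbar"] by simp
    then show "\<bar>?u'\<bar> \<le> K * (2 * \<epsilon>)"
      using norm_inner_l[of i ?d'] K_ge(1) by (smt (verit) mult_left_mono)
    have "norm (U1 - W1) \<le> norm (?d - ?d') + norm (U0 - W0)"
      using norm_triangle_ineq[of "?d - ?d'" "U0 - W0"] by simp
    then have "norm (U1 - W1) + norm (U0 - W0) \<le> norm (?d - ?d') + 2 * norm (U0 - W0)" by simp
    then have "K * L * (norm (U1 - W1) + norm (U0 - W0)) \<le> K * L * (norm (?d - ?d') + 2 * norm (U0 - W0))"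
      using KL_nonneg by (rule mult_left_mono)
    then show "norm (?v - ?v') \<le> K * L * (norm (?d - ?d') + 2 * norm (U0 - W0))"
      using avg_dir_Lipschitz[OF B(2,1,4,3), of i] by linarith
  qed (use K_ge(1) KL_nonneg \<epsilon> in auto)
  also have "\<dots> = 4 * K * (K * L * \<epsilon>) * (norm (?d - ?d') + norm (U0 - W0))"
    by (simp add: algebra_simps)
  finally show ?thesis .
qed

lemma fan_cone:
  assumes \<Gamma>: "fan_curve i \<epsilon> sg T \<Gamma>" and \<epsilon>: "\<epsilon> \<le> \<rho>" and st: "0 \<le> s" "s \<le> t" "t \<le> T"
  shows "l i \<bullet> (\<Gamma> t - \<Gamma> s) = sg * (t - s)" "norm (N i (\<Gamma> t - \<Gamma> s)) \<le> (K * L * \<epsilon>) * (t - s)"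
proof -
  have d: "(\<Gamma> has_vector_derivative sg *\<^sub>R dir i (\<Gamma> \<tau>)) (at \<tau> within {s..t})" "\<Gamma> \<tau> \<in> cball Vbar \<epsilon>"
    if "\<tau> \<in> {s..t}" for \<tau>
    using \<Gamma> st that by (auto simp: fan_curve_def intro: has_vector_derivative_within_subset[of _ _ _ "{0..T}"])
  have B: "\<Gamma> \<tau> \<in> B" if "\<tau> \<in> {s..t}" for \<tau> using d(2)[OF that] \<epsilon> by auto
  have "norm ((l i \<bullet> \<Gamma> t - sg * t) - (l i \<bullet> \<Gamma> s - sg * s)) \<le> 0 * (t - s)"
  proof (rule vector_derivative_norm_bound[OF st(2)])
    fix \<tau> assume \<tau>: "\<tau> \<in> {s..t}"
    have "((\<lambda>\<tau>. l i \<bullet> \<Gamma> \<tau>) has_vector_derivative (l i \<bullet> (sg *\<^sub>R dir i (\<Gamma> \<tau>)))) (at \<tau> within {s..t})"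
      by (rule bounded_linear.has_vector_derivative[OF bounded_linear_inner_right d(1)[OF \<tau>]])
    then have "((\<lambda>\<tau>. l i \<bullet> \<Gamma> \<tau> - sg * \<tau>) has_vector_derivative (l i \<bullet> (sg *\<^sub>R dir i (\<Gamma> \<tau>)) - sg * 1)) (at \<tau> within {s..t})"
      by (intro has_vector_derivative_diff has_vector_derivative_mult_right has_vector_derivative_id)
    then show "((\<lambda>\<tau>. l i \<bullet> \<Gamma> \<tau> - sg * \<tau>) has_vector_derivative 0) (at \<tau> within {s..t})"
      using speed_facts(3)[OF B[OF \<tau>], of i] by simp
  qed simp
  then show l: "l i \<bullet> (\<Gamma> t - \<Gamma> s) = sg * (t - s)"
    by (simp add: inner_diff_right algebra_simps)
  have "norm ((\<Gamma> t - t *\<^sub>R (sg *\<^sub>R r i)) - (\<Gamma> s - s *\<^sub>R (sg *\<^sub>R r i))) \<le> (K * L * \<epsilon>) * (t - s)"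
  proof (rule vector_derivative_norm_bound[OF st(2)])
    fix \<tau> assume \<tau>: "\<tau> \<in> {s..t}"
    have "((\<lambda>\<tau>. \<tau> *\<^sub>R (sg *\<^sub>R r i)) has_vector_derivative sg *\<^sub>R r i) (at \<tau> within {s..t})"
      unfolding has_vector_derivative_def by (auto intro!: derivative_eq_intros)
    then show "((\<lambda>\<tau>. \<Gamma> \<tau> - \<tau> *\<^sub>R (sg *\<^sub>R r i)) has_vector_derivative (sg *\<^sub>R dir i (\<Gamma> \<tau>) - sg *\<^sub>R r i)) (at \<tau> within {s..t})"
      by (intro has_vector_derivative_diff d(1)[OF \<tau>])
    have "norm (sg *\<^sub>R dir i (\<Gamma> \<tau>) - sg *\<^sub>R r i) = \<bar>sg\<bar> * norm (dir i (\<Gamma> \<tau>) - r i)"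
      by (simp only: scaleR_diff_right[symmetric] norm_scaleR)
    then show "norm (sg *\<^sub>R dir i (\<Gamma> \<tau>) - sg *\<^sub>R r i) \<le> K * L * \<epsilon>"
      using dir_near[OF d(2)[OF \<tau>] \<epsilon>, of i] \<Gamma> by (simp add: fan_curve_def)
  qed
  moreover have "N i (\<Gamma> t - \<Gamma> s) = (\<Gamma> t - t *\<^sub>R (sg *\<^sub>R r i)) - (\<Gamma> s - s *\<^sub>R (sg *\<^sub>R r i))"
    unfolding N_def l by (simp add: algebra_simps)
  ultimately show "norm (N i (\<Gamma> t - \<Gamma> s)) \<le> (K * L * \<epsilon>) * (t - s)" by simp
qed

text \<open>The field is Lipschitz and the time at most \<open>2 * K * \<epsilon>\<close>, so the largest distance exceeds the initial one by at
  most half of itself.\<close>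
lemma fan_fan_close:
  assumes \<Gamma>: "fan_curve i \<epsilon> sg T \<Gamma>" and \<Gamma>': "fan_curve i \<epsilon> sg T' \<Gamma>'" and TT: "T' \<le> T"
    and \<epsilon>: "\<epsilon> \<le> \<rho>" and small: "4 * K * (K * L * \<epsilon>) \<le> 1"
  shows "\<And>t. t \<in> {0..T'} \<Longrightarrow> norm (\<Gamma> t - \<Gamma>' t) \<le> 2 * norm (\<Gamma> 0 - \<Gamma>' 0)"
    and "norm ((\<Gamma> T' - \<Gamma>' T') - (\<Gamma> 0 - \<Gamma>' 0)) \<le> T' * (K * L * (2 * norm (\<Gamma> 0 - \<Gamma>' 0)))"
proof -
  have T': "0 \<le> T'" "T' \<le> 2 * K * \<epsilon>" and sg: "\<bar>sg\<bar> = 1" using \<Gamma>' by (auto simp: fan_curve_def)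
  let ?D = "\<lambda>t. \<Gamma> t - \<Gamma>' t"
  have d: "(?D has_vector_derivative (sg *\<^sub>R dir i (\<Gamma> t) - sg *\<^sub>R dir i (\<Gamma>' t))) (at t within {0..T'})"
    "\<Gamma> t \<in> B" "\<Gamma>' t \<in> B" if "t \<in> {0..T'}" for t
  proof -
    have "(\<Gamma> has_vector_derivative sg *\<^sub>R dir i (\<Gamma> t)) (at t within {0..T'})"
      using \<Gamma> TT that by (auto simp: fan_curve_def intro: has_vector_derivative_within_subset[of _ _ _ "{0..T}"])
    moreover have "(\<Gamma>' has_vector_derivative sg *\<^sub>R dir i (\<Gamma>' t)) (at t within {0..T'})"
      using \<Gamma>' that by (auto simp: fan_curve_def)
    ultimately show "(?D has_vector_derivative (sg *\<^sub>R dir i (\<Gamma> t) - sg *\<^sub>R dir i (\<Gamma>' t))) (at t within {0..T'})"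
      by (rule has_vector_derivative_diff)
    have "\<Gamma> t \<in> cball Vbar \<epsilon>" "\<Gamma>' t \<in> cball Vbar \<epsilon>"
      using \<Gamma> \<Gamma>' TT that by (auto simp: fan_curve_def simp del: mem_cball)
    then show "\<Gamma> t \<in> B" "\<Gamma>' t \<in> B"
      using \<epsilon> by auto
  qed
  have "continuous_on {0..T'} (\<lambda>t. norm (?D t))"
    by (rule continuous_on_norm[OF continuous_on_vector_derivative[OF d(1)]])
  then obtain t0 where t0: "t0 \<in> {0..T'}" "\<And>t. t \<in> {0..T'} \<Longrightarrow> norm (?D t) \<le> norm (?D t0)"
    using continuous_attains_sup[of "{0..T'}" "\<lambda>t. norm (?D t)"] T' by auto
  have bound: "norm (?D t - ?D 0) \<le> K * L * norm (?D t0) * (t - 0)" if t: "t \<in> {0..T'}" for t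
  proof (rule vector_derivative_norm_bound)
    fix s assume s: "s \<in> {0..t}"
    then have s': "s \<in> {0..T'}" using t by auto
    show "(?D has_vector_derivative (sg *\<^sub>R dir i (\<Gamma> s) - sg *\<^sub>R dir i (\<Gamma>' s))) (at s within {0..t})"
      by (rule has_vector_derivative_within_subset[OF d(1)[OF s']]) (use t in auto)
    have "norm (sg *\<^sub>R dir i (\<Gamma> s) - sg *\<^sub>R dir i (\<Gamma>' s)) = \<bar>sg\<bar> * norm (dir i (\<Gamma> s) - dir i (\<Gamma>' s))"
      by (simp only: scaleR_diff_right[symmetric] norm_scaleR)
    also have "\<dots> \<le> K * L * norm (?D s)"
      using dir_Lipschitz[OF d(2,3)[OF s'], of i] sg by simp
    also have "\<dots> \<le> K * L * norm (?D t0)"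
      using t0(2)[OF s'] KL_nonneg by (rule mult_left_mono)
    finally show "norm (sg *\<^sub>R dir i (\<Gamma> s) - sg *\<^sub>R dir i (\<Gamma>' s)) \<le> K * L * norm (?D t0)" .
  qed (use t in auto)
  have "norm (?D t0 - ?D 0) \<le> K * L * norm (?D t0) * t0" using bound[OF t0(1)] by simp
  also have "\<dots> \<le> K * L * norm (?D t0) * (2 * K * \<epsilon>)"
    using t0(1) T' KL_nonneg by (intro mult_left_mono) auto
  also have "\<dots> = (4 * K * (K * L * \<epsilon>)) * (norm (?D t0) / 2)" by simp
  also have "\<dots> \<le> 1 * (norm (?D t0) / 2)"
    using small by (rule mult_right_mono) simp
  finally have "norm (?D t0 - ?D 0) \<le> norm (?D t0) / 2" by simp
  then have sup: "norm (?D t0) \<le> 2 * norm (?D 0)"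
    using norm_triangle_ineq2[of "?D t0" "?D 0"] by linarith
  then show "norm (\<Gamma> t - \<Gamma>' t) \<le> 2 * norm (\<Gamma> 0 - \<Gamma>' 0)" if "t \<in> {0..T'}" for t
    using t0(2)[OF that] by linarith
  have "norm (?D T' - ?D 0) \<le> K * L * norm (?D t0) * (T' - 0)" using bound T' by simp
  also have "\<dots> \<le> K * L * (2 * norm (?D 0)) * T'"
    using sup KL_nonneg T' by (auto intro!: mult_mono)
  finally show "norm ((\<Gamma> T' - \<Gamma>' T') - (\<Gamma> 0 - \<Gamma>' 0)) \<le> T' * (K * L * (2 * norm (\<Gamma> 0 - \<Gamma>' 0)))"
    by (simp add: mult.commute mult.left_commute)
qed

lemma fan_fan_cone_ordered:
  assumes \<Gamma>: "fan_curve i \<epsilon> sg T \<Gamma>" and \<Gamma>': "fan_curve i \<epsilon> sg T' \<Gamma>'" and TT: "T' \<le> T"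
    and \<epsilon>: "\<epsilon> \<le> \<rho>" and small: "4 * K * (K * L * \<epsilon>) \<le> 1"
  shows "norm (N i ((\<Gamma> T - \<Gamma> 0) - (\<Gamma>' T' - \<Gamma>' 0)))
    \<le> 4 * K * (K * L * \<epsilon>) * (norm ((\<Gamma> T - \<Gamma> 0) - (\<Gamma>' T' - \<Gamma>' 0)) + norm (\<Gamma> 0 - \<Gamma>' 0))"
proof -
  let ?d = "\<Gamma> T - \<Gamma> 0" and ?d' = "\<Gamma>' T' - \<Gamma>' 0" and ?E = "K * L * \<epsilon>"
  have T: "0 \<le> T" "0 \<le> T'" "T' \<le> 2 * K * \<epsilon>" and sg: "\<bar>sg\<bar> = 1" using \<Gamma> \<Gamma>' by (auto simp: fan_curve_def)
  have e0: "0 \<le> \<epsilon>" using T K_ge(1) by (smt (verit) mult_pos_neg)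
  let ?a = "(\<Gamma> T' - \<Gamma>' T') - (\<Gamma> 0 - \<Gamma>' 0)"
  have "l i \<bullet> ?a = 0"
  proof -
    have "?a = (\<Gamma> T' - \<Gamma> 0) - (\<Gamma>' T' - \<Gamma>' 0)" by simp
    then show ?thesis
      using fan_cone(1)[OF \<Gamma> \<epsilon>, of 0 T'] fan_cone(1)[OF \<Gamma>' \<epsilon>, of 0 T'] T TT by (simp add: inner_diff_right)
  qed
  then have a: "N i ?a = ?a" by (rule N_kernel)
  have "?d - ?d' = ?a + (\<Gamma> T - \<Gamma> T')" by simp
  then have "N i (?d - ?d') = ?a + N i (\<Gamma> T - \<Gamma> T')"
    by (metis a N_diff add_diff_cancel diff_add_cancel)
  then have "norm (N i (?d - ?d')) \<le> norm ?a + norm (N i (\<Gamma> T - \<Gamma> T'))"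
    by (metis norm_triangle_ineq)
  also have "norm ?a \<le> T' * (K * L * (2 * norm (\<Gamma> 0 - \<Gamma>' 0)))"
    by (rule fan_fan_close(2)[OF \<Gamma> \<Gamma>' TT \<epsilon> small])
  also have "\<dots> \<le> (2 * K * \<epsilon>) * (K * L * (2 * norm (\<Gamma> 0 - \<Gamma>' 0)))"
    using T KL_nonneg by (intro mult_right_mono) auto
  also have "norm (N i (\<Gamma> T - \<Gamma> T')) \<le> ?E * (T - T')"
    using fan_cone(2)[OF \<Gamma> \<epsilon>, of T' T] T TT by simp
  also have "T - T' \<le> K * norm (?d - ?d')"
  proof -
    have "l i \<bullet> (?d - ?d') = sg * T - sg * T'"
      unfolding inner_diff_right[of "l i" ?d] fan_cone(1)[OF \<Gamma> \<epsilon> order_refl T(1) order_refl]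
        fan_cone(1)[OF \<Gamma>' \<epsilon> order_refl T(2) order_refl] by simp
    then have "\<bar>l i \<bullet> (?d - ?d')\<bar> = T - T'"
      using sg TT by (simp add: right_diff_distrib[symmetric] abs_mult)
    then show ?thesis using norm_inner_l[of i "?d - ?d'"] by linarith
  qed
  finally have "norm (N i (?d - ?d')) \<le> 2 * K * \<epsilon> * (K * L * (2 * norm (\<Gamma> 0 - \<Gamma>' 0))) + ?E * (K * norm (?d - ?d'))"
    using e0 KL_nonneg by (smt (verit) mult_left_mono mult_nonneg_nonneg)
  also have "\<dots> = 4 * K * ?E * norm (\<Gamma> 0 - \<Gamma>' 0) + K * ?E * norm (?d - ?d')" by simp
  also have "\<dots> \<le> 4 * K * ?E * norm (\<Gamma> 0 - \<Gamma>' 0) + 4 * K * ?E * norm (?d - ?d')"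
    using e0 KL_nonneg K_ge(1) by (intro add_left_mono mult_right_mono) (auto intro!: mult_nonneg_nonneg)
  finally show ?thesis by (simp add: distrib_left add.commute)
qed

lemma fan_fan_cone:
  assumes \<Gamma>: "fan_curve i \<epsilon> sg T \<Gamma>" and \<Gamma>': "fan_curve i \<epsilon> sg T' \<Gamma>'"
    and \<epsilon>: "\<epsilon> \<le> \<rho>" and small: "4 * K * (K * L * \<epsilon>) \<le> 1"
  shows "norm (N i ((\<Gamma> T - \<Gamma> 0) - (\<Gamma>' T' - \<Gamma>' 0)))
    \<le> 4 * K * (K * L * \<epsilon>) * (norm ((\<Gamma> T - \<Gamma> 0) - (\<Gamma>' T' - \<Gamma>' 0)) + norm (\<Gamma> 0 - \<Gamma>' 0))"
proof (cases "T' \<le> T")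
  case True
  then show ?thesis using fan_fan_cone_ordered[OF \<Gamma> \<Gamma>' _ \<epsilon> small] by simp
next
  case False
  then have "norm (N i ((\<Gamma>' T' - \<Gamma>' 0) - (\<Gamma> T - \<Gamma> 0)))
    \<le> 4 * K * (K * L * \<epsilon>) * (norm ((\<Gamma>' T' - \<Gamma>' 0) - (\<Gamma> T - \<Gamma> 0)) + norm (\<Gamma>' 0 - \<Gamma> 0))"
    using fan_fan_cone_ordered[OF \<Gamma>' \<Gamma> _ \<epsilon> small] by simp
  then show ?thesis
    unfolding N_diff[of i "\<Gamma> T - \<Gamma> 0"] N_diff[of i "\<Gamma>' T' - \<Gamma>' 0"]
    by (simp only: norm_minus_commute)
qed

lemma shock_fan_cone:
  assumes S: "shock_pair i \<epsilon> U0 U1" and \<Gamma>: "fan_curve i \<epsilon> sg T \<Gamma>" and opp: "sg * (l i \<bullet> (U1 - U0)) \<le> 0"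
    and \<epsilon>: "\<epsilon> \<le> \<rho>" "0 < \<epsilon>"
  shows "norm (N i ((U1 - U0) - (\<Gamma> T - \<Gamma> 0))) \<le> 4 * K * (K * L * \<epsilon>) * norm ((U1 - U0) - (\<Gamma> T - \<Gamma> 0))"
proof -
  let ?d = "U1 - U0" and ?d' = "\<Gamma> T - \<Gamma> 0" and ?E = "K * L * \<epsilon>"
  let ?u = "l i \<bullet> ?d"
  have T: "0 \<le> T" and sg: "\<bar>sg\<bar> = 1" using \<Gamma> by (auto simp: fan_curve_def)
  have E: "0 \<le> ?E" using KL_nonneg \<epsilon> by simp
  have fc: "l i \<bullet> ?d' = sg * T" "norm (N i ?d') \<le> ?E * T"
    using fan_cone[OF \<Gamma> \<epsilon>(1), of 0 T] T by auto
  have "\<bar>?u\<bar> + T = \<bar>?u - sg * T\<bar>"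
    using opp sg T by (auto simp: abs_if split: if_splits)
  also have "?u - sg * T = l i \<bullet> (?d - ?d')" using fc(1) by (simp only: inner_diff_right[of "l i" ?d])
  also have "\<bar>\<dots>\<bar> \<le> K * norm (?d - ?d')" by (rule norm_inner_l)
  finally have le: "\<bar>?u\<bar> + T \<le> K * norm (?d - ?d')" .
  have "norm (N i (?d - ?d')) \<le> norm (N i ?d) + norm (N i ?d')"
    unfolding N_diff[of i ?d] by (rule norm_triangle_ineq4)
  also have "\<dots> \<le> \<bar>?u\<bar> * (2 * ?E) + ?E * T"
    by (rule add_mono[OF shock_cone[OF S \<epsilon>(1)] fc(2)])
  also have "\<dots> \<le> \<bar>?u\<bar> * (2 * ?E) + 2 * (?E * T)"
    using mult_nonneg_nonneg[OF E T] by linarith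
  also have "\<dots> = 2 * ?E * (\<bar>?u\<bar> + T)" by (simp add: algebra_simps)
  also have "\<dots> \<le> 2 * ?E * (K * norm (?d - ?d'))" using le E by (intro mult_left_mono) auto
  also have "\<dots> = 2 * (K * ?E * norm (?d - ?d'))" by simp
  also have "\<dots> \<le> 4 * (K * ?E * norm (?d - ?d'))"
    using E K_ge(1) by (intro mult_right_mono) (auto intro!: mult_nonneg_nonneg)
  finally show ?thesis by (simp add: mult.assoc)
qed

end

locale small_nonlinear_profile = nonlinear_profile A0 lam r l \<delta> \<eta> f J J' Vbar \<rho> L e q g g' c \<epsilon> V M i
  for A0 :: "real^'m^'m" and lam r l \<delta> \<eta> f J J' Vbar \<rho> L e q g g' c \<epsilon> V M i +
  fixes \<kappa> :: real
  assumes nonzero: "curv i \<noteq> 0"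
    and monotone: "\<lbrakk>U \<in> cball Vbar \<epsilon>; W \<in> cball Vbar \<epsilon>; U - W = u *\<^sub>R (r i + w); norm w \<le> \<kappa>; u \<noteq> 0\<rbrakk>
      \<Longrightarrow> 0 < (speed i U - speed i W) * (curv i * u)"
    and small: "4 * K * K * (K * L * \<epsilon>) \<le> 1 / 2" "8 * K * K * K * (K * L * \<epsilon>) + K * L * \<epsilon> \<le> \<kappa>"
begin

text \<open>On a fan the profile is sonic, so \<open>V_eq\<close> makes its increments eigenvectors of the averaged Jacobian up to
  an error, and the distance \<open>\<bar>x - y\<bar>\<close> is itself bounded by the increment of the speed.\<close>
lemma fan_increment:
  assumes F: "fan i a b" and x: "x \<in> {a..b}" and y: "y \<in> {a..b}"
    and C: "\<And>s. s \<in> closed_segment x y \<Longrightarrow> norm (V s - V y) \<le> C"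
  shows "norm ((V x - V y) - (l i \<bullet> (V x - V y)) *\<^sub>R dir i (V x))
      \<le> K * (C * (K * L * norm (V x - V y)) + \<bar>l i \<bullet> (V x - V y)\<bar> * (L * norm (V x - V y) * K))"
proof -
  let ?\<Delta> = "V x - V y" and ?v = "dir i (V x)" and ?A = "avg (V x) (V y)"
  let ?u = "l i \<bullet> ?\<Delta>"
  let ?z = "?\<Delta> - ?u *\<^sub>R ?v"
  have sx: "speed i (V x) = x" "speed i (V y) = y" using F x y by (auto simp: fan_def)
  have xl: "\<bar>x - lam i\<bar> \<le> 2 * \<delta>" using speed_near[OF V_ball[of x], of i] sx \<delta>_pos by linarith
  have C0: "0 \<le> C" using C[of y] norm_ge_zero order_trans by force
  have z0: "l i \<bullet> ?z = 0"
    using speed_facts(3)[OF V_B[of x], of i] by (simp add: inner_diff_right)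
  have "?A *v ?z - x *\<^sub>R ?z = (f (V x) - f (V y) - x *\<^sub>R ?\<Delta>) - ?u *\<^sub>R ((?A - J (V x)) *v ?v)"
    using speed_facts(2)[OF V_B[of x], of i] sx(1)
    by (simp add: avg_diff matrix_diff_vector matrix_vector_mult_diff_distrib matrix_vector_mult_scaleR algebra_simps)
  then have "norm (?A *v ?z - x *\<^sub>R ?z) \<le> norm (f (V x) - f (V y) - x *\<^sub>R ?\<Delta>) + norm (?u *\<^sub>R ((?A - J (V x)) *v ?v))"
    by (metis norm_triangle_ineq4)
  also have "\<dots> \<le> C * (K * L * norm ?\<Delta>) + \<bar>?u\<bar> * (L * norm ?\<Delta> * K)"
  proof (rule add_mono)
    have "norm (f (V x) - f (V y) - x *\<^sub>R ?\<Delta>) \<le> C * \<bar>x - y\<bar>" by (rule V_eq[OF C])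
    also have "\<dots> \<le> C * (K * L * norm ?\<Delta>)"
      using speed_Lipschitz[OF V_B[of x] V_B[of y], of i] sx C0 by (intro mult_left_mono) auto
    finally show "norm (f (V x) - f (V y) - x *\<^sub>R ?\<Delta>) \<le> C * (K * L * norm ?\<Delta>)" .
    have "norm ((?A - J (V x)) *v ?v) \<le> norm (?A - avg (V x) (V x)) * norm ?v"
      unfolding avg_same by (rule norm_matrix_vector_le)
    also have "\<dots> \<le> (L * norm ?\<Delta>) * K"
      using avg_Lipschitz[OF V_B[of x] V_B[of y] V_B[of x] V_B[of x]] speed_facts(4)[OF V_B[of x], of i] L_nonneg
      by (intro mult_mono) (auto simp: norm_minus_commute)
    finally show "norm (?u *\<^sub>R ((?A - J (V x)) *v ?v)) \<le> \<bar>?u\<bar> * (L * norm ?\<Delta> * K)"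
      by (simp add: mult_left_mono)
  qed
  finally have "norm (?A *v ?z - x *\<^sub>R ?z) \<le> C * (K * L * norm ?\<Delta>) + \<bar>?u\<bar> * (L * norm ?\<Delta> * K)" .
  then have "K * norm (?A *v ?z - x *\<^sub>R ?z) \<le> K * (C * (K * L * norm ?\<Delta>) + \<bar>?u\<bar> * (L * norm ?\<Delta> * K))"
    using K_ge(1) by (intro mult_left_mono) auto
  moreover have "norm ?z \<le> K * norm (?A *v ?z - x *\<^sub>R ?z)"
    using sector[OF avg_near[OF V_B V_B] xl, of ?z] z0 by simp
  ultimately show ?thesis by linarith
qed

lemma fan_increment_small:
  assumes F: "fan i a b" and x: "x \<in> {a..b}" and y: "y \<in> {a..b}"
  shows "norm ((V x - V y) - (l i \<bullet> (V x - V y)) *\<^sub>R dir i (V x)) \<le> 4 * K * K * (K * L * \<epsilon>) * norm (V x - V y)"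
    and "norm (V x - V y) \<le> 2 * K * \<bar>l i \<bullet> (V x - V y)\<bar>"
proof -
  let ?\<Delta> = "V x - V y" and ?v = "dir i (V x)"
  let ?u = "l i \<bullet> ?\<Delta>"
  have u: "\<bar>?u\<bar> \<le> K * (2 * \<epsilon>)"
    using norm_inner_l[of i ?\<Delta>] V_diff[of x y] K_ge(1) by (smt (verit) mult_left_mono)
  have "norm (?\<Delta> - ?u *\<^sub>R ?v) \<le> K * (2 * \<epsilon> * (K * L * norm ?\<Delta>) + \<bar>?u\<bar> * (L * norm ?\<Delta> * K))"
    by (rule fan_increment[OF F x y V_diff])
  also have "\<dots> \<le> K * (K * (2 * \<epsilon>) * (K * L * norm ?\<Delta>) + K * (2 * \<epsilon>) * (L * norm ?\<Delta> * K))"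
    using u K_ge(1) L_nonneg \<epsilon>_bounds KL_nonneg
    by (intro mult_left_mono add_mono mult_right_mono) auto
  also have "\<dots> = 4 * K * K * (K * L * \<epsilon>) * norm ?\<Delta>" by simp
  finally show 1: "norm (?\<Delta> - ?u *\<^sub>R ?v) \<le> 4 * K * K * (K * L * \<epsilon>) * norm ?\<Delta>" .
  have "4 * K * K * (K * L * \<epsilon>) * norm ?\<Delta> \<le> 1 / 2 * norm ?\<Delta>"
    using small(1) by (rule mult_right_mono) simp
  with 1 have "norm (?\<Delta> - ?u *\<^sub>R ?v) \<le> 1 / 2 * norm ?\<Delta>" by linarith
  moreover have "norm (?u *\<^sub>R ?v) \<le> \<bar>?u\<bar> * K"
    using speed_facts(4)[OF V_B[of x], of i] by (simp add: mult_left_mono)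
  moreover have "norm ?\<Delta> \<le> norm (?\<Delta> - ?u *\<^sub>R ?v) + norm (?u *\<^sub>R ?v)"
    by (metis diff_add_cancel norm_triangle_ineq)
  ultimately show "norm ?\<Delta> \<le> 2 * K * \<bar>?u\<bar>" by (simp add: algebra_simps)
qed

text \<open>The speed equals the position and so increases; by \<open>monotone\<close> the coordinate \<open>l i\<close> then moves in the direction
  of \<open>sgn (curv i)\<close>.\<close>
lemma fan_strict_mono:
  assumes F: "fan i a b" and x: "x \<in> {a..b}" and y: "y \<in> {a..b}" and "y < x"
  shows "0 < sgn (curv i) * (l i \<bullet> (V x - V y))"
proof -
  let ?\<Delta> = "V x - V y" and ?v = "dir i (V x)"
  let ?u = "l i \<bullet> ?\<Delta>"
  have sx: "speed i (V x) = x" "speed i (V y) = y" using F x y by (auto simp: fan_def)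
  then have "norm ?\<Delta> > 0" using \<open>y < x\<close> by auto
  then have u: "?u \<noteq> 0" using fan_increment_small(2)[OF F x y] by auto
  define w where "w = (1 / ?u) *\<^sub>R (?\<Delta> - ?u *\<^sub>R ?v) + (?v - r i)"
  have eq: "?\<Delta> = ?u *\<^sub>R (r i + w)"
  proof -
    have "x = u *\<^sub>R (z + ((1 / u) *\<^sub>R (x - u *\<^sub>R y) + (y - z)))" if "u \<noteq> 0" for u :: real and x y z :: "real^'m"
      using that by (simp add: scaleR_add_right scaleR_diff_right)
    then show ?thesis unfolding w_def using u by blast
  qed
  have "norm w \<le> norm (?\<Delta> - ?u *\<^sub>R ?v) / \<bar>?u\<bar> + norm (?v - r i)"
    unfolding w_def by (rule order_trans[OF norm_triangle_ineq]) (simp add: divide_inverse mult.commute)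
  also have "norm (?\<Delta> - ?u *\<^sub>R ?v) / \<bar>?u\<bar> \<le> 8 * K * K * K * (K * L * \<epsilon>)"
  proof -
    have "norm (?\<Delta> - ?u *\<^sub>R ?v) \<le> 4 * K * K * (K * L * \<epsilon>) * norm ?\<Delta>"
      by (rule fan_increment_small(1)[OF F x y])
    also have "\<dots> \<le> 4 * K * K * (K * L * \<epsilon>) * (2 * K * \<bar>?u\<bar>)"
      using fan_increment_small(2)[OF F x y] K_ge(1) L_nonneg \<epsilon>_bounds by (intro mult_left_mono) auto
    also have "\<dots> = 8 * K * K * K * (K * L * \<epsilon>) * \<bar>?u\<bar>" by simp
    finally show ?thesis using u by (simp add: pos_divide_le_eq)
  qed
  also have "norm (?v - r i) \<le> K * L * \<epsilon>" by (rule dir_near[OF V_ball \<epsilon>_bounds(2)])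
  finally have "norm w \<le> \<kappa>" using small(2) by linarith
  from monotone[OF V_ball V_ball eq this u]
  have "0 < (x - y) * (curv i * ?u)" by (simp only: sx)
  then have "0 < curv i * ?u" using \<open>y < x\<close> by (simp add: zero_less_mult_iff)
  then show ?thesis by (auto simp: sgn_if zero_less_mult_iff)
qed

text \<open>The profile is reparametrised by its strictly monotone \<open>i\<close>-th coordinate. In this parameter \<open>fan_increment\<close> has a
  quadratic error, which yields differentiability although \<open>V\<close> is only known to be continuous.\<close>
lemma fan_has_curve:
  assumes F: "fan i a b"
  obtains \<Gamma> T where "fan_curve i \<epsilon> (sgn (curv i)) T \<Gamma>" "\<Gamma> 0 = left_state i" "\<Gamma> T = right_state i" "V ` {a..b} = \<Gamma> ` {0..T}"
proof -
  let ?sg = "sgn (curv i)"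
  have sg: "\<bar>?sg\<bar> = 1" "?sg * ?sg = 1" using nonzero by (auto simp: sgn_if)
  have ab: "a \<le> b" and cont: "continuous_on {a..b} V" using F by (auto simp: fan_def)
  have st: "left_state i = V a" "right_state i = V b"
  proof -
    have "a \<in> strip i" "b \<in> strip i" using F \<delta>_pos by (auto simp: fan_def strip_iff)
    then show "left_state i = V a" "right_state i = V b" using F by (auto simp: fan_def)
  qed
  define m where "m x = ?sg * (l i \<bullet> (V x - V a))" for x
  define T where "T = m b"
  have m_diff: "m x - m y = ?sg * (l i \<bullet> (V x - V y))" for x y
    by (simp add: m_def inner_diff_right algebra_simps)
  have m_mono: "m y < m x" if "x \<in> {a..b}" "y \<in> {a..b}" "y < x" for x y
    using fan_strict_mono[OF F that] m_diff[of x y] by simp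
  then have m_mono': "m y \<le> m x" if "x \<in> {a..b}" "y \<in> {a..b}" "y \<le> x" for x y
    using that by (cases "y = x") (auto intro: less_imp_le)
  have m0: "m a = 0" by (simp add: m_def)
  have T0: "0 \<le> T" using m_mono'[of b a] ab by (simp add: T_def m0)
  have m_cont: "continuous_on {a..b} m"
    unfolding m_def by (intro continuous_intros cont)
  have "\<exists>x. x \<in> {a..b} \<and> m x = \<tau>" if "\<tau> \<in> {0..T}" for \<tau>
    using IVT'[of m a \<tau> b] that ab m_cont by (auto simp: m0 T_def)
  then obtain X where X: "\<And>\<tau>. \<tau> \<in> {0..T} \<Longrightarrow> X \<tau> \<in> {a..b} \<and> m (X \<tau>) = \<tau>" by metis
  define \<Gamma> where "\<Gamma> \<tau> = V (X \<tau>)" for \<tau>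
  have Xm: "X (m x) = x" if "x \<in> {a..b}" for x
  proof -
    have "m x \<in> {0..T}" using m_mono'[of x a] m_mono'[of b x] that ab by (auto simp: m0 T_def)
    from X[OF this] show ?thesis
      using m_mono[of x "X (m x)"] m_mono[of "X (m x)" x] that by (metis less_irrefl linorder_neqE)
  qed
  have absm: "\<bar>m x - m y\<bar> = \<bar>l i \<bullet> (V x - V y)\<bar>" for x y
    unfolding m_diff by (simp only: abs_mult sg mult_1)
  define C2 where "C2 = 8 * K * K * K * K * L"
  have C2: "0 \<le> C2" using K_ge(1) L_nonneg by (simp add: C2_def)
  have quad: "norm (\<Gamma> \<tau>' - \<Gamma> \<tau> - (\<tau>' - \<tau>) *\<^sub>R (?sg *\<^sub>R dir i (\<Gamma> \<tau>))) \<le> C2 * \<bar>\<tau>' - \<tau>\<bar>\<^sup>2"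
    if t: "\<tau> \<in> {0..T}" "\<tau>' \<in> {0..T}" for \<tau> \<tau>'
  proof -
    let ?x = "X \<tau>" and ?y = "X \<tau>'"
    have xy: "?x \<in> {a..b}" "?y \<in> {a..b}" and mx: "m ?x = \<tau>" "m ?y = \<tau>'" using X t by auto
    let ?\<Delta> = "V ?x - V ?y"
    let ?u = "l i \<bullet> ?\<Delta>"
    have u: "\<bar>?u\<bar> = \<bar>\<tau>' - \<tau>\<bar>" using absm[of ?x ?y] mx by (simp add: abs_minus_commute)
    have C: "norm (V s - V ?y) \<le> 2 * K * \<bar>\<tau>' - \<tau>\<bar>" if s: "s \<in> closed_segment ?x ?y" for s
    proof -
      have sab: "s \<in> {a..b}" using s xy by (auto simp: closed_segment_eq_real_ivl split: if_splits)
      have "norm (V s - V ?y) \<le> 2 * K * \<bar>l i \<bullet> (V s - V ?y)\<bar>" by (rule fan_increment_small(2)[OF F sab xy(2)])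
      also have "\<bar>l i \<bullet> (V s - V ?y)\<bar> = \<bar>m s - m ?y\<bar>" by (simp only: absm)
      also have "\<dots> \<le> \<bar>m ?x - m ?y\<bar>"
        using s m_mono'[OF sab xy(2)] m_mono'[OF xy(2) sab] m_mono'[OF xy(1) sab] m_mono'[OF sab xy(1)]
        by (auto simp: closed_segment_eq_real_ivl split: if_splits)
      finally show ?thesis using K_ge(1) mx by (simp add: abs_minus_commute)
    qed
    have nD: "norm ?\<Delta> \<le> 2 * K * \<bar>\<tau>' - \<tau>\<bar>" using fan_increment_small(2)[OF F xy] u by simp
    have "norm (?\<Delta> - ?u *\<^sub>R dir i (V ?x)) \<le> K * (2 * K * \<bar>\<tau>' - \<tau>\<bar> * (K * L * norm ?\<Delta>) + \<bar>?u\<bar> * (L * norm ?\<Delta> * K))"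
      by (rule fan_increment[OF F xy C])
    also have "\<dots> \<le> K * (2 * K * \<bar>\<tau>' - \<tau>\<bar> * (K * L * (2 * K * \<bar>\<tau>' - \<tau>\<bar>)) + (2 * K * \<bar>\<tau>' - \<tau>\<bar>) * (L * (2 * K * \<bar>\<tau>' - \<tau>\<bar>) * K))"
    proof -
      have "\<bar>?u\<bar> \<le> 2 * K * \<bar>\<tau>' - \<tau>\<bar>"
        unfolding u using mult_right_mono[of 1 "2 * K" "\<bar>\<tau>' - \<tau>\<bar>"] K_ge(1) by simp
      then show ?thesis
        using nD K_ge(1) L_nonneg KL_nonneg by (intro mult_left_mono add_mono mult_mono mult_right_mono) auto
    qed
    also have "\<dots> = C2 * \<bar>\<tau>' - \<tau>\<bar>\<^sup>2"
    proof -
      have "K * (2 * K * a * (K * L * (2 * K * a)) + 2 * K * a * (L * (2 * K * a) * K)) = C2 * a\<^sup>2" for a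
        by (simp add: C2_def power2_eq_square algebra_simps)
      then show ?thesis .
    qed
    finally have 1: "norm (?\<Delta> - ?u *\<^sub>R dir i (V ?x)) \<le> C2 * \<bar>\<tau>' - \<tau>\<bar>\<^sup>2" .
    have "?u = ?sg * (\<tau> - \<tau>')"
      using m_diff[of ?x ?y] mx by (metis mult.assoc mult_1 sg(2))
    moreover have "\<Gamma> \<tau>' - \<Gamma> \<tau> - (\<tau>' - \<tau>) *\<^sub>R (?sg *\<^sub>R dir i (\<Gamma> \<tau>))
        = - (?\<Delta> - (?sg * (\<tau> - \<tau>')) *\<^sub>R dir i (V ?x))"
      by (simp add: \<Gamma>_def algebra_simps)
    ultimately have "\<Gamma> \<tau>' - \<Gamma> \<tau> - (\<tau>' - \<tau>) *\<^sub>R (?sg *\<^sub>R dir i (\<Gamma> \<tau>)) = - (?\<Delta> - ?u *\<^sub>R dir i (V ?x))"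
      by (simp only:)
    then show ?thesis using 1 by (simp only: norm_minus_cancel)
  qed
  have der: "(\<Gamma> has_vector_derivative ?sg *\<^sub>R dir i (\<Gamma> \<tau>)) (at \<tau> within {0..T})" if t: "\<tau> \<in> {0..T}" for \<tau>
    unfolding has_vector_derivative_def has_derivative_within_alt
  proof (intro conjI allI impI bounded_linear_scaleR_left)
    fix z :: real assume z: "z > 0"
    show "\<exists>d>0. \<forall>y\<in>{0..T}. norm (y - \<tau>) < d \<longrightarrow> norm (\<Gamma> y - \<Gamma> \<tau> - (y - \<tau>) *\<^sub>R ?sg *\<^sub>R dir i (\<Gamma> \<tau>)) \<le> z * norm (y - \<tau>)"
    proof (intro exI[of _ "z / (C2 + 1)"] conjI ballI impI)
      show "0 < z / (C2 + 1)" using z C2 by simp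
      fix y assume y: "y \<in> {0..T}" "norm (y - \<tau>) < z / (C2 + 1)"
      have "C2 * \<bar>y - \<tau>\<bar> \<le> (C2 + 1) * \<bar>y - \<tau>\<bar>" by (intro mult_right_mono) auto
      also have "\<dots> \<le> z" using y(2) C2 by (simp add: field_simps)
      finally have "C2 * \<bar>y - \<tau>\<bar> * \<bar>y - \<tau>\<bar> \<le> z * \<bar>y - \<tau>\<bar>" by (rule mult_right_mono) simp
      then show "norm (\<Gamma> y - \<Gamma> \<tau> - (y - \<tau>) *\<^sub>R ?sg *\<^sub>R dir i (\<Gamma> \<tau>)) \<le> z * norm (y - \<tau>)"
        using quad[OF t y(1)] by (simp add: power2_eq_square)
    qed
  qed
  have TK: "T \<le> 2 * K * \<epsilon>"
  proof -
    have "T = \<bar>m b - m a\<bar>" using T0 by (simp add: T_def m0)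
    also have "\<dots> \<le> K * norm (V b - V a)" unfolding absm by (rule norm_inner_l)
    also have "\<dots> \<le> K * (2 * \<epsilon>)" using V_diff[of b a] K_ge(1) by (intro mult_left_mono) auto
    finally show ?thesis by simp
  qed
  show ?thesis
  proof (rule that)
    show "fan_curve i \<epsilon> ?sg T \<Gamma>"
      unfolding fan_curve_def using T0 TK sg der V_ball by (simp add: \<Gamma>_def)
    show "\<Gamma> 0 = left_state i" using Xm[of a] ab by (simp add: \<Gamma>_def m0 st)
    show "\<Gamma> T = right_state i" using Xm[of b] ab by (simp add: \<Gamma>_def T_def st)
    show "V ` {a..b} = \<Gamma> ` {0..T}"
    proof
      show "\<Gamma> ` {0..T} \<subseteq> V ` {a..b}" using X by (auto simp: \<Gamma>_def)
      show "V ` {a..b} \<subseteq> \<Gamma> ` {0..T}"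
      proof
        fix z assume "z \<in> V ` {a..b}"
        then obtain x where x: "x \<in> {a..b}" "z = V x" by blast
        have "m x \<in> {0..T}" using m_mono'[of x a] m_mono'[of b x] x ab by (auto simp: m0 T_def)
        moreover have "z = \<Gamma> (m x)" using Xm[OF x(1)] x by (simp add: \<Gamma>_def)
        ultimately show "z \<in> \<Gamma> ` {0..T}" by blast
      qed
    qed
  qed
qed

end

context riemann_profile
begin

text \<open>On a fan the position of a state is its speed, so the set of states, which is what the integral curve provides,
  determines the profile.\<close>
definition nonlinear_wave where
  "nonlinear_wave i \<longleftrightarrow> (\<exists>\<sigma>. jump_at i \<sigma> \<and> curv i * (l i \<bullet> (right_state i - left_state i)) < 0) \<or>
    (\<exists>a b \<Gamma> T. fan i a b \<and> fan_curve i \<epsilon> (sgn (curv i)) T \<Gamma> \<and> \<Gamma> 0 = left_state i \<and> \<Gamma> T = right_state i \<and>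
      V ` {a..b} = \<Gamma> ` {0..T}) \<or> (\<forall>s\<in>strip i. V s = left_state i)"

lemma states_in_ball: "left_state i \<in> cball Vbar \<epsilon>" "right_state i \<in> cball Vbar \<epsilon>"
  by (simp_all only: left_state_def right_state_def V_ball)

lemma jump_shock_pair:
  assumes "jump_at i \<sigma>"
  shows "shock_pair i \<epsilon> (left_state i) (right_state i)"
proof (cases "right_state i = left_state i")
  case True
  then show ?thesis using states_in_ball by (simp add: shock_pair_def)
next
  case False
  have "right_state i - left_state i = (l i \<bullet> (right_state i - left_state i)) *\<^sub>R rv i (avg (right_state i) (left_state i))"
    by (rule Rankine_Hugoniot_direction(2)[of _ _ \<sigma>])
      (use assms states_in_ball ball_B False \<delta>_pos in \<open>auto simp: jump_at_def\<close>)
  then show ?thesis using states_in_ball by (simp add: shock_pair_def)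
qed

lemma constant_states:
  assumes "\<forall>s\<in>strip i. V s = left_state i"
  shows "right_state i = left_state i"
  using assms ends_in_strip by (simp add: right_state_def)

lemma nonlinear_wave_cases:
  assumes "nonlinear_wave i" and "curv i \<noteq> 0"
  shows "(shock_pair i \<epsilon> (left_state i) (right_state i) \<and> sgn (curv i) * (l i \<bullet> (right_state i - left_state i)) \<le> 0) \<or>
    (\<exists>\<Gamma> T. fan_curve i \<epsilon> (sgn (curv i)) T \<Gamma> \<and> \<Gamma> 0 = left_state i \<and> \<Gamma> T = right_state i)"
proof -
  have "shock_pair i \<epsilon> (left_state i) (right_state i) \<and> sgn (curv i) * (l i \<bullet> (right_state i - left_state i)) \<le> 0"
    if "jump_at i \<sigma>" "curv i * (l i \<bullet> (right_state i - left_state i)) < 0" for \<sigma>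
    using jump_shock_pair[OF that(1)] that(2) by (auto simp: sgn_if mult_less_0_iff)
  moreover have "shock_pair i \<epsilon> (left_state i) (right_state i) \<and> sgn (curv i) * (l i \<bullet> (right_state i - left_state i)) \<le> 0"
    if "\<forall>s\<in>strip i. V s = left_state i"
    using constant_states[OF that] states_in_ball by (simp add: shock_pair_def)
  moreover have "(\<exists>\<sigma>. jump_at i \<sigma> \<and> curv i * (l i \<bullet> (right_state i - left_state i)) < 0) \<or>
    (\<exists>\<Gamma> T. fan_curve i \<epsilon> (sgn (curv i)) T \<Gamma> \<and> \<Gamma> 0 = left_state i \<and> \<Gamma> T = right_state i)
    \<or> (\<forall>s\<in>strip i. V s = left_state i)"
    using assms(1) unfolding nonlinear_wave_def by blast
  ultimately show ?thesis by (elim disjE exE conjE) auto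
qed

end

theorem (in small_nonlinear_profile) nonlinear_wave: "nonlinear_wave i"
  using sector_structure fan_has_curve unfolding nonlinear_wave_def by metis

section \<open>Comparison of two profiles\<close>

context flux
begin

text \<open>A sum of \<open>m\<close> vectors, each nearly parallel to its own eigenvector, can only vanish if all of them do.\<close>
lemma cone_sum_zero:
  fixes D :: "nat \<Rightarrow> real^'m"
  assumes p: "bij_betw p {..<CARD('m)} (UNIV :: 'm set)" and ends: "D 0 = 0" "D (CARD('m)) = 0"
    and cone: "\<And>k. k < CARD('m) \<Longrightarrow> norm (N (p k) (D (Suc k) - D k)) \<le> \<theta> * (norm (D (Suc k) - D k) + norm (D k))"
    and \<theta>: "0 \<le> \<theta>" "real (CARD('m)) * (2 * \<theta> + K * (real (CARD('m)) * (K * (2 * \<theta>)))) < 1"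
    and k: "k \<le> CARD('m)"
  shows "D k = 0"
proof -
  let ?m = "CARD('m)"
  let ?x = "\<lambda>k. D (Suc k) - D k"
  define S where "S = (\<Sum>k<?m. norm (?x k))"
  have S0: "0 \<le> S" by (simp add: S_def sum_nonneg)
  have tel: "D k = (\<Sum>j<k. ?x j)" for k
    using sum_lessThan_telescope[of D k] ends(1) by simp
  have DS: "norm (D k) \<le> S" if "k \<le> ?m" for k
  proof -
    have "norm (D k) \<le> (\<Sum>j<k. norm (?x j))" by (subst tel) (rule norm_sum)
    also have "\<dots> \<le> S" unfolding S_def using that by (intro sum_mono2) auto
    finally show ?thesis .
  qed
  have xS: "norm (?x k) \<le> S" if "k < ?m" for k
    unfolding S_def using that by (intro member_le_sum) auto
  have NS: "norm (N (p k) (?x k)) \<le> 2 * \<theta> * S" if "k < ?m" for k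
  proof -
    have "norm (N (p k) (?x k)) \<le> \<theta> * (norm (?x k) + norm (D k))" by (rule cone[OF that])
    also have "\<dots> \<le> \<theta> * (S + S)" using xS[OF that] DS[of k] that \<theta>(1) by (intro mult_left_mono) auto
    finally show ?thesis by simp
  qed
  have inj: "p j \<noteq> p k" if "j < ?m" "k < ?m" "j \<noteq> k" for j k
    using p that by (auto simp: bij_betw_def inj_on_def)
  have xb: "norm (?x j) \<le> 2 * \<theta> * S + K * (real ?m * (K * (2 * \<theta> * S)))" if j: "j < ?m" for j
  proof -
    have "(\<Sum>k<?m. ?x k) = 0" using tel[of ?m] ends(2) by simp
    then have "0 = (\<Sum>k<?m. l (p j) \<bullet> ?x k)" by (simp only: inner_sum_right[symmetric] inner_zero_right)
    also have "\<dots> = l (p j) \<bullet> ?x j + (\<Sum>k\<in>{..<?m} - {j}. l (p j) \<bullet> ?x k)"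
      using j by (subst sum.remove[of _ j]) auto
    also have "(\<Sum>k\<in>{..<?m} - {j}. l (p j) \<bullet> ?x k) = (\<Sum>k\<in>{..<?m} - {j}. l (p j) \<bullet> N (p k) (?x k))"
    proof (rule sum.cong[OF refl])
      fix k assume "k \<in> {..<?m} - {j}"
      then have "l (p j) \<bullet> r (p k) = 0" using inj[of j k] j by (simp add: dual)
      then show "l (p j) \<bullet> ?x k = l (p j) \<bullet> N (p k) (?x k)" by (simp add: N_def inner_diff_right)
    qed
    finally have "\<bar>l (p j) \<bullet> ?x j\<bar> = \<bar>\<Sum>k\<in>{..<?m} - {j}. l (p j) \<bullet> N (p k) (?x k)\<bar>" by linarith
    also have "\<dots> \<le> (\<Sum>k\<in>{..<?m} - {j}. \<bar>l (p j) \<bullet> N (p k) (?x k)\<bar>)" by (rule sum_abs)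
    also have "\<dots> \<le> (\<Sum>k\<in>{..<?m} - {j}. K * (2 * \<theta> * S))"
      using NS K_ge(1) by (intro sum_mono order_trans[OF norm_inner_l] mult_left_mono) auto
    also have "\<dots> \<le> (\<Sum>k<?m. K * (2 * \<theta> * S))"
      using K_ge(1) \<theta>(1) S0 by (intro sum_mono2) auto
    finally have lx: "\<bar>l (p j) \<bullet> ?x j\<bar> \<le> real ?m * (K * (2 * \<theta> * S))" by simp
    have "?x j = N (p j) (?x j) + (l (p j) \<bullet> ?x j) *\<^sub>R r (p j)" by (simp add: N_def)
    then have "norm (?x j) \<le> norm (N (p j) (?x j)) + norm ((l (p j) \<bullet> ?x j) *\<^sub>R r (p j))"
      by (metis norm_triangle_ineq)
    also have "norm ((l (p j) \<bullet> ?x j) *\<^sub>R r (p j)) \<le> K * (real ?m * (K * (2 * \<theta> * S)))"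
    proof -
      have "norm (r (p j)) \<le> K" using R_ge(2)[of "p j"] R_ge(1) K_ge(4) by linarith
      then have "norm (r (p j)) * \<bar>l (p j) \<bullet> ?x j\<bar> \<le> K * (real ?m * (K * (2 * \<theta> * S)))"
        using lx K_ge(1) by (intro mult_mono) auto
      then show ?thesis by (simp add: mult.commute)
    qed
    finally show ?thesis using NS[OF j] by linarith
  qed
  have "S \<le> (\<Sum>j<?m. 2 * \<theta> * S + K * (real ?m * (K * (2 * \<theta> * S))))"
    unfolding S_def[of] by (rule sum_mono) (use xb S_def in auto)
  also have "\<dots> = (real ?m * (2 * \<theta> + K * (real ?m * (K * (2 * \<theta>))))) * S"
    by (simp add: algebra_simps)
  finally have "(1 - real ?m * (2 * \<theta> + K * (real ?m * (K * (2 * \<theta>))))) * S \<le> 0"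
    by (simp only: left_diff_distrib mult_1 diff_le_0_iff_le)
  with \<theta>(2) have "S \<le> 0" by (simp only: mult_le_0_iff) linarith
  then have "norm (D k) \<le> 0" using DS[OF k] by (rule order_trans[rotated])
  then show ?thesis by simp
qed

end

context riemann_profile
begin

lemma gap_after:
  assumes s: "lam i + \<delta> \<le> s" "\<And>k. lam i < lam k \<Longrightarrow> s \<le> lam k - \<delta>"
  shows "V s = right_state i"
  unfolding right_state_def
proof (rule constant_in_gap[of "{lam i + \<delta>..s}"])
  fix x k assume x: "x \<in> {lam i + \<delta>..s}"
  show "\<delta> \<le> \<bar>lam k - x\<bar>"
    using x s(2)[of k] \<delta>_pos by (cases "lam i < lam k") auto
qed (use s in auto)

lemma gap_before:
  assumes "\<And>k. s \<le> lam k - \<delta>" "\<And>k. t \<le> lam k - \<delta>"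
  shows "V s = V t"
proof (rule constant_in_gap[of "{..max s t}"])
  fix x k assume "x \<in> {..max s t}"
  then show "\<delta> \<le> \<bar>lam k - x\<bar>" using assms(1)[of k] assms(2)[of k] by auto
qed auto

end

locale two_profiles =
  v?: riemann_profile A0 lam r l \<delta> \<eta> f J J' Vbar \<rho> L e q g g' c \<epsilon> V M +
  w: riemann_profile A0 lam r l \<delta> \<eta> f J J' Vbar \<rho> L e q g g' c \<epsilon> W M'
  for A0 :: "real^'m^'m" and lam r l \<delta> \<eta> f J J' Vbar \<rho> L e q g g' c \<epsilon> V M W M' +
  assumes cone_small: "4 * K * (K * L * \<epsilon>) \<le> 1"
begin

definition comparable where
  "comparable i \<longleftrightarrow> (curv i \<noteq> 0 \<and> v.nonlinear_wave i \<and> w.nonlinear_wave i) \<or>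
    ((\<exists>\<sigma>. v.jump_at i \<sigma>) \<and> (\<exists>\<sigma>. w.jump_at i \<sigma>))"

abbreviation d where "d i \<equiv> (v.right_state i - v.left_state i) - (w.right_state i - w.left_state i)"

lemma wave_cone:
  assumes "comparable i"
  shows "norm (N i (d i)) \<le> 4 * K * (K * L * \<epsilon>) * (norm (d i) + norm (v.left_state i - w.left_state i))"
proof -
  let ?\<theta> = "4 * K * (K * L * \<epsilon>)"
  note \<epsilon> = \<epsilon>_bounds(2,1)
  have th: "0 \<le> ?\<theta>" using K_ge(1) KL_nonneg \<epsilon> by simp
  have weaken: "norm x \<le> ?\<theta> * norm (d i) \<Longrightarrow> norm x \<le> ?\<theta> * (norm (d i) + norm (v.left_state i - w.left_state i))" for x :: "real^'m"
    using mult_nonneg_nonneg[OF th norm_ge_zero[of "v.left_state i - w.left_state i"]] by (simp only: distrib_left)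
  have SS: ?thesis if "shock_pair i \<epsilon> (v.left_state i) (v.right_state i)" "shock_pair i \<epsilon> (w.left_state i) (w.right_state i)"
    using shock_shock_cone[OF that \<epsilon>] .
  show ?thesis
  proof (cases "(\<exists>\<sigma>. v.jump_at i \<sigma>) \<and> (\<exists>\<sigma>. w.jump_at i \<sigma>)")
    case True
    then show ?thesis using SS v.jump_shock_pair w.jump_shock_pair by blast
  next
    case False
    then have nl: "curv i \<noteq> 0" "v.nonlinear_wave i" "w.nonlinear_wave i" using assms by (auto simp: comparable_def)
    consider (v) "shock_pair i \<epsilon> (v.left_state i) (v.right_state i)" "sgn (curv i) * (l i \<bullet> (v.right_state i - v.left_state i)) \<le> 0"
      | (vf) \<Gamma> T where "fan_curve i \<epsilon> (sgn (curv i)) T \<Gamma>" "\<Gamma> 0 = v.left_state i" "\<Gamma> T = v.right_state i"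
      using v.nonlinear_wave_cases[OF nl(2,1)] by blast
    note v_cases = this
    consider (w) "shock_pair i \<epsilon> (w.left_state i) (w.right_state i)" "sgn (curv i) * (l i \<bullet> (w.right_state i - w.left_state i)) \<le> 0"
      | (wf) \<Gamma>' T' where "fan_curve i \<epsilon> (sgn (curv i)) T' \<Gamma>'" "\<Gamma>' 0 = w.left_state i" "\<Gamma>' T' = w.right_state i"
      using w.nonlinear_wave_cases[OF nl(3,1)] by blast
    note w_cases = this
    from v_cases show ?thesis
    proof cases
      case v
      from w_cases show ?thesis
      proof cases
        case w
        then show ?thesis using SS v by blast
      next
        case wf
        then show ?thesis
          using shock_fan_cone[OF v(1) wf(1) v(2) \<epsilon>] by (intro weaken) simp
      qed
    next
      case vf
      from w_cases show ?thesis
      proof cases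
        case w
        have "norm (N i ((w.right_state i - w.left_state i) - (v.right_state i - v.left_state i)))
            \<le> ?\<theta> * norm ((w.right_state i - w.left_state i) - (v.right_state i - v.left_state i))"
          using shock_fan_cone[OF w(1) vf(1) w(2) \<epsilon>] vf(2,3) by simp
        then have "norm (N i (d i)) \<le> ?\<theta> * norm (d i)"
          unfolding N_diff[of i "w.right_state i - w.left_state i"] N_diff[of i "v.right_state i - v.left_state i"]
          by (simp only: norm_minus_commute)
        then show ?thesis by (rule weaken)
      next
        case wf
        then show ?thesis
          using fan_fan_cone[OF vf(1) wf(1) \<epsilon>(1) cone_small] vf(2,3) by simp
      qed
    qed
  qed
qed

text \<open>Equal end states force equal waves: the speed of a jump is fixed by the Rankine-Hugoniot relation, and a fan by the integral curve through
  its left state. The sign of \<open>curv i * (l i \<bullet> (right_state i - left_state i))\<close> tells shocks from fans. Jumps may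
  differ at the point of discontinuity, whence finiteness rather than equality.\<close>
lemma wave_unique:
  assumes cmp: "comparable i" and eq: "v.left_state i = w.left_state i" "v.right_state i = w.right_state i"
  shows "finite {s \<in> strip i. V s \<noteq> W s}"
proof -
  have JJ: ?thesis if a: "v.jump_at i \<sigma>" and b: "w.jump_at i \<sigma>'" for \<sigma> \<sigma>'
  proof (cases "v.right_state i = v.left_state i")
    case True
    have "{s \<in> strip i. V s \<noteq> W s} \<subseteq> {\<sigma>, \<sigma>'}"
    proof (rule ccontr)
      assume "\<not> ?thesis"
      then obtain s where s: "s \<in> strip i" "V s \<noteq> W s" "s \<noteq> \<sigma>" "s \<noteq> \<sigma>'" by blast
      have "V s = v.left_state i" using a s True unfolding v.jump_at_def by (metis linorder_neqE)
      moreover have "W s = w.left_state i" using b s True eq unfolding w.jump_at_def by (metis linorder_neqE)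
      ultimately show False using s eq by simp
    qed
    then show ?thesis using finite_subset by blast
  next
    case False
    have "\<sigma> *\<^sub>R (v.right_state i - v.left_state i) = \<sigma>' *\<^sub>R (v.right_state i - v.left_state i)"
      using a b eq unfolding v.jump_at_def w.jump_at_def by metis
    then have ss: "\<sigma> = \<sigma>'" using False by simp
    have "{s \<in> strip i. V s \<noteq> W s} \<subseteq> {\<sigma>}"
    proof (rule ccontr)
      assume "\<not> ?thesis"
      then obtain s where s: "s \<in> strip i" "V s \<noteq> W s" "s \<noteq> \<sigma>" by blast
      then show False using a b ss eq unfolding v.jump_at_def w.jump_at_def by (metis linorder_neqE)
    qed
    then show ?thesis using finite_subset by blast
  qed
  have agree: ?thesis if "\<And>s. s \<in> strip i \<Longrightarrow> V s = W s"
  proof -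
    have "{s \<in> strip i. V s \<noteq> W s} = {}" using that by blast
    then show ?thesis by (simp only: finite.emptyI)
  qed
  show ?thesis
  proof (cases "(\<exists>\<sigma>. v.jump_at i \<sigma>) \<and> (\<exists>\<sigma>. w.jump_at i \<sigma>)")
    case True
    then show ?thesis using JJ by blast
  next
    case False
    then have nl: "curv i \<noteq> 0" "v.nonlinear_wave i" "w.nonlinear_wave i" using cmp by (auto simp: comparable_def)
    let ?D = "v.right_state i - v.left_state i"
    have fan_sign: "l i \<bullet> (\<Gamma> T - \<Gamma> 0) = sgn (curv i) * T" "0 \<le> T" if "fan_curve i \<epsilon> (sgn (curv i)) T \<Gamma>" for \<Gamma> T
      using fan_cone(1)[OF that \<epsilon>_bounds(2), of 0 T] that by (auto simp: fan_curve_def)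
    have fan_pos: "0 \<le> curv i * (l i \<bullet> (\<Gamma> T - \<Gamma> 0))" if "fan_curve i \<epsilon> (sgn (curv i)) T \<Gamma>" for \<Gamma> T
      unfolding fan_sign(1)[OF that] using fan_sign(2)[OF that] by (auto simp: sgn_if mult_nonpos_nonneg)
    have fan_zero: "T = 0" if "fan_curve i \<epsilon> (sgn (curv i)) T \<Gamma>" "\<Gamma> T = \<Gamma> 0" for \<Gamma> T
      using fan_sign(1)[OF that(1)] that(2) nl(1) by (simp add: sgn_if split: if_splits)
    have trivial_fan: "\<And>s. s \<in> strip i \<Longrightarrow> V s = v.left_state i"
      if F: "v.fan i a b" and G: "fan_curve i \<epsilon> (sgn (curv i)) T \<Gamma>" "\<Gamma> 0 = v.left_state i" "\<Gamma> T = v.right_state i"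
        "V ` {a..b} = \<Gamma> ` {0..T}" and z: "v.right_state i = v.left_state i" for a b \<Gamma> T
    proof -
      have "T = 0" using fan_zero[OF G(1)] G z by simp
      then have im: "V s = v.left_state i" if "s \<in> {a..b}" for s using G(2,4) that by auto
      fix s assume "s \<in> strip i"
      then show "V s = v.left_state i"
        using F z im[of s] unfolding v.fan_def by (cases "s \<le> a"; cases "b \<le> s") auto
    qed
    have trivial_fan': "\<And>s. s \<in> strip i \<Longrightarrow> W s = w.left_state i"
      if F: "w.fan i a b" and G: "fan_curve i \<epsilon> (sgn (curv i)) T \<Gamma>" "\<Gamma> 0 = w.left_state i" "\<Gamma> T = w.right_state i"
        "W ` {a..b} = \<Gamma> ` {0..T}" and z: "w.right_state i = w.left_state i" for a b \<Gamma> T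
    proof -
      have "T = 0" using fan_zero[OF G(1)] G z by simp
      then have im: "W s = w.left_state i" if "s \<in> {a..b}" for s using G(2,4) that by auto
      fix s assume "s \<in> strip i"
      then show "W s = w.left_state i"
        using F z im[of s] unfolding w.fan_def by (cases "s \<le> a"; cases "b \<le> s") auto
    qed
    have FF: "\<And>s. s \<in> strip i \<Longrightarrow> V s = W s"
      if F: "v.fan i a b" "fan_curve i \<epsilon> (sgn (curv i)) T \<Gamma>" "\<Gamma> 0 = v.left_state i" "\<Gamma> T = v.right_state i"
        "V ` {a..b} = \<Gamma> ` {0..T}"
      and F': "w.fan i a' b'" "fan_curve i \<epsilon> (sgn (curv i)) T' \<Gamma>'" "\<Gamma>' 0 = w.left_state i" "\<Gamma>' T' = w.right_state i"
        "W ` {a'..b'} = \<Gamma>' ` {0..T'}" for a b T \<Gamma> a' b' T' \<Gamma>'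
    proof -
      have "sgn (curv i) * T = sgn (curv i) * T'"
        using fan_sign(1)[OF F(2)] fan_sign(1)[OF F'(2)] F(3,4) F'(3,4) eq by simp
      then have TT: "T' = T" using nl(1) by (simp add: sgn_if split: if_splits)
      have GG: "\<Gamma> t = \<Gamma>' t" if "t \<in> {0..T}" for t
        using fan_fan_close(1)[OF F(2) F'(2)[unfolded TT] order_refl \<epsilon>_bounds(2) cone_small that] F(3) F'(3) eq by simp
      have ab: "a \<in> strip i" "b \<in> strip i" "a' \<in> strip i" "b' \<in> strip i" "a \<le> b" "a' \<le> b'"
        using F(1) F'(1) \<delta>_pos by (auto simp: v.fan_def w.fan_def strip_iff)
      have sp: "speed i (V s) = s" if "s \<in> {a..b}" for s using F(1) that by (simp add: v.fan_def)
      have sp': "speed i (W s) = s" if "s \<in> {a'..b'}" for s using F'(1) that by (simp add: w.fan_def)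
      have Vab: "V a = v.left_state i" "V b = v.right_state i" "W a' = w.left_state i" "W b' = w.right_state i"
        using F(1) F'(1) ab by (auto simp: v.fan_def w.fan_def)
      have aa: "a' = a" "b' = b"
        using sp[of a] sp[of b] sp'[of a'] sp'[of b'] ab Vab eq by auto
      fix s assume s: "s \<in> strip i"
      show "V s = W s"
      proof (cases "s \<in> {a..b}")
        case True
        have "W s \<in> W ` {a'..b'}" using True aa by blast
        then obtain t where t: "t \<in> {0..T}" "W s = \<Gamma>' t" using F'(5) TT by auto
        then have "W s = \<Gamma> t" using GG by simp
        then have "W s \<in> V ` {a..b}" using F(5) t(1) by blast
        then obtain s' where s': "s' \<in> {a..b}" "W s = V s'" by blast
        have "s' = s" using sp[OF s'(1)] sp'[of s] True aa s'(2) by simp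
        then show ?thesis using s' by simp
      next
        case False
        then show ?thesis using F(1) F'(1) s aa eq unfolding v.fan_def w.fan_def by (cases "s \<le> a") auto
      qed
    qed
    have neg: "\<not> (curv i * (l i \<bullet> ?D) < 0)" if "?D = 0" using that by simp
    note v = nl(2)[unfolded v.nonlinear_wave_def]
    note w = nl(3)[unfolded w.nonlinear_wave_def, folded eq]
    from v show ?thesis
    proof (elim disjE exE conjE)
      fix \<sigma> assume j: "v.jump_at i \<sigma>" and n: "curv i * (l i \<bullet> ?D) < 0"
      from w show ?thesis
      proof (elim disjE exE conjE)
        fix \<sigma>' assume "w.jump_at i \<sigma>'"
        then show ?thesis using JJ[OF j] by blast
      next
        fix a b \<Gamma> T assume "fan_curve i \<epsilon> (sgn (curv i)) T \<Gamma>" "\<Gamma> 0 = v.left_state i" "\<Gamma> T = v.right_state i"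
        then show ?thesis using fan_pos[of T \<Gamma>] n by simp
      next
        assume "\<forall>s\<in>strip i. W s = v.left_state i"
        then have "?D = 0" using w.constant_states eq by simp
        then show ?thesis using neg n by blast
      qed
    next
      fix a b \<Gamma> T assume F: "v.fan i a b" "fan_curve i \<epsilon> (sgn (curv i)) T \<Gamma>" "\<Gamma> 0 = v.left_state i" "\<Gamma> T = v.right_state i"
        "V ` {a..b} = \<Gamma> ` {0..T}"
      from w show ?thesis
      proof (elim disjE exE conjE)
        fix \<sigma>' assume "curv i * (l i \<bullet> ?D) < 0"
        then show ?thesis using fan_pos[OF F(2)] F(3,4) by simp
      next
        fix a' b' \<Gamma>' T' assume "w.fan i a' b'" "fan_curve i \<epsilon> (sgn (curv i)) T' \<Gamma>'" "\<Gamma>' 0 = v.left_state i"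
          "\<Gamma>' T' = v.right_state i" "W ` {a'..b'} = \<Gamma>' ` {0..T'}"
        then show ?thesis using FF[OF F] eq by (intro agree) metis
      next
        assume Wc: "\<forall>s\<in>strip i. W s = v.left_state i"
        then have "v.right_state i = v.left_state i" using w.constant_states eq by simp
        then show ?thesis using trivial_fan[OF F] Wc by (intro agree) simp
      qed
    next
      assume Vc: "\<forall>s\<in>strip i. V s = v.left_state i"
      then have z: "v.right_state i = v.left_state i" by (rule v.constant_states)
      from w show ?thesis
      proof (elim disjE exE conjE)
        fix \<sigma>' assume "curv i * (l i \<bullet> ?D) < 0"
        then show ?thesis using neg z by simp
      next
        fix a' b' \<Gamma>' T' assume "w.fan i a' b'" "fan_curve i \<epsilon> (sgn (curv i)) T' \<Gamma>'" "\<Gamma>' 0 = v.left_state i"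
          "\<Gamma>' T' = v.right_state i" "W ` {a'..b'} = \<Gamma>' ` {0..T'}"
        then have "W s = w.left_state i" if "s \<in> strip i" for s
          using trivial_fan'[of a' b' T' \<Gamma>' s] that z eq by simp
        then show ?thesis using Vc eq by (intro agree) simp
      next
        assume "\<forall>s\<in>strip i. W s = v.left_state i"
        then show ?thesis using Vc by (intro agree) simp
      qed
    qed
  qed
qed

text \<open>Let \<open>D k\<close> be the difference of the two profiles in the constant region before the \<open>k\<close>-th wave. It vanishes at both
  ends, and its increments satisfy the cone condition, so \<open>cone_sum_zero\<close> applies.\<close>
theorem profiles_agree:
  assumes cmp: "\<And>i. comparable i"
    and p: "bij_betw p {..<CARD('m)} (UNIV :: 'm set)"
    and mono: "\<And>j k. j < k \<Longrightarrow> k < CARD('m) \<Longrightarrow> lam (p j) < lam (p k)"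
    and ends: "\<And>s. (\<And>k. s \<le> lam k - \<delta>) \<Longrightarrow> V s = W s" "\<And>s. (\<And>k. lam k + \<delta> \<le> s) \<Longrightarrow> V s = W s"
    and small: "real (CARD('m)) * (2 * (4 * K * (K * L * \<epsilon>)) + K * (real (CARD('m)) * (K * (2 * (4 * K * (K * L * \<epsilon>)))))) < 1"
  shows "finite {s. V s \<noteq> W s}"
proof -
  let ?m = "CARD('m)"
  have m: "0 < ?m" by simp
  have img: "\<exists>j<?m. i = p j" for i using p by (metis UNIV_I bij_betw_def imageE lessThan_iff)
  have lam_le: "lam (p j) \<le> lam (p k)" if "j \<le> k" "k < ?m" for j k
    using mono[of j k] that by (cases "j = k") auto
  have sep: "lam (p j) + 4 * \<delta> \<le> lam (p k)" if "j < k" "k < ?m" for j k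
    using mono[OF that] separated[of "p k" "p j"] by fastforce
  have v_next: "v.left_state (p (Suc k)) = v.right_state (p k)" and w_next: "w.left_state (p (Suc k)) = w.right_state (p k)"
    if k: "Suc k < ?m" for k
  proof -
    have 1: "lam (p k) + \<delta> \<le> lam (p (Suc k)) - \<delta>" using sep[of k "Suc k"] k \<delta>_pos by simp
    have 2: "lam (p (Suc k)) - \<delta> \<le> lam j - \<delta>" if lt: "lam (p k) < lam j" for j
    proof -
      obtain n where n: "n < ?m" "j = p n" using img by blast
      have "k < n" using lt n k lam_le[of n k] by (metis Suc_lessD not_le)
      then show ?thesis using lam_le[of "Suc k" n] n by simp
    qed
    show "v.left_state (p (Suc k)) = v.right_state (p k)" "w.left_state (p (Suc k)) = w.right_state (p k)"
      unfolding v.left_state_def w.left_state_def by (intro v.gap_after w.gap_after 1 2; assumption)+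
  qed
  define D where "D k = (if k = 0 then 0 else v.right_state (p (k - 1)) - w.right_state (p (k - 1)))" for k :: nat
  have first: "v.left_state (p 0) = w.left_state (p 0)"
    unfolding v.left_state_def w.left_state_def
  proof (rule ends(1))
    fix k obtain n where "n < ?m" "k = p n" using img by blast
    then show "lam (p 0) - \<delta> \<le> lam k - \<delta>" using lam_le[of 0 n] by simp
  qed
  have last: "v.right_state (p (?m - 1)) = w.right_state (p (?m - 1))"
    unfolding v.right_state_def w.right_state_def
  proof (rule ends(2))
    fix k obtain n where "n < ?m" "k = p n" using img by blast
    then show "lam k + \<delta> \<le> lam (p (?m - 1)) + \<delta>" using lam_le[of n "?m - 1"] by simp
  qed
  have D_left: "D k = v.left_state (p k) - w.left_state (p k)" if "k < ?m" for k
    using first v_next[of "k - 1"] w_next[of "k - 1"] that by (cases k) (auto simp: D_def)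
  have D_right: "D (Suc k) = v.right_state (p k) - w.right_state (p k)" for k by (simp add: D_def)
  have D_diff: "D (Suc k) - D k = d (p k)" if "k < ?m" for k
    unfolding D_right D_left[OF that] by simp
  have D0: "D k = 0" if "k \<le> ?m" for k
  proof (rule cone_sum_zero[OF p _ _ _ _ small that])
    show "D 0 = 0" by (simp add: D_def)
    show "D ?m = 0" using last m by (simp add: D_def)
    show "norm (N (p k) (D (Suc k) - D k)) \<le> 4 * K * (K * L * \<epsilon>) * (norm (D (Suc k) - D k) + norm (D k))" if "k < ?m" for k
      using wave_cone[OF cmp, of "p k"]
      by (simp only: D_diff[OF that, symmetric] D_left[OF that, symmetric])
    show "0 \<le> 4 * K * (K * L * \<epsilon>)" using K_ge(1) KL_nonneg \<epsilon>_bounds by simp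
  qed
  have st: "v.left_state i = w.left_state i" "v.right_state i = w.right_state i" for i
  proof -
    obtain k where k: "k < ?m" "i = p k" using img by blast
    show "v.left_state i = w.left_state i" using D_left[OF k(1)] D0[of k] k by simp
    show "v.right_state i = w.right_state i" using D_right[of k] D0[of "Suc k"] k by simp
  qed
  have "{s. V s \<noteq> W s} \<subseteq> (\<Union>i. {s \<in> strip i. V s \<noteq> W s})"
  proof
    fix s assume s: "s \<in> {s. V s \<noteq> W s}"
    show "s \<in> (\<Union>i. {s \<in> strip i. V s \<noteq> W s})"
    proof (rule ccontr)
      assume "\<not> ?thesis"
      then have far: "2 * \<delta> \<le> \<bar>s - lam i\<bar>" for i using s by (auto simp: strip_iff not_less)
      show False
      proof (cases "\<exists>i. lam i < s")
        case False
        have "s \<le> lam k - \<delta>" for k using False far[of k] \<delta>_pos by (smt (verit))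
        then show False using ends(1) s by blast
      next
        case True
        let ?A = "lam ` {i. lam i < s}"
        have fin: "finite ?A" and "?A \<noteq> {}" using True by auto
        then have "Max ?A \<in> ?A" by (rule Max_in)
        then obtain i0 where i0: "lam i0 < s" "Max ?A = lam i0" by auto
        have "lam k \<le> lam i0" if "lam k < s" for k
          using Max_ge[OF fin, of "lam k"] i0(2) that by auto
        with i0(1) obtain i where i: "lam i < s" "\<And>k. lam k < s \<Longrightarrow> lam k \<le> lam i" by blast
        have 1: "lam i + \<delta> \<le> s" using far[of i] i(1) \<delta>_pos by linarith
        have 2: "s \<le> lam k - \<delta>" if "lam i < lam k" for k
          using far[of k] i(2)[of k] that \<delta>_pos by (smt (verit))
        show False using v.gap_after[OF 1 2] w.gap_after[OF 1 2] st(2)[of i] s by simp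
      qed
    qed
  qed
  then show ?thesis
    by (rule finite_subset) (use wave_unique[OF cmp st] in auto)
qed

end

section \<open>Smooth bumps and steps\<close>

lemma Ck_on_imp_differentiable: "Ck_on (Suc k) f S \<Longrightarrow> x \<in> S \<Longrightarrow> (f has_derivative frechet_derivative f (at x)) (at x)"
  by (simp add: frechet_derivative_works)

text \<open>The Frechet derivative agrees with \<open>D\<close> on \<open>S\<close> only, so congruence at level \<open>k\<close> enters as a hypothesis. In the proof of
  \<open>Ck_on_cong\<close> it is the induction hypothesis.\<close>
lemma Ck_on_SucI:
  fixes f :: "'a::euclidean_space \<Rightarrow> 'b::real_normed_vector"
  assumes "\<And>x. x \<in> S \<Longrightarrow> (f has_derivative D x) (at x)" and "\<And>h. Ck_on k (\<lambda>x. D x h) S"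
    and cong: "\<And>(g :: 'a \<Rightarrow> 'b) g'. \<lbrakk>\<And>x. x \<in> S \<Longrightarrow> g x = g' x; Ck_on k g S\<rbrakk> \<Longrightarrow> Ck_on k g' S"
  shows "Ck_on (Suc k) f S"
proof -
  have "frechet_derivative f (at x) = D x" if "x \<in> S" for x
    using frechet_derivative_at[OF assms(1)[OF that]] by simp
  then have "Ck_on k (\<lambda>x. frechet_derivative f (at x) h) S" for h
    using cong[OF _ assms(2)[of h]] by simp
  then show ?thesis
    using assms(1) by (auto simp: differentiable_def)
qed

lemma Ck_on_cong:
  assumes "open S" "\<And>x. x \<in> S \<Longrightarrow> f x = g x" "Ck_on k f S"
  shows "Ck_on k g S"
  using assms(2,3)
proof (induction k arbitrary: f g)
  case 0
  then show ?case using continuous_on_cong by force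
next
  case (Suc k)
  show ?case
  proof (rule Ck_on_SucI)
    show "(g has_derivative frechet_derivative f (at x)) (at x)" if "x \<in> S" for x
      using has_derivative_transform_within_open[OF Ck_on_imp_differentiable[OF Suc.prems(2) that] assms(1) that Suc.prems(1)] .
    show "Ck_on k (\<lambda>x. frechet_derivative f (at x) h) S" for h using Suc.prems(2) by simp
  qed (rule Suc.IH)
qed

lemma Ck_on_derivI:
  fixes f :: "'a::euclidean_space \<Rightarrow> 'b::real_normed_vector"
  assumes "open S" "\<And>x. x \<in> S \<Longrightarrow> (f has_derivative D x) (at x)" "\<And>h. Ck_on k (\<lambda>x. D x h) S"
  shows "Ck_on (Suc k) f S"
  using assms(2,3)
proof (rule Ck_on_SucI)
  show "Ck_on k g' S" if "\<And>x. x \<in> S \<Longrightarrow> g x = g' x" "Ck_on k g S" for g g' :: "'a \<Rightarrow> 'b"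
    using that by (rule Ck_on_cong[OF assms(1)])
qed

lemma Ck_on_continuous: "Ck_on k f S \<Longrightarrow> continuous_on S f"
  by (cases k) (auto intro!: continuous_at_imp_continuous_on differentiable_imp_continuous_within)

lemma Ck_on_Suc_imp: "Ck_on (Suc k) f S \<Longrightarrow> Ck_on k f S"
proof (induction k arbitrary: f)
  case 0
  show ?case using Ck_on_continuous[OF 0] by simp
qed auto

lemma Ck_on_const: "open S \<Longrightarrow> Ck_on k (\<lambda>x. c) S"
proof (induction k arbitrary: c)
  case (Suc k)
  show ?case by (rule Ck_on_derivI[OF Suc.prems has_derivative_const]) (rule Suc.IH[OF Suc.prems])
qed simp

lemma Ck_on_linear: "bounded_linear f \<Longrightarrow> open S \<Longrightarrow> Ck_on k f S"
proof (cases k)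
  case 0
  assume "bounded_linear f"
  then show ?thesis using 0 by (simp add: linear_continuous_on)
next
  case (Suc k)
  assume f: "bounded_linear f" and S: "open S"
  show ?thesis
    unfolding Suc by (rule Ck_on_derivI[OF S bounded_linear_imp_has_derivative[OF f]]) (rule Ck_on_const[OF S])
qed

lemma Ck_on_add:
  assumes "open S" "Ck_on k f S" "Ck_on k g S"
  shows "Ck_on k (\<lambda>x. f x + g x) S"
  using assms(2,3)
proof (induction k arbitrary: f g)
  case 0
  then show ?case by (auto intro: continuous_on_add)
next
  case (Suc k)
  show ?case
  proof (rule Ck_on_derivI[OF assms(1)])
    show "((\<lambda>x. f x + g x) has_derivative (\<lambda>h. frechet_derivative f (at x) h + frechet_derivative g (at x) h)) (at x)"
      if "x \<in> S" for x
      by (intro has_derivative_add Ck_on_imp_differentiable[OF Suc.prems(1) that] Ck_on_imp_differentiable[OF Suc.prems(2) that])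
    show "Ck_on k (\<lambda>x. frechet_derivative f (at x) h + frechet_derivative g (at x) h) S" for h
      using Suc.prems by (intro Suc.IH) auto
  qed
qed

lemma Ck_on_mult:
  fixes f g :: "'a::euclidean_space \<Rightarrow> real"
  assumes "open S" "Ck_on k f S" "Ck_on k g S"
  shows "Ck_on k (\<lambda>x. f x * g x) S"
  using assms(2,3)
proof (induction k arbitrary: f g)
  case 0
  then show ?case by (auto intro: continuous_on_mult)
next
  case (Suc k)
  show ?case
  proof (rule Ck_on_derivI[OF assms(1)])
    show "((\<lambda>x. f x * g x) has_derivative (\<lambda>h. f x * frechet_derivative g (at x) h + frechet_derivative f (at x) h * g x)) (at x)"
      if "x \<in> S" for x
      by (rule has_derivative_mult[OF Ck_on_imp_differentiable[OF Suc.prems(1) that] Ck_on_imp_differentiable[OF Suc.prems(2) that]])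
    show "Ck_on k (\<lambda>x. f x * frechet_derivative g (at x) h + frechet_derivative f (at x) h * g x) S" for h
      using Suc.prems Ck_on_Suc_imp[OF Suc.prems(1)] Ck_on_Suc_imp[OF Suc.prems(2)]
      by (intro Ck_on_add[OF assms(1)] Suc.IH) auto
  qed
qed

lemma Ck_on_compose:
  fixes F :: "real \<Rightarrow> real" and g :: "'a::euclidean_space \<Rightarrow> real"
  assumes "open S" and "g ` S \<subseteq> T" and "Ck_on k F T" "Ck_on k g S"
  shows "Ck_on k (\<lambda>x. F (g x)) S"
  using assms(3,4)
proof (induction k arbitrary: F)
  case 0
  then show ?case using assms(2) by (auto intro: continuous_on_compose2)
next
  case (Suc k)
  show ?case
  proof (rule Ck_on_derivI[OF assms(1)])
    fix x assume x: "x \<in> S"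
    have F: "(F has_derivative frechet_derivative F (at (g x))) (at (g x))"
      using assms(2) x by (intro Ck_on_imp_differentiable[OF Suc.prems(1)]) auto
    have lin: "frechet_derivative F (at (g x)) y = frechet_derivative F (at (g x)) 1 * y" for y
      using linear_scale[OF has_derivative_linear[OF F], of y 1] by simp
    have "((\<lambda>x. F (g x)) has_derivative (\<lambda>h. frechet_derivative F (at (g x)) (frechet_derivative g (at x) h))) (at x)"
      by (rule has_derivative_compose[OF Ck_on_imp_differentiable[OF Suc.prems(2) x] F])
    moreover have "(\<lambda>h. frechet_derivative F (at (g x)) (frechet_derivative g (at x) h))
        = (\<lambda>h. frechet_derivative F (at (g x)) 1 * frechet_derivative g (at x) h)"
      by (rule ext) (rule lin)
    ultimately show "((\<lambda>x. F (g x)) has_derivative (\<lambda>h. frechet_derivative F (at (g x)) 1 * frechet_derivative g (at x) h)) (at x)"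
      by (simp only:)
  next
    fix h
    have "Ck_on k (\<lambda>y. frechet_derivative F (at y) 1) T" using Suc.prems(1) by simp
    from Suc.IH[OF this Ck_on_Suc_imp[OF Suc.prems(2)]]
    have 1: "Ck_on k (\<lambda>x. frechet_derivative F (at (g x)) 1) S" .
    have 2: "Ck_on k (\<lambda>x. frechet_derivative g (at x) h) S" using Suc.prems(2) by simp
    show "Ck_on k (\<lambda>x. frechet_derivative F (at (g x)) 1 * frechet_derivative g (at x) h) S"
      by (rule Ck_on_mult[OF assms(1) 1 2])
  qed
qed

lemma Ck_on_Un:
  assumes "open S" "open T" "Ck_on k f S" "Ck_on k f T"
  shows "Ck_on k f (S \<union> T)"
  using assms(3,4)
proof (induction k arbitrary: f)
  case 0
  then show ?case using assms by (simp add: continuous_on_open_Un)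
qed auto

lemma Ck_on_real_derivI:
  fixes f :: "real \<Rightarrow> real"
  assumes "open S" "\<And>x. x \<in> S \<Longrightarrow> (f has_real_derivative f' x) (at x)" "Ck_on k f' S"
  shows "Ck_on (Suc k) f S"
proof (rule Ck_on_derivI[OF assms(1)])
  show "(f has_derivative (\<lambda>h. f' x * h)) (at x)" if "x \<in> S" for x
    using assms(2)[OF that] by (simp add: has_field_derivative_def)
  show "Ck_on k (\<lambda>x. f' x * h) S" for h
    by (intro Ck_on_mult assms Ck_on_const)
qed

lemma Ck_on_inverse: "Ck_on k (inverse :: real \<Rightarrow> real) {0<..}"
proof (induction k)
  case 0
  then show ?case by (auto intro!: continuous_intros)
next
  case (Suc k)
  have "Ck_on k (\<lambda>x::real. (-1) * (inverse x * inverse x)) {0<..}"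
    by (intro Ck_on_mult Ck_on_const Suc open_greaterThan)
  then show ?case
    by (rule Ck_on_real_derivI[rotated 2]) (auto intro!: derivative_eq_intros)
qed

text \<open>The powers \<open>x^(-n)\<close> are included to make the family closed under differentiation, which gives smoothness by induction.\<close>
definition flat :: "nat \<Rightarrow> real \<Rightarrow> real" where
  "flat n x = (if x > 0 then exp (- inverse x) * inverse x ^ n else 0)"

lemma flat_tendsto_0: "(flat n \<longlongrightarrow> 0) (at 0)"
proof -
  have "((\<lambda>x::real. inverse x ^ n / exp (inverse x)) \<longlongrightarrow> 0) (at_right 0)"
    using filterlim_compose[OF tendsto_power_div_exp_0 filterlim_inverse_at_top_right] .
  then have "(flat n \<longlongrightarrow> 0) (at_right 0)"
    by (rule Lim_transform_eventually)
      (auto simp: flat_def exp_minus divide_inverse mult.commute eventually_at_right_field intro!: exI[of _ 1])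
  moreover have "(flat n \<longlongrightarrow> 0) (at_left 0)"
    by (rule tendsto_eventually) (auto simp: flat_def eventually_at_left_field intro!: exI[of _ "-1"])
  ultimately show ?thesis by (simp add: filterlim_split_at)
qed

lemma flat_deriv: "(flat n has_real_derivative flat (n + 2) x + (- real n) * flat (n + 1) x) (at x)"
proof (cases x "0::real" rule: linorder_cases)
  case less
  have "((\<lambda>x. 0) has_real_derivative 0) (at x)" by simp
  then have "(flat n has_real_derivative 0) (at x)"
    by (rule has_field_derivative_transform_within_open[of _ _ _ "{..<0}"]) (use less in \<open>auto simp: flat_def\<close>)
  then show ?thesis using less by (simp add: flat_def)
next
  case equal
  have "(\<lambda>y. (flat n y - flat n 0) / (y - 0)) \<midarrow>0\<rightarrow> 0"
  proof (rule Lim_transform_eventually[OF flat_tendsto_0[of "Suc n"]])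
    show "\<forall>\<^sub>F y in at 0. flat (Suc n) y = (flat n y - flat n 0) / (y - 0)"
      by (auto simp: flat_def divide_inverse)
  qed
  then show ?thesis using equal by (simp add: has_field_derivative_iff flat_def)
next
  case greater
  have eq: "exp (- inverse x) * (inverse x * inverse x) * inverse x ^ n
      + exp (- inverse x) * (real n * inverse x ^ (n - Suc 0) * (- (inverse x * inverse x)))
      = flat (n + 2) x + (- real n) * flat (n + 1) x"
  proof (cases n)
    case 0
    then show ?thesis using greater by (simp add: flat_def power2_eq_square)
  next
    case (Suc k)
    then show ?thesis using greater by (simp add: flat_def power2_eq_square algebra_simps)
  qed
  have "((\<lambda>x. exp (- inverse x) * inverse x ^ n) has_real_derivative
      exp (- inverse x) * (inverse x * inverse x) * inverse x ^ n
      + exp (- inverse x) * (real n * inverse x ^ (n - Suc 0) * (- (inverse x * inverse x)))) (at x)"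
    using greater by (auto intro!: derivative_eq_intros simp: algebra_simps)
  then have "(flat n has_real_derivative
      exp (- inverse x) * (inverse x * inverse x) * inverse x ^ n
      + exp (- inverse x) * (real n * inverse x ^ (n - Suc 0) * (- (inverse x * inverse x)))) (at x)"
    by (rule has_field_derivative_transform_within_open[of _ _ _ "{0<..}"]) (use greater in \<open>auto simp: flat_def\<close>)
  then show ?thesis unfolding eq .
qed

lemma Ck_on_flat: "Ck_on k (flat n) UNIV"
proof (induction k arbitrary: n)
  case 0
  then show ?case
    using flat_deriv DERIV_continuous by (fastforce simp: continuous_on_eq_continuous_at)
next
  case (Suc k)
  show ?case
    by (rule Ck_on_real_derivI[OF open_UNIV flat_deriv])
      (intro Ck_on_add Ck_on_mult Ck_on_const Suc open_UNIV)
qed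

text \<open>Smooth approximations, as \<open>n\<close> grows, of the indicator function of \<open>{0<..<h}\<close>.\<close>
definition bump :: "nat \<Rightarrow> real \<Rightarrow> real \<Rightarrow> real" where
  "bump n h x = flat 0 (real (Suc n) * x) * flat 0 (real (Suc n) * (h - x))"

lemma flat_bounds: "0 \<le> flat 0 x" "flat 0 x \<le> 1" "flat 0 x = 0 \<longleftrightarrow> x \<le> 0"
  by (auto simp: flat_def)

lemma bump_bounds: "0 \<le> bump n h x" "bump n h x \<le> 1" "bump n h x \<noteq> 0 \<longleftrightarrow> 0 < x \<and> x < h"
  unfolding bump_def using flat_bounds by (auto intro: mult_le_one simp: zero_less_mult_iff mult_le_0_iff not_le)

lemma bump_zero: "x \<le> 0 \<or> h \<le> x \<Longrightarrow> bump n h x = 0"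
  using bump_bounds(3)[of n h x] by (meson not_le)

lemma Ck_on_affine: "Ck_on k (\<lambda>x::real. c * x + d) UNIV"
  by (intro Ck_on_add Ck_on_linear Ck_on_const bounded_linear_mult_right open_UNIV)

lemma Ck_on_bump: "Ck_on k (bump n h) UNIV"
proof -
  have 1: "Ck_on k (\<lambda>x. flat 0 (real (Suc n) * x + 0)) UNIV"
    by (rule Ck_on_compose[OF open_UNIV subset_UNIV Ck_on_flat Ck_on_affine])
  have 2: "Ck_on k (\<lambda>x. flat 0 (- real (Suc n) * x + real (Suc n) * h)) UNIV"
    by (rule Ck_on_compose[OF open_UNIV subset_UNIV Ck_on_flat Ck_on_affine])
  have "(\<lambda>x. flat 0 (real (Suc n) * x + 0) * flat 0 (- real (Suc n) * x + real (Suc n) * h)) = bump n h"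
  proof
    fix x
    have "- real (Suc n) * x + real (Suc n) * h = real (Suc n) * (h - x)" by (simp add: algebra_simps)
    then show "flat 0 (real (Suc n) * x + 0) * flat 0 (- real (Suc n) * x + real (Suc n) * h) = bump n h x"
      unfolding bump_def by (simp only: add_0_right)
  qed
  then show ?thesis using Ck_on_mult[OF open_UNIV 1 2] by simp
qed

lemma bump_continuous: "continuous_on S (bump n h)"
  using Ck_on_continuous[OF Ck_on_bump] continuous_on_subset by blast

lemma flat_scaled_limit: "x > 0 \<Longrightarrow> (\<lambda>n. flat 0 (real (Suc n) * x)) \<longlonglongrightarrow> 1"
proof -
  assume x: "x > 0"
  have "(\<lambda>n. exp (- (inverse (real (Suc n)) * inverse x))) \<longlonglongrightarrow> exp (- (0 * inverse x))"
    by (intro tendsto_intros LIMSEQ_inverse_real_of_nat)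
  then show ?thesis using x by (simp add: flat_def)
qed

lemma bump_limit: "(\<lambda>n. bump n h x) \<longlonglongrightarrow> indicator {0<..<h} x"
proof (cases "0 < x \<and> x < h")
  case True
  then have "(\<lambda>n. bump n h x) \<longlonglongrightarrow> 1 * 1"
    unfolding bump_def by (intro tendsto_mult flat_scaled_limit) auto
  then show ?thesis using True by simp
next
  case False
  then have "bump n h x = 0" for n using bump_bounds(3) by blast
  then show ?thesis using False by (auto simp: indicator_def)
qed

text \<open>The lower limit is any point to the left of the support of the bump.\<close>
definition step :: "nat \<Rightarrow> real \<Rightarrow> real \<Rightarrow> real" where
  "step n h x = integral {-1..x} (bump n h)"

lemma step_deriv: "(step n h has_real_derivative bump n h x) (at x)"
proof (cases "x < 0")
  case True
  have "step n h y = 0" if "y < 0" for y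
  proof -
    have "integral {-1..y} (bump n h) = integral {-1..y} (\<lambda>x. 0)"
      using that by (intro integral_cong bump_zero) auto
    then show ?thesis by (simp add: step_def)
  qed
  moreover have "bump n h x = 0" using True bump_bounds(3)[of n h x] by auto
  ultimately show ?thesis
    using has_field_derivative_transform_within_open[of "\<lambda>x. 0" 0 x "{..<0}" "step n h", OF DERIV_const]
      True by simp
next
  case False
  have "((\<lambda>x. integral {-1..x} (bump n h)) has_vector_derivative bump n h x) (at x within {-1..x+1})"
    by (rule integral_has_vector_derivative[OF bump_continuous]) (use False in auto)
  moreover have "x \<in> interior {-1..x+1}" using False by simp
  ultimately show ?thesis
    unfolding step_def[abs_def] has_real_derivative_iff_has_vector_derivative
    using at_within_interior by metis
qed

lemma Ck_on_step: "Ck_on k (step n h) UNIV"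
proof (cases k)
  case 0
  then show ?thesis
    using step_deriv DERIV_continuous by (fastforce simp: continuous_on_eq_continuous_at)
next
  case (Suc k)
  then show ?thesis using Ck_on_real_derivI[OF open_UNIV step_deriv Ck_on_bump] by simp
qed

lemma step_mono:
  assumes "x \<le> y"
  shows "step n h x \<le> step n h y"
proof (rule DERIV_nonneg_imp_nondecreasing[OF assms])
  show "\<exists>D. (step n h has_real_derivative D) (at t) \<and> 0 \<le> D" for t
    using step_deriv[of n h t] bump_bounds(1)[of n h t] by (intro exI[of _ "bump n h t"] conjI)
qed

lemma step_left: "x \<le> 0 \<Longrightarrow> step n h x = 0"
proof -
  assume "x \<le> 0"
  then have "integral {-1..x} (bump n h) = integral {-1..x} (\<lambda>x. 0)"
    by (intro integral_cong bump_zero) auto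
  then show ?thesis by (simp add: step_def)
qed

lemma step_right: "0 \<le> h \<Longrightarrow> h \<le> x \<Longrightarrow> step n h x = step n h h"
proof -
  assume h: "0 \<le> h" "h \<le> x"
  have "integral {h..x} (bump n h) = integral {h..x} (\<lambda>x. 0)"
    by (intro integral_cong bump_zero) auto
  moreover have "integral {-1..h} (bump n h) + integral {h..x} (bump n h) = integral {-1..x} (bump n h)"
    using h by (intro Henstock_Kurzweil_Integration.integral_combine integrable_continuous_real bump_continuous) auto
  ultimately show ?thesis by (simp add: step_def)
qed

lemma step_le: "0 \<le> h \<Longrightarrow> step n h x \<le> h"
proof -
  assume h: "0 \<le> h"
  have "step n h (max x h) = step n h h" by (rule step_right) (use h in auto)
  then have "step n h x \<le> step n h h" using step_mono[of x "max x h" n h] by simp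
  also have "\<dots> \<le> h"
  proof -
    have "norm (step n h h - step n h 0) \<le> 1 * norm (h - 0)"
      by (rule field_differentiable_bound[of UNIV "step n h" "bump n h"])
        (use step_deriv bump_bounds in auto)
    then show ?thesis using h step_left[of 0 n h] by simp
  qed
  finally show ?thesis .
qed

lemma step_nonneg: "0 \<le> step n h x"
  using step_mono[of "min x 0" x n h] step_left[of "min x 0" n h] by simp

lemma step_limit:
  assumes "0 < h"
  shows "(\<lambda>n. step n h x) \<longlonglongrightarrow> max 0 (min x h)"
proof -
  have "(\<lambda>n. integral {-1..x} (bump n h)) \<longlonglongrightarrow> integral {-1..x} (indicator {0<..<h})"
    by (rule dominated_convergence(2)[of _ _ "\<lambda>x. 1"])
      (use bump_bounds bump_limit in \<open>auto intro!: integrable_continuous_real bump_continuous\<close>)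
  moreover have "integral {-1..x} (indicator {0<..<h} :: real \<Rightarrow> real) = max 0 (min x h)"
  proof -
    have "((indicator {0<..<h} :: real \<Rightarrow> real) has_integral max 0 (min x h)) {-1..x}"
    proof -
      have "((\<lambda>s. 1::real) has_integral max 0 (min x h)) {0..min x h}"
        using has_integral_const_real[of "1::real" 0 "min x h"]
        by (cases "0 \<le> min x h") (auto simp: max_def)
      then have "((\<lambda>s. if s \<in> {0..min x h} then 1 else (0::real)) has_integral max 0 (min x h)) {-1..x}"
        by (subst has_integral_restrict) auto
      then show ?thesis
        by (rule has_integral_spike_finite[of "{0, h, x}", rotated 2]) (auto simp: indicator_def)
    qed
    then show ?thesis by (rule integral_unique)
  qed
  ultimately show ?thesis by (simp add: step_def)
qed

section \<open>Self-similar test functions\<close>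

lemma integrable_bounded_support:
  fixes F :: "'a::euclidean_space \<Rightarrow> 'b::{banach, second_countable_topology}"
  assumes "F \<in> borel_measurable borel" "compact S" "\<And>x. x \<in> S \<Longrightarrow> norm (F x) \<le> C" "\<And>x. x \<notin> S \<Longrightarrow> F x = 0"
  shows "integrable lborel F"
proof (rule integrableI_bounded_set[of S _ _ C])
  show "emeasure lborel S < \<infinity>"
    by (rule emeasure_bounded_finite[OF compact_imp_bounded[OF assms(2)]])
qed (use assms in \<open>auto simp: borel_compact\<close>)

text \<open>Test functions \<open>a(t) b(z/t)\<close>. Since \<open>a\<close> vanishes near \<open>t = 0\<close>, the initial data do not enter, and in the variables
  \<open>t\<close> and \<open>s = z/t\<close> the weak formulation splits into a product of two integrals.\<close>
locale test_product =
  fixes a a' b b' :: "real \<Rightarrow> real" and R :: real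
  assumes a_smooth: "Ck_on k a UNIV" and b_smooth: "Ck_on k b UNIV"
    and a_deriv: "(a has_real_derivative a' t) (at t)" and b_deriv: "(b has_real_derivative b' t) (at t)"
    and a'_cont: "continuous_on UNIV a'" and b'_cont: "continuous_on UNIV b'"
    and a_support: "t \<notin> {1<..<2} \<Longrightarrow> a t = 0" and a'_support: "t \<notin> {1<..<2} \<Longrightarrow> a' t = 0"
    and b_support: "s \<notin> {-R..R} \<Longrightarrow> b s = 0" and b'_support: "s \<notin> {-R..R} \<Longrightarrow> b' s = 0"
begin

definition phi :: "real \<times> real \<Rightarrow> real" where "phi p = a (fst p) * b (snd p * inverse (fst p))"

lemma a_cont: "continuous_on UNIV a" by (rule Ck_on_continuous[OF a_smooth])
lemma b_cont: "continuous_on UNIV b" by (rule Ck_on_continuous[OF b_smooth])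

lemma a_support_closed: "t \<notin> {1..2} \<Longrightarrow> a t = 0" "t \<notin> {1..2} \<Longrightarrow> a' t = 0"
  using a_support[of t] a'_support[of t] by auto

lemma bounded_all:
  obtains C where "C \<ge> 0" "\<And>t. \<bar>a t\<bar> \<le> C" "\<And>t. \<bar>a' t\<bar> \<le> C" "\<And>t. \<bar>b t\<bar> \<le> C" "\<And>t. \<bar>b' t\<bar> \<le> C"
proof -
  have bnd: "\<exists>C\<ge>0. \<forall>t. \<bar>g t\<bar> \<le> C" if "continuous_on UNIV g" "\<And>t. t \<notin> {u..v} \<Longrightarrow> g t = 0" for g :: "real \<Rightarrow> real" and u v
  proof -
    have "compact (g ` {u..v})" by (intro compact_continuous_image continuous_on_subset[OF that(1)]) auto
    then have "bounded (g ` {u..v})" by (rule compact_imp_bounded)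
    then obtain C where C: "C > 0" "\<forall>x \<in> g ` {u..v}. norm x \<le> C"
      unfolding bounded_pos by metis
    have "\<bar>g t\<bar> \<le> C" for t
    proof (cases "t \<in> {u..v}")
      case True
      then show ?thesis using C(2) by simp
    next
      case False
      then show ?thesis using that(2)[OF False] C(1) by simp
    qed
    then show ?thesis using C(1) by (intro exI[of _ C]) auto
  qed
  obtain C1 where C1: "C1 \<ge> 0" "\<forall>t. \<bar>a t\<bar> \<le> C1" using bnd[OF a_cont, of 1 2] a_support_closed(1) by blast
  obtain C2 where C2: "C2 \<ge> 0" "\<forall>t. \<bar>a' t\<bar> \<le> C2" using bnd[OF a'_cont, of 1 2] a_support_closed(2) by blast
  obtain C3 where C3: "C3 \<ge> 0" "\<forall>t. \<bar>b t\<bar> \<le> C3" using bnd[OF b_cont, of "-R" R] b_support by blast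
  obtain C4 where C4: "C4 \<ge> 0" "\<forall>t. \<bar>b' t\<bar> \<le> C4" using bnd[OF b'_cont, of "-R" R] b'_support by blast
  show ?thesis
  proof (rule that[of "C1 + C2 + C3 + C4"])
    fix t
    show "\<bar>a t\<bar> \<le> C1 + C2 + C3 + C4" "\<bar>a' t\<bar> \<le> C1 + C2 + C3 + C4" "\<bar>b t\<bar> \<le> C1 + C2 + C3 + C4" "\<bar>b' t\<bar> \<le> C1 + C2 + C3 + C4"
      using C1(1) C2(1) C3(1) C4(1) spec[OF C1(2), of t] spec[OF C2(2), of t] spec[OF C3(2), of t] spec[OF C4(2), of t]
      by linarith+
  qed (use C1 C2 C3 C4 in auto)
qed

lemma phi_deriv:
  assumes "0 < t"
  shows "dt phi (t, z) = a' t * b (z / t) - a t * b' (z / t) * (z / t) / t"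
    "dz phi (t, z) = a t * b' (z / t) / t"
proof -
  have ad: "(a has_derivative (\<lambda>h. a' t * h)) (at t)" using a_deriv by (simp add: has_field_derivative_def)
  have bd: "(b has_derivative (\<lambda>h. b' (z * inverse t) * h)) (at (z * inverse t))"
    using b_deriv by (simp add: has_field_derivative_def)
  have 1: "((\<lambda>p::real \<times> real. a (fst p)) has_derivative (\<lambda>h. a' t * fst h)) (at (t, z))"
    by (rule has_derivative_compose[of fst fst, OF _ ]) (use ad in \<open>auto intro!: derivative_eq_intros\<close>)
  have 2: "((\<lambda>p::real \<times> real. snd p * inverse (fst p)) has_derivative
      (\<lambda>h. snd h * inverse t - z * (inverse t * fst h * inverse t))) (at (t, z))"
    using assms by (auto intro!: derivative_eq_intros simp: algebra_simps)
  have 3: "((\<lambda>p::real \<times> real. b (snd p * inverse (fst p))) has_derivative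
      (\<lambda>h. b' (z * inverse t) * (snd h * inverse t - z * (inverse t * fst h * inverse t)))) (at (t, z))"
    using has_derivative_compose[OF 2, of b "\<lambda>h. b' (z * inverse t) * h"] bd by simp
  have "(phi has_derivative (\<lambda>h. a (fst (t, z)) * (b' (z * inverse t) * (snd h * inverse t - z * (inverse t * fst h * inverse t)))
      + a' t * fst h * b (snd (t, z) * inverse (fst (t, z))))) (at (t, z))"
    unfolding phi_def[abs_def] by (rule has_derivative_mult[OF 1 3])
  from frechet_derivative_at[OF this]
  have "frechet_derivative phi (at (t, z)) = (\<lambda>h. a t * (b' (z * inverse t) * (snd h * inverse t - z * (inverse t * fst h * inverse t)))
      + a' t * fst h * b (z * inverse t))" by simp
  then show "dt phi (t, z) = a' t * b (z / t) - a t * b' (z / t) * (z / t) / t"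
    "dz phi (t, z) = a t * b' (z / t) / t"
    by (simp_all add: divide_inverse)
qed

lemma phi_test: "test_function phi" "closure {p. phi p \<noteq> 0} \<subseteq> upper_half"
proof -
  have "{p. phi p \<noteq> 0} \<subseteq> {1..2} \<times> {- (2 * R)..2 * R}"
  proof
    fix p assume "p \<in> {p. phi p \<noteq> 0}"
    then have p: "a (fst p) \<noteq> 0" "b (snd p * inverse (fst p)) \<noteq> 0" by (auto simp: phi_def)
    then have t: "fst p \<in> {1<..<2}" and s': "snd p * inverse (fst p) \<in> {-R..R}"
      using a_support[of "fst p"] b_support[of "snd p * inverse (fst p)"] by blast+
    from s' have s: "\<bar>snd p * inverse (fst p)\<bar> \<le> R"
      by (simp only: atLeastAtMost_iff) (intro abs_leI, linarith+)
    have "\<bar>snd p\<bar> = \<bar>snd p * inverse (fst p)\<bar> * fst p" using t by (simp add: abs_mult)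
    also have "\<dots> \<le> R * 2" using t s by (intro mult_mono) auto
    finally show "p \<in> {1..2} \<times> {- (2 * R)..2 * R}" using t by (cases p) auto
  qed
  then have sub: "closure {p. phi p \<noteq> 0} \<subseteq> {1..2} \<times> {- (2 * R)..2 * R}"
    by (rule closure_minimal) (intro closed_Times closed_atLeastAtMost)
  then show "closure {p. phi p \<noteq> 0} \<subseteq> upper_half" by auto
  have "compact ({1..2} \<times> {- (2 * R)..2 * R} :: (real \<times> real) set)" by (intro compact_Times compact_Icc)
  then have comp: "compact (closure {p. phi p \<noteq> 0})"
    using sub compact_Int_closed[of _ "closure {p. phi p \<noteq> 0}"] by (metis closed_closure inf.absorb2)
  have o: "open ({0<..} \<times> UNIV :: (real \<times> real) set)" "open ({..<1} \<times> UNIV :: (real \<times> real) set)"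
    by (auto intro!: open_Times)
  have "Ck_on k phi UNIV" for k
  proof -
    have 1: "Ck_on k phi ({0<..} \<times> UNIV)"
      unfolding phi_def[abs_def]
    proof (intro Ck_on_mult[OF o(1)])
      show "Ck_on k (\<lambda>p. a (fst p)) ({0<..} \<times> UNIV :: (real \<times> real) set)"
        by (rule Ck_on_compose[OF o(1) subset_UNIV a_smooth Ck_on_linear[OF bounded_linear_fst o(1)]])
      have i: "Ck_on k (\<lambda>p. inverse (fst p)) ({0<..} \<times> UNIV :: (real \<times> real) set)"
        by (rule Ck_on_compose[OF o(1) _ Ck_on_inverse Ck_on_linear[OF bounded_linear_fst o(1)]]) auto
      show "Ck_on k (\<lambda>p. b (snd p * inverse (fst p))) ({0<..} \<times> UNIV :: (real \<times> real) set)"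
        by (rule Ck_on_compose[OF o(1) subset_UNIV b_smooth Ck_on_mult[OF o(1) Ck_on_linear[OF bounded_linear_snd o(1)] i]])
    qed
    have 2: "Ck_on k phi ({..<1} \<times> UNIV)"
      by (rule Ck_on_cong[OF o(2) _ Ck_on_const[OF o(2), of _ 0]]) (auto simp: phi_def a_support)
    have "({0<..} \<times> UNIV) \<union> ({..<1} \<times> UNIV) = (UNIV :: (real \<times> real) set)" by auto
    then show ?thesis using Ck_on_Un[OF o 1 2] by simp
  qed
  then show "test_function phi" using comp by (simp add: test_function_def smooth_on_def)
qed

lemma integral_ta: "(LINT t|lborel. t * a' t) = - (LINT t|lborel. a t)"
proof -
  have [measurable]: "a \<in> borel_measurable borel" "a' \<in> borel_measurable borel"
    using a_cont a'_cont by (auto intro: borel_measurable_continuous_onI)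
  obtain C where C: "C \<ge> 0" "\<And>t. \<bar>a t\<bar> \<le> C" "\<And>t. \<bar>a' t\<bar> \<le> C" using bounded_all by metis
  have i1: "integrable lborel a"
    by (rule integrable_bounded_support[of _ "{0..3}" C]) (use C a_support in auto)
  have i2: "integrable lborel (\<lambda>t. t * a' t)"
    by (rule integrable_bounded_support[of _ "{0..3}" "3 * C"]) (use C a'_support in \<open>auto simp: abs_mult intro!: mult_mono\<close>)
  have der: "((\<lambda>t. t * a t) has_real_derivative a t + t * a' t) (at t)" for t
    by (auto intro!: derivative_eq_intros a_deriv)
  have "(LINT t|lborel. indicator {0..3} t *\<^sub>R (a t + t * a' t)) = 3 * a 3 - 0 * a 0"
  proof (rule integral_FTC_atLeastAtMost[where F = "\<lambda>t. t * a t"])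
    show "((\<lambda>t. t * a t) has_vector_derivative a t + t * a' t) (at t within {0..3})" for t
      using has_field_derivative_at_within[OF der] by (simp add: has_real_derivative_iff_has_vector_derivative)
    show "continuous_on {0..3} (\<lambda>t. a t + t * a' t)"
      by (intro continuous_intros continuous_on_subset[OF a_cont] continuous_on_subset[OF a'_cont]) auto
  qed simp
  moreover have "(LINT t|lborel. indicator {0..3} t *\<^sub>R (a t + t * a' t)) = (LINT t|lborel. a t + t * a' t)"
  proof (intro Bochner_Integration.integral_cong refl)
    show "indicator {0..3} t *\<^sub>R (a t + t * a' t) = a t + t * a' t" for t
      using a_support[of t] a'_support[of t] by (cases "t \<in> {1<..<2}") auto
  qed
  ultimately have "(LINT t|lborel. a t + t * a' t) = 0" by (simp add: a_support)
  then show ?thesis using i1 i2 by simp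
qed

text \<open>Substituting \<open>z = t s\<close> produces the Jacobian factor \<open>t\<close>; the time integral of \<open>t a'(t)\<close> is minus that of \<open>a\<close>.\<close>
lemma weak_identity:
  fixes E Q :: "real \<Rightarrow> 'b::euclidean_space"
  assumes [measurable]: "E \<in> borel_measurable borel" "Q \<in> borel_measurable borel"
    and bound: "\<And>s. norm (E s) \<le> C" "\<And>s. norm (Q s) \<le> C"
  shows "(LINT p:upper_half|lborel. dt phi p *\<^sub>R E (snd p / fst p) + dz phi p *\<^sub>R Q (snd p / fst p))
    = (LINT t|lborel. a t) *\<^sub>R (LINT s|lborel. b' s *\<^sub>R (Q s - s *\<^sub>R E s) - b s *\<^sub>R E s)"
proof -
  have [measurable]: "a \<in> borel_measurable borel" "a' \<in> borel_measurable borel" "b \<in> borel_measurable borel" "b' \<in> borel_measurable borel"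
    using a_cont a'_cont b_cont b'_cont by (auto intro: borel_measurable_continuous_onI)
  obtain D where D: "D \<ge> 0" "\<And>t. \<bar>a t\<bar> \<le> D" "\<And>t. \<bar>a' t\<bar> \<le> D" "\<And>t. \<bar>b t\<bar> \<le> D" "\<And>t. \<bar>b' t\<bar> \<le> D"
    using bounded_all by metis
  have C0: "C \<ge> 0" using bound(1)[of 0] norm_ge_zero order_trans by blast
  define F where "F p = (let t = fst p; s = snd p / fst p in if t > 0 then
    (a' t * b s - a t * b' s * s / t) *\<^sub>R E s + (a t * b' s / t) *\<^sub>R Q s else 0)" for p :: "real \<times> real"
  have F_meas: "F \<in> borel_measurable borel"
    unfolding F_def Let_def borel_prod[symmetric] by measurable
  have FI: "(LINT p:upper_half|lborel. dt phi p *\<^sub>R E (snd p / fst p) + dz phi p *\<^sub>R Q (snd p / fst p)) = (LINT p|lborel. F p)"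
    unfolding set_lebesgue_integral_def
    by (intro Bochner_Integration.integral_cong) (auto simp: F_def Let_def phi_deriv indicator_def)
  have F_zero: "F p = 0" if "p \<notin> {1..2} \<times> {- (2 * \<bar>R\<bar>)..2 * \<bar>R\<bar>}" for p
  proof (cases "fst p \<in> {1<..<2} \<and> \<bar>snd p / fst p\<bar> \<le> R")
    case True
    then have t: "fst p \<in> {1<..<2}" and s: "\<bar>snd p / fst p\<bar> \<le> \<bar>R\<bar>" by auto
    have "\<bar>snd p\<bar> = \<bar>snd p / fst p\<bar> * fst p" using t by (simp add: abs_mult)
    also have "\<dots> \<le> \<bar>R\<bar> * 2" using t s by (intro mult_mono) auto
    finally have "p \<in> {1..2} \<times> {- (2 * \<bar>R\<bar>)..2 * \<bar>R\<bar>}" using t by (cases p) auto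
    with that show ?thesis by simp
  next
    case False
    moreover have "\<bar>y\<bar> \<le> R" if "y \<in> {-R..R}" for y
      using that by (simp only: atLeastAtMost_iff) (intro abs_leI, linarith+)
    ultimately consider "fst p \<notin> {1<..<2}" | "snd p / fst p \<notin> {-R..R}" by blast
    then show ?thesis
    proof cases
      case 1
      then have "a (fst p) = 0" "a' (fst p) = 0" by (intro a_support a'_support; assumption)+
      then show ?thesis by (simp add: F_def Let_def)
    next
      case 2
      then have "b (snd p / fst p) = 0" "b' (snd p / fst p) = 0" by (intro b_support b'_support; assumption)+
      then show ?thesis by (simp add: F_def Let_def)
    qed
  qed
  have F_bound: "norm (F p) \<le> (D * D + D * D * \<bar>R\<bar>) * C + D * D * C" if "p \<in> {1..2} \<times> {- (2 * \<bar>R\<bar>)..2 * \<bar>R\<bar>}" for p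
  proof (cases "\<bar>snd p / fst p\<bar> \<le> \<bar>R\<bar>")
    case True
    let ?t = "fst p" and ?s = "snd p / fst p"
    have t: "1 \<le> ?t" using that by auto
    have x1: "\<bar>a' ?t * b ?s\<bar> \<le> D * D" using D by (simp add: abs_mult mult_mono)
    have x2: "\<bar>a ?t * b' ?s / ?t\<bar> \<le> D * D"
    proof -
      have "\<bar>a ?t * b' ?s / ?t\<bar> = \<bar>a ?t\<bar> * \<bar>b' ?s\<bar> / ?t" using t by (simp add: abs_mult)
      also have "\<dots> \<le> \<bar>a ?t\<bar> * \<bar>b' ?s\<bar> / 1" using t by (intro divide_left_mono) auto
      also have "\<dots> \<le> D * D" using D by (simp add: mult_mono)
      finally show ?thesis .
    qed
    have x3: "\<bar>a ?t * b' ?s * ?s / ?t\<bar> \<le> D * D * \<bar>R\<bar>"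
    proof -
      have "\<bar>a ?t * b' ?s * ?s / ?t\<bar> = \<bar>a ?t * b' ?s / ?t\<bar> * \<bar>?s\<bar>" by (simp add: abs_mult)
      also have "\<dots> \<le> D * D * \<bar>R\<bar>" using x2 True D by (intro mult_mono) auto
      finally show ?thesis .
    qed
    have "norm (F p) \<le> \<bar>a' ?t * b ?s - a ?t * b' ?s * ?s / ?t\<bar> * norm (E ?s) + \<bar>a ?t * b' ?s / ?t\<bar> * norm (Q ?s)"
      using t unfolding F_def Let_def by (auto intro: order_trans[OF norm_triangle_ineq])
    also have "\<dots> \<le> (D * D + D * D * \<bar>R\<bar>) * C + D * D * C"
    proof (intro add_mono mult_mono x2 bound)
      show "\<bar>a' ?t * b ?s - a ?t * b' ?s * ?s / ?t\<bar> \<le> D * D + D * D * \<bar>R\<bar>"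
        using x1 x3 by linarith
    qed (use D C0 in auto)
    finally show ?thesis .
  next
    case False
    then have "snd p / fst p \<notin> {-R..R}" by auto
    then have "b (snd p / fst p) = 0" "b' (snd p / fst p) = 0" by (intro b_support b'_support; assumption)+
    then have "F p = 0" by (simp add: F_def Let_def)
    then show ?thesis using D C0 by simp
  qed
  have F_int: "integrable lborel F"
  proof (rule integrable_bounded_support[OF F_meas])
    show "compact ({1..2} \<times> {- (2 * \<bar>R\<bar>)..2 * \<bar>R\<bar>} :: (real \<times> real) set)"
      by (intro compact_Times compact_Icc)
  qed (fact F_bound, fact F_zero)
  have iE: "integrable lborel (\<lambda>s. b s *\<^sub>R E s)"
    by (rule integrable_bounded_support[of _ "{-R..R}" "D * C"])
      (use D bound b_support in \<open>auto intro!: mult_mono\<close>)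
  have iQ: "integrable lborel (\<lambda>s. b' s *\<^sub>R Q s)"
    by (rule integrable_bounded_support[of _ "{-R..R}" "D * C"])
      (use D bound b'_support in \<open>auto intro!: mult_mono\<close>)
  have isE: "integrable lborel (\<lambda>s. (b' s * s) *\<^sub>R E s)"
    by (rule integrable_bounded_support[of _ "{-R..R}" "(D * \<bar>R\<bar>) * C"])
      (use D bound b'_support in \<open>auto simp: abs_mult intro!: mult_mono\<close>)
  let ?X = "LINT s|lborel. b s *\<^sub>R E s" and ?Y = "LINT s|lborel. b' s *\<^sub>R (Q s - s *\<^sub>R E s)"
  have Y: "?Y = (LINT s|lborel. b' s *\<^sub>R Q s) - (LINT s|lborel. (b' s * s) *\<^sub>R E s)"
    using iQ isE by (simp add: scaleR_diff_right)
  have inner: "(LINT z|lborel. F (t, z)) = (t * a' t) *\<^sub>R ?X + a t *\<^sub>R ?Y" for t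
  proof (cases "t > 0")
    case True
    have "(LINT z|lborel. F (t, z)) = \<bar>t\<bar> *\<^sub>R (LINT s|lborel. F (t, 0 + t * s))"
      by (rule lborel_integral_real_affine) (use True in simp)
    also have "\<dots> = \<bar>t\<bar> *\<^sub>R (LINT s|lborel. a' t *\<^sub>R (b s *\<^sub>R E s) - (a t / t) *\<^sub>R ((b' s * s) *\<^sub>R E s) + (a t / t) *\<^sub>R (b' s *\<^sub>R Q s))"
      using True by (simp add: F_def Let_def scaleR_diff_left mult.assoc)
    also have "\<dots> = \<bar>t\<bar> *\<^sub>R (a' t *\<^sub>R ?X - (a t / t) *\<^sub>R (LINT s|lborel. (b' s * s) *\<^sub>R E s) + (a t / t) *\<^sub>R (LINT s|lborel. b' s *\<^sub>R Q s))"
      using iE iQ isE by (simp del: scaleR_scaleR)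
    also have "\<dots> = (t * a' t) *\<^sub>R ?X + a t *\<^sub>R ?Y"
      using True unfolding Y by (simp add: scaleR_add_right scaleR_diff_right)
    finally show ?thesis .
  next
    case False
    then show ?thesis by (simp add: F_def Let_def a_support a'_support)
  qed
  have ia: "integrable lborel a"
    by (rule integrable_bounded_support[of _ "{0..3}" D]) (use D a_support in auto)
  have ita: "integrable lborel (\<lambda>t. t * a' t)"
    by (rule integrable_bounded_support[of _ "{0..3}" "3 * D"]) (use D a'_support in \<open>auto simp: abs_mult intro!: mult_mono\<close>)
  have "(LINT p|lborel. F p) = (LINT t|lborel. LINT z|lborel. F (t, z))"
    using lborel_pair.integral_fst'[of F] F_int by (simp add: lborel_prod)
  also have "\<dots> = (LINT t|lborel. t * a' t) *\<^sub>R ?X + (LINT t|lborel. a t) *\<^sub>R ?Y"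
    unfolding inner using ia ita by simp
  also have "\<dots> = (LINT t|lborel. a t) *\<^sub>R (?Y - ?X)"
    unfolding integral_ta by (simp add: scaleR_diff_right)
  also have "?Y - ?X = (LINT s|lborel. b' s *\<^sub>R (Q s - s *\<^sub>R E s) - b s *\<^sub>R E s)"
    using iE iQ isE by (simp add: scaleR_diff_right)
  finally show ?thesis using FI by simp
qed

end

section \<open>From weak to pointwise relations\<close>

text \<open>By Fubini: each time slice of the cone is a dilate of \<open>N\<close>.\<close>
lemma negligible_cone:
  assumes "negligible (N :: real set)"
  shows "negligible {p :: real \<times> real. 0 < fst p \<and> snd p / fst p \<in> N}"
proof -
  have "N \<in> null_sets lebesgue" using assms by (simp add: negligible_iff_null_sets)
  then obtain N' where N': "N' \<in> null_sets lborel" "N \<subseteq> N'"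
    using null_sets_completion_iff2[of N lborel] by auto
  have [measurable]: "N' \<in> sets borel" using N' by auto
  let ?S = "{p :: real \<times> real. 0 < fst p \<and> snd p / fst p \<in> N'}"
  have meas: "?S \<in> sets (lborel \<Otimes>\<^sub>M lborel)"
  proof -
    have "{p \<in> space (lborel \<Otimes>\<^sub>M lborel). 0 < fst p \<and> snd p / fst p \<in> N'} \<in> sets (lborel \<Otimes>\<^sub>M lborel)"
      by measurable
    then show ?thesis by (simp add: space_pair_measure)
  qed
  have slice: "emeasure lborel (Pair t -` ?S) = 0" for t
  proof (cases "t > 0")
    case True
    have "emeasure lborel (Pair t -` ?S) = (\<integral>\<^sup>+ z. indicator N' (z / t) \<partial>lborel)"
    proof -
      have "Pair t -` ?S \<in> sets lborel" using meas by (rule sets_Pair1)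
      then have "emeasure lborel (Pair t -` ?S) = (\<integral>\<^sup>+ z. indicator (Pair t -` ?S) z \<partial>lborel)" by simp
      also have "\<dots> = (\<integral>\<^sup>+ z. indicator N' (z / t) \<partial>lborel)"
        using True by (intro nn_integral_cong) (auto simp: indicator_def)
      finally show ?thesis .
    qed
    also have "\<dots> = ennreal \<bar>t\<bar> * (\<integral>\<^sup>+ s. indicator N' ((0 + t * s) / t) \<partial>lborel)"
      by (rule nn_integral_real_affine) (use True in auto)
    also have "(\<integral>\<^sup>+ s. indicator N' ((0 + t * s) / t) \<partial>lborel) = emeasure lborel N'"
      using True by simp
    also have "\<dots> = 0" using N' by auto
    finally show ?thesis by simp
  next
    case False
    then show ?thesis by simp
  qed
  have "emeasure (lborel \<Otimes>\<^sub>M lborel) ?S = (\<integral>\<^sup>+ t. emeasure lborel (Pair t -` ?S) \<partial>lborel)"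
    by (rule lborel.emeasure_pair_measure_alt[OF meas])
  also have "\<dots> = 0" by (simp only: slice) simp
  finally have "?S \<in> null_sets (lborel :: (real \<times> real) measure)"
    using meas unfolding lborel_prod by (intro null_setsI)
  then have "?S \<in> null_sets (lebesgue :: (real \<times> real) measure)"
    by (rule null_sets_completionI)
  then have "negligible ?S" by (simp add: negligible_iff_null_sets)
  then show ?thesis by (rule negligible_subset) (use N' in auto)
qed

text \<open>Replacing the solution by a Borel version changes the integrand on a null set of the half plane only.\<close>
lemma upper_half_integral_AE:
  fixes F G :: "real \<times> real \<Rightarrow> 'b::euclidean_space"
  assumes F: "F \<in> borel_measurable borel" and ae: "AE p in lebesgue. p \<in> upper_half \<longrightarrow> G p = F p"
  shows "(LINT p:upper_half|lebesgue. G p) = (LINT p:upper_half|lborel. F p)"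
proof -
  let ?F = "\<lambda>p. indicator upper_half p *\<^sub>R F p" and ?G = "\<lambda>p. indicator upper_half p *\<^sub>R G p"
  have uh: "upper_half \<in> sets borel" by (intro borel_open open_Times) auto
  have Fm: "?F \<in> borel_measurable lborel" using F uh by measurable
  then have Fm': "?F \<in> borel_measurable lebesgue" by (rule measurable_completion)
  have eq: "AE p in lebesgue. ?F p = ?G p"
    using ae by eventually_elim (auto simp: indicator_def)
  have "?G \<in> borel_measurable lebesgue" by (rule borel_measurable_AE[OF Fm' eq])
  then have "(LINT p|lebesgue. ?G p) = (LINT p|lebesgue. ?F p)"
    using eq Fm' by (intro integral_cong_AE) auto
  also have "\<dots> = (LINT p|lborel. ?F p)" by (rule integral_completion[OF Fm])
  finally show ?thesis by (simp add: set_lebesgue_integral_def)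
qed

lemma bounded_borel_integrable_on:
  fixes g :: "real \<Rightarrow> 'b::euclidean_space"
  assumes "g \<in> borel_measurable borel" "\<And>s. s \<in> {x..y} \<Longrightarrow> norm (g s) \<le> C"
  shows "integrable lborel (\<lambda>s. indicator {x..y} s *\<^sub>R g s)" "g integrable_on {x..y}"
    "(LINT s|lborel. indicator {x..y} s *\<^sub>R g s) = integral {x..y} g"
proof -
  show i: "integrable lborel (\<lambda>s. indicator {x..y} s *\<^sub>R g s)"
    by (rule integrable_bounded_support[of _ "{x..y}" C])
      (use assms in \<open>auto simp: indicator_def intro!: borel_measurable_scaleR borel_measurable_indicator\<close>)
  then have "set_integrable lborel {x..y} g" by (simp add: set_integrable_def)
  from set_borel_integral_eq_integral[OF this]
  show "g integrable_on {x..y}" "(LINT s|lborel. indicator {x..y} s *\<^sub>R g s) = integral {x..y} g"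
    by (simp_all add: set_lebesgue_integral_def)
qed

definition ramp :: "real \<Rightarrow> real \<Rightarrow> real" where "ramp h x = max 0 (min x h)"

text \<open>The one-dimensional weak inequality, tested with the difference of two smooth steps, holds for
  increments almost everywhere: first the steps become ramps, then the ramps become jumps, and the
  averages of \<open>G\<close> over their slopes converge by Lebesgue's differentiation theorem.\<close>
lemma weak_inequality_pointwise:
  fixes G E :: "real \<Rightarrow> real"
  assumes [measurable]: "G \<in> borel_measurable borel" "E \<in> borel_measurable borel"
    and bound: "\<And>s. \<bar>G s\<bar> \<le> C * (1 + \<bar>s\<bar>)" "\<And>s. \<bar>E s\<bar> \<le> C"
    and weak: "\<And>n h x y. \<lbrakk>0 < h; x < y\<rbrakk> \<Longrightarrow>
      0 \<le> (LINT s|lborel. (bump n h (s - x) - bump n h (s - y)) * G s - (step n h (s - x) - step n h (s - y)) * E s)"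
  obtains N where "negligible N" "\<And>x y. \<lbrakk>x \<notin> N; y \<notin> N; x < y\<rbrakk> \<Longrightarrow> integral {x..y} E \<le> G x - G y"
proof -
  have C0: "0 \<le> C" using bound(2)[of 0] by simp
  have Gb: "\<bar>G s\<bar> \<le> C * (1 + (\<bar>x\<bar> + \<bar>y\<bar>))" if "s \<in> {x..y}" for s x y
    using bound(1)[of s] that C0 by (smt (verit) atLeastAtMost_iff mult_left_mono)
  have Gint: "G integrable_on {x..y}" for x y
    by (rule bounded_borel_integrable_on(2)[of G x y "C * (1 + (\<bar>x\<bar> + \<bar>y\<bar>))"]) (use Gb in auto)
  have meas_bump[measurable]: "bump n h \<in> borel_measurable borel" for n h
    by (rule borel_measurable_continuous_onI[OF bump_continuous])
  have meas_step[measurable]: "step n h \<in> borel_measurable borel" for n h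
    by (rule borel_measurable_continuous_onI[OF Ck_on_continuous[OF Ck_on_step]])
  have stage1: "0 \<le> integral {x..x+h} G - integral {y..y+h} G
      - (LINT s|lborel. (ramp h (s - x) - ramp h (s - y)) * E s)" if h: "0 < h" and xy: "x < y" for h x y
  proof -
    let ?c = "C * (1 + (\<bar>x\<bar> + \<bar>y + h\<bar>)) + h * C"
    let ?L = "\<lambda>s. (indicator {0<..<h} (s - x) - indicator {0<..<h} (s - y)) * G s - (ramp h (s - x) - ramp h (s - y)) * E s"
    let ?F = "\<lambda>n s. (bump n h (s - x) - bump n h (s - y)) * G s - (step n h (s - x) - step n h (s - y)) * E s"
    have lim: "(\<lambda>n. LINT s|lborel. ?F n s) \<longlonglongrightarrow> (LINT s|lborel. ?L s)"
    proof (rule integral_dominated_convergence[where w = "\<lambda>s. indicator {x..y+h} s * ?c"])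
      show "?L \<in> borel_measurable lborel" "?F n \<in> borel_measurable lborel" for n
        unfolding ramp_def by measurable
      show "integrable lborel (\<lambda>s. indicator {x..y+h} s * ?c)"
        using bounded_borel_integrable_on(1)[of "\<lambda>s. ?c" x "y+h" "\<bar>?c\<bar>"] by simp
      show "AE s in lborel. (\<lambda>n. ?F n s) \<longlonglongrightarrow> ?L s"
        unfolding ramp_def by (intro AE_I2 tendsto_intros bump_limit step_limit h)
      show "AE s in lborel. norm (?F n s) \<le> indicator {x..y+h} s * ?c" for n
      proof (rule AE_I2)
        fix s
        show "norm (?F n s) \<le> indicator {x..y+h} s * ?c"
        proof (cases "s \<in> {x..y+h}")
          case False
          then consider "s < x" | "y + h < s" by fastforce
          then have "?F n s = 0"
          proof cases
            case 1
            then show ?thesis using xy by (simp add: bump_zero step_left)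
          next
            case 2
            then have "step n h (s - x) = step n h h" "step n h (s - y) = step n h h"
              using xy h by (auto intro!: step_right)
            then show ?thesis using 2 xy by (simp add: bump_zero)
          qed
          then show ?thesis using False by simp
        next
          case True
          have "\<bar>bump n h (s - x) - bump n h (s - y)\<bar> \<le> 1"
            using bump_bounds(1,2)[of n h "s - x"] bump_bounds(1,2)[of n h "s - y"] by linarith
          then have "\<bar>(bump n h (s - x) - bump n h (s - y)) * G s\<bar> \<le> 1 * (C * (1 + (\<bar>x\<bar> + \<bar>y + h\<bar>)))"
            unfolding abs_mult using Gb[OF True] by (intro mult_mono) auto
          moreover have "\<bar>step n h (s - x) - step n h (s - y)\<bar> \<le> h"
            using step_nonneg[of n h "s - x"] step_nonneg[of n h "s - y"] step_le[of h n "s - x"] step_le[of h n "s - y"] h by linarith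
          then have "\<bar>(step n h (s - x) - step n h (s - y)) * E s\<bar> \<le> h * C"
            unfolding abs_mult using bound(2)[of s] h by (intro mult_mono) auto
          ultimately show ?thesis using True by simp
        qed
      qed
    qed
    have nonneg: "0 \<le> (LINT s|lborel. ?L s)"
      by (rule LIMSEQ_le_const[OF lim]) (use weak[OF h xy] in blast)
    have ind: "(LINT s|lborel. indicator {0<..<h} (s - z) * G s) = integral {z..z+h} G"
      "integrable lborel (\<lambda>s. indicator {0<..<h} (s - z) * G s)" for z
    proof -
      have ae: "AE s in lborel. indicator {0<..<h} (s - z) * G s = indicator {z..z+h} s *\<^sub>R G s"
        using AE_lborel_singleton[of z] AE_lborel_singleton[of "z + h"]
        by eventually_elim (auto simp: indicator_def)
      have i: "integrable lborel (\<lambda>s. indicator {z..z+h} s *\<^sub>R G s)"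
        "(LINT s|lborel. indicator {z..z+h} s *\<^sub>R G s) = integral {z..z+h} G"
      proof -
        have b: "norm (G s) \<le> C * (1 + (\<bar>z\<bar> + \<bar>z + h\<bar>))" if "s \<in> {z..z+h}" for s
          using Gb[OF that] by simp
        show "integrable lborel (\<lambda>s. indicator {z..z+h} s *\<^sub>R G s)"
          "(LINT s|lborel. indicator {z..z+h} s *\<^sub>R G s) = integral {z..z+h} G"
          by (rule bounded_borel_integrable_on(1)[OF assms(1) b] bounded_borel_integrable_on(3)[OF assms(1) b]; assumption)+
      qed
      show "(LINT s|lborel. indicator {0<..<h} (s - z) * G s) = integral {z..z+h} G"
        unfolding i(2)[symmetric] by (rule integral_cong_AE) (use ae in measurable)
      show "integrable lborel (\<lambda>s. indicator {0<..<h} (s - z) * G s)"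
        by (rule integrable_cong_AE_imp[OF i(1)]) (use ae in \<open>auto elim!: eventually_mono\<close>)
    qed
    have rint: "integrable lborel (\<lambda>s. (ramp h (s - x) - ramp h (s - y)) * E s)"
    proof (rule integrable_bounded_support[of _ "{x..y+h}" "h * C"])
      show "(\<lambda>s. (ramp h (s - x) - ramp h (s - y)) * E s) \<in> borel_measurable borel"
        unfolding ramp_def by measurable
      show "norm ((ramp h (s - x) - ramp h (s - y)) * E s) \<le> h * C" for s
        unfolding real_norm_def abs_mult using bound(2)[of s] h by (intro mult_mono) (auto simp: ramp_def)
      show "(ramp h (s - x) - ramp h (s - y)) * E s = 0" if "s \<notin> {x..y+h}" for s
        using that xy h by (auto simp: ramp_def)
    qed simp
    have "(LINT s|lborel. ?L s) = integral {x..x+h} G - integral {y..y+h} G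
        - (LINT s|lborel. (ramp h (s - x) - ramp h (s - y)) * E s)"
      using ind(2)[of x] ind(2)[of y] rint by (simp add: left_diff_distrib ind(1) del: ramp_def)
    then show ?thesis using nonneg by simp
  qed
  have "\<And>a b. G integrable_on cbox a b" using Gint by simp
  then obtain N where N: "negligible N" "\<And>x \<epsilon>. \<lbrakk>x \<notin> N; 0 < \<epsilon>\<rbrakk> \<Longrightarrow> \<exists>d>0. \<forall>h. 0 < h \<and> h < d \<longrightarrow>
      norm (integral (cbox x (x + h *\<^sub>R One)) G /\<^sub>R h ^ DIM(real) - G x) < \<epsilon>"
    using integrable_ccontinuous_explicit[of G] by metis
  have avg: "(\<lambda>k. real (Suc k) * integral {x..x + 1 / real (Suc k)} G) \<longlonglongrightarrow> G x" if xN: "x \<notin> N" for x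
  proof (rule LIMSEQ_I)
    fix \<epsilon> :: real assume "0 < \<epsilon>"
    then obtain d where d: "d > 0" "\<And>h. 0 < h \<and> h < d \<Longrightarrow> norm (integral {x..x + h} G / h - G x) < \<epsilon>"
      using N(2)[of x \<epsilon>] xN by (auto simp: divide_inverse mult.commute)
    obtain k0 where k0: "1 / real (Suc k0) < d" using reals_Archimedean[OF d(1)] by (auto simp: inverse_eq_divide)
    show "\<exists>no. \<forall>k\<ge>no. norm (real (Suc k) * integral {x..x + 1 / real (Suc k)} G - G x) < \<epsilon>"
    proof (intro exI[of _ k0] allI impI)
      fix k assume "k0 \<le> k"
      then have "1 / real (Suc k) \<le> 1 / real (Suc k0)" by (intro divide_left_mono) auto
      then show "norm (real (Suc k) * integral {x..x + 1 / real (Suc k)} G - G x) < \<epsilon>"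
        using d(2)[of "1 / real (Suc k)"] k0 by (simp add: mult.commute)
    qed
  qed
  show ?thesis
  proof (rule that[OF N(1)])
    fix x y assume x: "x \<notin> N" and y: "y \<notin> N" and xy: "x < y"
    define h where "h k = 1 / real (Suc k)" for k
    have h: "0 < h k" "h k \<le> 1" for k by (auto simp: h_def)
    have hk: "real (Suc k) * h k = 1" for k by (simp add: h_def)
    have lim: "(\<lambda>k. LINT s|lborel. (real (Suc k) * (ramp (h k) (s - x) - ramp (h k) (s - y))) * E s)
        \<longlonglongrightarrow> (LINT s|lborel. indicator {x<..y} s * E s)"
    proof (rule integral_dominated_convergence[where w = "\<lambda>s. indicator {x..y+1} s * C"])
      show "(\<lambda>s. indicator {x<..y} s * E s) \<in> borel_measurable lborel" by measurable
      show "(\<lambda>s. (real (Suc k) * (ramp (h k) (s - x) - ramp (h k) (s - y))) * E s) \<in> borel_measurable lborel" for k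
        unfolding ramp_def by measurable
      show "integrable lborel (\<lambda>s. indicator {x..y+1} s * C)"
        using bounded_borel_integrable_on(1)[of "\<lambda>s. C" x "y+1" "\<bar>C\<bar>"] by simp
      have r1: "(\<lambda>k. real (Suc k) * ramp (h k) t) \<longlonglongrightarrow> (if 0 < t then 1 else 0)" for t
      proof (cases "0 < t")
        case True
        have "h \<longlonglongrightarrow> 0" unfolding h_def[abs_def] by (rule LIMSEQ_Suc[OF lim_const_over_n])
        then have "\<forall>\<^sub>F k in sequentially. h k < t" using True order_tendstoD(2) by blast
        then have "\<forall>\<^sub>F k in sequentially. real (Suc k) * ramp (h k) t = 1"
          by eventually_elim (use True h(1)[THEN less_imp_le] hk in \<open>simp add: ramp_def min_def max_def\<close>)
        then show ?thesis using True by (simp add: tendsto_eventually)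
      next
        case False
        then have "ramp (h k) t = 0" for k using h(1)[of k] by (simp add: ramp_def)
        then show ?thesis using False by simp
      qed
      show "AE s in lborel. (\<lambda>k. (real (Suc k) * (ramp (h k) (s - x) - ramp (h k) (s - y))) * E s) \<longlonglongrightarrow> indicator {x<..y} s * E s"
      proof (rule AE_I2)
        fix s
        have "(\<lambda>k. (real (Suc k) * ramp (h k) (s - x) - real (Suc k) * ramp (h k) (s - y)) * E s)
            \<longlonglongrightarrow> ((if 0 < s - x then 1 else 0) - (if 0 < s - y then 1 else 0)) * E s"
          by (intro tendsto_intros r1)
        moreover have "((if 0 < s - x then 1 else 0) - (if 0 < s - y then 1 else 0)) * E s = indicator {x<..y} s * E s"
          using xy by (auto simp: indicator_def)
        ultimately show "(\<lambda>k. (real (Suc k) * (ramp (h k) (s - x) - ramp (h k) (s - y))) * E s) \<longlonglongrightarrow> indicator {x<..y} s * E s"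
          by (simp only: right_diff_distrib)
      qed
      show "AE s in lborel. norm ((real (Suc k) * (ramp (h k) (s - x) - ramp (h k) (s - y))) * E s) \<le> indicator {x..y+1} s * C" for k
      proof (rule AE_I2)
        fix s
        show "norm ((real (Suc k) * (ramp (h k) (s - x) - ramp (h k) (s - y))) * E s) \<le> indicator {x..y+1} s * C"
        proof (cases "s \<in> {x..y+1}")
          case True
          have "\<bar>ramp (h k) (s - x) - ramp (h k) (s - y)\<bar> \<le> h k"
            using h[of k] xy by (auto simp: ramp_def)
          then have "real (Suc k) * \<bar>ramp (h k) (s - x) - ramp (h k) (s - y)\<bar> \<le> real (Suc k) * h k"
            by (intro mult_left_mono) auto
          then have "\<bar>real (Suc k) * (ramp (h k) (s - x) - ramp (h k) (s - y))\<bar> \<le> 1"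
            unfolding hk by (simp only: abs_mult abs_of_nat)
          then have "\<bar>real (Suc k) * (ramp (h k) (s - x) - ramp (h k) (s - y))\<bar> * \<bar>E s\<bar> \<le> 1 * C"
            using bound(2)[of s] by (intro mult_mono) auto
          then show ?thesis using True by (simp only: real_norm_def abs_mult) simp
        next
          case False
          then have "ramp (h k) (s - x) = ramp (h k) (s - y)"
            using xy h[of k] by (auto simp: ramp_def)
          then show ?thesis using False by simp
        qed
      qed
    qed
    have "(\<lambda>k. real (Suc k) * integral {x..x + h k} G - real (Suc k) * integral {y..y + h k} G
        - (LINT s|lborel. (real (Suc k) * (ramp (h k) (s - x) - ramp (h k) (s - y))) * E s))
        \<longlonglongrightarrow> G x - G y - (LINT s|lborel. indicator {x<..y} s * E s)"
      using avg[OF x] avg[OF y] by (intro tendsto_diff lim) (simp_all add: h_def)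
    moreover have "0 \<le> real (Suc k) * integral {x..x + h k} G - real (Suc k) * integral {y..y + h k} G
        - (LINT s|lborel. (real (Suc k) * (ramp (h k) (s - x) - ramp (h k) (s - y))) * E s)" for k
    proof -
      have "0 \<le> real (Suc k) * (integral {x..x+h k} G - integral {y..y+h k} G
        - (LINT s|lborel. (ramp (h k) (s - x) - ramp (h k) (s - y)) * E s))"
        using stage1[OF h(1) xy] by (intro mult_nonneg_nonneg) auto
      also have "\<dots> = real (Suc k) * integral {x..x + h k} G - real (Suc k) * integral {y..y + h k} G
        - (LINT s|lborel. (real (Suc k) * (ramp (h k) (s - x) - ramp (h k) (s - y))) * E s)"
        by (simp only: right_diff_distrib[of "real (Suc k)" "_ - _"] right_diff_distrib[of "real (Suc k)" "integral _ _"]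
            mult.assoc integral_mult_right_zero)
      finally show ?thesis .
    qed
    ultimately have "0 \<le> G x - G y - (LINT s|lborel. indicator {x<..y} s * E s)"
      by (intro LIMSEQ_le_const) auto
    moreover have "(LINT s|lborel. indicator {x<..y} s * E s) = integral {x..y} E"
    proof -
      have ae: "AE s in lborel. indicator {x<..y} s * E s = indicator {x..y} s *\<^sub>R E s"
        using AE_lborel_singleton[of x] by eventually_elim (auto simp: indicator_def)
      have "(LINT s|lborel. indicator {x<..y} s * E s) = (LINT s|lborel. indicator {x..y} s *\<^sub>R E s)"
        by (rule integral_cong_AE) (use ae in measurable)
      also have "\<dots> = integral {x..y} E"
        by (rule bounded_borel_integrable_on(3)[of _ _ _ C]) (use bound(2) in auto)
      finally show ?thesis .
    qed
    ultimately show "integral {x..y} E \<le> G x - G y" by simp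
  qed
qed

lemma (in test_product) density_integrable:
  fixes E Q :: "real \<Rightarrow> 'b::euclidean_space"
  assumes [measurable]: "E \<in> borel_measurable borel" "Q \<in> borel_measurable borel"
    and bound: "\<And>s. norm (E s) \<le> C" "\<And>s. norm (Q s) \<le> C"
  shows "integrable lborel (\<lambda>s. b' s *\<^sub>R (Q s - s *\<^sub>R E s) - b s *\<^sub>R E s)"
proof -
  have [measurable]: "b \<in> borel_measurable borel" "b' \<in> borel_measurable borel"
    using b_cont b'_cont by (auto intro: borel_measurable_continuous_onI)
  obtain C0 where C0: "C0 \<ge> 0" "\<And>t. \<bar>b t\<bar> \<le> C0" "\<And>t. \<bar>b' t\<bar> \<le> C0" using bounded_all by metis
  show ?thesis
  proof (rule integrable_bounded_support[of _ "{-R..R}" "C0 * (C + \<bar>R\<bar> * C) + C0 * C"])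
    fix s assume "s \<in> {-R..R}"
    then have "\<bar>s\<bar> \<le> \<bar>R\<bar>" by auto
    then have "norm (s *\<^sub>R E s) \<le> \<bar>R\<bar> * C" using bound(1)[of s] by (auto intro!: mult_mono)
    then have "norm (Q s - s *\<^sub>R E s) \<le> C + \<bar>R\<bar> * C"
      using norm_triangle_ineq4[of "Q s" "s *\<^sub>R E s"] bound(2)[of s] by linarith
    then have "norm (b' s *\<^sub>R (Q s - s *\<^sub>R E s)) \<le> C0 * (C + \<bar>R\<bar> * C)"
      unfolding norm_scaleR using C0 by (intro mult_mono) auto
    moreover have "norm (b s *\<^sub>R E s) \<le> C0 * C"
      unfolding norm_scaleR using C0 bound(1)[of s] by (intro mult_mono) auto
    ultimately show "norm (b' s *\<^sub>R (Q s - s *\<^sub>R E s) - b s *\<^sub>R E s) \<le> C0 * (C + \<bar>R\<bar> * C) + C0 * C"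
      using norm_triangle_ineq4[of "b' s *\<^sub>R (Q s - s *\<^sub>R E s)" "b s *\<^sub>R E s"] by linarith
  qed (use b_support b'_support in auto)
qed

lemma (in test_product) weak_identity_lebesgue:
  fixes E Q :: "real \<Rightarrow> 'b::euclidean_space"
  assumes [measurable]: "E \<in> borel_measurable borel" "Q \<in> borel_measurable borel"
    and bound: "\<And>s. norm (E s) \<le> C" "\<And>s. norm (Q s) \<le> C"
    and ae: "AE p in lebesgue. p \<in> upper_half \<longrightarrow> v p = E (snd p / fst p) \<and> w p = Q (snd p / fst p)"
  shows "(LINT p:upper_half|lebesgue. dt phi p *\<^sub>R v p + dz phi p *\<^sub>R w p)
    = (LINT t|lborel. a t) *\<^sub>R (LINT s|lborel. b' s *\<^sub>R (Q s - s *\<^sub>R E s) - b s *\<^sub>R E s)"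
proof -
  have [measurable]: "a \<in> borel_measurable borel" "a' \<in> borel_measurable borel" "b \<in> borel_measurable borel" "b' \<in> borel_measurable borel"
    using a_cont a'_cont b_cont b'_cont by (auto intro: borel_measurable_continuous_onI)
  define F where "F p = (a' (fst p) * b (snd p / fst p) - a (fst p) * b' (snd p / fst p) * (snd p / fst p) / fst p) *\<^sub>R E (snd p / fst p)
    + (a (fst p) * b' (snd p / fst p) / fst p) *\<^sub>R Q (snd p / fst p)" for p :: "real \<times> real"
  have F_meas: "F \<in> borel_measurable borel"
    unfolding F_def borel_prod[symmetric] by measurable
  have "(LINT p:upper_half|lebesgue. dt phi p *\<^sub>R v p + dz phi p *\<^sub>R w p) = (LINT p:upper_half|lborel. F p)"
    by (rule upper_half_integral_AE[OF F_meas])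
      (use ae in eventually_elim, auto simp: F_def phi_deriv)
  also have "\<dots> = (LINT p:upper_half|lborel. dt phi p *\<^sub>R E (snd p / fst p) + dz phi p *\<^sub>R Q (snd p / fst p))"
    unfolding set_lebesgue_integral_def
    by (intro Bochner_Integration.integral_cong) (auto simp: F_def phi_deriv indicator_def)
  finally show ?thesis
    using weak_identity[OF assms(1,2) bound] by simp
qed

lemma bump_shift:
  shows Ck_on_bump_shift: "Ck_on k (\<lambda>t. bump n h (t - s)) UNIV"
    and bump_shift_deriv: "((\<lambda>t. bump n h (t - s)) has_real_derivative frechet_derivative (\<lambda>t. bump n h (t - s)) (at t) 1) (at t)"
    and bump_shift_deriv_cont: "continuous_on UNIV (\<lambda>t. frechet_derivative (\<lambda>t. bump n h (t - s)) (at t) 1)"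
    and bump_shift_deriv_zero: "t \<notin> {s<..<s+h} \<Longrightarrow> frechet_derivative (\<lambda>t. bump n h (t - s)) (at t) 1 = 0"
proof -
  let ?g = "\<lambda>t. bump n h (t - s)"
  show smooth: "Ck_on k ?g UNIV" for k
  proof -
    have "Ck_on k (\<lambda>t. bump n h (1 * t + (- s))) UNIV"
      by (rule Ck_on_compose[OF open_UNIV subset_UNIV Ck_on_bump Ck_on_affine])
    then show ?thesis by simp
  qed
  have D: "(?g has_derivative frechet_derivative ?g (at t)) (at t)"
    by (rule Ck_on_imp_differentiable[OF smooth[of "Suc 0"]]) simp
  have "frechet_derivative ?g (at t) z = frechet_derivative ?g (at t) 1 * z" for z
    using linear_scale[OF has_derivative_linear[OF D], of z 1] by simp
  then have "frechet_derivative ?g (at t) = (*) (frechet_derivative ?g (at t) 1)" by (rule ext)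
  then show der: "(?g has_real_derivative frechet_derivative ?g (at t) 1) (at t)"
    using D unfolding has_field_derivative_def by metis
  show "continuous_on UNIV (\<lambda>t. frechet_derivative ?g (at t) 1)" using smooth[of "Suc 0"] by simp
  show "frechet_derivative ?g (at t) 1 = 0" if t: "t \<notin> {s<..<s+h}"
  proof (rule DERIV_local_min[OF der zero_less_one])
    have "?g t = 0" by (rule bump_zero) (use t in auto)
    then show "\<forall>y. \<bar>t - y\<bar> < 1 \<longrightarrow> ?g t \<le> ?g y" by (simp add: bump_bounds)
  qed
qed

lemma bump_shift_integrable: "integrable lborel (\<lambda>t. bump n h (t - s))"
proof (rule integrable_bounded_support[of _ "{s..s+h}" 1])
  show "(\<lambda>t. bump n h (t - s)) \<in> borel_measurable borel"
    by (rule borel_measurable_continuous_onI[OF Ck_on_continuous[OF Ck_on_bump_shift]])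
qed (auto simp: bump_bounds intro!: bump_zero)

lemma bump_shift_integral:
  assumes "0 < h"
  shows "0 < (LINT t|lborel. bump n h (t - s))"
proof -
  have "(LINT t|lborel. bump n h (t - s)) \<noteq> 0"
  proof
    assume "(LINT t|lborel. bump n h (t - s)) = 0"
    then have "AE t in lborel. bump n h (t - s) = 0"
      using integral_nonneg_eq_0_iff_AE[OF bump_shift_integrable] bump_bounds by simp
    moreover have "bump n h (t - s) \<noteq> 0" if "t \<in> {s<..<s+h}" for t
      using bump_bounds(3)[of n h "t - s"] that by auto
    ultimately have "AE t in lborel. t \<notin> {s<..<s+h}"
      by (auto elim!: eventually_mono)
    then have "emeasure lborel {s<..<s+h} = 0"
      by (subst (asm) AE_iff_measurable[of "{s<..<s+h}"]) auto
    then show False using assms by simp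
  qed
  moreover have "0 \<le> (LINT t|lborel. bump n h (t - s))" by (simp add: bump_bounds)
  ultimately show ?thesis by simp
qed

lemma step_test_product:
  assumes "0 < h" "x < y"
  shows "test_product (\<lambda>t. bump 0 1 (t - 1)) (\<lambda>t. frechet_derivative (\<lambda>t. bump 0 1 (t - 1)) (at t) 1)
    (\<lambda>s. step n h (s - x) - step n h (s - y)) (\<lambda>s. bump n h (s - x) - bump n h (s - y)) (\<bar>x\<bar> + \<bar>y\<bar> + h)"
proof
  fix k t s
  let ?T = "\<lambda>t. bump 0 1 (t - 1)"
  show "Ck_on k ?T UNIV" by (rule Ck_on_bump_shift)
  have *: "Ck_on k (\<lambda>s. step n h (1 * s + (- z))) UNIV" for z
    by (rule Ck_on_compose[OF open_UNIV subset_UNIV Ck_on_step Ck_on_affine])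
  have "Ck_on k (\<lambda>s. step n h (1 * s + (- x)) + (-1) * step n h (1 * s + (- y))) UNIV"
    by (intro Ck_on_add Ck_on_mult Ck_on_const * open_UNIV)
  then show "Ck_on k (\<lambda>s. step n h (s - x) - step n h (s - y)) UNIV" by simp
  show "(?T has_real_derivative frechet_derivative ?T (at t) 1) (at t)" for t by (rule bump_shift_deriv)
  have sd: "((\<lambda>s. step n h (s - z)) has_real_derivative bump n h (s - z)) (at s)" for z s
    using DERIV_shift[of "step n h" "bump n h (s - z)" s "- z"] step_deriv[of n h "s - z"] by simp
  then show "((\<lambda>s. step n h (s - x) - step n h (s - y)) has_real_derivative bump n h (t - x) - bump n h (t - y)) (at t)"
    by (intro DERIV_diff)
  show "continuous_on UNIV (\<lambda>t. frechet_derivative ?T (at t) 1)" by (rule bump_shift_deriv_cont)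
  show "continuous_on UNIV (\<lambda>s. bump n h (s - x) - bump n h (s - y))"
    by (intro continuous_intros continuous_on_compose2[OF bump_continuous[of UNIV]]) auto
  show "?T t = 0" if "t \<notin> {1<..<2}" by (rule bump_zero) (use that in auto)
  show "frechet_derivative ?T (at t) 1 = 0" if "t \<notin> {1<..<2}" by (rule bump_shift_deriv_zero) (use that in auto)
  show "step n h (s - x) - step n h (s - y) = 0" "bump n h (s - x) - bump n h (s - y) = 0"
    if s: "s \<notin> {- (\<bar>x\<bar> + \<bar>y\<bar> + h)..\<bar>x\<bar> + \<bar>y\<bar> + h}"
  proof -
    consider "s < x" "s < y" | "x + h < s" "y + h < s" using s assms by fastforce
    then show "step n h (s - x) - step n h (s - y) = 0" "bump n h (s - x) - bump n h (s - y) = 0"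
    proof (atomize(full), cases)
      case 1
      then show "step n h (s - x) - step n h (s - y) = 0 \<and> bump n h (s - x) - bump n h (s - y) = 0"
        by (simp add: step_left bump_zero)
    next
      case 2
      then have "step n h (s - x) = step n h h" "step n h (s - y) = step n h h"
        using assms by (auto intro!: step_right)
      then show "step n h (s - x) - step n h (s - y) = 0 \<and> bump n h (s - x) - bump n h (s - y) = 0"
        using 2 by (simp add: bump_zero)
    qed
  qed
qed

text \<open>Each coordinate has a Borel version; where these leave the ball, the centre is substituted.\<close>
lemma Linfty_Borel_version:
  fixes V :: "real \<Rightarrow> real^'m"
  assumes V: "V \<in> Linfty_cball Vbar \<epsilon>" and "0 < \<epsilon>"
  obtains U N where "U \<in> borel_measurable borel" "\<And>s. U s \<in> cball Vbar \<epsilon>" "negligible N" "\<And>s. s \<notin> N \<Longrightarrow> V s = U s"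
proof -
  have Vm: "V \<in> borel_measurable (completion lborel)" and Vb: "AE s in lebesgue. norm (V s - Vbar) \<le> \<epsilon>"
    using V by (auto simp: Linfty_cball_def)
  have "\<exists>g\<in>borel_measurable lborel. AE s in lborel. V s \<bullet> i = g s" for i
  proof -
    have "(\<lambda>s. V s \<bullet> i) \<in> borel_measurable (completion lborel)" using Vm by measurable
    then show ?thesis by (rule completion_ex_borel_measurable_real)
  qed
  then obtain g where g: "\<And>i. g i \<in> borel_measurable borel" "\<And>i. AE s in lborel. V s \<bullet> i = g i s"
    by (metis measurable_lborel2)
  define U0 where "U0 s = (\<Sum>i\<in>Basis. g i s *\<^sub>R i)" for s
  define U where "U s = (if U0 s \<in> cball Vbar \<epsilon> then U0 s else Vbar)" for s
  have U0m: "U0 \<in> borel_measurable borel"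
    unfolding U0_def using g(1) by measurable
  have Um: "U \<in> borel_measurable borel"
    unfolding U_def mem_cball using U0m by measurable
  have "AE s in lborel. \<forall>i\<in>Basis. V s \<bullet> i = g i s"
    using g(2) by (intro AE_finite_allI) auto
  then have "AE s in lebesgue. \<forall>i\<in>Basis. V s \<bullet> i = g i s" by (rule AE_completion)
  then have "AE s in lebesgue. V s = U s"
    using Vb
  proof eventually_elim
    case (elim s)
    then have "V s = U0 s"
      unfolding U0_def by (subst euclidean_representation[of "V s", symmetric]) (auto intro!: sum.cong)
    then show ?case using elim by (simp add: U_def dist_norm norm_minus_commute)
  qed
  then obtain N where N: "N \<in> null_sets lebesgue" "{s. V s \<noteq> U s} \<subseteq> N"
    by (auto simp: eventually_ae_filter)
  show ?thesis
  proof (rule that[OF Um, of N])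
    show "U s \<in> cball Vbar \<epsilon>" for s using assms(2) by (simp add: U_def)
    show "negligible N" using N(1) by (simp add: negligible_iff_null_sets)
    show "V s = U s" if "s \<notin> N" for s using that N(2) by blast
  qed
qed

lemma continuous_compose_borel:
  fixes f :: "'a::euclidean_space \<Rightarrow> 'b::euclidean_space"
  assumes "continuous_on C f" "closed C" "U \<in> borel_measurable borel" "\<And>s. U s \<in> C"
  shows "(\<lambda>s. f (U s)) \<in> borel_measurable borel"
proof -
  have "(\<lambda>x. indicator C x *\<^sub>R f x) \<in> borel_measurable borel"
    using assms by (intro borel_measurable_continuous_on_indicator) auto
  from measurable_compose[OF assms(3) this] show ?thesis using assms(4) by simp
qed

text \<open>Outside a null set the two weak relations hold for increments between points: the conservation law is used as
  two opposite inequalities in each coordinate direction, so that \<open>weak_inequality_pointwise\<close> covers both.\<close>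
lemma pointwise_relations:
  fixes V :: "real \<Rightarrow> real^'m" and f :: "real^'m \<Rightarrow> real^'m" and e q :: "real^'m \<Rightarrow> real"
  assumes \<epsilon>: "0 < \<epsilon>" and V: "V \<in> Linfty_cball Vbar \<epsilon>"
    and cont: "continuous_on (cball Vbar \<epsilon>) f" "continuous_on (cball Vbar \<epsilon>) e" "continuous_on (cball Vbar \<epsilon>) q"
    and weak: "weak_solution f v0 (self_similar V)" and entropy: "entropy_admissible e q (self_similar V)"
  obtains U N M where "U \<in> borel_measurable borel" "\<And>s. U s \<in> cball Vbar \<epsilon>" "negligible N" "\<And>s. s \<notin> N \<Longrightarrow> V s = U s"
    "\<And>x y. \<lbrakk>x \<notin> N; y \<notin> N; x < y\<rbrakk> \<Longrightarrow> (f (U x) - x *\<^sub>R U x) - (f (U y) - y *\<^sub>R U y) = integral {x..y} U"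
    "\<And>x y. \<lbrakk>x \<notin> N; y \<notin> N; x < y\<rbrakk> \<Longrightarrow> (q (U y) - y * e (U y)) - (q (U x) - x * e (U x)) \<le> M * (y - x)"
proof -
  obtain U N0 where U: "U \<in> borel_measurable borel" "\<And>s. U s \<in> cball Vbar \<epsilon>"
    and N0: "negligible N0" "\<And>s. s \<notin> N0 \<Longrightarrow> V s = U s"
    using Linfty_Borel_version[OF V \<epsilon>] by blast
  note [measurable] = U(1)
  have [measurable]: "(\<lambda>s. f (U s)) \<in> borel_measurable borel" "(\<lambda>s. e (U s)) \<in> borel_measurable borel"
    "(\<lambda>s. q (U s)) \<in> borel_measurable borel"
    by (rule continuous_compose_borel[OF _ closed_cball U]; rule cont)+
  have bnd: "\<exists>C. \<forall>x\<in>cball Vbar \<epsilon>. norm (g x) \<le> C" if "continuous_on (cball Vbar \<epsilon>) g" for g :: "real^'m \<Rightarrow> 'b::real_normed_vector"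
    using compact_imp_bounded[OF compact_continuous_image[OF that compact_cball]] by (auto simp: bounded_iff)
  obtain C1 C2 C3 C4 where C: "\<forall>x\<in>cball Vbar \<epsilon>. norm (f x) \<le> C1" "\<forall>x\<in>cball Vbar \<epsilon>. norm (e x) \<le> C2"
    "\<forall>x\<in>cball Vbar \<epsilon>. norm (q x) \<le> C3" "\<forall>x\<in>cball Vbar \<epsilon>. norm x \<le> C4"
    using bnd[OF cont(1)] bnd[OF cont(2)] bnd[OF cont(3)] bnd[OF continuous_on_id] by metis
  define C where "C = \<bar>C1\<bar> + \<bar>C2\<bar> + \<bar>C3\<bar> + \<bar>C4\<bar>"
  have CU: "norm (f (U s)) \<le> C" "norm (e (U s)) \<le> C" "norm (q (U s)) \<le> C" "norm (U s) \<le> C" for s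
    using C(1)[rule_format, OF U(2)[of s]] C(2)[rule_format, OF U(2)[of s]] C(3)[rule_format, OF U(2)[of s]]
      C(4)[rule_format, OF U(2)[of s]] by (simp_all add: C_def)
  have C0: "0 \<le> C" by (simp add: C_def)
  have ae: "AE p in lebesgue. p \<in> upper_half \<longrightarrow> self_similar V p = U (snd p / fst p)"
  proof -
    have "AE p in lebesgue. p \<notin> {p :: real \<times> real. 0 < fst p \<and> snd p / fst p \<in> N0}"
      using negligible_cone[OF N0(1)] by (intro AE_not_in) (simp add: negligible_iff_null_sets)
    then show ?thesis
      by eventually_elim (use N0(2) in \<open>auto simp: self_similar_def split: prod.splits\<close>)
  qed
  have sys: "(LINT s|lborel. (bump n h (s - x) - bump n h (s - y)) *\<^sub>R (f (U s) - s *\<^sub>R U s)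
      - (step n h (s - x) - step n h (s - y)) *\<^sub>R U s) = 0" if hxy: "0 < h" "x < y" for n h x y
  proof -
    interpret tp: test_product "\<lambda>t. bump 0 1 (t - 1)" "\<lambda>t. frechet_derivative (\<lambda>t. bump 0 1 (t - 1)) (at t) 1"
      "\<lambda>s. step n h (s - x) - step n h (s - y)" "\<lambda>s. bump n h (s - x) - bump n h (s - y)" "\<bar>x\<bar> + \<bar>y\<bar> + h"
      by (rule step_test_product[OF hxy])
    have "(LINT p:upper_half|lebesgue. dt tp.phi p *\<^sub>R self_similar V p + dz tp.phi p *\<^sub>R f (self_similar V p))
       + (LINT z|lebesgue. tp.phi (0, z) *\<^sub>R v0 z) = 0"
      using weak tp.phi_test(1) by (simp add: weak_solution_def)
    moreover have "tp.phi (0, z) = 0" for z by (simp add: tp.phi_def bump_zero)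
    moreover have "(LINT p:upper_half|lebesgue. dt tp.phi p *\<^sub>R self_similar V p + dz tp.phi p *\<^sub>R f (self_similar V p))
      = (LINT t|lborel. bump 0 1 (t - 1)) *\<^sub>R (LINT s|lborel. (bump n h (s - x) - bump n h (s - y)) *\<^sub>R (f (U s) - s *\<^sub>R U s)
      - (step n h (s - x) - step n h (s - y)) *\<^sub>R U s)"
      by (rule tp.weak_identity_lebesgue[where C = C]) (use CU ae in \<open>auto elim!: eventually_mono\<close>)
    ultimately show ?thesis using bump_shift_integral[of 1 0 1] by simp
  qed
  have sys_int: "integrable lborel (\<lambda>s. (bump n h (s - x) - bump n h (s - y)) *\<^sub>R (f (U s) - s *\<^sub>R U s)
      - (step n h (s - x) - step n h (s - y)) *\<^sub>R U s)" if hxy: "0 < h" "x < y" for n h x y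
  proof -
    interpret tp: test_product "\<lambda>t. bump 0 1 (t - 1)" "\<lambda>t. frechet_derivative (\<lambda>t. bump 0 1 (t - 1)) (at t) 1"
      "\<lambda>s. step n h (s - x) - step n h (s - y)" "\<lambda>s. bump n h (s - x) - bump n h (s - y)" "\<bar>x\<bar> + \<bar>y\<bar> + h"
      by (rule step_test_product[OF hxy])
    show ?thesis by (rule tp.density_integrable[where C = C]) (use CU in auto)
  qed
  have ent: "0 \<le> (LINT s|lborel. (bump n h (s - x) - bump n h (s - y)) * (q (U s) - s * e (U s))
      - (step n h (s - x) - step n h (s - y)) * e (U s))" if hxy: "0 < h" "x < y" for n h x y
  proof -
    interpret tp: test_product "\<lambda>t. bump 0 1 (t - 1)" "\<lambda>t. frechet_derivative (\<lambda>t. bump 0 1 (t - 1)) (at t) 1"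
      "\<lambda>s. step n h (s - x) - step n h (s - y)" "\<lambda>s. bump n h (s - x) - bump n h (s - y)" "\<bar>x\<bar> + \<bar>y\<bar> + h"
      by (rule step_test_product[OF hxy])
    have "0 \<le> tp.phi p" for p
      unfolding tp.phi_def using bump_bounds(1) hxy by (intro mult_nonneg_nonneg) (auto intro: step_mono)
    then have "0 \<le> (LINT p:upper_half|lebesgue. dt tp.phi p * e (self_similar V p) + dz tp.phi p * q (self_similar V p))"
      using entropy tp.phi_test unfolding entropy_admissible_def by blast
    moreover have "(LINT p:upper_half|lebesgue. dt tp.phi p *\<^sub>R e (self_similar V p) + dz tp.phi p *\<^sub>R q (self_similar V p))
      = (LINT t|lborel. bump 0 1 (t - 1)) *\<^sub>R (LINT s|lborel. (bump n h (s - x) - bump n h (s - y)) *\<^sub>R (q (U s) - s *\<^sub>R e (U s))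
      - (step n h (s - x) - step n h (s - y)) *\<^sub>R e (U s))"
      by (rule tp.weak_identity_lebesgue[where C = C]) (use CU ae in \<open>auto elim!: eventually_mono\<close>)
    ultimately show ?thesis using bump_shift_integral[of 1 0 1] by (simp add: zero_le_mult_iff)
  qed
  have growth: "\<bar>a - s * b\<bar> \<le> C * (1 + \<bar>s\<bar>)" if "\<bar>a\<bar> \<le> C" "\<bar>b\<bar> \<le> C" for a b s :: real
  proof -
    have "\<bar>a - s * b\<bar> \<le> \<bar>a\<bar> + \<bar>s\<bar> * \<bar>b\<bar>" using abs_triangle_ineq4[of a "s * b"] by (simp add: abs_mult)
    also have "\<dots> \<le> C + \<bar>s\<bar> * C" using that by (intro add_mono mult_left_mono) auto
    finally show ?thesis by (simp add: algebra_simps)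
  qed
  have comp: "\<exists>N. negligible N \<and> (\<forall>x y. x \<notin> N \<longrightarrow> y \<notin> N \<longrightarrow> x < y \<longrightarrow>
      integral {x..y} (\<lambda>s. U s \<bullet> i) \<le> (f (U x) - x *\<^sub>R U x) \<bullet> i - (f (U y) - y *\<^sub>R U y) \<bullet> i)"
    if i: "norm i = 1" for i :: "real^'m"
  proof -
    have ii: "\<bar>z \<bullet> i\<bar> \<le> norm z" for z using Cauchy_Schwarz_ineq2[of z i] i by simp
    have "\<exists>N. negligible N \<and> (\<forall>x y. x \<notin> N \<longrightarrow> y \<notin> N \<longrightarrow> x < y \<longrightarrow>
      integral {x..y} (\<lambda>s. U s \<bullet> i) \<le> (\<lambda>s. f (U s) \<bullet> i - s * (U s \<bullet> i)) x - (\<lambda>s. f (U s) \<bullet> i - s * (U s \<bullet> i)) y)"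
    proof (rule weak_inequality_pointwise[of "\<lambda>s. f (U s) \<bullet> i - s * (U s \<bullet> i)" "\<lambda>s. U s \<bullet> i" C])
      show "\<bar>f (U s) \<bullet> i - s * (U s \<bullet> i)\<bar> \<le> C * (1 + \<bar>s\<bar>)" "\<bar>U s \<bullet> i\<bar> \<le> C" for s
        using CU[of s] ii[of "f (U s)"] ii[of "U s"] by (auto intro!: growth)
      show "0 \<le> (LINT s|lborel. (bump n h (s - x) - bump n h (s - y)) * (f (U s) \<bullet> i - s * (U s \<bullet> i))
          - (step n h (s - x) - step n h (s - y)) * (U s \<bullet> i))" if hxy: "0 < h" "x < y" for n h x y
      proof -
        have "(LINT s|lborel. ((bump n h (s - x) - bump n h (s - y)) *\<^sub>R (f (U s) - s *\<^sub>R U s)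
          - (step n h (s - x) - step n h (s - y)) *\<^sub>R U s) \<bullet> i) = 0"
          by (subst integral_inner_left) (use sys[OF hxy] sys_int[OF hxy] in simp_all)
        then show ?thesis by (simp add: inner_diff_left)
      qed
    qed (measurable, blast)
    then show ?thesis by (simp add: inner_diff_left)
  qed
  have "\<exists>N. negligible N \<and> (\<forall>x y. x \<notin> N \<longrightarrow> y \<notin> N \<longrightarrow> x < y \<longrightarrow>
      integral {x..y} (\<lambda>s. e (U s)) \<le> (\<lambda>s. q (U s) - s * e (U s)) x - (\<lambda>s. q (U s) - s * e (U s)) y)"
  proof (rule weak_inequality_pointwise[of "\<lambda>s. q (U s) - s * e (U s)" "\<lambda>s. e (U s)" C])
    show "\<bar>q (U s) - s * e (U s)\<bar> \<le> C * (1 + \<bar>s\<bar>)" "\<bar>e (U s)\<bar> \<le> C" for s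
      using CU[of s] by (auto intro!: growth)
  qed (measurable, use ent in blast, blast)
  then obtain Ne where Ne: "negligible Ne" "\<And>x y. \<lbrakk>x \<notin> Ne; y \<notin> Ne; x < y\<rbrakk> \<Longrightarrow>
      integral {x..y} (\<lambda>s. e (U s)) \<le> (q (U x) - x * e (U x)) - (q (U y) - y * e (U y))" by blast
  have "\<forall>i\<in>Basis \<union> uminus ` Basis. \<exists>N. negligible N \<and> (\<forall>x y. x \<notin> N \<longrightarrow> y \<notin> N \<longrightarrow> x < y \<longrightarrow>
      integral {x..y} (\<lambda>s. U s \<bullet> i) \<le> (f (U x) - x *\<^sub>R U x) \<bullet> i - (f (U y) - y *\<^sub>R U y) \<bullet> i)"
    by (intro ballI comp) auto
  then obtain Nf where Nf: "\<And>i. i \<in> Basis \<union> uminus ` Basis \<Longrightarrow> negligible (Nf i)"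
    "\<And>i x y. \<lbrakk>i \<in> Basis \<union> uminus ` Basis; x \<notin> Nf i; y \<notin> Nf i; x < y\<rbrakk> \<Longrightarrow>
      integral {x..y} (\<lambda>s. U s \<bullet> i) \<le> (f (U x) - x *\<^sub>R U x) \<bullet> i - (f (U y) - y *\<^sub>R U y) \<bullet> i"
    by metis
  define N where "N = N0 \<union> Ne \<union> (\<Union>i\<in>Basis \<union> uminus ` Basis. Nf i)"
  have Uint: "U integrable_on {x..y}" for x y
    by (rule bounded_borel_integrable_on(2)[of U x y C]) (use U CU in auto)
  show ?thesis
  proof (rule that[OF U, of N C])
    show "negligible N"
      unfolding N_def using N0 Ne Nf(1) by (intro negligible_Un negligible_Union finite_imageI) auto
    show "V s = U s" if "s \<notin> N" for s using that N0(2) by (auto simp: N_def)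
    fix x y assume xy: "x \<notin> N" "y \<notin> N" "x < y"
    show "(f (U x) - x *\<^sub>R U x) - (f (U y) - y *\<^sub>R U y) = integral {x..y} U"
    proof (rule euclidean_eqI)
      fix i :: "real^'m" assume i: "i \<in> Basis"
      have int_inner: "integral {x..y} (\<lambda>s. U s \<bullet> z) = integral {x..y} U \<bullet> z" for z
        using integral_linear[OF Uint bounded_linear_inner_left, of x y z] by (simp add: o_def)
      have "integral {x..y} (\<lambda>s. U s \<bullet> i) \<le> (f (U x) - x *\<^sub>R U x) \<bullet> i - (f (U y) - y *\<^sub>R U y) \<bullet> i"
        using i xy by (intro Nf(2)) (auto simp: N_def)
      moreover have "integral {x..y} (\<lambda>s. U s \<bullet> (- i)) \<le> (f (U x) - x *\<^sub>R U x) \<bullet> (- i) - (f (U y) - y *\<^sub>R U y) \<bullet> (- i)"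
        using i xy by (intro Nf(2)) (auto simp: N_def)
      ultimately show "((f (U x) - x *\<^sub>R U x) - (f (U y) - y *\<^sub>R U y)) \<bullet> i = integral {x..y} U \<bullet> i"
        unfolding int_inner by (simp add: inner_diff_left)
    qed
    have "integral {x..y} (\<lambda>s. e (U s)) \<le> (q (U x) - x * e (U x)) - (q (U y) - y * e (U y))"
      using xy by (intro Ne(2)) (auto simp: N_def)
    moreover have "- (C * (y - x)) \<le> integral {x..y} (\<lambda>s. e (U s))"
    proof -
      have "(\<lambda>s. e (U s)) integrable_on {x..y}"
        by (rule bounded_borel_integrable_on(2)[of _ x y C]) (use CU in auto)
      from has_integral_bound_real[OF C0 finite.emptyI integrable_integral[OF this]]
      have "norm (integral {x..y} (\<lambda>s. e (U s))) \<le> C * Henstock_Kurzweil_Integration.content {x..y}" using CU by blast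
      then show ?thesis using xy by simp
    qed
    ultimately show "(q (U y) - y * e (U y)) - (q (U x) - x * e (U x)) \<le> C * (y - x)" by linarith
  qed
qed

section \<open>Everywhere defined representatives and initial data\<close>

text \<open>On the exceptional null set the solution is redefined as a limit along regular points, which exists by
  compactness of the ball. All relations involve continuous functions of the position and the state and therefore
  pass to the limit, for whichever limit is chosen.\<close>
lemma regular_representative:
  fixes V :: "real \<Rightarrow> real^'m" and f :: "real^'m \<Rightarrow> real^'m" and e q :: "real^'m \<Rightarrow> real"
  assumes \<epsilon>: "0 < \<epsilon>" and V: "V \<in> Linfty_cball Vbar \<epsilon>"
    and cont: "continuous_on (cball Vbar \<epsilon>) f" "continuous_on (cball Vbar \<epsilon>) e" "continuous_on (cball Vbar \<epsilon>) q"
    and weak: "weak_solution f v0 (self_similar V)" and entropy: "entropy_admissible e q (self_similar V)"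
  obtains U M where "\<And>s. U s \<in> cball Vbar \<epsilon>" "negligible {s. V s \<noteq> U s}"
    "\<And>x y C. (\<And>s. s \<in> closed_segment x y \<Longrightarrow> norm (U s - U y) \<le> C) \<Longrightarrow>
      norm (f (U x) - f (U y) - x *\<^sub>R (U x - U y)) \<le> C * \<bar>x - y\<bar>"
    "\<And>x y. x < y \<Longrightarrow> (q (U y) - y * e (U y)) - (q (U x) - x * e (U x)) \<le> M * (y - x)"
proof -
  obtain U0 N M where U0: "U0 \<in> borel_measurable borel" "\<And>s. U0 s \<in> cball Vbar \<epsilon>" and N: "negligible N" "\<And>s. s \<notin> N \<Longrightarrow> V s = U0 s"
    and eq0: "\<And>x y. \<lbrakk>x \<notin> N; y \<notin> N; x < y\<rbrakk> \<Longrightarrow> (f (U0 x) - x *\<^sub>R U0 x) - (f (U0 y) - y *\<^sub>R U0 y) = integral {x..y} U0"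
    and ent0: "\<And>x y. \<lbrakk>x \<notin> N; y \<notin> N; x < y\<rbrakk> \<Longrightarrow> (q (U0 y) - y * e (U0 y)) - (q (U0 x) - x * e (U0 x)) \<le> M * (y - x)"
    using pointwise_relations[OF assms] by blast
  have "\<exists>b u. (\<forall>n. b n \<notin> N) \<and> b \<longlonglongrightarrow> x \<and> (\<lambda>n. U0 (b n)) \<longlonglongrightarrow> u \<and> u \<in> cball Vbar \<epsilon> \<and> (x \<notin> N \<longrightarrow> u = U0 x)" for x :: real
  proof (cases "x \<in> N")
    case False
    then show ?thesis using U0(2) by (intro exI[of _ "\<lambda>n. x"] exI[of _ "U0 x"]) auto
  next
    case True
    have "\<exists>b. b \<notin> N \<and> x - 1 / real (Suc n) < b \<and> b < x" for n
    proof (rule ccontr)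
      assume "\<not> ?thesis"
      then have "{x - 1 / real (Suc n)<..<x} \<subseteq> N" by auto
      then have "negligible {x - 1 / real (Suc n)<..<x}" by (rule negligible_subset[OF N(1)])
      moreover have "x - 1 / real (Suc n) < x" by simp
      then have "{x - 1 / real (Suc n)<..<x} \<noteq> {}" using dense[of "x - 1 / real (Suc n)" x] by auto
      ultimately show False using open_not_negligible[OF open_greaterThanLessThan] by blast
    qed
    then obtain b where b: "\<And>n. b n \<notin> N" "\<And>n. x - 1 / real (Suc n) < b n" "\<And>n. b n < x" by metis
    have "(\<lambda>n. x - 1 / real (Suc n)) \<longlonglongrightarrow> x - 0" by (intro tendsto_diff tendsto_const LIMSEQ_Suc[OF lim_const_over_n])
    then have bx: "b \<longlonglongrightarrow> x"
      by (intro tendsto_sandwich[of "\<lambda>n. x - 1 / real (Suc n)" b _ "\<lambda>n. x"]) (use b in \<open>auto intro!: eventually_sequentiallyI less_imp_le\<close>)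
    have "\<forall>n. U0 (b n) \<in> cball Vbar \<epsilon>" using U0(2) by blast
    then obtain u r where u: "u \<in> cball Vbar \<epsilon>" "strict_mono r" "((\<lambda>n. U0 (b n)) \<circ> r) \<longlonglongrightarrow> u"
      by (rule seq_compactE[OF compact_cball[of Vbar \<epsilon>, unfolded compact_eq_seq_compact_metric]])
    show ?thesis
    proof (rule exI[of _ "b \<circ> r"], rule exI[of _ u], intro conjI allI impI)
      show "(\<lambda>n. U0 ((b \<circ> r) n)) \<longlonglongrightarrow> u" using u(3) by (simp add: o_def)
      show "u = U0 x" if "x \<notin> N" using that True by simp
      show "(b \<circ> r) n \<notin> N" for n using b(1) by simp
      show "(b \<circ> r) \<longlonglongrightarrow> x" by (rule LIMSEQ_subseq_LIMSEQ[OF bx u(2)])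
      show "u \<in> cball Vbar \<epsilon>" by (rule u(1))
    qed
  qed
  then have "\<forall>x. \<exists>b u. (\<forall>n. b n \<notin> N) \<and> b \<longlonglongrightarrow> x \<and> (\<lambda>n. U0 (b n)) \<longlonglongrightarrow> u \<and> u \<in> cball Vbar \<epsilon> \<and> (x \<notin> N \<longrightarrow> u = U0 x)" by blast
  from choice[OF this] obtain b where "\<forall>x. \<exists>u. (\<forall>n. b x n \<notin> N) \<and> b x \<longlonglongrightarrow> x \<and> (\<lambda>n. U0 (b x n)) \<longlonglongrightarrow> u \<and> u \<in> cball Vbar \<epsilon> \<and> (x \<notin> N \<longrightarrow> u = U0 x)" by (rule exE)
  from choice[OF this] obtain U where
    "\<forall>x. (\<forall>n. b x n \<notin> N) \<and> b x \<longlonglongrightarrow> x \<and> (\<lambda>n. U0 (b x n)) \<longlonglongrightarrow> U x \<and> U x \<in> cball Vbar \<epsilon> \<and> (x \<notin> N \<longrightarrow> U x = U0 x)" by (rule exE)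
  note bU_all = this[rule_format]
  have bN: "b x n \<notin> N" and bx: "b x \<longlonglongrightarrow> x" and bU: "(\<lambda>n. U0 (b x n)) \<longlonglongrightarrow> U x" and U_ball: "U x \<in> cball Vbar \<epsilon>" for x n
    using bU_all[of x] by blast+
  have U_eq: "U x = U0 x" if "x \<notin> N" for x using bU_all[of x] that by blast
  note U = U_ball U_eq
  have lim: "(\<lambda>n. g (U0 (b x n))) \<longlonglongrightarrow> g (U x)" if "continuous_on (cball Vbar \<epsilon>) g" for g :: "real^'m \<Rightarrow> 'c::real_normed_vector" and x
    by (rule continuous_on_tendsto_compose[OF that bU U(1)]) (simp add: U0(2) del: mem_cball)
  have limA: "(\<lambda>n. f (U0 (b x n)) - b x n *\<^sub>R U0 (b x n)) \<longlonglongrightarrow> f (U x) - x *\<^sub>R U x" for x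
    by (intro tendsto_intros lim cont bx bU)
  have limB: "(\<lambda>n. q (U0 (b x n)) - b x n * e (U0 (b x n))) \<longlonglongrightarrow> q (U x) - x * e (U x)" for x
    by (intro tendsto_intros lim cont bx)
  have before: "\<forall>\<^sub>F n in sequentially. b x n < b y n" if "x < y" for x y
  proof -
    have "\<forall>\<^sub>F n in sequentially. b x n < (x + y) / 2" "\<forall>\<^sub>F n in sequentially. (x + y) / 2 < b y n"
      using that by (intro order_tendstoD[OF bx]; simp)+
    then show ?thesis by eventually_elim linarith
  qed
  have ent: "(q (U y) - y * e (U y)) - (q (U x) - x * e (U x)) \<le> M * (y - x)" if "x < y" for x y
  proof (rule tendsto_le[OF sequentially_bot])
    show "(\<lambda>n. M * (b y n - b x n)) \<longlonglongrightarrow> M * (y - x)" by (intro tendsto_intros bx)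
    show "(\<lambda>n. (q (U0 (b y n)) - b y n * e (U0 (b y n))) - (q (U0 (b x n)) - b x n * e (U0 (b x n))))
      \<longlonglongrightarrow> (q (U y) - y * e (U y)) - (q (U x) - x * e (U x))" by (intro tendsto_diff limB)
    show "\<forall>\<^sub>F n in sequentially. (q (U0 (b y n)) - b y n * e (U0 (b y n))) - (q (U0 (b x n)) - b x n * e (U0 (b x n)))
      \<le> M * (b y n - b x n)"
      using before[OF that] by eventually_elim (rule ent0[OF bN bN])
  qed
  have int0: "U0 integrable_on {x..y}" for x y
  proof (rule bounded_borel_integrable_on(2)[of U0 x y "norm Vbar + \<epsilon>"])
    show "norm (U0 s) \<le> norm Vbar + \<epsilon>" for s
      using U0(2)[of s] norm_triangle_ineq2[of "U0 s" Vbar] by (simp add: dist_norm norm_minus_commute)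
  qed (use U0(1) in simp)
  have spike: "integral {x..y} U = integral {x..y} U0" for x y
    by (rule integral_spike[OF N(1)]) (use U(2) in auto)
  have int: "U integrable_on {x..y}" for x y
    by (rule integrable_spike[OF int0 N(1)]) (use U(2) in auto)
  have eq: "(f (U x) - x *\<^sub>R U x) - (f (U y) - y *\<^sub>R U y) = integral {x..y} U" if xy: "x < y" for x y
  proof -
    define F where "F t = integral {x-1..t} U0" for t
    have Fc: "continuous_on {x-1..y+1} F" unfolding F_def by (rule indefinite_integral_continuous_1[OF int0])
    have F_lim: "(\<lambda>n. F (b z n)) \<longlonglongrightarrow> F z" if z: "z \<in> {x..y}" for z
    proof (rule continuous_on_tendsto_compose[OF Fc bx])
      show "z \<in> {x-1..y+1}" using z by auto
      have "\<forall>\<^sub>F n in sequentially. x - 1 < b z n" "\<forall>\<^sub>F n in sequentially. b z n < y + 1"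
        using z by (intro order_tendstoD[OF bx]; simp)+
      then show "\<forall>\<^sub>F n in sequentially. b z n \<in> {x-1..y+1}" by eventually_elim auto
    qed
    have F_diff: "F t - F s = integral {s..t} U0" if "x - 1 \<le> s" "s \<le> t" for s t
      using Henstock_Kurzweil_Integration.integral_combine[OF that int0] unfolding F_def by (simp add: algebra_simps)
    have "\<forall>\<^sub>F n in sequentially. x - 1 < b x n" by (rule order_tendstoD[OF bx]) simp
    with before[OF xy] have "\<forall>\<^sub>F n in sequentially. (f (U0 (b x n)) - b x n *\<^sub>R U0 (b x n)) - (f (U0 (b y n)) - b y n *\<^sub>R U0 (b y n))
        = F (b y n) - F (b x n)"
      by eventually_elim (simp only: eq0[OF bN bN] F_diff less_imp_le)
    moreover have "(\<lambda>n. F (b y n) - F (b x n)) \<longlonglongrightarrow> F y - F x"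
      using xy by (intro tendsto_diff F_lim) auto
    ultimately have "(\<lambda>n. (f (U0 (b x n)) - b x n *\<^sub>R U0 (b x n)) - (f (U0 (b y n)) - b y n *\<^sub>R U0 (b y n))) \<longlonglongrightarrow> F y - F x"
      by (subst tendsto_cong) 
    moreover have "(\<lambda>n. (f (U0 (b x n)) - b x n *\<^sub>R U0 (b x n)) - (f (U0 (b y n)) - b y n *\<^sub>R U0 (b y n)))
        \<longlonglongrightarrow> (f (U x) - x *\<^sub>R U x) - (f (U y) - y *\<^sub>R U y)"
      by (intro tendsto_diff limA)
    ultimately have "(f (U x) - x *\<^sub>R U x) - (f (U y) - y *\<^sub>R U y) = F y - F x"
      by (rule LIMSEQ_unique[rotated])
    then show ?thesis using F_diff[of x y] xy spike by simp
  qed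
  have bound: "norm (integral {x..y} U - (y - x) *\<^sub>R c) \<le> C * (y - x)"
    if xy: "x \<le> y" and C: "\<And>s. s \<in> {x..y} \<Longrightarrow> norm (U s - c) \<le> C" for x y c C
  proof -
    have C0: "0 \<le> C" using C[of x] xy norm_ge_zero[of "U x - c"] by (meson atLeastAtMost_iff order.refl order_trans)
    have "((\<lambda>s. U s - c) has_integral integral {x..y} U - (y - x) *\<^sub>R c) {x..y}"
      using has_integral_diff[OF integrable_integral[OF int] has_integral_const_real[of c x y]] xy by simp
    from has_integral_bound_real[OF C0 finite.emptyI this] show ?thesis using C xy by simp
  qed
  show ?thesis
  proof (rule that[OF U(1) _ _ ent])
    show "negligible {s. V s \<noteq> U s}"
    proof (rule negligible_subset[OF N(1)])
      have "V s = U s" if "s \<notin> N" for s using that by (simp add: N(2) U(2))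
      then show "{s. V s \<noteq> U s} \<subseteq> N" by blast
    qed
    fix x y C assume C: "\<And>s. s \<in> closed_segment x y \<Longrightarrow> norm (U s - U y) \<le> C"
    consider "x = y" | "x < y" | "y < x" by linarith
    then show "norm (f (U x) - f (U y) - x *\<^sub>R (U x - U y)) \<le> C * \<bar>x - y\<bar>"
    proof cases
      case 1
      then show ?thesis by simp
    next
      case 2
      have "f (U x) - f (U y) - x *\<^sub>R (U x - U y) = integral {x..y} U - (y - x) *\<^sub>R U y"
        unfolding eq[OF 2, symmetric] by (simp add: algebra_simps)
      then show ?thesis using bound[of x y "U y" C] C 2 by (simp add: closed_segment_eq_real_ivl)
    next
      case 3
      have "f (U x) - f (U y) - x *\<^sub>R (U x - U y) = - (integral {y..x} U - (x - y) *\<^sub>R U y)"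
        unfolding eq[OF 3, symmetric] by (simp add: algebra_simps)
      then have "norm (f (U x) - f (U y) - x *\<^sub>R (U x - U y)) = norm (integral {y..x} U - (x - y) *\<^sub>R U y)"
        by (simp only: norm_minus_cancel)
      then show ?thesis using bound[of y x "U y" C] C 3 by (simp add: closed_segment_eq_real_ivl)
    qed
  qed
qed

text \<open>The initial data enter only here: near a point of \<open>t = 0\<close> where the solution is constant, a
  product test function reduces the weak formulation to the difference of that constant and the datum.\<close>

lemma initial_value_constant:
  fixes c d :: "real^'m" and f :: "real^'m \<Rightarrow> real^'m"
  assumes weak: "weak_solution f v0 v" and \<tau>: "0 < \<tau>"
    and v: "AE p in lebesgue. 0 < fst p \<and> fst p < \<tau> \<and> snd p \<in> {z0<..<z0+1} \<longrightarrow> v p = c"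
    and v0: "\<And>z. z \<in> {z0<..<z0+1} \<Longrightarrow> v0 z = d"
  shows "c = d"
proof -
  define a where "a t = bump 0 (2 * \<tau>) (t - (- \<tau>))" for t
  define b where "b z = bump 0 1 (z - z0)" for z
  define a' where "a' t = frechet_derivative a (at t) 1" for t
  define b' where "b' t = frechet_derivative b (at t) 1" for t
  define \<phi> where "\<phi> p = a (fst p) * b (snd p)" for p :: "real \<times> real"
  have a_eq: "a = (\<lambda>t. bump 0 (2 * \<tau>) (t - (- \<tau>)))" and b_eq: "b = (\<lambda>z. bump 0 1 (z - z0))"
    by (auto simp: a_def b_def)
  have sm: "Ck_on k a UNIV" "Ck_on k b UNIV" for k unfolding a_eq b_eq by (rule Ck_on_bump_shift)+
  have ad: "(a has_real_derivative a' t) (at t)" for t unfolding a'_def a_eq by (rule bump_shift_deriv)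
  have bd: "(b has_real_derivative b' t) (at t)" for t unfolding b'_def b_eq by (rule bump_shift_deriv)
  have ac: "continuous_on UNIV a'" unfolding a'_def[abs_def] a_eq by (rule bump_shift_deriv_cont)
  have bc: "continuous_on UNIV b'" unfolding b'_def[abs_def] b_eq by (rule bump_shift_deriv_cont)
  note cont = Ck_on_continuous[OF sm(1)] Ck_on_continuous[OF sm(2)] ac bc
  note [measurable] = cont[THEN borel_measurable_continuous_onI]
  have a0: "a t = 0" "a' t = 0" if "t \<notin> {-\<tau><..<\<tau>}" for t
    using that bump_shift_deriv_zero[of t "-\<tau>" "2 * \<tau>" 0] by (auto simp: a'_def a_eq intro!: bump_zero)
  have b0: "b z = 0" "b' z = 0" if "z \<notin> {z0<..<z0+1}" for z
    using that bump_shift_deriv_zero[of z z0 1 0] by (auto simp: b'_def b_eq intro!: bump_zero)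
  have test: "test_function \<phi>"
  proof -
    have "closure {p. \<phi> p \<noteq> 0} \<subseteq> {-\<tau>..\<tau>} \<times> {z0..z0+1}"
    proof (rule closure_minimal)
      show "{p. \<phi> p \<noteq> 0} \<subseteq> {-\<tau>..\<tau>} \<times> {z0..z0+1}"
        using a0(1) b0(1) unfolding \<phi>_def by (auto simp: not_le) (meson a0(1) b0(1) greaterThanLessThan_iff less_imp_le)+
    qed (intro closed_Times closed_atLeastAtMost)
    then have "compact (closure {p. \<phi> p \<noteq> 0})"
      using compact_Int_closed[OF compact_Times[OF compact_Icc[of "-\<tau>" \<tau>] compact_Icc[of z0 "z0+1"]], of "closure {p. \<phi> p \<noteq> 0}"]
      by (metis closed_closure inf.absorb2)
    moreover have "Ck_on k \<phi> UNIV" for k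
      unfolding \<phi>_def[abs_def]
      by (intro Ck_on_mult open_UNIV Ck_on_compose[OF open_UNIV subset_UNIV sm(1) Ck_on_linear[OF bounded_linear_fst open_UNIV]]
          Ck_on_compose[OF open_UNIV subset_UNIV sm(2) Ck_on_linear[OF bounded_linear_snd open_UNIV]])
    ultimately show ?thesis by (simp add: test_function_def smooth_on_def)
  qed
  have der: "dt \<phi> p = a' (fst p) * b (snd p)" "dz \<phi> p = a (fst p) * b' (snd p)" for p
  proof -
    have 1: "((\<lambda>p::real \<times> real. a (fst p)) has_derivative (\<lambda>h. a' (fst p) * fst h)) (at p)"
      using has_derivative_compose[OF bounded_linear_imp_has_derivative[OF bounded_linear_fst], of a "\<lambda>h. a' (fst p) * h" p UNIV] ad[of "fst p"]
      by (simp add: has_field_derivative_def)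
    have 2: "((\<lambda>p::real \<times> real. b (snd p)) has_derivative (\<lambda>h. b' (snd p) * snd h)) (at p)"
      using has_derivative_compose[OF bounded_linear_imp_has_derivative[OF bounded_linear_snd], of b "\<lambda>h. b' (snd p) * h" p UNIV] bd[of "snd p"]
      by (simp add: has_field_derivative_def)
    have "(\<phi> has_derivative (\<lambda>h. a (fst p) * (b' (snd p) * snd h) + a' (fst p) * fst h * b (snd p))) (at p)"
      unfolding \<phi>_def[abs_def] by (rule has_derivative_mult[OF 1 2])
    from frechet_derivative_at[OF this]
    have "frechet_derivative \<phi> (at p) = (\<lambda>h. a (fst p) * (b' (snd p) * snd h) + a' (fst p) * fst h * b (snd p))" by simp
    then show "dt \<phi> p = a' (fst p) * b (snd p)" "dz \<phi> p = a (fst p) * b' (snd p)" by simp_all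
  qed
  have bnd: "\<exists>C\<ge>0. \<forall>t. \<bar>g t\<bar> \<le> C" if "continuous_on UNIV g" "\<And>t. t \<notin> {u..v} \<Longrightarrow> g t = 0" for g :: "real \<Rightarrow> real" and u v
  proof -
    have "bounded (g ` {u..v})"
      by (intro compact_imp_bounded compact_continuous_image continuous_on_subset[OF that(1)]) auto
    then obtain C where C: "C > 0" "\<forall>x \<in> g ` {u..v}. norm x \<le> C" unfolding bounded_pos by metis
    have "\<bar>g t\<bar> \<le> C" for t using C that(2)[of t] by (cases "t \<in> {u..v}") auto
    then show ?thesis using C(1) by (intro exI[of _ C]) auto
  qed
  obtain C1 where C1: "C1 \<ge> 0" "\<forall>t. \<bar>a t\<bar> \<le> C1" using bnd[OF cont(1), of "-\<tau>" \<tau>] a0(1) by force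
  obtain C2 where C2: "C2 \<ge> 0" "\<forall>t. \<bar>a' t\<bar> \<le> C2" using bnd[OF cont(3), of "-\<tau>" \<tau>] a0(2) by force
  obtain C3 where C3: "C3 \<ge> 0" "\<forall>t. \<bar>b t\<bar> \<le> C3" using bnd[OF cont(2), of z0 "z0+1"] b0(1) by force
  obtain C4 where C4: "C4 \<ge> 0" "\<forall>t. \<bar>b' t\<bar> \<le> C4" using bnd[OF cont(4), of z0 "z0+1"] b0(2) by force
  have ib: "integrable lborel b" unfolding b_eq by (rule bump_shift_integrable)
  have ib': "integrable lborel b'"
    by (rule integrable_bounded_support[of _ "{z0..z0+1}" C4]) (use C4 b0 in auto)
  have ia: "integrable lborel (\<lambda>t. indicator {0<..} t * a t)"
    by (rule integrable_bounded_support[of _ "{-\<tau>..\<tau>}" C1]) (use C1 a0 in \<open>auto simp: indicator_def\<close>)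
  have ia': "integrable lborel (\<lambda>t. indicator {0<..} t * a' t)"
    by (rule integrable_bounded_support[of _ "{-\<tau>..\<tau>}" C2]) (use C2 a0 in \<open>auto simp: indicator_def\<close>)
  have int_b': "(LINT z|lborel. b' z) = 0"
  proof -
    have "(LINT z|lborel. indicator {z0..z0+1} z *\<^sub>R b' z) = b (z0 + 1) - b z0"
    proof (rule integral_FTC_atLeastAtMost)
      show "(b has_vector_derivative b' t) (at t within {z0..z0+1})" for t
        using has_field_derivative_at_within[OF bd] by (simp add: has_real_derivative_iff_has_vector_derivative)
      show "continuous_on {z0..z0+1} b'" by (rule continuous_on_subset[OF bc]) simp
    qed simp
    moreover have "indicator {z0..z0+1} z *\<^sub>R b' z = b' z" for z using b0(2)[of z] by (cases "z \<in> {z0<..<z0+1}") auto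
    then have "(LINT z|lborel. indicator {z0..z0+1} z *\<^sub>R b' z) = (LINT z|lborel. b' z)"
      by (intro Bochner_Integration.integral_cong refl)
    ultimately show ?thesis by (simp add: b0)
  qed
  have int_a': "(LINT t|lborel. indicator {0<..} t * a' t) = - a 0"
  proof -
    have "(LINT t|lborel. indicator {0..\<tau>} t *\<^sub>R a' t) = a \<tau> - a 0"
    proof (rule integral_FTC_atLeastAtMost)
      show "(a has_vector_derivative a' t) (at t within {0..\<tau>})" for t
        using has_field_derivative_at_within[OF ad] by (simp add: has_real_derivative_iff_has_vector_derivative)
      show "continuous_on {0..\<tau>} a'" by (rule continuous_on_subset[OF ac]) simp
    qed (use \<tau> in simp)
    moreover have "(LINT t|lborel. indicator {0..\<tau>} t *\<^sub>R a' t) = (LINT t|lborel. indicator {0<..} t * a' t)"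
    proof (rule integral_cong_AE)
      show "AE t in lborel. indicator {0..\<tau>} t *\<^sub>R a' t = indicator {0<..} t * a' t"
        using AE_lborel_singleton[of 0]
      proof eventually_elim
        case (elim t)
        then show ?case using a0(2)[of t] \<tau> by (auto simp: indicator_def)
      qed
    qed measurable
    ultimately show ?thesis using a0(1)[of \<tau>] by simp
  qed
  let ?F = "\<lambda>p::real \<times> real. (a' (fst p) * b (snd p)) *\<^sub>R c + (a (fst p) * b' (snd p)) *\<^sub>R f c"
  let ?G = "\<lambda>p::real \<times> real. (indicator {0<..} (fst p) * a' (fst p)) *\<^sub>R (b (snd p) *\<^sub>R c) + (indicator {0<..} (fst p) * a (fst p)) *\<^sub>R (b' (snd p) *\<^sub>R f c)"
  have G_int: "integrable lborel ?G"
  proof (rule integrable_bounded_support[of _ "{-\<tau>..\<tau>} \<times> {z0..z0+1}" "C2 * (C3 * norm c) + C1 * (C4 * norm (f c))"])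
    show "?G \<in> borel_measurable borel" unfolding borel_prod[symmetric] by measurable
    show "compact ({-\<tau>..\<tau>} \<times> {z0..z0+1})" by (intro compact_Times compact_Icc)
    fix p
    have "norm (?G p) \<le> \<bar>indicator {0<..} (fst p) * a' (fst p)\<bar> * (\<bar>b (snd p)\<bar> * norm c) + \<bar>indicator {0<..} (fst p) * a (fst p)\<bar> * (\<bar>b' (snd p)\<bar> * norm (f c))"
      by (rule order_trans[OF norm_triangle_ineq]) (simp only: norm_scaleR order_refl)
    also have "\<dots> \<le> C2 * (C3 * norm c) + C1 * (C4 * norm (f c))"
      using C1 C2 C3 C4 by (intro add_mono mult_mono) (auto simp: indicator_def)
    finally show "norm (?G p) \<le> C2 * (C3 * norm c) + C1 * (C4 * norm (f c))" .
    show "?G p = 0" if "p \<notin> {-\<tau>..\<tau>} \<times> {z0..z0+1}"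
    proof -
      have "fst p \<notin> {-\<tau><..<\<tau>} \<or> snd p \<notin> {z0<..<z0+1}" using that by (cases p) auto
      then show ?thesis using a0[of "fst p"] b0[of "snd p"] by auto
    qed
  qed
  have "(LINT p:upper_half|lebesgue. dt \<phi> p *\<^sub>R v p + dz \<phi> p *\<^sub>R f (v p)) = (LINT p:upper_half|lborel. ?F p)"
  proof (rule upper_half_integral_AE)
    show "?F \<in> borel_measurable borel" unfolding borel_prod[symmetric] by measurable
    show "AE p in lebesgue. p \<in> upper_half \<longrightarrow> dt \<phi> p *\<^sub>R v p + dz \<phi> p *\<^sub>R f (v p) = ?F p"
      using v
    proof eventually_elim
      case (elim p)
      show ?case
      proof
        assume "p \<in> upper_half"
        then have p: "0 < fst p" by (cases p) auto
        show "dt \<phi> p *\<^sub>R v p + dz \<phi> p *\<^sub>R f (v p) = ?F p"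
        proof (cases "fst p < \<tau> \<and> snd p \<in> {z0<..<z0+1}")
          case True
          then show ?thesis using elim p by (simp add: der)
        next
          case False
          then have "fst p \<notin> {-\<tau><..<\<tau>} \<or> snd p \<notin> {z0<..<z0+1}" by auto
          then show ?thesis using a0[of "fst p"] b0[of "snd p"] by (auto simp: der)
        qed
      qed
    qed
  qed
  also have "\<dots> = (LINT p|lborel. ?G p)"
    unfolding set_lebesgue_integral_def
    by (intro Bochner_Integration.integral_cong) (auto simp: indicator_def)
  also have "\<dots> = (LINT t|lborel. LINT z|lborel. ?G (t, z))"
    using lborel_pair.integral_fst'[of ?G] G_int by (simp add: lborel_prod)
  also have "\<dots> = (LINT t|lborel. (indicator {0<..} t * a' t) *\<^sub>R ((LINT z|lborel. b z) *\<^sub>R c))"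
    using ib ib' int_b' by (simp del: scaleR_scaleR)
  also have "\<dots> = (- a 0) *\<^sub>R ((LINT z|lborel. b z) *\<^sub>R c)"
    using ia' int_a' by (simp del: scaleR_scaleR)
  finally have 1: "(LINT p:upper_half|lebesgue. dt \<phi> p *\<^sub>R v p + dz \<phi> p *\<^sub>R f (v p)) = (- a 0) *\<^sub>R ((LINT z|lborel. b z) *\<^sub>R c)" .
  have "(LINT z|lebesgue. \<phi> (0, z) *\<^sub>R v0 z) = (LINT z|lebesgue. a 0 *\<^sub>R (b z *\<^sub>R d))"
  proof (intro Bochner_Integration.integral_cong refl)
    show "\<phi> (0, z) *\<^sub>R v0 z = a 0 *\<^sub>R (b z *\<^sub>R d)" for z
      using v0[of z] b0(1)[of z] by (cases "z \<in> {z0<..<z0+1}") (auto simp: \<phi>_def)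
  qed
  also have "\<dots> = (LINT z|lborel. a 0 *\<^sub>R (b z *\<^sub>R d))"
    by (rule integral_completion) measurable
  also have "\<dots> = a 0 *\<^sub>R ((LINT z|lborel. b z) *\<^sub>R d)"
    using ib by (simp del: scaleR_scaleR)
  finally have 2: "(LINT z|lebesgue. \<phi> (0, z) *\<^sub>R v0 z) = a 0 *\<^sub>R ((LINT z|lborel. b z) *\<^sub>R d)" .
  have "(- a 0) *\<^sub>R ((LINT z|lborel. b z) *\<^sub>R c) + a 0 *\<^sub>R ((LINT z|lborel. b z) *\<^sub>R d) = 0"
    using weak test unfolding weak_solution_def 1[symmetric] 2[symmetric] by blast
  then have "(a 0 * (LINT z|lborel. b z)) *\<^sub>R (d - c) = 0" by (simp add: scaleR_diff_right)
  moreover have "a 0 \<noteq> 0" unfolding a_def using bump_bounds(3)[of 0 "2 * \<tau>" \<tau>] \<tau> by simp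
  moreover have "(LINT z|lborel. b z) \<noteq> 0" using bump_shift_integral[of 1 0 z0] by (simp add: b_eq)
  ultimately show ?thesis by simp
qed

lemma far_states:
  fixes VL VR :: "real^'m" and f :: "real^'m \<Rightarrow> real^'m"
  assumes weak: "weak_solution f (riemann_data VL VR) (self_similar V)" and U: "negligible {s. V s \<noteq> U s}"
  shows far_left: "(\<And>s. s \<le> s0 \<Longrightarrow> U s = c) \<Longrightarrow> c = VL" and far_right: "(\<And>s. s0 \<le> s \<Longrightarrow> U s = c) \<Longrightarrow> c = VR"
proof -
  have "AE p in lebesgue. p \<notin> {p :: real \<times> real. 0 < fst p \<and> snd p / fst p \<in> {s. V s \<noteq> U s}}"
    using negligible_cone[OF U] by (intro AE_not_in) (simp add: negligible_iff_null_sets)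
  then have ae: "AE p in lebesgue. 0 < fst p \<longrightarrow> self_similar V p = U (snd p / fst p)"
    by eventually_elim (auto simp: self_similar_def split: prod.splits)
  define \<tau> where "\<tau> = 1 / (1 + \<bar>s0\<bar>)"
  have \<tau>: "0 < \<tau>" by (simp add: \<tau>_def)
  have steep: "\<bar>s0\<bar> \<le> 1 / t" if "0 < t" "t < \<tau>" for t
  proof -
    have "t * (1 + \<bar>s0\<bar>) < 1" using that by (simp add: \<tau>_def pos_less_divide_eq)
    then show ?thesis using that by (simp add: pos_le_divide_eq algebra_simps)
  qed
  show "c = VL" if c: "\<And>s. s \<le> s0 \<Longrightarrow> U s = c"
  proof (rule initial_value_constant[OF weak \<tau>, of "-2"])
    show "AE p in lebesgue. 0 < fst p \<and> fst p < \<tau> \<and> snd p \<in> {-2<..<-2+1} \<longrightarrow> self_similar V p = c"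
      using ae
    proof eventually_elim
      case (elim p)
      have "snd p / fst p \<le> s0" if "0 < fst p" "fst p < \<tau>" "snd p < -1"
      proof -
        have "snd p / fst p \<le> (-1) / fst p" using that by (intro divide_right_mono) auto
        then show ?thesis using steep[OF that(1,2)] by simp
      qed
      then show ?case using elim c by auto
    qed
  qed (simp add: riemann_data_def)
  show "c = VR" if c: "\<And>s. s0 \<le> s \<Longrightarrow> U s = c"
  proof (rule initial_value_constant[OF weak \<tau>, of 1])
    show "AE p in lebesgue. 0 < fst p \<and> fst p < \<tau> \<and> snd p \<in> {1<..<1+1} \<longrightarrow> self_similar V p = c"
      using ae
    proof eventually_elim
      case (elim p)
      have "s0 \<le> snd p / fst p" if "0 < fst p" "fst p < \<tau>" "1 < snd p"
      proof -
        have "1 / fst p \<le> snd p / fst p" using that by (intro divide_right_mono) auto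
        then show ?thesis using steep[OF that(1,2)] by simp
      qed
      then show ?case using elim c by auto
    qed
  qed (simp add: riemann_data_def)
qed

section \<open>Uniqueness for profiles with values in a small ball\<close>

text \<open>The denominator \<open>a + 1\<close> covers the case \<open>a = 0\<close>.\<close>
lemma linear_smallness:
  fixes a b x :: real
  assumes "0 \<le> a" "0 < b" "0 \<le> x" "x \<le> b / (a + 1)"
  shows "a * x < b"
proof -
  have "a * x \<le> a * (b / (a + 1))" using assms by (intro mult_left_mono) auto
  also have "\<dots> < b" using assms by (simp add: field_simps)
  finally show ?thesis .
qed

context entropic
begin

lemma nonlinear_field:
  assumes "curv i \<noteq> 0"
  obtains \<kappa> \<kappa>' where "\<kappa> > 0" "\<And>\<epsilon> V M. \<lbrakk>riemann_profile A0 lam r l \<delta> \<eta> f J J' Vbar \<rho> L e q g g' c \<epsilon> V M; \<epsilon> \<le> \<kappa>\<rbrakk>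
    \<Longrightarrow> small_nonlinear_profile A0 lam r l \<delta> \<eta> f J J' Vbar \<rho> L e q g g' c \<epsilon> V M i \<kappa>'"
proof -
  obtain \<kappa>1 where k1: "\<kappa>1 > 0" "\<kappa>1 \<le> \<rho>" "\<And>U W u w. \<lbrakk>U \<in> cball Vbar \<kappa>1; W \<in> cball Vbar \<kappa>1; U - W = u *\<^sub>R (r i + w);
     norm w \<le> \<kappa>1; u \<noteq> 0\<rbrakk> \<Longrightarrow> 0 < (speed i U - speed i W) * (curv i * u)"
    using speed_monotone[OF assms] by blast
  obtain \<kappa>2 where k2: "\<kappa>2 > 0" "\<kappa>2 \<le> \<rho>" "\<And>U W \<sigma>. \<lbrakk>U \<in> cball Vbar \<kappa>2; W \<in> cball Vbar \<kappa>2;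
     f U - f W = \<sigma> *\<^sub>R (U - W); \<bar>\<sigma> - lam i\<bar> \<le> 2 * \<delta>; U \<noteq> W\<rbrakk>
     \<Longrightarrow> 0 < (\<sigma> - speed i W) * (curv i * (l i \<bullet> (U - W)))"
    using Lax_condition[OF assms] by blast
  obtain \<kappa>3 where k3: "\<kappa>3 > 0" "\<kappa>3 \<le> \<rho>" "\<And>U W \<sigma>. \<lbrakk>U \<in> cball Vbar \<kappa>3; W \<in> cball Vbar \<kappa>3;
     f U - f W = \<sigma> *\<^sub>R (U - W); \<bar>\<sigma> - lam i\<bar> \<le> 2 * \<delta>; U \<noteq> W\<rbrakk>
     \<Longrightarrow> 0 < ((q U - \<sigma> * e U) - (q W - \<sigma> * e W)) * (curv i * (l i \<bullet> (U - W)))"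
    using entropy_jump[OF assms] by blast
  let ?a = "4 * K * K * (K * L)" and ?b = "8 * K * K * K * (K * L) + K * L"
  have ab: "0 \<le> ?a" "0 \<le> ?b" using K_ge(1) KL_nonneg by (auto intro!: add_nonneg_nonneg mult_nonneg_nonneg)
  define \<kappa> where "\<kappa> = min (min \<kappa>1 (min \<kappa>2 \<kappa>3)) (min (1 / 2 / (?a + 1)) (\<kappa>1 / (?b + 1)))"
  have k: "\<kappa> \<le> \<kappa>1" "\<kappa> \<le> \<kappa>2" "\<kappa> \<le> \<kappa>3" "\<kappa> \<le> 1 / 2 / (?a + 1)" "\<kappa> \<le> \<kappa>1 / (?b + 1)"
    by (simp_all only: \<kappa>_def min_le_iff_disj order_refl simp_thms)
  have "0 < 1 / 2 / (?a + 1)" "0 < \<kappa>1 / (?b + 1)"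
    using ab k1(1) by (auto intro!: divide_pos_pos add_nonneg_pos)
  then have pos: "\<kappa> > 0" using k1(1) k2(1) k3(1) by (simp add: \<kappa>_def)
  show ?thesis
  proof (rule that[OF pos, of \<kappa>1])
    fix \<epsilon> V M assume prof: "riemann_profile A0 lam r l \<delta> \<eta> f J J' Vbar \<rho> L e q g g' c \<epsilon> V M" and le: "\<epsilon> \<le> \<kappa>"
    interpret riemann_profile A0 lam r l \<delta> \<eta> f J J' Vbar \<rho> L e q g g' c \<epsilon> V M by (rule prof)
    have sub: "X \<in> cball Vbar \<kappa>1" "X \<in> cball Vbar \<kappa>2" "X \<in> cball Vbar \<kappa>3" if "X \<in> cball Vbar \<epsilon>" for X
      using that le k(1-3) by auto
    show "small_nonlinear_profile A0 lam r l \<delta> \<eta> f J J' Vbar \<rho> L e q g g' c \<epsilon> V M i \<kappa>1"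
    proof (unfold_locales, goal_cases)
      case (1 U W \<sigma>)
      then show ?case by (intro k2(3) sub)
    next
      case (2 U W \<sigma>)
      then show ?case by (intro k3(3) sub)
    next
      case 3
      show ?case by (rule assms)
    next
      case (4 U W u w)
      show ?case by (rule k1(3)[OF sub(1)[OF 4(1)] sub(1)[OF 4(2)] 4(3,4,5)])
    next
      case 5
      have "?a * \<epsilon> < 1 / 2" by (rule linear_smallness) (use ab le k(4) \<epsilon>_bounds(1) in auto)
      then show ?case by (simp add: mult.assoc)
    next
      case 6
      have "?b * \<epsilon> < \<kappa>1" by (rule linear_smallness) (use ab le k(5) k1(1) \<epsilon>_bounds(1) in auto)
      then show ?case by (simp add: mult.assoc distrib_right)
    qed
  qed
qed

lemma contact_field:
  assumes "lindeg i"
  obtains \<kappa> where "\<kappa> > 0" "\<And>\<epsilon> V M. \<lbrakk>riemann_profile A0 lam r l \<delta> \<eta> f J J' Vbar \<rho> L e q g g' c \<epsilon> V M; \<epsilon> \<le> \<kappa>\<rbrakk>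
    \<Longrightarrow> contact_profile A0 lam r l \<delta> \<eta> f J J' Vbar \<rho> L e q g g' c \<epsilon> V M i"
proof -
  obtain \<kappa>1 where k1: "\<kappa>1 > 0" "\<kappa>1 \<le> \<rho>" "\<And>U W \<sigma>. \<lbrakk>U \<in> cball Vbar \<kappa>1; W \<in> cball Vbar \<kappa>1;
     f U - f W = \<sigma> *\<^sub>R (U - W); \<bar>\<sigma> - lam i\<bar> \<le> 2 * \<delta>; U \<noteq> W\<rbrakk> \<Longrightarrow> speed i U = \<sigma> \<and> speed i W = \<sigma>"
    using contact_speeds[OF assms] by blast
  let ?a = "2 * K * K" and ?b = "K * L * K * (2 + 2 * K * K)"
  have ab: "0 \<le> ?a" "0 \<le> ?b" using K_ge(1) KL_nonneg by (auto intro!: add_nonneg_nonneg mult_nonneg_nonneg)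
  define \<kappa> where "\<kappa> = min (min \<kappa>1 (\<rho> / 4)) (min (\<rho> / 4 / (?a + 1)) (1 / (?b + 1)))"
  have k: "\<kappa> \<le> \<kappa>1" "\<kappa> \<le> \<rho> / 4" "\<kappa> \<le> \<rho> / 4 / (?a + 1)" "\<kappa> \<le> 1 / (?b + 1)" by (simp_all only: \<kappa>_def min_le_iff_disj order_refl simp_thms)
  have "0 < \<rho> / 4 / (?a + 1)" "0 < 1 / (?b + 1)"
    using ab \<rho>_pos by (auto intro!: divide_pos_pos add_nonneg_pos)
  then have pos: "\<kappa> > 0" using k1(1) \<rho>_pos by (simp add: \<kappa>_def)
  show ?thesis
  proof (rule that[OF pos])
    fix \<epsilon> V M assume prof: "riemann_profile A0 lam r l \<delta> \<eta> f J J' Vbar \<rho> L e q g g' c \<epsilon> V M" and le: "\<epsilon> \<le> \<kappa>"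
    interpret riemann_profile A0 lam r l \<delta> \<eta> f J J' Vbar \<rho> L e q g g' c \<epsilon> V M by (rule prof)
    have sub: "X \<in> cball Vbar \<kappa>1" if "X \<in> cball Vbar \<epsilon>" for X
      using that le k(1) by auto
    show "contact_profile A0 lam r l \<delta> \<eta> f J J' Vbar \<rho> L e q g g' c \<epsilon> V M i"
    proof (unfold_locales, goal_cases)
      case 1
      show ?case by (rule assms)
    next
      case (2 U W \<sigma>)
      then show ?case by (intro k1(3) sub)
    next
      case 3
      then show ?case using le k(2) by linarith
    next
      case 4
      have "?a * \<epsilon> < \<rho> / 4" by (rule linear_smallness) (use ab le k(3) \<rho>_pos \<epsilon>_bounds(1) in auto)
      then show ?case by simp
    next
      case 5
      have "?b * \<epsilon> < 1" by (rule linear_smallness) (use ab le k(4) \<epsilon>_bounds(1) in auto)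
      then show ?case by (simp add: algebra_simps)
    qed
  qed
qed

text \<open>The radius is chosen as the minimum over the finitely many fields of the radii for which each field has its wave structure,
  and small enough for the two linear conditions of \<open>profiles_agree\<close>.\<close>

theorem profiles_unique:
  assumes fields: "\<And>i. curv i \<noteq> 0 \<or> lindeg i"
    and p: "bij_betw p {..<CARD('m)} (UNIV :: 'm set)"
    and mono: "\<And>j k. j < k \<Longrightarrow> k < CARD('m) \<Longrightarrow> lam (p j) < lam (p k)"
  obtains \<epsilon> where "0 < \<epsilon>" "\<epsilon> \<le> \<rho>"
    "\<And>V M W M'. \<lbrakk>riemann_profile A0 lam r l \<delta> \<eta> f J J' Vbar \<rho> L e q g g' c \<epsilon> V M;
        riemann_profile A0 lam r l \<delta> \<eta> f J J' Vbar \<rho> L e q g g' c \<epsilon> W M';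
        \<And>s. (\<And>k. s \<le> lam k - \<delta>) \<Longrightarrow> V s = W s; \<And>s. (\<And>k. lam k + \<delta> \<le> s) \<Longrightarrow> V s = W s\<rbrakk>
      \<Longrightarrow> finite {s. V s \<noteq> W s}"
proof -
  have "\<exists>\<kappa> \<kappa>'. \<kappa> > 0 \<and> (\<forall>\<epsilon> V M. riemann_profile A0 lam r l \<delta> \<eta> f J J' Vbar \<rho> L e q g g' c \<epsilon> V M \<longrightarrow> \<epsilon> \<le> \<kappa> \<longrightarrow>
      (curv i \<noteq> 0 \<longrightarrow> small_nonlinear_profile A0 lam r l \<delta> \<eta> f J J' Vbar \<rho> L e q g g' c \<epsilon> V M i \<kappa>') \<and>
      (curv i = 0 \<longrightarrow> contact_profile A0 lam r l \<delta> \<eta> f J J' Vbar \<rho> L e q g g' c \<epsilon> V M i))" for i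
  proof (cases "curv i = 0")
    case True
    then have "lindeg i" using fields by blast
    from contact_field[OF this] obtain \<kappa> where "\<kappa> > 0" "\<And>\<epsilon> V M. \<lbrakk>riemann_profile A0 lam r l \<delta> \<eta> f J J' Vbar \<rho> L e q g g' c \<epsilon> V M; \<epsilon> \<le> \<kappa>\<rbrakk>
      \<Longrightarrow> contact_profile A0 lam r l \<delta> \<eta> f J J' Vbar \<rho> L e q g g' c \<epsilon> V M i" by blast
    then show ?thesis using True by blast
  next
    case False
    from nonlinear_field[OF this] obtain \<kappa> \<kappa>' where "\<kappa> > 0" "\<And>\<epsilon> V M. \<lbrakk>riemann_profile A0 lam r l \<delta> \<eta> f J J' Vbar \<rho> L e q g g' c \<epsilon> V M; \<epsilon> \<le> \<kappa>\<rbrakk>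
      \<Longrightarrow> small_nonlinear_profile A0 lam r l \<delta> \<eta> f J J' Vbar \<rho> L e q g g' c \<epsilon> V M i \<kappa>'" by blast
    then show ?thesis using False by blast
  qed
  then obtain \<kappa> \<kappa>' where k: "\<And>i. \<kappa> i > 0" "\<And>i \<epsilon> V M. riemann_profile A0 lam r l \<delta> \<eta> f J J' Vbar \<rho> L e q g g' c \<epsilon> V M \<Longrightarrow> \<epsilon> \<le> \<kappa> i \<Longrightarrow>
      (curv i \<noteq> 0 \<longrightarrow> small_nonlinear_profile A0 lam r l \<delta> \<eta> f J J' Vbar \<rho> L e q g g' c \<epsilon> V M i (\<kappa>' i)) \<and>
      (curv i = 0 \<longrightarrow> contact_profile A0 lam r l \<delta> \<eta> f J J' Vbar \<rho> L e q g g' c \<epsilon> V M i)"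
    by metis
  let ?m = "real (CARD('m))"
  let ?a = "4 * K * (K * L)" and ?b = "?m * (2 * (4 * K * (K * L)) + K * (?m * (K * (2 * (4 * K * (K * L))))))"
  have ab: "0 \<le> ?a" "0 \<le> ?b" using K_ge(1) KL_nonneg by (auto intro!: add_nonneg_nonneg mult_nonneg_nonneg)
  define \<epsilon> where "\<epsilon> = min (min \<rho> (Min (range \<kappa>))) (min (1 / (?a + 1)) (1 / (?b + 1)))"
  have "0 < Min (range \<kappa>)" using k(1) by (subst Min_gr_iff) auto
  moreover have "0 < 1 / (?a + 1)" "0 < 1 / (?b + 1)"
    using ab by (auto intro!: divide_pos_pos add_nonneg_pos)
  ultimately have pos: "\<epsilon> > 0" using \<rho>_pos by (simp add: \<epsilon>_def)
  have le: "\<epsilon> \<le> \<rho>" "\<epsilon> \<le> Min (range \<kappa>)" "\<epsilon> \<le> 1 / (?a + 1)" "\<epsilon> \<le> 1 / (?b + 1)" by (simp_all only: \<epsilon>_def min_le_iff_disj order_refl simp_thms)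
  have le_k: "\<epsilon> \<le> \<kappa> i" for i by (rule order_trans[OF le(2) Min_le]) auto
  have small_a: "?a * \<epsilon> < 1" by (rule linear_smallness) (use ab le(3) pos in auto)
  have small_b: "?b * \<epsilon> < 1" by (rule linear_smallness) (use ab le(4) pos in auto)
  show ?thesis
  proof (rule that[OF pos le(1)])
    fix V M W M'
    assume V: "riemann_profile A0 lam r l \<delta> \<eta> f J J' Vbar \<rho> L e q g g' c \<epsilon> V M"
      and W: "riemann_profile A0 lam r l \<delta> \<eta> f J J' Vbar \<rho> L e q g g' c \<epsilon> W M'"
      and ends: "\<And>s. (\<And>k. s \<le> lam k - \<delta>) \<Longrightarrow> V s = W s" "\<And>s. (\<And>k. lam k + \<delta> \<le> s) \<Longrightarrow> V s = W s"
    interpret P: two_profiles A0 lam r l \<delta> \<eta> f J J' Vbar \<rho> L e q g g' c \<epsilon> V M W M'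
    proof -
      have "4 * K * (K * L * \<epsilon>) \<le> 1" using small_a by (simp add: mult.assoc)
      then show "two_profiles A0 lam r l \<delta> \<eta> f J J' Vbar \<rho> L e q g g' c \<epsilon> V M W M'"
        using V W by (simp add: two_profiles_def two_profiles_axioms_def)
    qed
    show "finite {s. V s \<noteq> W s}"
    proof (rule P.profiles_agree[OF _ p mono ends])
      show "P.comparable i" for i
      proof (cases "curv i = 0")
        case True
        then have "contact_profile A0 lam r l \<delta> \<eta> f J J' Vbar \<rho> L e q g g' c \<epsilon> V M i"
          "contact_profile A0 lam r l \<delta> \<eta> f J J' Vbar \<rho> L e q g g' c \<epsilon> W M' i"
          using k(2)[OF V le_k[of i]] k(2)[OF W le_k[of i]] by blast+
        from this[THEN contact_profile.sector_structure] show ?thesis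
          unfolding P.comparable_def by blast
      next
        case False
        then have "small_nonlinear_profile A0 lam r l \<delta> \<eta> f J J' Vbar \<rho> L e q g g' c \<epsilon> V M i (\<kappa>' i)"
          "small_nonlinear_profile A0 lam r l \<delta> \<eta> f J J' Vbar \<rho> L e q g g' c \<epsilon> W M' i (\<kappa>' i)"
          using k(2)[OF V le_k[of i]] k(2)[OF W le_k[of i]] by blast+
        from this[THEN small_nonlinear_profile.nonlinear_wave] False show ?thesis
          unfolding P.comparable_def by blast
      qed
      have "?m * (2 * (4 * K * (K * L * \<epsilon>)) + K * (?m * (K * (2 * (4 * K * (K * L * \<epsilon>)))))) = ?b * \<epsilon>"
        by (simp add: algebra_simps)
      then show "?m * (2 * (4 * K * (K * L * \<epsilon>)) + K * (?m * (K * (2 * (4 * K * (K * L * \<epsilon>)))))) < 1"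
        using small_b by simp
    qed
  qed
qed

end

section \<open>The characteristic fields of a smooth flux\<close>

text \<open>An eigenvalue \<open>\<delta>\<close>-far from all \<open>lam k\<close> is excluded by \<open>gap\<close>; one near some \<open>lam k\<close> is \<open>ev k A\<close>.\<close>
lemma (in spectral_nbhd) real_eigenvalues_near:
  assumes A: "norm (A - A0) \<le> \<eta>"
  shows "real_eigenvalues A = range (\<lambda>i. ev i A)"
proof (intro equalityI subsetI)
  fix t assume "t \<in> real_eigenvalues A"
  then obtain v where v: "v \<noteq> 0" "A *v v = t *\<^sub>R v" by (auto simp: real_eigenvalues_def right_eigenvector_def)
  have "\<exists>k. \<bar>lam k - t\<bar> < \<delta>"
  proof (rule ccontr)
    assume "\<not> ?thesis"
    then have "norm v \<le> K * norm (A *v v - t *\<^sub>R v)" by (intro gap[OF A]) (auto simp: not_less)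
    then show False using v by simp
  qed
  then obtain k where "\<bar>lam k - t\<bar> < \<delta>" by blast
  then have "\<bar>t - lam k\<bar> \<le> 2 * \<delta>" using \<delta>_pos by linarith
  from eigenpair_unique(1)[OF A this v(2,1)] show "t \<in> range (\<lambda>i. ev i A)" by blast
next
  fix t assume "t \<in> range (\<lambda>i. ev i A)"
  then obtain i where "t = ev i A" by blast
  then have "right_eigenvector A t (rv i A)" using rv[OF A, of i] by (auto simp: right_eigenvector_def)
  then show "t \<in> real_eigenvalues A" by (auto simp: real_eigenvalues_def)
qed

lemma (in spectral_nbhd) sorted_eigenvalues:
  assumes A: "norm (A - A0) \<le> \<eta>"
    and p: "bij_betw p {..<CARD('m)} (UNIV :: 'm set)"
    and mono: "\<And>j k. j < k \<Longrightarrow> k < CARD('m) \<Longrightarrow> lam (p j) < lam (p k)"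
    and j: "j < CARD('m)"
  shows "sorted_list_of_set (real_eigenvalues A) ! j = ev (p j) A"
proof -
  let ?xs = "map (\<lambda>j. ev (p j) A) [0..<CARD('m)]"
  have less: "ev (p j) A < ev (p k) A" if "j < k" "k < CARD('m)" for j k
  proof -
    have "p j \<noteq> p k" using mono[OF that] by auto
    then have "lam (p j) + 4 * \<delta> \<le> lam (p k)" using separated[of "p j" "p k"] mono[OF that] by auto
    then show ?thesis using ev(1)[OF A, of "p j"] ev(1)[OF A, of "p k"] \<delta>_pos by linarith
  qed
  then have ss: "sorted_wrt (<) ?xs" by (auto simp: sorted_wrt_iff_nth_less)
  have img: "p ` {..<CARD('m)} = UNIV" using p by (simp add: bij_betw_def)
  have "set ?xs = (\<lambda>i. ev i A) ` (p ` {..<CARD('m)})" by (auto simp: image_image)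
  then have set: "set ?xs = real_eigenvalues A" using real_eigenvalues_near[OF A] img by simp
  then have fin: "finite (real_eigenvalues A)" by (metis finite_set)
  have "sorted_list_of_set (real_eigenvalues A) = ?xs"
    by (rule sorted_distinct_set_unique) (use ss set fin in \<open>auto simp: strict_sorted_iff\<close>)
  then show ?thesis using j by simp
qed

lemma (in spectral) speed_order_exists:
  obtains p where "bij_betw p {..<CARD('m)} (UNIV :: 'm set)" "\<And>j k. j < k \<Longrightarrow> k < CARD('m) \<Longrightarrow> lam (p j) < lam (p k)"
proof -
  have inj: "inj lam"
  proof (rule injI, rule ccontr)
    fix i j assume "lam i = lam j" "i \<noteq> j"
    then show False using separated[of i j] \<delta>_pos by simp
  qed
  let ?xs = "sorted_list_of_set (range lam)"
  have len: "length ?xs = CARD('m)" using inj by (simp add: card_image)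
  have b1: "bij_betw ((!) ?xs) {..<CARD('m)} (range lam)"
    by (rule bij_betw_nth) (use len in auto)
  have b2: "bij_betw (inv_into UNIV lam) (range lam) UNIV"
    by (rule bij_betw_inv_into) (use inj in \<open>simp add: bij_betw_def\<close>)
  let ?p = "inv_into UNIV lam \<circ> (!) ?xs"
  have val: "lam (?p j) = ?xs ! j" if "j < CARD('m)" for j
    using f_inv_into_f[of "?xs ! j" lam UNIV] bij_betwE[OF b1] that by auto
  show ?thesis
  proof (rule that[of ?p])
    show "bij_betw ?p {..<CARD('m)} UNIV" by (rule bij_betw_trans[OF b1 b2])
    fix j k assume jk: "j < k" "k < CARD('m)"
    have "?xs ! j < ?xs ! k"
      by (rule sorted_wrt_nth_less[OF strict_sorted_list_of_set]) (use jk len in auto)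
    then show "lam (?p j) < lam (?p k)" using val[of j] val[of k] jk by simp
  qed
qed

context flux
begin

context
  fixes p :: "nat \<Rightarrow> 'm"
  assumes J_jacobian: "J = (\<lambda>X. jacobian f (at X))"
    and p: "bij_betw p {..<CARD('m)} (UNIV :: 'm set)"
    and mono: "\<And>j k. j < k \<Longrightarrow> k < CARD('m) \<Longrightarrow> lam (p j) < lam (p k)"
begin

lemma char_speed_eq: "X \<in> B \<Longrightarrow> \<alpha> < CARD('m) \<Longrightarrow> char_speed f \<alpha> X = speed (p \<alpha>) X"
proof -
  assume "X \<in> B" "\<alpha> < CARD('m)"
  from sorted_eigenvalues[OF J_near[OF this(1)] p mono this(2)]
  show ?thesis unfolding char_speed_def speed_def fun_cong[OF J_jacobian, of X] .
qed

lemma dir_right_eigenvector: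
  assumes "X \<in> B" "\<alpha> < CARD('m)"
  shows "right_eigenvector (jacobian f (at X)) (char_speed f \<alpha> X) (dir (p \<alpha>) X)"
proof -
  have "dir (p \<alpha>) X \<noteq> 0" using speed_facts(3)[OF assms(1), of "p \<alpha>"] by auto
  then show ?thesis using speed_facts(2)[OF assms(1), of "p \<alpha>"] char_speed_eq[OF assms]
    by (simp add: right_eigenvector_def J_jacobian)
qed

lemma char_speed_derivative:
  assumes X: "X \<in> ball Vbar \<rho>" and \<alpha>: "\<alpha> < CARD('m)"
  shows "frechet_derivative (char_speed f \<alpha>) (at X) h =
    (codir (p \<alpha>) X \<bullet> (J' X h *v dir (p \<alpha>) X)) / (codir (p \<alpha>) X \<bullet> dir (p \<alpha>) X)"
proof -
  have "(char_speed f \<alpha> has_derivative (\<lambda>h. (codir (p \<alpha>) X \<bullet> (J' X h *v dir (p \<alpha>) X)) / (codir (p \<alpha>) X \<bullet> dir (p \<alpha>) X))) (at X)"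
    by (rule has_derivative_transform_within_open[OF speed_has_derivative[OF X] open_ball X])
      (use \<alpha> char_speed_eq in auto)
  from frechet_derivative_at[OF this] show ?thesis by metis
qed

text \<open>At the centre the derivative of the characteristic speed along its eigenvector \<open>r i\<close> is \<open>curv i\<close>.\<close>
lemma genuinely_nonlinear_curv:
  assumes \<alpha>: "\<alpha> < CARD('m)" and "genuinely_nonlinear_near f \<alpha> Vbar"
  shows "curv (p \<alpha>) \<noteq> 0"
proof -
  have V: "Vbar \<in> ball Vbar \<rho>" using \<rho>_pos by simp
  have "\<forall>v. right_eigenvector (jacobian f (at Vbar)) (char_speed f \<alpha> Vbar) v \<longrightarrow>
       frechet_derivative (char_speed f \<alpha>) (at Vbar) v \<noteq> 0"
    using assms(2) unfolding genuinely_nonlinear_near_def by (rule eventually_nhds_x_imp_x)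
  then have "frechet_derivative (char_speed f \<alpha>) (at Vbar) (dir (p \<alpha>) Vbar) \<noteq> 0"
    using dir_right_eigenvector[OF center \<alpha>] by blast
  then show ?thesis unfolding char_speed_derivative[OF V \<alpha>]
    by (simp add: curv_def dir_def codir_def J_center at_A0)
qed

lemma linearly_degenerate_lindeg:
  assumes \<alpha>: "\<alpha> < CARD('m)" and deg: "\<And>X v. X \<in> ball Vbar \<rho> \<Longrightarrow>
    right_eigenvector (jacobian f (at X)) (char_speed f \<alpha> X) v \<Longrightarrow> frechet_derivative (char_speed f \<alpha>) (at X) v = 0"
  shows "lindeg (p \<alpha>)"
  unfolding lindeg_def
proof
  fix X assume X: "X \<in> ball Vbar \<rho>"
  then have XB: "X \<in> B" by auto
  have "codir (p \<alpha>) X \<bullet> dir (p \<alpha>) X \<noteq> 0" using codir_dir_ge[OF XB XB, of "p \<alpha>"] by simp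
  then show "codir (p \<alpha>) X \<bullet> (J' X (dir (p \<alpha>) X) *v dir (p \<alpha>) X) = 0"
    using deg[OF X dir_right_eigenvector[OF XB \<alpha>]] unfolding char_speed_derivative[OF X \<alpha>] by simp
qed

end

end

section \<open>Derivatives of smooth fluxes and entropies\<close>

definition matrix_with_column :: "'m \<Rightarrow> real^'m \<Rightarrow> real^'m^'m" where
  "matrix_with_column j v = (\<chi> i k. if k = j then v $ i else 0)"

lemma matrix_with_column_bounded_linear: "bounded_linear (matrix_with_column j)"
  by (intro linear_conv_bounded_linear[THEN iffD1] linearI) (auto simp: matrix_with_column_def vec_eq_iff)

lemma matrix_columns: "matrix G = (\<Sum>j\<in>UNIV. matrix_with_column j (G (axis j 1)))"
  by (simp add: vec_eq_iff matrix_def matrix_with_column_def sum.delta)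

lemma smooth_on_derivatives:
  assumes "smooth_on f P" "X \<in> P"
  shows "(f has_derivative frechet_derivative f (at X)) (at X)"
    "((\<lambda>Y. frechet_derivative f (at Y) h) has_derivative frechet_derivative (\<lambda>Y. frechet_derivative f (at Y) h) (at X)) (at X)"
proof -
  have C: "Ck_on (Suc (Suc 0)) f P" using assms(1) by (simp add: smooth_on_def)
  then show "(f has_derivative frechet_derivative f (at X)) (at X)"
    using assms(2) frechet_derivative_works by auto
  have "Ck_on (Suc 0) (\<lambda>Y. frechet_derivative f (at Y) h) P" using C by simp
  then show "((\<lambda>Y. frechet_derivative f (at Y) h) has_derivative frechet_derivative (\<lambda>Y. frechet_derivative f (at Y) h) (at X)) (at X)"
    using assms(2) frechet_derivative_works by auto
qed

lemma smooth_on_second_derivative_continuous: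
  assumes "smooth_on f P"
  shows "continuous_on P (\<lambda>X. frechet_derivative (\<lambda>Y. frechet_derivative f (at Y) k) (at X) h)"
proof -
  have C: "Ck_on (Suc (Suc 0)) f P" using assms(1) by (simp add: smooth_on_def)
  then have "Ck_on (Suc 0) (\<lambda>Y. frechet_derivative f (at Y) k) P" by simp
  then show ?thesis by simp
qed

text \<open>The radius \<open>\<rho>\<close> is left free because it is shrunk afterwards to the neighbourhood on which the linearly degenerate
  fields are degenerate.\<close>
lemma entropic_system_exists:
  fixes f :: "real^'m \<Rightarrow> real^'m" and e q :: "real^'m \<Rightarrow> real"
  assumes P: "open P" "Vbar \<in> P" and f: "smooth_on f P" and e: "smooth_on e P" and q: "smooth_on q P"
    and pair: "entropy_flux_pair f P e q" and conv: "uniformly_convex_on e P"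
    and sp: "spectral_nbhd (jacobian f (at Vbar)) lam r l \<delta> \<eta>"
  obtains \<rho>0 J' L g g' c where "\<rho>0 > 0" "cball Vbar \<rho>0 \<subseteq> P"
    "\<And>\<rho>. 0 < \<rho> \<Longrightarrow> \<rho> \<le> \<rho>0 \<Longrightarrow>
      entropic (jacobian f (at Vbar)) lam r l \<delta> \<eta> f (\<lambda>X. jacobian f (at X)) J' Vbar \<rho> L e q g g' c"
proof -
  interpret spectral_nbhd "jacobian f (at Vbar)" lam r l \<delta> \<eta> by (rule sp)
  let ?J = "\<lambda>X. jacobian f (at X)"
  define J' where "J' X h = (\<Sum>j\<in>UNIV. matrix_with_column j (frechet_derivative (\<lambda>Y. frechet_derivative f (at Y) (axis j 1)) (at X) h))" for X h
  define g where "g X = (\<Sum>b\<in>Basis. frechet_derivative e (at X) b *\<^sub>R b)" for X :: "real^'m"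
  define g' where "g' X h = (\<Sum>b\<in>Basis. frechet_derivative (\<lambda>Y. frechet_derivative e (at Y) b) (at X) h *\<^sub>R b)" for X h :: "real^'m"
  obtain c where c: "c > 0" "\<And>V h. V \<in> P \<Longrightarrow> c * (norm h)\<^sup>2 \<le> frechet_derivative (\<lambda>W. frechet_derivative e (at W) h) (at V) h"
    using conv unfolding uniformly_convex_on_def by blast
  have fd: "(f has_derivative (\<lambda>h. ?J X *v h)) (at X)" if "X \<in> P" for X
    using smooth_on_derivatives(1)[OF f that] jacobian_works differentiableI by blast
  have Jd: "(?J has_derivative J' X) (at X)" if "X \<in> P" for X
  proof -
    have J_eq: "?J = (\<lambda>Y. \<Sum>j\<in>UNIV. matrix_with_column j (frechet_derivative f (at Y) (axis j 1)))"
      by (rule ext) (simp only: jacobian_def matrix_columns)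
    have J'_eq: "J' X = (\<lambda>h. \<Sum>j\<in>UNIV. matrix_with_column j (frechet_derivative (\<lambda>Y. frechet_derivative f (at Y) (axis j 1)) (at X) h))"
      by (rule ext) (simp only: J'_def)
    show ?thesis unfolding J_eq J'_eq
      by (intro has_derivative_sum bounded_linear.has_derivative[OF matrix_with_column_bounded_linear]
          smooth_on_derivatives(2)[OF f that])
  qed
  have J'c: "continuous_on P (\<lambda>X. J' X h)" for h
    unfolding J'_def
    by (intro continuous_on_sum bounded_linear.continuous_on[OF matrix_with_column_bounded_linear]
        smooth_on_second_derivative_continuous[OF f])
  have lin_e: "frechet_derivative e (at X) h = (\<Sum>b\<in>Basis. (h \<bullet> b) * frechet_derivative e (at X) b)" if "X \<in> P" for X h
  proof -
    have lin: "linear (frechet_derivative e (at X))" using smooth_on_derivatives(1)[OF e that] has_derivative_linear by blast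
    have "frechet_derivative e (at X) h = frechet_derivative e (at X) (\<Sum>b\<in>Basis. (h \<bullet> b) *\<^sub>R b)"
      by (simp add: euclidean_representation)
    also have "\<dots> = (\<Sum>b\<in>Basis. (h \<bullet> b) * frechet_derivative e (at X) b)"
      by (simp add: linear_sum[OF lin] linear_scale[OF lin])
    finally show ?thesis .
  qed
  have e_grad: "frechet_derivative e (at X) h = g X \<bullet> h" if "X \<in> P" for X h
    by (subst lin_e[OF that]) (simp add: g_def inner_sum_left inner_commute[of h] mult.commute)
  have ed: "(e has_derivative (\<lambda>h. g X \<bullet> h)) (at X)" if "X \<in> P" for X
  proof -
    have "frechet_derivative e (at X) = (\<lambda>h. g X \<bullet> h)" by (rule ext) (rule e_grad[OF that])
    then show ?thesis using smooth_on_derivatives(1)[OF e that] by simp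
  qed
  have qd: "(q has_derivative (\<lambda>h. g X \<bullet> (?J X *v h))) (at X)" if X: "X \<in> P" for X
  proof -
    have "frechet_derivative f (at X) = (\<lambda>h. ?J X *v h)" using frechet_derivative_at[OF fd[OF X]] by simp
    then have "frechet_derivative q (at X) = (\<lambda>h. g X \<bullet> (?J X *v h))"
      using pair X e_grad[OF X] unfolding entropy_flux_pair_def by (auto simp: o_def)
    then show ?thesis using smooth_on_derivatives(1)[OF q X] by simp
  qed
  have gd: "(g has_derivative g' X) (at X)" if "X \<in> P" for X
  proof -
    have eqs: "g = (\<lambda>Y. \<Sum>b\<in>Basis. frechet_derivative e (at Y) b *\<^sub>R b)"
      "g' X = (\<lambda>h. \<Sum>b\<in>Basis. frechet_derivative (\<lambda>Y. frechet_derivative e (at Y) b) (at X) h *\<^sub>R b)"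
      by (rule ext, simp only: g_def g'_def)+
    show ?thesis unfolding eqs
      by (intro has_derivative_sum has_derivative_scaleR_left smooth_on_derivatives(2)[OF e that])
  qed
  have g'c: "continuous_on P (\<lambda>X. g' X h)" for h
    unfolding g'_def by (intro continuous_on_sum continuous_on_scaleR smooth_on_second_derivative_continuous[OF e] continuous_on_const)
  have convex: "c * (norm h)\<^sup>2 \<le> g' Vbar h \<bullet> h" for h
  proof -
    have "((\<lambda>W. g W \<bullet> h) has_derivative (\<lambda>k. g' Vbar k \<bullet> h)) (at Vbar)"
      by (intro has_derivative_inner_left gd P)
    then have "((\<lambda>W. frechet_derivative e (at W) h) has_derivative (\<lambda>k. g' Vbar k \<bullet> h)) (at Vbar)"
      by (rule has_derivative_transform_within_open[OF _ P]) (simp add: e_grad)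
    from frechet_derivative_at[OF this]
    have "frechet_derivative (\<lambda>W. frechet_derivative e (at W) h) (at Vbar) h = g' Vbar h \<bullet> h" by metis
    then show ?thesis using c(2)[OF P(2), of h] by simp
  qed
  obtain \<rho>1 where \<rho>1: "\<rho>1 > 0" "cball Vbar \<rho>1 \<subseteq> P" using P open_contains_cball by blast
  have "isCont ?J Vbar" by (rule has_derivative_continuous[OF Jd[OF P(2)]])
  then obtain d where d: "d > 0" "\<And>X. dist X Vbar < d \<Longrightarrow> dist (?J X) (?J Vbar) < \<eta>"
    unfolding continuous_at_eps_delta using \<eta>_pos by blast
  define \<rho>0 where "\<rho>0 = min \<rho>1 (d / 2)"
  have \<rho>0: "\<rho>0 > 0" "cball Vbar \<rho>0 \<subseteq> P" using \<rho>1 d(1) by (auto simp: \<rho>0_def)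
  have near: "norm (?J X - ?J Vbar) \<le> \<eta>" if "X \<in> cball Vbar \<rho>0" for X
  proof -
    have "dist X Vbar < d" using that d(1) by (auto simp: \<rho>0_def dist_commute)
    from d(2)[OF this] show ?thesis by (simp add: dist_norm)
  qed
  have "\<exists>C. \<forall>X\<in>cball Vbar \<rho>0. norm (J' X b) \<le> C" for b
    using compact_imp_bounded[OF compact_continuous_image[OF continuous_on_subset[OF J'c \<rho>0(2)] compact_cball], of b]
    by (auto simp: bounded_iff)
  then obtain C where C: "\<And>b X. X \<in> cball Vbar \<rho>0 \<Longrightarrow> norm (J' X b) \<le> C b" by metis
  define L where "L = (\<Sum>b\<in>Basis. C b)"
  have L: "norm (J' X h) \<le> L * norm h" if X: "X \<in> cball Vbar \<rho>0" for X h
  proof -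
    have lin: "linear (J' X)" using Jd[of X] X \<rho>0(2) has_derivative_linear by blast
    have "J' X h = J' X (\<Sum>b\<in>Basis. (h \<bullet> b) *\<^sub>R b)" by (simp add: euclidean_representation)
    also have "\<dots> = (\<Sum>b\<in>Basis. (h \<bullet> b) *\<^sub>R J' X b)" by (simp only: linear_sum[OF lin] linear_scale[OF lin])
    finally have "norm (J' X h) \<le> (\<Sum>b\<in>Basis. norm ((h \<bullet> b) *\<^sub>R J' X b))" by (simp only: norm_sum)
    also have "\<dots> \<le> (\<Sum>b\<in>Basis. norm h * C b)"
      unfolding norm_scaleR by (intro sum_mono mult_mono C[OF X]) (auto simp: Basis_le_norm)
    finally show ?thesis by (simp add: L_def sum_distrib_left mult.commute)
  qed
  show ?thesis
  proof (rule that[OF \<rho>0])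
    fix \<rho> :: real assume \<rho>: "0 < \<rho>" "\<rho> \<le> \<rho>0"
    have sub: "X \<in> cball Vbar \<rho>0" if "X \<in> cball Vbar \<rho>" for X using that \<rho> by auto
    have subP: "X \<in> P" if "X \<in> cball Vbar \<rho>" for X using sub[OF that] \<rho>0(2) by blast
    show "entropic (?J Vbar) lam r l \<delta> \<eta> f ?J J' Vbar \<rho> L e q g g' c"
    proof (unfold_locales, goal_cases)
      case 1 show ?case by (rule \<rho>(1))
    next
      case (2 X) then show ?case by (intro fd subP)
    next
      case (3 X) then show ?case by (intro Jd subP)
    next
      case 4 show ?case by simp
    next
      case (5 X) then show ?case by (intro near sub)
    next
      case (6 X h) then show ?case by (intro L sub)
    next
      case (7 h) show ?case by (rule continuous_on_subset[OF J'c]) (use subP in blast)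
    next
      case (8 X) then show ?case by (intro ed subP)
    next
      case (9 X) then show ?case by (intro qd subP)
    next
      case (10 X) then show ?case by (intro gd subP)
    next
      case (11 h) show ?case by (rule continuous_on_subset[OF g'c]) (use subP in blast)
    next
      case 12 show ?case by (rule c(1))
    next
      case (13 h) show ?case by (rule convex)
    qed
  qed
qed

section \<open>Uniqueness for the Riemann problem\<close>

lemma (in riemann_profile) beyond_last_field:
  assumes "\<And>k. lam k + \<delta> \<le> s" "\<And>k. lam k + \<delta> \<le> t"
  shows "V s = V t"
proof (rule constant_in_gap[of "{min s t..}"])
  fix x k assume "x \<in> {min s t..}"
  then show "\<delta> \<le> \<bar>lam k - x\<bar>" using assms(1)[of k] assms(2)[of k] by auto
qed auto

text \<open>A profile is constant beyond the outermost characteristic speeds, and this constant is the initial datum.\<close>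
lemma (in riemann_profile) far_state_values:
  assumes "weak_solution f (riemann_data VL VR) (self_similar U)" "negligible {s. U s \<noteq> V s}"
  shows "(\<And>k. s \<le> lam k - \<delta>) \<Longrightarrow> V s = VL" and "(\<And>k. lam k + \<delta> \<le> s) \<Longrightarrow> V s = VR"
proof -
  show "V s = VL" if s: "\<And>k. s \<le> lam k - \<delta>"
  proof (rule far_left[OF assms])
    show "V t = V s" if "t \<le> s" for t
      by (rule gap_before) (use that s in \<open>auto intro: order_trans\<close>)
  qed
  show "V s = VR" if s: "\<And>k. lam k + \<delta> \<le> s"
  proof (rule far_right[OF assms])
    show "V t = V s" if "s \<le> t" for t
      by (rule beyond_last_field) (use that s in \<open>auto intro: order_trans\<close>)
  qed
qed

lemma (in entropic) solution_profile:
  assumes "0 < \<epsilon>" "\<epsilon> \<le> \<rho>" and V: "V \<in> Linfty_cball Vbar \<epsilon>" and sol: "admissible_riemann_solution f e q VL VR V"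
  obtains U M where "riemann_profile A0 lam r l \<delta> \<eta> f J J' Vbar \<rho> L e q g g' c \<epsilon> U M" "negligible {s. V s \<noteq> U s}"
    "\<forall>s. (\<forall>k. s \<le> lam k - \<delta>) \<longrightarrow> U s = VL" "\<forall>s. (\<forall>k. lam k + \<delta> \<le> s) \<longrightarrow> U s = VR"
proof -
  have sub: "cball Vbar \<epsilon> \<subseteq> B" using assms(2) by auto
  have weak: "weak_solution f (riemann_data VL VR) (self_similar V)" and ent: "entropy_admissible e q (self_similar V)"
    using sol by (auto simp: admissible_riemann_solution_def)
  obtain U M where U: "\<And>s. U s \<in> cball Vbar \<epsilon>" "negligible {s. V s \<noteq> U s}"
    "\<And>x y C. (\<And>s. s \<in> closed_segment x y \<Longrightarrow> norm (U s - U y) \<le> C) \<Longrightarrow>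
      norm (f (U x) - f (U y) - x *\<^sub>R (U x - U y)) \<le> C * \<bar>x - y\<bar>"
    "\<And>x y. x < y \<Longrightarrow> (q (U y) - y * e (U y)) - (q (U x) - x * e (U x)) \<le> M * (y - x)"
    using regular_representative[OF assms(1) V continuous_on_subset[OF f_continuous sub] continuous_on_subset[OF e_continuous sub]
        continuous_on_subset[OF q_continuous sub] weak ent] by blast
  have prof: "riemann_profile A0 lam r l \<delta> \<eta> f J J' Vbar \<rho> L e q g g' c \<epsilon> U M"
    by (unfold_locales) (use U assms in auto)
  show ?thesis
    by (rule that[OF prof U(2)]) (use riemann_profile.far_state_values[OF prof weak U(2)] in blast)+
qed

theorem mainTheorem2:
  fixes f :: "real^'m \<Rightarrow> real^'m"
    and P :: "(real^'m) set"
    and Vbar :: "real^'m"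
    and e q :: "real^'m \<Rightarrow> real"
  assumes "open P" and "Vbar \<in> P" and "smooth_on f P"
    and "strictly_hyperbolic_at f Vbar"
    and "\<And>\<alpha>. \<alpha> < CARD('m) \<Longrightarrow>
           genuinely_nonlinear_near f \<alpha> Vbar \<or> linearly_degenerate_near f \<alpha> Vbar"
    and "smooth_on e P" and "smooth_on q P"
    and "entropy_flux_pair f P e q"
    and "uniformly_convex_on e P"
  shows "\<exists>\<epsilon>>0. cball Vbar \<epsilon> \<subseteq> P \<and>
           (\<forall>VL VR. norm (VL - Vbar) \<le> \<epsilon> \<and> norm (VR - Vbar) \<le> \<epsilon> \<longrightarrow>
             (\<forall>V\<in>Linfty_cball Vbar \<epsilon>. \<forall>W\<in>Linfty_cball Vbar \<epsilon>.
                admissible_riemann_solution f e q VL VR V \<and>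
                admissible_riemann_solution f e q VL VR W \<longrightarrow>
                (AE \<xi> in lebesgue. V \<xi> = W \<xi>)))"
proof -
  let ?A = "jacobian f (at Vbar)"
  obtain lam :: "'m \<Rightarrow> real" and r l \<delta> where sp: "spectral ?A lam r l \<delta>"
    using spectral_basis_exists[of ?A] assms(4) unfolding strictly_hyperbolic_at_def by metis
  obtain \<eta> where nb: "spectral_nbhd ?A lam r l \<delta> \<eta>" using spectral.nbhd_exists[OF sp] by blast
  obtain p where p: "bij_betw p {..<CARD('m)} (UNIV :: 'm set)" "\<And>j k. j < k \<Longrightarrow> k < CARD('m) \<Longrightarrow> lam (p j) < lam (p k)"
    using spectral.speed_order_exists[OF sp] by blast
  obtain \<rho>0 J' L g g' c where \<rho>0: "\<rho>0 > 0" "cball Vbar \<rho>0 \<subseteq> P" and sys: "\<And>\<rho>. 0 < \<rho> \<Longrightarrow> \<rho> \<le> \<rho>0 \<Longrightarrow>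
      entropic ?A lam r l \<delta> \<eta> f (\<lambda>X. jacobian f (at X)) J' Vbar \<rho> L e q g g' c"
    using entropic_system_exists[OF assms(1,2,3,6,7,8,9) nb] by blast
  define D where "D = {\<alpha>. \<alpha> < CARD('m) \<and> linearly_degenerate_near f \<alpha> Vbar}"
  have "\<forall>\<^sub>F X in nhds Vbar. \<forall>\<alpha>\<in>D. \<forall>v. right_eigenvector (jacobian f (at X)) (char_speed f \<alpha> X) v \<longrightarrow>
       frechet_derivative (char_speed f \<alpha>) (at X) v = 0"
    by (rule eventually_ball_finite) (auto simp: D_def linearly_degenerate_near_def)
  then obtain d where d: "d > 0" "\<And>X \<alpha> v. dist X Vbar < d \<Longrightarrow> \<alpha> \<in> D \<Longrightarrow> right_eigenvector (jacobian f (at X)) (char_speed f \<alpha> X) v \<Longrightarrow>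
       frechet_derivative (char_speed f \<alpha>) (at X) v = 0"
    unfolding eventually_nhds_metric by blast
  define \<rho> where "\<rho> = min \<rho>0 d"
  have \<rho>: "0 < \<rho>" "\<rho> \<le> \<rho>0" "\<rho> \<le> d" using \<rho>0(1) d(1) by (auto simp: \<rho>_def)
  interpret E: entropic ?A lam r l \<delta> \<eta> f "\<lambda>X. jacobian f (at X)" J' Vbar \<rho> L e q g g' c
    by (rule sys[OF \<rho>(1,2)])
  have fields: "E.curv i \<noteq> 0 \<or> E.lindeg i" for i
  proof -
    obtain \<alpha> where \<alpha>: "\<alpha> < CARD('m)" "i = p \<alpha>" using p(1) by (metis UNIV_I bij_betw_def imageE lessThan_iff)
    from assms(5)[OF \<alpha>(1)] show ?thesis
    proof
      assume "genuinely_nonlinear_near f \<alpha> Vbar"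
      from E.genuinely_nonlinear_curv[OF refl p \<alpha>(1) this] show ?thesis using \<alpha>(2) by simp
    next
      assume "linearly_degenerate_near f \<alpha> Vbar"
      then have "\<alpha> \<in> D" using \<alpha>(1) by (simp add: D_def)
      then have "E.lindeg (p \<alpha>)"
        using d(2) \<rho>(3) by (intro E.linearly_degenerate_lindeg[OF refl p \<alpha>(1)]) (auto simp: dist_commute)
      then show ?thesis using \<alpha>(2) by simp
    qed
  qed
  obtain \<epsilon> where \<epsilon>: "0 < \<epsilon>" "\<epsilon> \<le> \<rho>" and unique:
    "\<And>V M W M'. \<lbrakk>riemann_profile ?A lam r l \<delta> \<eta> f (\<lambda>X. jacobian f (at X)) J' Vbar \<rho> L e q g g' c \<epsilon> V M;
        riemann_profile ?A lam r l \<delta> \<eta> f (\<lambda>X. jacobian f (at X)) J' Vbar \<rho> L e q g g' c \<epsilon> W M';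
        \<And>s. (\<And>k. s \<le> lam k - \<delta>) \<Longrightarrow> V s = W s; \<And>s. (\<And>k. lam k + \<delta> \<le> s) \<Longrightarrow> V s = W s\<rbrakk>
      \<Longrightarrow> finite {s. V s \<noteq> W s}"
    using E.profiles_unique[OF fields p] by blast
  show ?thesis
  proof (intro exI[of _ \<epsilon>] conjI allI ballI impI)
    show "0 < \<epsilon>" by (rule \<epsilon>(1))
    show "cball Vbar \<epsilon> \<subseteq> P" using \<rho>0(2) \<epsilon>(2) \<rho>(2) by (meson order_trans subset_cball)
    fix VL VR V W
    assume V: "V \<in> Linfty_cball Vbar \<epsilon>" and W: "W \<in> Linfty_cball Vbar \<epsilon>"
      and sol: "admissible_riemann_solution f e q VL VR V \<and> admissible_riemann_solution f e q VL VR W"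
    obtain V1 M where V1: "riemann_profile ?A lam r l \<delta> \<eta> f (\<lambda>X. jacobian f (at X)) J' Vbar \<rho> L e q g g' c \<epsilon> V1 M"
      "negligible {s. V s \<noteq> V1 s}" "\<forall>s. (\<forall>k. s \<le> lam k - \<delta>) \<longrightarrow> V1 s = VL" "\<forall>s. (\<forall>k. lam k + \<delta> \<le> s) \<longrightarrow> V1 s = VR"
      using E.solution_profile[OF \<epsilon> V conjunct1[OF sol]] by blast
    obtain W1 M' where W1: "riemann_profile ?A lam r l \<delta> \<eta> f (\<lambda>X. jacobian f (at X)) J' Vbar \<rho> L e q g g' c \<epsilon> W1 M'"
      "negligible {s. W s \<noteq> W1 s}" "\<forall>s. (\<forall>k. s \<le> lam k - \<delta>) \<longrightarrow> W1 s = VL" "\<forall>s. (\<forall>k. lam k + \<delta> \<le> s) \<longrightarrow> W1 s = VR"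
      using E.solution_profile[OF \<epsilon> W conjunct2[OF sol]] by blast
    have "finite {s. V1 s \<noteq> W1 s}"
      by (rule unique[OF V1(1) W1(1)]) (simp_all add: V1(3,4)[rule_format] W1(3,4)[rule_format])
    then have "negligible ({s. V s \<noteq> V1 s} \<union> {s. W s \<noteq> W1 s} \<union> {s. V1 s \<noteq> W1 s})"
      by (intro negligible_Un V1(2) W1(2) negligible_finite)
    then have "negligible {s. V s \<noteq> W s}" by (rule negligible_subset) auto
    then show "AE \<xi> in lebesgue. V \<xi> = W \<xi>"
      by (intro AE_I'[of "{s. V s \<noteq> W s}"]) (auto simp: negligible_iff_null_sets)
  qed
qed

end
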